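(* Let $\mathcal M$ be a Green 2-functor for a spannable pair $(\mathbb G;\mathbb J)$ taking values in idempotent complete additive categories. Let $i\colon H\to G$ be in $\mathbb J$, and let $A(i)=i_!(\mathbf 1_H)=i_*(\mathbf 1_H)\in\mathcal M(G)$ be the induced Frobenius object. Then $\mathcal M(H)$ is canonically equivalent to both the category of $A(i)$-comodules and that of $A(i)$-modules in $\mathcal M(G)$: $$A(i)\text{-}\mathrm{Comod}_{\mathcal M(G)}\overset{\sim}{\longleftarrow}\mathcal M(H)\overset{\sim}{\longrightarrow}A(i)\text{-}\mathrm{Mod}_{\mathcal M(G)}.$$ These equivalences identify, respectively, the adjunction $i_!\dashv i^*$ with the forgetful–cofree adjunction for comodules, and the adjunction $i^*\dashv i_*$ with the free–forgetful adjunction for modules. If the Green 2-functor $\mathcal M$ is braided, both are equivalences of braided monoidal categories, where modules and comodules are endowed with the usual tensor product of $\mathcal M(G)$ amalgamated over $A(i)$.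
   Context: Fix a commutative ring $\Bbbk$. $\mathsf{ADD}_\Bbbk$ is the 2-category of (possibly large) additive $\Bbbk$-linear categories, $\Bbbk$-linear functors and natural transformations, and $\mathbb A=\mathsf{ADD}_\Bbbk^{ic}$ is its full 2-subcategory of idempotent complete ones. A spannable pair $(\mathbb G;\mathbb J)$ consists of: (1) an essentially small $(2,1)$-category $\mathbb G$ (Hom categories are small groupoids; up to equivalence only a small set of objects), which (2) is extensive (it has finite coproducts and for all $G,H$ the pseudofunctor $\mathbb G/G\times\mathbb G/H\to\mathbb G/(G\sqcup H)$, $(u,v)\mapsto u\sqcup v$, is a biequivalence); (3) a 2-full 2-subcategory $\mathbb J\subseteq\mathbb G$ containing all equivalences and closed under isomorphic 1-cells, such that (4) for $i\colon H\to G$ in $\mathbb J$ and any $u\colon K\to G$ there is a pseudopullback ("Mackey square") $p\colon P\to H$, $q\colon P\to K$, $\gamma\colon ip\overset{\sim}{\Rightarrow}uq$, with $q\in\mathbb J$; and (5) for every finite family $u_\ell\colon H_\ell\to G$, the induced $\sqcup_\ell H_\ell\to G$ is in $\mathbb J$ iff every $u_\ell$ is. A Mackey 2-functor for $(\mathbb G;\mathbb J)$ is a 2-functor $\mathcal M\colon\mathbb G^{op}\to\mathbb A$ (write $u^*=\mathcal M(u)$) such that: (1) it sends finite coproducts to direct sums; (2) for $i\in\mathbb J$, $i^*$ has a left adjoint $i_!$ and a right adjoint $i_*$; (3) for every Mackey square with $i,q\in\mathbb J$ the mates $\gamma_!\colon q_!p^*\Rightarrow u^*i_!$ and $(\gamma^{-1})_*\colon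 u^*i_*\Rightarrow q_*p^*$ are invertible; (4) $i_!\simeq i_*$ for $i\in\mathbb J$. Standing assumption: all Mackey 2-functors are rectified, i.e. come with chosen adjunctions $(i_!\dashv i^*,{}^\ell\eta,{}^\ell\varepsilon)$ and $(i^*\dashv i_*,{}^r\eta,{}^r\varepsilon)$ for $i\in\mathbb J$ with $i_!=i_*$ as functors, the pseudofunctors $i\mapsto i_!$ and $i\mapsto i_*$ on $\mathbb J$ equal, $(\gamma_!)^{-1}=(\gamma^{-1})_*$ for all Mackey squares, and ${}^r\varepsilon\circ{}^\ell\eta=\mathrm{id}$. A Green 2-functor for $(\mathbb G;\mathbb J)$ is a Mackey 2-functor $\mathcal M$ together with a lift of $\mathcal M$ to a 2-functor into monoidal categories in $\mathbb A$ (tensor product $\otimes$ $\Bbbk$-bilinear, unit $\mathbf 1_G$), $\Bbbk$-linear strong monoidal functors $u^*$ (write $\otimes_u\colon u^*(X\otimes X')\xrightarrow{\sim}u^*X\otimes u^*X'$) and monoidal transformations, satisfying the projection formulas: for all $i\in\mathbb J$, the maps $\mathrm{Rp}^1_{X,Y}=i_*(i^*X\otimes{}^r\varepsilon)\circ i_*(\otimes_i)\circ{}^r\eta\colon X\otimes i_*Y\to i_*(i^*X\otimes Y)$ and $\mathrm{Rp}^2_{Y,X}=i_*({}^r\varepsilon\otimes i^*X)\circ i_*(\otimes_i)\circ{}^r\eta\colon i_*Y\otimes X\to i_*(Y\otimes i^*X)$ are inverse to $\mathrm{Lp}^1_{X,Y}={}^\ell\varepsilon\circ i_!(\otimes_i^{-1})\circ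 i_!(i^*X\otimes{}^\ell\eta)$ and $\mathrm{Lp}^2_{Y,X}={}^\ell\varepsilon\circ i_!(\otimes_i^{-1})\circ i_!({}^\ell\eta\otimes i^*X)$ respectively. It is braided if the lift is to braided monoidal categories and braided strong monoidal functors. $A(i)$ has a monoid structure $(\mu,\iota)$ given by the lax monoidal structure of $i_*$ (induced by the strong structure of its left adjoint $i^*$) at $\mathbf 1_H$, and a comonoid structure $(\delta,\epsilon)$ given by the colax structure of $i_!$ (induced from its right adjoint $i^*$) at $\mathbf 1_H$. $A(i)\text{-}\mathrm{Mod}$ and $A(i)\text{-}\mathrm{Comod}$ denote left modules over the monoid and left comodules over the comonoid. The free module on $X$ is $(A(i)\otimes X,\mu\otimes\mathrm{id})$, left adjoint to the forgetful functor; the cofree comodule on $X$ is $(A(i)\otimes X,\delta\otimes\mathrm{id})$, right adjoint to the forgetful functor. Canonical functors: with $\pi_X\colon A(i)\otimes X\xrightarrow{\sim}i_*i^*X$ the isomorphism $\mathrm{Rp}^2_{\mathbf 1,X}$ followed by $i_*(\mathbf 1\otimes i^*X)\cong i_*i^*X$, $Y\in\mathcal M(H)$ is sent to the module $(i_*Y,\ i_*({}^r\varepsilon_Y)\circ\pi_{i_*Y})$ and to the comodule $(i_!Y,\ \pi_{i_!Y}^{-1}\circ i_!({}^\ell\eta_Y))$. The tensor product of modules (comodules) over $A(i)$ is defined by a split coequalizer (split equalizer). *)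

theory Defs
  imports "HOL-Algebra.Module"
begin

section \<open>Categories, functors, equivalences, adjunctions\<close>

text \<open>A category is given by carrier sets of objects and arrows; every arrow has one domain and one
  codomain. \<open>g \<cdot>\<^bsub>C\<^esub> f\<close> is \<open>g\<close> after \<open>f\<close>. All equations between functors or natural
  transformations are imposed on the carriers only; values elsewhere are irrelevant.\<close>

record ('o, 'm) cat =
  Obj :: "'o set"
  Arr :: "'m set"
  Dom :: "'m \<Rightarrow> 'o"
  Cod :: "'m \<Rightarrow> 'o"
  Ide :: "'o \<Rightarrow> 'm"
  Cmp :: "'m \<Rightarrow> 'm \<Rightarrow> 'm" (infixr "\<cdot>\<index>" 55)

definition homs :: "('o, 'm, 'x) cat_scheme \<Rightarrow> 'o \<Rightarrow> 'o \<Rightarrow> 'm set" where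
  "homs C a b = {f \<in> Arr C. Dom C f = a \<and> Cod C f = b}"

locale category =
  fixes C :: "('o, 'm, 'x) cat_scheme" (structure)
  assumes dom_obj: "f \<in> Arr C \<Longrightarrow> Dom C f \<in> Obj C"
    and cod_obj: "f \<in> Arr C \<Longrightarrow> Cod C f \<in> Obj C"
    and ide_hom: "a \<in> Obj C \<Longrightarrow> Ide C a \<in> homs C a a"
    and cmp_hom: "\<lbrakk>f \<in> homs C a b; g \<in> homs C b c\<rbrakk> \<Longrightarrow> g \<cdot> f \<in> homs C a c"
    and cmp_assoc: "\<lbrakk>f \<in> homs C a b; g \<in> homs C b c; h \<in> homs C c d\<rbrakk>
      \<Longrightarrow> (h \<cdot> g) \<cdot> f = h \<cdot> (g \<cdot> f)"
    and cmp_ide_right: "f \<in> homs C a b \<Longrightarrow> f \<cdot> Ide C a = f"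
    and cmp_ide_left: "f \<in> homs C a b \<Longrightarrow> Ide C b \<cdot> f = f"

definition inverse_pair :: "('o, 'm, 'x) cat_scheme \<Rightarrow> 'm \<Rightarrow> 'm \<Rightarrow> bool" where
  "inverse_pair C f g \<longleftrightarrow> f \<in> Arr C \<and> g \<in> homs C (Cod C f) (Dom C f) \<and>
     g \<cdot>\<^bsub>C\<^esub> f = Ide C (Dom C f) \<and> f \<cdot>\<^bsub>C\<^esub> g = Ide C (Cod C f)"

definition is_iso :: "('o, 'm, 'x) cat_scheme \<Rightarrow> 'm \<Rightarrow> bool" where
  "is_iso C f \<longleftrightarrow> (\<exists>g. inverse_pair C f g)"

definition cinv :: "('o, 'm, 'x) cat_scheme \<Rightarrow> 'm \<Rightarrow> 'm" where
  "cinv C f = (THE g. inverse_pair C f g)"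

record ('o, 'm, 'p, 'n) func =
  fobj :: "'o \<Rightarrow> 'p"
  farr :: "'m \<Rightarrow> 'n"

locale cfunctor = C: category C + D: category D
  for C :: "('o, 'm, 'x) cat_scheme" and D :: "('p, 'n, 'y) cat_scheme" +
  fixes F :: "('o, 'm, 'p, 'n) func"
  assumes fobj_obj: "a \<in> Obj C \<Longrightarrow> fobj F a \<in> Obj D"
    and farr_hom: "f \<in> homs C a b \<Longrightarrow> farr F f \<in> homs D (fobj F a) (fobj F b)"
    and farr_ide: "a \<in> Obj C \<Longrightarrow> farr F (Ide C a) = Ide D (fobj F a)"
    and farr_cmp: "\<lbrakk>f \<in> homs C a b; g \<in> homs C b c\<rbrakk>
      \<Longrightarrow> farr F (g \<cdot>\<^bsub>C\<^esub> f) = farr F g \<cdot>\<^bsub>D\<^esub> farr F f"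

definition fid :: "('o, 'm, 'o, 'm) func" where
  "fid = \<lparr>fobj = (\<lambda>x. x), farr = (\<lambda>f. f)\<rparr>"

definition fcomp ::
  "('p, 'n, 'q, 'l) func \<Rightarrow> ('o, 'm, 'p, 'n) func \<Rightarrow> ('o, 'm, 'q, 'l) func" where
  "fcomp F' F = \<lparr>fobj = (\<lambda>x. fobj F' (fobj F x)), farr = (\<lambda>f. farr F' (farr F f))\<rparr>"

definition feq ::
  "('o, 'm, 'x) cat_scheme \<Rightarrow> ('o, 'm, 'p, 'n) func \<Rightarrow> ('o, 'm, 'p, 'n) func \<Rightarrow> bool" where
  "feq C F F' \<longleftrightarrow> (\<forall>x \<in> Obj C. fobj F x = fobj F' x) \<and> (\<forall>f \<in> Arr C. farr F f = farr F' f)"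

definition nat_trans ::
  "('o, 'm, 'x) cat_scheme \<Rightarrow> ('p, 'n, 'y) cat_scheme \<Rightarrow>
   ('o, 'm, 'p, 'n) func \<Rightarrow> ('o, 'm, 'p, 'n) func \<Rightarrow> ('o \<Rightarrow> 'n) \<Rightarrow> bool" where
  "nat_trans C D F F' \<tau> \<longleftrightarrow> cfunctor C D F \<and> cfunctor C D F' \<and>
     (\<forall>x \<in> Obj C. \<tau> x \<in> homs D (fobj F x) (fobj F' x)) \<and>
     (\<forall>f \<in> Arr C. \<tau> (Cod C f) \<cdot>\<^bsub>D\<^esub> farr F f = farr F' f \<cdot>\<^bsub>D\<^esub> \<tau> (Dom C f))"

definition nat_iso ::
  "('o, 'm, 'x) cat_scheme \<Rightarrow> ('p, 'n, 'y) cat_scheme \<Rightarrow>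
   ('o, 'm, 'p, 'n) func \<Rightarrow> ('o, 'm, 'p, 'n) func \<Rightarrow> ('o \<Rightarrow> 'n) \<Rightarrow> bool" where
  "nat_iso C D F F' \<tau> \<longleftrightarrow> nat_trans C D F F' \<tau> \<and> (\<forall>x \<in> Obj C. is_iso D (\<tau> x))"

definition equivalence ::
  "('o, 'm, 'x) cat_scheme \<Rightarrow> ('p, 'n, 'y) cat_scheme \<Rightarrow> ('o, 'm, 'p, 'n) func \<Rightarrow> bool" where
  "equivalence C D F \<longleftrightarrow> cfunctor C D F \<and>
     (\<exists>F' \<tau> \<sigma>. cfunctor D C F' \<and> nat_iso C C fid (fcomp F' F) \<tau> \<and> nat_iso D D (fcomp F F') fid \<sigma>)"

text \<open>\<open>adjunction C D F U \<eta> \<epsilon>\<close>: \<open>F : C \<rightarrow> D\<close> is left adjoint to \<open>U : D \<rightarrow> C\<close>.\<close>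

definition adjunction ::
  "('o, 'm, 'x) cat_scheme \<Rightarrow> ('p, 'n, 'y) cat_scheme \<Rightarrow>
   ('o, 'm, 'p, 'n) func \<Rightarrow> ('p, 'n, 'o, 'm) func \<Rightarrow> ('o \<Rightarrow> 'm) \<Rightarrow> ('p \<Rightarrow> 'n) \<Rightarrow> bool" where
  "adjunction C D F U \<eta> \<epsilon> \<longleftrightarrow>
     nat_trans C C fid (fcomp U F) \<eta> \<and> nat_trans D D (fcomp F U) fid \<epsilon> \<and>
     (\<forall>x \<in> Obj C. \<epsilon> (fobj F x) \<cdot>\<^bsub>D\<^esub> farr F (\<eta> x) = Ide D (fobj F x)) \<and>
     (\<forall>y \<in> Obj D. farr U (\<epsilon> y) \<cdot>\<^bsub>C\<^esub> \<eta> (fobj U y) = Ide C (fobj U y))"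

text \<open>Two adjunctions with the same base category \<open>C\<close> are identified along a functor
  \<open>E : D \<rightarrow> D'\<close> that strictly commutes with the functors to \<open>C\<close>: the other two functors correspond
  under \<open>E\<close> up to a natural isomorphism \<open>\<theta>\<close> that carries unit to unit and counit to counit.
  In the first version the functors to \<open>C\<close> are right adjoints, in the second one left adjoints.\<close>

definition identifies_right_adjoints ::
  "('o, 'm, 'x) cat_scheme \<Rightarrow> ('p, 'n, 'y) cat_scheme \<Rightarrow> ('q, 'l, 'z) cat_scheme \<Rightarrow>
   ('p, 'n, 'q, 'l) func \<Rightarrow>
   ('o, 'm, 'p, 'n) func \<Rightarrow> ('p, 'n, 'o, 'm) func \<Rightarrow> ('o \<Rightarrow> 'm) \<Rightarrow> ('p \<Rightarrow> 'n) \<Rightarrow>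
   ('o, 'm, 'q, 'l) func \<Rightarrow> ('q, 'l, 'o, 'm) func \<Rightarrow> ('o \<Rightarrow> 'm) \<Rightarrow> ('q \<Rightarrow> 'l) \<Rightarrow> bool" where
  "identifies_right_adjoints C D D' E F U \<eta> \<epsilon> F' U' \<eta>' \<epsilon>' \<longleftrightarrow>
     adjunction C D F U \<eta> \<epsilon> \<and> adjunction C D' F' U' \<eta>' \<epsilon>' \<and> feq D (fcomp U' E) U \<and>
     (\<exists>\<theta>. nat_iso C D' F' (fcomp E F) \<theta> \<and>
       (\<forall>x \<in> Obj C. farr U' (\<theta> x) \<cdot>\<^bsub>C\<^esub> \<eta>' x = \<eta> x) \<and>
       (\<forall>y \<in> Obj D. farr E (\<epsilon> y) \<cdot>\<^bsub>D'\<^esub> \<theta> (fobj U y) = \<epsilon>' (fobj E y)))"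

definition identifies_left_adjoints ::
  "('o, 'm, 'x) cat_scheme \<Rightarrow> ('p, 'n, 'y) cat_scheme \<Rightarrow> ('q, 'l, 'z) cat_scheme \<Rightarrow>
   ('p, 'n, 'q, 'l) func \<Rightarrow>
   ('p, 'n, 'o, 'm) func \<Rightarrow> ('o, 'm, 'p, 'n) func \<Rightarrow> ('p \<Rightarrow> 'n) \<Rightarrow> ('o \<Rightarrow> 'm) \<Rightarrow>
   ('q, 'l, 'o, 'm) func \<Rightarrow> ('o, 'm, 'q, 'l) func \<Rightarrow> ('q \<Rightarrow> 'l) \<Rightarrow> ('o \<Rightarrow> 'm) \<Rightarrow> bool" where
  "identifies_left_adjoints C D D' E U F \<eta> \<epsilon> U' F' \<eta>' \<epsilon>' \<longleftrightarrow>
     adjunction D C U F \<eta> \<epsilon> \<and> adjunction D' C U' F' \<eta>' \<epsilon>' \<and> feq D (fcomp U' E) U \<and>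
     (\<exists>\<theta>. nat_iso C D' (fcomp E F) F' \<theta> \<and>
       (\<forall>y \<in> Obj D. \<theta> (fobj U y) \<cdot>\<^bsub>D'\<^esub> farr E (\<eta> y) = \<eta>' (fobj E y)) \<and>
       (\<forall>x \<in> Obj C. \<epsilon>' x \<cdot>\<^bsub>C\<^esub> farr U' (\<theta> x) = \<epsilon> x))"

definition prod_cat :: "nat \<Rightarrow> (nat \<Rightarrow> ('o, 'm, 'x) cat_scheme) \<Rightarrow> (nat \<Rightarrow> 'o, nat \<Rightarrow> 'm) cat" where
  "prod_cat n C =
     \<lparr>Obj = (\<Pi>\<^sub>E l \<in> {..<n}. Obj (C l)),
      Arr = (\<Pi>\<^sub>E l \<in> {..<n}. Arr (C l)),
      Dom = (\<lambda>f. \<lambda>l \<in> {..<n}. Dom (C l) (f l)),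
      Cod = (\<lambda>f. \<lambda>l \<in> {..<n}. Cod (C l) (f l)),
      Ide = (\<lambda>x. \<lambda>l \<in> {..<n}. Ide (C l) (x l)),
      Cmp = (\<lambda>g f. \<lambda>l \<in> {..<n}. g l \<cdot>\<^bsub>C l\<^esub> f l)\<rparr>"

definition ftuple :: "nat \<Rightarrow> (nat \<Rightarrow> ('o, 'm, 'p, 'n) func) \<Rightarrow> ('o, 'm, nat \<Rightarrow> 'p, nat \<Rightarrow> 'n) func" where
  "ftuple n F = \<lparr>fobj = (\<lambda>x. \<lambda>l \<in> {..<n}. fobj (F l) x), farr = (\<lambda>f. \<lambda>l \<in> {..<n}. farr (F l) f)\<rparr>"

text \<open>The iso-comma category (pseudopullback) of \<open>F : B \<rightarrow> D\<close> and \<open>F' : C \<rightarrow> D\<close>.\<close>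

definition isocomma_objs where
  "isocomma_objs B C D F F' = {(a, b, \<sigma>). a \<in> Obj B \<and> b \<in> Obj C \<and>
     \<sigma> \<in> homs D (fobj F a) (fobj F' b) \<and> is_iso D \<sigma>}"

definition isocomma ::
  "('o, 'm, 'x) cat_scheme \<Rightarrow> ('p, 'n, 'y) cat_scheme \<Rightarrow> ('q, 'l, 'z) cat_scheme \<Rightarrow>
   ('o, 'm, 'q, 'l) func \<Rightarrow> ('p, 'n, 'q, 'l) func \<Rightarrow>
   ('o \<times> 'p \<times> 'l, ('o \<times> 'p \<times> 'l) \<times> ('m \<times> 'n) \<times> ('o \<times> 'p \<times> 'l)) cat" where
  "isocomma B C D F F' =
     \<lparr>Obj = isocomma_objs B C D F F',
      Arr = {((a, b, \<sigma>), (f, g), (a', b', \<sigma>')) | a b \<sigma> f g a' b' \<sigma>'.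
               (a, b, \<sigma>) \<in> isocomma_objs B C D F F' \<and> (a', b', \<sigma>') \<in> isocomma_objs B C D F F' \<and>
               f \<in> homs B a a' \<and> g \<in> homs C b b' \<and>
               farr F' g \<cdot>\<^bsub>D\<^esub> \<sigma> = \<sigma>' \<cdot>\<^bsub>D\<^esub> farr F f},
      Dom = (\<lambda>(x, _, _). x),
      Cod = (\<lambda>(_, _, y). y),
      Ide = (\<lambda>x. case x of (a, b, _) \<Rightarrow> (x, (Ide B a, Ide C b), x)),
      Cmp = (\<lambda>(_, (f', g'), z) (x, (f, g), _). (x, (f' \<cdot>\<^bsub>B\<^esub> f, g' \<cdot>\<^bsub>C\<^esub> g), z))\<rparr>"


section \<open>Strict 2-categories\<close>

text \<open>\<open>v \<star> u\<close> is composition of 1-cells, \<open>\<beta> \<bullet> \<alpha>\<close> vertical and \<open>\<beta> \<^bold>* \<alpha>\<close> horizontal composition of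
  2-cells; in each case the right-hand factor comes first. Carriers of records are HOL sets, so the
  smallness conditions on a (2,1)-category need no separate formulation.\<close>

record ('g, 'u, 'c) twocat =
  Ob :: "'g set"
  One :: "'u set"
  src1 :: "'u \<Rightarrow> 'g"
  trg1 :: "'u \<Rightarrow> 'g"
  id1 :: "'g \<Rightarrow> 'u"
  cmp1 :: "'u \<Rightarrow> 'u \<Rightarrow> 'u" (infixr "\<star>\<index>" 60)
  Two :: "'c set"
  dom2 :: "'c \<Rightarrow> 'u"
  cod2 :: "'c \<Rightarrow> 'u"
  id2 :: "'u \<Rightarrow> 'c"
  vcmp :: "'c \<Rightarrow> 'c \<Rightarrow> 'c" (infixr "\<bullet>\<index>" 55)
  hcmp :: "'c \<Rightarrow> 'c \<Rightarrow> 'c" (infixr "\<^bold>*\<index>" 60)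

definition cat1 :: "('g, 'u, 'c) twocat \<Rightarrow> ('g, 'u) cat" where
  "cat1 K = \<lparr>Obj = Ob K, Arr = One K, Dom = src1 K, Cod = trg1 K, Ide = id1 K, Cmp = cmp1 K\<rparr>"

definition cat2 :: "('g, 'u, 'c) twocat \<Rightarrow> ('u, 'c) cat" where
  "cat2 K = \<lparr>Obj = One K, Arr = Two K, Dom = dom2 K, Cod = cod2 K, Ide = id2 K, Cmp = vcmp K\<rparr>"

abbreviation hom1 :: "('g, 'u, 'c) twocat \<Rightarrow> 'g \<Rightarrow> 'g \<Rightarrow> 'u set" where
  "hom1 K \<equiv> homs (cat1 K)"

abbreviation hom2 :: "('g, 'u, 'c) twocat \<Rightarrow> 'u \<Rightarrow> 'u \<Rightarrow> 'c set" where
  "hom2 K \<equiv> homs (cat2 K)"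

abbreviation inv2 :: "('g, 'u, 'c) twocat \<Rightarrow> 'c \<Rightarrow> 'c" where
  "inv2 K \<equiv> cinv (cat2 K)"

locale two_category = one: category "cat1 K" + two: category "cat2 K"
  for K :: "('g, 'u, 'c) twocat" (structure) +
  assumes parallel: "\<alpha> \<in> hom2 K u v \<Longrightarrow> src1 K u = src1 K v \<and> trg1 K u = trg1 K v"
    and hcmp_hom: "\<lbrakk>u \<in> hom1 K a b; v \<in> hom1 K b c; \<alpha> \<in> hom2 K u u'; \<beta> \<in> hom2 K v v'\<rbrakk>
      \<Longrightarrow> \<beta> \<^bold>* \<alpha> \<in> hom2 K (v \<star> u) (v' \<star> u')"
    and interchange: "\<lbrakk>u \<in> hom1 K a b; v \<in> hom1 K b c; \<alpha> \<in> hom2 K u u'; \<alpha>' \<in> hom2 K u' u'';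
        \<beta> \<in> hom2 K v v'; \<beta>' \<in> hom2 K v' v''\<rbrakk>
      \<Longrightarrow> (\<beta>' \<bullet> \<beta>) \<^bold>* (\<alpha>' \<bullet> \<alpha>) = (\<beta>' \<^bold>* \<alpha>') \<bullet> (\<beta> \<^bold>* \<alpha>)"
    and hcmp_id2: "\<lbrakk>u \<in> hom1 K a b; v \<in> hom1 K b c\<rbrakk> \<Longrightarrow> id2 K v \<^bold>* id2 K u = id2 K (v \<star> u)"
    and hcmp_assoc: "\<lbrakk>u \<in> hom1 K a b; v \<in> hom1 K b c; w \<in> hom1 K c d;
        \<alpha> \<in> hom2 K u u'; \<beta> \<in> hom2 K v v'; \<gamma> \<in> hom2 K w w'\<rbrakk>
      \<Longrightarrow> (\<gamma> \<^bold>* \<beta>) \<^bold>* \<alpha> = \<gamma> \<^bold>* (\<beta> \<^bold>* \<alpha>)"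
    and hcmp_unit_left: "\<lbrakk>u \<in> hom1 K a b; \<alpha> \<in> hom2 K u u'\<rbrakk> \<Longrightarrow> id2 K (id1 K b) \<^bold>* \<alpha> = \<alpha>"
    and hcmp_unit_right: "\<lbrakk>u \<in> hom1 K a b; \<alpha> \<in> hom2 K u u'\<rbrakk> \<Longrightarrow> \<alpha> \<^bold>* id2 K (id1 K a) = \<alpha>"

locale two_one_category = two_category +
  assumes two_cells_invertible: "\<alpha> \<in> Two K \<Longrightarrow> is_iso (cat2 K) \<alpha>"

definition Hom :: "('g, 'u, 'c) twocat \<Rightarrow> 'g \<Rightarrow> 'g \<Rightarrow> ('u, 'c) cat" where
  "Hom K a b = \<lparr>Obj = hom1 K a b, Arr = {\<alpha> \<in> Two K. dom2 K \<alpha> \<in> hom1 K a b \<and> cod2 K \<alpha> \<in> hom1 K a b},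
     Dom = dom2 K, Cod = cod2 K, Ide = id2 K, Cmp = vcmp K\<rparr>"

definition postcomp :: "('g, 'u, 'c) twocat \<Rightarrow> 'u \<Rightarrow> ('u, 'c, 'u, 'c) func" where
  "postcomp K v = \<lparr>fobj = (\<lambda>w. v \<star>\<^bsub>K\<^esub> w), farr = (\<lambda>\<theta>. id2 K v \<^bold>*\<^bsub>K\<^esub> \<theta>)\<rparr>"

definition precomp :: "('g, 'u, 'c) twocat \<Rightarrow> 'u \<Rightarrow> ('u, 'c, 'u, 'c) func" where
  "precomp K u = \<lparr>fobj = (\<lambda>w. w \<star>\<^bsub>K\<^esub> u), farr = (\<lambda>\<theta>. \<theta> \<^bold>*\<^bsub>K\<^esub> id2 K u)\<rparr>"

definition iso_one_cells :: "('g, 'u, 'c) twocat \<Rightarrow> 'u \<Rightarrow> 'u \<Rightarrow> bool" where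
  "iso_one_cells K u v \<longleftrightarrow> (\<exists>\<alpha> \<in> hom2 K u v. is_iso (cat2 K) \<alpha>)"

definition equivalence_one_cell :: "('g, 'u, 'c) twocat \<Rightarrow> 'u \<Rightarrow> bool" where
  "equivalence_one_cell K u \<longleftrightarrow> u \<in> One K \<and>
     (\<exists>v \<in> hom1 K (trg1 K u) (src1 K u).
        iso_one_cells K (v \<star>\<^bsub>K\<^esub> u) (id1 K (src1 K u)) \<and>
        iso_one_cells K (u \<star>\<^bsub>K\<^esub> v) (id1 K (trg1 K u)))"

record ('g, 'u, 'c, 'h, 'v, 'd) psfun =
  ps0 :: "'g \<Rightarrow> 'h"
  ps1 :: "'u \<Rightarrow> 'v"
  ps2 :: "'c \<Rightarrow> 'd"

text \<open>\<open>\<phi> g f : F g \<star> F f \<Rightarrow> F (g \<star> f)\<close> and \<open>\<psi> x : id \<Rightarrow> F id\<close> are the coherence isomorphisms.\<close>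

definition pseudofunctor_with ::
  "('g, 'u, 'c) twocat \<Rightarrow> ('h, 'v, 'd) twocat \<Rightarrow> ('g, 'u, 'c, 'h, 'v, 'd) psfun \<Rightarrow>
   ('u \<Rightarrow> 'u \<Rightarrow> 'd) \<Rightarrow> ('g \<Rightarrow> 'd) \<Rightarrow> bool" where
  "pseudofunctor_with K L F \<phi> \<psi> \<longleftrightarrow> two_category K \<and> two_category L \<and>
     (\<forall>x \<in> Ob K. ps0 F x \<in> Ob L) \<and>
     (\<forall>x \<in> Ob K. \<forall>y \<in> Ob K. cfunctor (Hom K x y) (Hom L (ps0 F x) (ps0 F y))
        \<lparr>fobj = ps1 F, farr = ps2 F\<rparr>) \<and>
     (\<forall>x y z f g. f \<in> hom1 K x y \<and> g \<in> hom1 K y z \<longrightarrow>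
        \<phi> g f \<in> hom2 L (ps1 F g \<star>\<^bsub>L\<^esub> ps1 F f) (ps1 F (g \<star>\<^bsub>K\<^esub> f)) \<and> is_iso (cat2 L) (\<phi> g f)) \<and>
     (\<forall>x y z f f' g g' \<alpha> \<beta>. f \<in> hom1 K x y \<and> g \<in> hom1 K y z \<and>
        \<alpha> \<in> hom2 K f f' \<and> \<beta> \<in> hom2 K g g' \<longrightarrow>
        \<phi> g' f' \<bullet>\<^bsub>L\<^esub> (ps2 F \<beta> \<^bold>*\<^bsub>L\<^esub> ps2 F \<alpha>) = ps2 F (\<beta> \<^bold>*\<^bsub>K\<^esub> \<alpha>) \<bullet>\<^bsub>L\<^esub> \<phi> g f) \<and>
     (\<forall>x y z w f g h. f \<in> hom1 K x y \<and> g \<in> hom1 K y z \<and> h \<in> hom1 K z w \<longrightarrow>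
        \<phi> (h \<star>\<^bsub>K\<^esub> g) f \<bullet>\<^bsub>L\<^esub> (\<phi> h g \<^bold>*\<^bsub>L\<^esub> id2 L (ps1 F f)) =
        \<phi> h (g \<star>\<^bsub>K\<^esub> f) \<bullet>\<^bsub>L\<^esub> (id2 L (ps1 F h) \<^bold>*\<^bsub>L\<^esub> \<phi> g f)) \<and>
     (\<forall>x \<in> Ob K. \<psi> x \<in> hom2 L (id1 L (ps0 F x)) (ps1 F (id1 K x)) \<and> is_iso (cat2 L) (\<psi> x)) \<and>
     (\<forall>x y f. f \<in> hom1 K x y \<longrightarrow>
        \<phi> (id1 K y) f \<bullet>\<^bsub>L\<^esub> (\<psi> y \<^bold>*\<^bsub>L\<^esub> id2 L (ps1 F f)) = id2 L (ps1 F f) \<and>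
        \<phi> f (id1 K x) \<bullet>\<^bsub>L\<^esub> (id2 L (ps1 F f) \<^bold>*\<^bsub>L\<^esub> \<psi> x) = id2 L (ps1 F f))"

definition biequivalence ::
  "('g, 'u, 'c) twocat \<Rightarrow> ('h, 'v, 'd) twocat \<Rightarrow> ('g, 'u, 'c, 'h, 'v, 'd) psfun \<Rightarrow> bool" where
  "biequivalence K L F \<longleftrightarrow> (\<exists>\<phi> \<psi>. pseudofunctor_with K L F \<phi> \<psi>) \<and>
     (\<forall>x \<in> Ob K. \<forall>y \<in> Ob K. equivalence (Hom K x y) (Hom L (ps0 F x) (ps0 F y))
        \<lparr>fobj = ps1 F, farr = ps2 F\<rparr>) \<and>
     (\<forall>z \<in> Ob L. \<exists>x \<in> Ob K. \<exists>e \<in> hom1 L (ps0 F x) z. equivalence_one_cell L e)"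

definition prod_twocat ::
  "('g, 'u, 'c) twocat \<Rightarrow> ('h, 'v, 'd) twocat \<Rightarrow> ('g \<times> 'h, 'u \<times> 'v, 'c \<times> 'd) twocat" where
  "prod_twocat K L =
     \<lparr>Ob = Ob K \<times> Ob L, One = One K \<times> One L,
      src1 = map_prod (src1 K) (src1 L), trg1 = map_prod (trg1 K) (trg1 L),
      id1 = map_prod (id1 K) (id1 L), cmp1 = (\<lambda>(u', v') (u, v). (u' \<star>\<^bsub>K\<^esub> u, v' \<star>\<^bsub>L\<^esub> v)),
      Two = Two K \<times> Two L,
      dom2 = map_prod (dom2 K) (dom2 L), cod2 = map_prod (cod2 K) (cod2 L),
      id2 = map_prod (id2 K) (id2 L),
      vcmp = (\<lambda>(\<alpha>', \<beta>') (\<alpha>, \<beta>). (\<alpha>' \<bullet>\<^bsub>K\<^esub> \<alpha>, \<beta>' \<bullet>\<^bsub>L\<^esub> \<beta>)),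
      hcmp = (\<lambda>(\<alpha>', \<beta>') (\<alpha>, \<beta>). (\<alpha>' \<^bold>*\<^bsub>K\<^esub> \<alpha>, \<beta>' \<^bold>*\<^bsub>L\<^esub> \<beta>))\<rparr>"

text \<open>The slice over \<open>A\<close>: objects are 1-cells \<open>u\<close> with target \<open>A\<close>; a 1-cell \<open>u \<rightarrow> u'\<close> is
  \<open>(u, w, \<alpha>, u')\<close> with an invertible \<open>\<alpha> : u \<Rightarrow> u' \<star> w\<close>; a 2-cell \<open>(w, \<alpha>) \<Rightarrow> (w', \<alpha>')\<close> is a 2-cell
  \<open>\<theta> : w \<Rightarrow> w'\<close> with \<open>(u' \<star> \<theta>) \<bullet> \<alpha> = \<alpha>'\<close>.\<close>

type_synonym ('u, 'c) slice1 = "'u \<times> 'u \<times> 'c \<times> 'u"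

definition slice_one :: "('g, 'u, 'c) twocat \<Rightarrow> 'g \<Rightarrow> ('u, 'c) slice1 set" where
  "slice_one K A = {(u, w, \<alpha>, u'). u \<in> One K \<and> trg1 K u = A \<and> u' \<in> One K \<and> trg1 K u' = A \<and>
     w \<in> hom1 K (src1 K u) (src1 K u') \<and> \<alpha> \<in> hom2 K u (u' \<star>\<^bsub>K\<^esub> w) \<and> is_iso (cat2 K) \<alpha>}"

definition slice ::
  "('g, 'u, 'c) twocat \<Rightarrow> 'g \<Rightarrow>
   ('u, ('u, 'c) slice1, ('u, 'c) slice1 \<times> 'c \<times> ('u, 'c) slice1) twocat" where
  "slice K A =
    (let cp1 = (\<lambda>(_, w', \<alpha>', u'') (u, w, \<alpha>, _).
                  (u, w' \<star>\<^bsub>K\<^esub> w, (\<alpha>' \<^bold>*\<^bsub>K\<^esub> id2 K w) \<bullet>\<^bsub>K\<^esub> \<alpha>, u''))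
     in
     \<lparr>Ob = {u \<in> One K. trg1 K u = A},
      One = slice_one K A,
      src1 = (\<lambda>(u, _, _, _). u),
      trg1 = (\<lambda>(_, _, _, u'). u'),
      id1 = (\<lambda>u. (u, id1 K (src1 K u), id2 K u, u)),
      cmp1 = cp1,
      Two = {((u, w, \<alpha>, u'), \<theta>, (u, w', \<alpha>', u')) | u w \<alpha> u' \<theta> w' \<alpha>'.
               (u, w, \<alpha>, u') \<in> slice_one K A \<and> (u, w', \<alpha>', u') \<in> slice_one K A \<and>
               \<theta> \<in> hom2 K w w' \<and> (id2 K u' \<^bold>*\<^bsub>K\<^esub> \<theta>) \<bullet>\<^bsub>K\<^esub> \<alpha> = \<alpha>'},
      dom2 = (\<lambda>(c, _, _). c),
      cod2 = (\<lambda>(_, _, d). d),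
      id2 = (\<lambda>c. case c of (_, w, _, _) \<Rightarrow> (c, id2 K w, c)),
      vcmp = (\<lambda>(_, \<theta>', e) (c, \<theta>, _). (c, \<theta>' \<bullet>\<^bsub>K\<^esub> \<theta>, e)),
      hcmp = (\<lambda>(c', \<theta>', d') (c, \<theta>, d). (cp1 c' c, \<theta>' \<^bold>*\<^bsub>K\<^esub> \<theta>, cp1 d' d))\<rparr>)"


section \<open>Extensive (2,1)-categories and spannable pairs\<close>

text \<open>Coproducts and pullbacks are the bicategorical ones: their universal property is an equivalence
  of Hom categories.\<close>

definition coproduct ::
  "('g, 'u, 'c) twocat \<Rightarrow> nat \<Rightarrow> (nat \<Rightarrow> 'g) \<Rightarrow> 'g \<Rightarrow> (nat \<Rightarrow> 'u) \<Rightarrow> bool" where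
  "coproduct K n A P inc \<longleftrightarrow> P \<in> Ob K \<and> (\<forall>l<n. A l \<in> Ob K \<and> inc l \<in> hom1 K (A l) P) \<and>
     (\<forall>X \<in> Ob K. equivalence (Hom K P X) (prod_cat n (\<lambda>l. Hom K (A l) X))
        (ftuple n (\<lambda>l. precomp K (inc l))))"

definition has_finite_coproducts :: "('g, 'u, 'c) twocat \<Rightarrow> bool" where
  "has_finite_coproducts K \<longleftrightarrow>
     (\<forall>n A. (\<forall>l<n. A l \<in> Ob K) \<longrightarrow> (\<exists>P inc. coproduct K n A P inc))"

definition two :: "'a \<Rightarrow> 'a \<Rightarrow> nat \<Rightarrow> 'a" where
  "two a b l = (if l = 0 then a else b)"

definition csum :: "('g, 'u, 'c) twocat \<Rightarrow> 'g \<Rightarrow> 'g \<Rightarrow> 'g \<times> (nat \<Rightarrow> 'u)" where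
  "csum K A B = (SOME (P, inc). coproduct K 2 (two A B) P inc)"

abbreviation csum_ob where "csum_ob K A B \<equiv> fst (csum K A B)"
abbreviation csum_in where "csum_in K A B \<equiv> snd (csum K A B)"

text \<open>\<open>csum1 K f g = (z, \<kappa>)\<close>: the 1-cell \<open>z = f \<squnion> g\<close> together with isomorphisms
  \<open>\<kappa> l : z \<star> in l \<Rightarrow> in l \<star> (f or g)\<close>.\<close>

definition csum1 :: "('g, 'u, 'c) twocat \<Rightarrow> 'u \<Rightarrow> 'u \<Rightarrow> 'u \<times> (nat \<Rightarrow> 'c)" where
  "csum1 K f g =
    (let S = csum K (src1 K f) (src1 K g); T = csum K (trg1 K f) (trg1 K g) in
     SOME (z, \<kappa>). z \<in> hom1 K (fst S) (fst T) \<and>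
       (\<forall>l<2. \<kappa> l \<in> hom2 K (z \<star>\<^bsub>K\<^esub> snd S l) (snd T l \<star>\<^bsub>K\<^esub> two f g l) \<and> is_iso (cat2 K) (\<kappa> l)))"

definition csum2 :: "('g, 'u, 'c) twocat \<Rightarrow> (nat \<Rightarrow> 'u) \<Rightarrow> 'u \<Rightarrow> 'u \<Rightarrow> (nat \<Rightarrow> 'c) \<Rightarrow> 'c" where
  "csum2 K inc z z' \<sigma> = (THE \<zeta>. \<zeta> \<in> hom2 K z z' \<and> (\<forall>l<2. \<zeta> \<^bold>*\<^bsub>K\<^esub> id2 K (inc l) = \<sigma> l))"

definition sum1 ::
  "('g, 'u, 'c) twocat \<Rightarrow> 'g \<Rightarrow> 'g \<Rightarrow>
   ('u, 'c) slice1 \<times> ('u, 'c) slice1 \<Rightarrow> ('u, 'c) slice1" where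
  "sum1 K A B = (\<lambda>((u, w, \<alpha>, u'), (v, x, \<beta>, v')).
     let (t, \<kappa>) = csum1 K u v; (t', \<kappa>') = csum1 K u' v'; (z, \<rho>) = csum1 K w x;
         inc = csum_in K (src1 K u) (src1 K v);
         \<zeta> = csum2 K inc t (t' \<star>\<^bsub>K\<^esub> z) (\<lambda>l.
               (id2 K t' \<^bold>*\<^bsub>K\<^esub> inv2 K (\<rho> l)) \<bullet>\<^bsub>K\<^esub>
               (inv2 K (\<kappa>' l) \<^bold>*\<^bsub>K\<^esub> id2 K (two w x l)) \<bullet>\<^bsub>K\<^esub>
               (id2 K (csum_in K A B l) \<^bold>*\<^bsub>K\<^esub> two \<alpha> \<beta> l) \<bullet>\<^bsub>K\<^esub> \<kappa> l)
     in (t, z, \<zeta>, t'))"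

text \<open>The pseudofunctor \<open>K/A \<times> K/B \<rightarrow> K/(A \<squnion> B)\<close>, \<open>(u, v) \<mapsto> u \<squnion> v\<close>, for chosen coproducts.\<close>

definition slice_sum ::
  "('g, 'u, 'c) twocat \<Rightarrow> 'g \<Rightarrow> 'g \<Rightarrow>
   ('u \<times> 'u, ('u, 'c) slice1 \<times> ('u, 'c) slice1,
    (('u, 'c) slice1 \<times> 'c \<times> ('u, 'c) slice1) \<times> (('u, 'c) slice1 \<times> 'c \<times> ('u, 'c) slice1),
    'u, ('u, 'c) slice1, ('u, 'c) slice1 \<times> 'c \<times> ('u, 'c) slice1) psfun" where
  "slice_sum K A B =
     \<lparr>ps0 = (\<lambda>(u, v). fst (csum1 K u v)),
      ps1 = sum1 K A B,
      ps2 = (\<lambda>((c, \<theta>, c'), (d, \<phi>, d')).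
        case (c, d, c', d') of ((u, w, _, u'), (v, x, _, v'), (_, w', _, _), (_, x', _, _)) \<Rightarrow>
          let (z, \<rho>) = csum1 K w x; (z', \<rho>') = csum1 K w' x';
              \<zeta> = csum2 K (csum_in K (src1 K u) (src1 K v)) z z' (\<lambda>l.
                    inv2 K (\<rho>' l) \<bullet>\<^bsub>K\<^esub>
                    (id2 K (csum_in K (src1 K u') (src1 K v') l) \<^bold>*\<^bsub>K\<^esub> two \<theta> \<phi> l) \<bullet>\<^bsub>K\<^esub> \<rho> l)
          in (sum1 K A B (c, d), \<zeta>, sum1 K A B (c', d')))\<rparr>"

definition extensive :: "('g, 'u, 'c) twocat \<Rightarrow> bool" where
  "extensive K \<longleftrightarrow> has_finite_coproducts K \<and>
     (\<forall>A \<in> Ob K. \<forall>B \<in> Ob K.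
        biequivalence (prod_twocat (slice K A) (slice K B)) (slice K (csum_ob K A B))
          (slice_sum K A B))"

text \<open>\<open>pseudopullback K i u p q \<gamma>\<close>: for \<open>i : H \<rightarrow> G\<close>, \<open>u : L \<rightarrow> G\<close> the square
  \<open>p : P \<rightarrow> H\<close>, \<open>q : P \<rightarrow> L\<close>, \<open>\<gamma> : i \<star> p \<Rightarrow> u \<star> q\<close> is a pseudopullback.\<close>

definition pseudopullback ::
  "('g, 'u, 'c) twocat \<Rightarrow> 'u \<Rightarrow> 'u \<Rightarrow> 'u \<Rightarrow> 'u \<Rightarrow> 'c \<Rightarrow> bool" where
  "pseudopullback K i u p q \<gamma> \<longleftrightarrow> i \<in> One K \<and> u \<in> One K \<and> trg1 K i = trg1 K u \<and>
     p \<in> One K \<and> q \<in> One K \<and> src1 K p = src1 K q \<and> trg1 K p = src1 K i \<and> trg1 K q = src1 K u \<and>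
     \<gamma> \<in> hom2 K (i \<star>\<^bsub>K\<^esub> p) (u \<star>\<^bsub>K\<^esub> q) \<and> is_iso (cat2 K) \<gamma> \<and>
     (\<forall>T \<in> Ob K.
        let sq = (\<lambda>w. (p \<star>\<^bsub>K\<^esub> w, q \<star>\<^bsub>K\<^esub> w, \<gamma> \<^bold>*\<^bsub>K\<^esub> id2 K w)) in
        equivalence (Hom K T (src1 K p))
          (isocomma (Hom K T (src1 K i)) (Hom K T (src1 K u)) (Hom K T (trg1 K i))
             (postcomp K i) (postcomp K u))
          \<lparr>fobj = sq,
           farr = (\<lambda>\<theta>. (sq (dom2 K \<theta>), (id2 K p \<^bold>*\<^bsub>K\<^esub> \<theta>, id2 K q \<^bold>*\<^bsub>K\<^esub> \<theta>), sq (cod2 K \<theta>)))\<rparr>)"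

text \<open>The 2-full 2-subcategory is given by its set of 1-cells; it contains all objects because it
  contains the identities.\<close>

locale spannable_pair = two_one_category K
  for K :: "('g, 'u, 'c) twocat" (structure) +
  fixes J :: "'u set"
  assumes extensive: "extensive K"
    and J_one: "J \<subseteq> One K"
    and J_cmp: "\<lbrakk>i \<in> J; j \<in> J; trg1 K j = src1 K i\<rbrakk> \<Longrightarrow> i \<star> j \<in> J"
    and J_equivalence: "equivalence_one_cell K u \<Longrightarrow> u \<in> J"
    and J_iso_closed: "\<lbrakk>i \<in> J; iso_one_cells K i j\<rbrakk> \<Longrightarrow> j \<in> J"
    and mackey_square_exists: "\<lbrakk>i \<in> J; u \<in> One K; trg1 K i = trg1 K u\<rbrakk>
      \<Longrightarrow> \<exists>p q \<gamma>. pseudopullback K i u p q \<gamma> \<and> q \<in> J"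
    and J_coproduct: "\<lbrakk>coproduct K n A P inc; \<And>l. l < n \<Longrightarrow> us l \<in> hom1 K (A l) B; w \<in> hom1 K P B;
        \<And>l. l < n \<Longrightarrow> iso_one_cells K (w \<star> inc l) (us l)\<rbrakk>
      \<Longrightarrow> w \<in> J \<longleftrightarrow> (\<forall>l<n. us l \<in> J)"


section \<open>Linear and monoidal categories\<close>

record ('o, 'm, 'k) lincat = "('o, 'm) cat" +
  Add :: "'m \<Rightarrow> 'm \<Rightarrow> 'm"
  Zer :: "'o \<Rightarrow> 'o \<Rightarrow> 'm"
  Smu :: "'k \<Rightarrow> 'm \<Rightarrow> 'm"

text \<open>The Hom module; the multiplicative fields of the record are irrelevant for the locale
  \<open>module\<close>.\<close>

definition hom_module :: "('o, 'm, 'k, 'x) lincat_scheme \<Rightarrow> 'o \<Rightarrow> 'o \<Rightarrow> ('k, 'm) module" where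
  "hom_module C a b = \<lparr>carrier = homs C a b, monoid.mult = (\<lambda>_ _. undefined), one = undefined,
     zero = Zer C a b, add = Add C, smult = Smu C\<rparr>"

locale linear_category = category C
  for R :: "('k, 'r) ring_scheme" and C :: "('o, 'm, 'k, 'x) lincat_scheme" +
  assumes hom_module: "\<lbrakk>a \<in> Obj C; b \<in> Obj C\<rbrakk> \<Longrightarrow> module R (hom_module C a b)"
    and cmp_add_left: "\<lbrakk>f \<in> homs C a b; g \<in> homs C b c; g' \<in> homs C b c\<rbrakk>
      \<Longrightarrow> Add C g g' \<cdot>\<^bsub>C\<^esub> f = Add C (g \<cdot>\<^bsub>C\<^esub> f) (g' \<cdot>\<^bsub>C\<^esub> f)"
    and cmp_add_right: "\<lbrakk>f \<in> homs C a b; f' \<in> homs C a b; g \<in> homs C b c\<rbrakk>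
      \<Longrightarrow> g \<cdot>\<^bsub>C\<^esub> Add C f f' = Add C (g \<cdot>\<^bsub>C\<^esub> f) (g \<cdot>\<^bsub>C\<^esub> f')"
    and cmp_smu_left: "\<lbrakk>r \<in> carrier R; f \<in> homs C a b; g \<in> homs C b c\<rbrakk>
      \<Longrightarrow> Smu C r g \<cdot>\<^bsub>C\<^esub> f = Smu C r (g \<cdot>\<^bsub>C\<^esub> f)"
    and cmp_smu_right: "\<lbrakk>r \<in> carrier R; f \<in> homs C a b; g \<in> homs C b c\<rbrakk>
      \<Longrightarrow> g \<cdot>\<^bsub>C\<^esub> Smu C r f = Smu C r (g \<cdot>\<^bsub>C\<^esub> f)"

locale additive_category = linear_category R C
  for R :: "('k, 'r) ring_scheme" and C :: "('o, 'm, 'k, 'x) lincat_scheme" +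
  assumes zero_object: "\<exists>z \<in> Obj C. Ide C z = Zer C z z"
    and biproduct: "\<lbrakk>a \<in> Obj C; b \<in> Obj C\<rbrakk> \<Longrightarrow>
      \<exists>s \<in> Obj C. \<exists>i1 \<in> homs C a s. \<exists>i2 \<in> homs C b s. \<exists>p1 \<in> homs C s a. \<exists>p2 \<in> homs C s b.
        p1 \<cdot>\<^bsub>C\<^esub> i1 = Ide C a \<and> p2 \<cdot>\<^bsub>C\<^esub> i2 = Ide C b \<and>
        p1 \<cdot>\<^bsub>C\<^esub> i2 = Zer C b a \<and> p2 \<cdot>\<^bsub>C\<^esub> i1 = Zer C a b \<and>
        Add C (i1 \<cdot>\<^bsub>C\<^esub> p1) (i2 \<cdot>\<^bsub>C\<^esub> p2) = Ide C s"

locale idempotent_complete_additive = additive_category R C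
  for R :: "('k, 'r) ring_scheme" and C :: "('o, 'm, 'k, 'x) lincat_scheme" +
  assumes idempotents_split: "\<lbrakk>e \<in> homs C a a; e \<cdot>\<^bsub>C\<^esub> e = e\<rbrakk> \<Longrightarrow>
      \<exists>b \<in> Obj C. \<exists>r \<in> homs C a b. \<exists>s \<in> homs C b a. r \<cdot>\<^bsub>C\<^esub> s = Ide C b \<and> s \<cdot>\<^bsub>C\<^esub> r = e"

locale linear_functor = C: linear_category R C + D: linear_category R D + cfunctor C D F
  for R :: "('k, 'r) ring_scheme" and C :: "('o, 'm, 'k, 'x) lincat_scheme"
    and D :: "('p, 'n, 'k, 'y) lincat_scheme" and F :: "('o, 'm, 'p, 'n) func" +
  assumes farr_add: "\<lbrakk>f \<in> homs C a b; f' \<in> homs C a b\<rbrakk>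
      \<Longrightarrow> farr F (Add C f f') = Add D (farr F f) (farr F f')"
    and farr_smu: "\<lbrakk>r \<in> carrier R; f \<in> homs C a b\<rbrakk> \<Longrightarrow> farr F (Smu C r f) = Smu D r (farr F f)"

text \<open>\<open>X \<boxtimes> Y\<close> is the tensor product of objects and \<open>f \<boxdot> g\<close> that of arrows; the associator goes from
  \<open>(X \<boxtimes> Y) \<boxtimes> Z\<close> to \<open>X \<boxtimes> (Y \<boxtimes> Z)\<close>.\<close>

record ('o, 'm) mon =
  TO :: "'o \<Rightarrow> 'o \<Rightarrow> 'o" (infixr "\<boxtimes>\<index>" 70)
  TA :: "'m \<Rightarrow> 'm \<Rightarrow> 'm" (infixr "\<boxdot>\<index>" 70)
  Unit :: "'o"
  ass :: "'o \<Rightarrow> 'o \<Rightarrow> 'o \<Rightarrow> 'm"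
  lun :: "'o \<Rightarrow> 'm"
  run :: "'o \<Rightarrow> 'm"

locale monoidal_category = category C
  for C :: "('o, 'm, 'x) cat_scheme" and V :: "('o, 'm) mon" (structure) +
  assumes TO_obj: "\<lbrakk>a \<in> Obj C; b \<in> Obj C\<rbrakk> \<Longrightarrow> a \<boxtimes> b \<in> Obj C"
    and TA_hom: "\<lbrakk>f \<in> homs C a a'; g \<in> homs C b b'\<rbrakk> \<Longrightarrow> f \<boxdot> g \<in> homs C (a \<boxtimes> b) (a' \<boxtimes> b')"
    and TA_ide: "\<lbrakk>a \<in> Obj C; b \<in> Obj C\<rbrakk> \<Longrightarrow> Ide C a \<boxdot> Ide C b = Ide C (a \<boxtimes> b)"
    and TA_cmp: "\<lbrakk>f \<in> homs C a b; f' \<in> homs C b c; g \<in> homs C x y; g' \<in> homs C y z\<rbrakk>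
      \<Longrightarrow> (f' \<cdot>\<^bsub>C\<^esub> f) \<boxdot> (g' \<cdot>\<^bsub>C\<^esub> g) = (f' \<boxdot> g') \<cdot>\<^bsub>C\<^esub> (f \<boxdot> g)"
    and Un_obj: "Unit V \<in> Obj C"
    and ass_hom: "\<lbrakk>a \<in> Obj C; b \<in> Obj C; c \<in> Obj C\<rbrakk>
      \<Longrightarrow> ass V a b c \<in> homs C ((a \<boxtimes> b) \<boxtimes> c) (a \<boxtimes> (b \<boxtimes> c)) \<and> is_iso C (ass V a b c)"
    and ass_natural: "\<lbrakk>f \<in> homs C a a'; g \<in> homs C b b'; h \<in> homs C c c'\<rbrakk>
      \<Longrightarrow> ass V a' b' c' \<cdot>\<^bsub>C\<^esub> ((f \<boxdot> g) \<boxdot> h) = (f \<boxdot> (g \<boxdot> h)) \<cdot>\<^bsub>C\<^esub> ass V a b c"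
    and lun_hom: "a \<in> Obj C \<Longrightarrow> lun V a \<in> homs C (Unit V \<boxtimes> a) a \<and> is_iso C (lun V a)"
    and lun_natural: "f \<in> homs C a b
      \<Longrightarrow> lun V b \<cdot>\<^bsub>C\<^esub> (Ide C (Unit V) \<boxdot> f) = f \<cdot>\<^bsub>C\<^esub> lun V a"
    and run_hom: "a \<in> Obj C \<Longrightarrow> run V a \<in> homs C (a \<boxtimes> Unit V) a \<and> is_iso C (run V a)"
    and run_natural: "f \<in> homs C a b
      \<Longrightarrow> run V b \<cdot>\<^bsub>C\<^esub> (f \<boxdot> Ide C (Unit V)) = f \<cdot>\<^bsub>C\<^esub> run V a"
    and pentagon: "\<lbrakk>a \<in> Obj C; b \<in> Obj C; c \<in> Obj C; d \<in> Obj C\<rbrakk> \<Longrightarrow>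
      (Ide C a \<boxdot> ass V b c d) \<cdot>\<^bsub>C\<^esub> ass V a (b \<boxtimes> c) d \<cdot>\<^bsub>C\<^esub> (ass V a b c \<boxdot> Ide C d) =
      ass V a b (c \<boxtimes> d) \<cdot>\<^bsub>C\<^esub> ass V (a \<boxtimes> b) c d"
    and triangle: "\<lbrakk>a \<in> Obj C; b \<in> Obj C\<rbrakk> \<Longrightarrow>
      (Ide C a \<boxdot> lun V b) \<cdot>\<^bsub>C\<^esub> ass V a (Unit V) b = run V a \<boxdot> Ide C b"

locale braided_monoidal = monoidal_category C V
  for C :: "('o, 'm, 'x) cat_scheme" and V :: "('o, 'm) mon" (structure) +
  fixes br :: "'o \<Rightarrow> 'o \<Rightarrow> 'm"
  assumes br_hom: "\<lbrakk>a \<in> Obj C; b \<in> Obj C\<rbrakk>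
      \<Longrightarrow> br a b \<in> homs C (a \<boxtimes> b) (b \<boxtimes> a) \<and> is_iso C (br a b)"
    and br_natural: "\<lbrakk>f \<in> homs C a a'; g \<in> homs C b b'\<rbrakk>
      \<Longrightarrow> br a' b' \<cdot>\<^bsub>C\<^esub> (f \<boxdot> g) = (g \<boxdot> f) \<cdot>\<^bsub>C\<^esub> br a b"
    and hexagon: "\<lbrakk>a \<in> Obj C; b \<in> Obj C; c \<in> Obj C\<rbrakk> \<Longrightarrow>
      ass V b c a \<cdot>\<^bsub>C\<^esub> br a (b \<boxtimes> c) \<cdot>\<^bsub>C\<^esub> ass V a b c =
      (Ide C b \<boxdot> br a c) \<cdot>\<^bsub>C\<^esub> ass V b a c \<cdot>\<^bsub>C\<^esub> (br a b \<boxdot> Ide C c)"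
    and hexagon': "\<lbrakk>a \<in> Obj C; b \<in> Obj C; c \<in> Obj C\<rbrakk> \<Longrightarrow>
      cinv C (ass V c a b) \<cdot>\<^bsub>C\<^esub> br (a \<boxtimes> b) c \<cdot>\<^bsub>C\<^esub> cinv C (ass V a b c) =
      (br a c \<boxdot> Ide C b) \<cdot>\<^bsub>C\<^esub> cinv C (ass V a c b) \<cdot>\<^bsub>C\<^esub> (Ide C a \<boxdot> br b c)"

text \<open>Strong monoidal functors carry isomorphisms \<open>t X Y : F (X \<boxtimes> Y) \<rightarrow> F X \<boxtimes> F Y\<close> and \<open>t0 : F 1 \<rightarrow> 1\<close>.\<close>

locale strong_monoidal = C: monoidal_category C V + D: monoidal_category D W + cfunctor C D F
  for C :: "('o, 'm, 'x) cat_scheme" and V :: "('o, 'm) mon"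
    and D :: "('p, 'n, 'y) cat_scheme" and W :: "('p, 'n) mon"
    and F :: "('o, 'm, 'p, 'n) func" +
  fixes t :: "'o \<Rightarrow> 'o \<Rightarrow> 'n" and t0 :: 'n
  assumes t_hom: "\<lbrakk>a \<in> Obj C; b \<in> Obj C\<rbrakk> \<Longrightarrow>
      t a b \<in> homs D (fobj F (a \<boxtimes>\<^bsub>V\<^esub> b)) (fobj F a \<boxtimes>\<^bsub>W\<^esub> fobj F b) \<and> is_iso D (t a b)"
    and t_natural: "\<lbrakk>f \<in> homs C a a'; g \<in> homs C b b'\<rbrakk> \<Longrightarrow>
      t a' b' \<cdot>\<^bsub>D\<^esub> farr F (f \<boxdot>\<^bsub>V\<^esub> g) = (farr F f \<boxdot>\<^bsub>W\<^esub> farr F g) \<cdot>\<^bsub>D\<^esub> t a b"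
    and t0_hom: "t0 \<in> homs D (fobj F (Unit V)) (Unit W) \<and> is_iso D t0"
    and t_ass: "\<lbrakk>a \<in> Obj C; b \<in> Obj C; c \<in> Obj C\<rbrakk> \<Longrightarrow>
      ass W (fobj F a) (fobj F b) (fobj F c) \<cdot>\<^bsub>D\<^esub>
        (t a b \<boxdot>\<^bsub>W\<^esub> Ide D (fobj F c)) \<cdot>\<^bsub>D\<^esub> t (a \<boxtimes>\<^bsub>V\<^esub> b) c =
      (Ide D (fobj F a) \<boxdot>\<^bsub>W\<^esub> t b c) \<cdot>\<^bsub>D\<^esub> t a (b \<boxtimes>\<^bsub>V\<^esub> c) \<cdot>\<^bsub>D\<^esub> farr F (ass V a b c)"
    and t_lun: "a \<in> Obj C \<Longrightarrow>
      lun W (fobj F a) \<cdot>\<^bsub>D\<^esub> (t0 \<boxdot>\<^bsub>W\<^esub> Ide D (fobj F a)) \<cdot>\<^bsub>D\<^esub> t (Unit V) a = farr F (lun V a)"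
    and t_run: "a \<in> Obj C \<Longrightarrow>
      run W (fobj F a) \<cdot>\<^bsub>D\<^esub> (Ide D (fobj F a) \<boxdot>\<^bsub>W\<^esub> t0) \<cdot>\<^bsub>D\<^esub> t a (Unit V) = farr F (run V a)"

definition braided_strong_monoidal ::
  "('o, 'm, 'x) cat_scheme \<Rightarrow> ('o, 'm) mon \<Rightarrow> ('o \<Rightarrow> 'o \<Rightarrow> 'm) \<Rightarrow>
   ('p, 'n, 'y) cat_scheme \<Rightarrow> ('p, 'n) mon \<Rightarrow> ('p \<Rightarrow> 'p \<Rightarrow> 'n) \<Rightarrow>
   ('o, 'm, 'p, 'n) func \<Rightarrow> ('o \<Rightarrow> 'o \<Rightarrow> 'n) \<Rightarrow> 'n \<Rightarrow> bool" where
  "braided_strong_monoidal C V br D W br' F t t0 \<longleftrightarrow>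
     braided_monoidal C V br \<and> braided_monoidal D W br' \<and> strong_monoidal C V D W F t t0 \<and>
     (\<forall>a \<in> Obj C. \<forall>b \<in> Obj C.
        br' (fobj F a) (fobj F b) \<cdot>\<^bsub>D\<^esub> t a b = t b a \<cdot>\<^bsub>D\<^esub> farr F (br a b))"

definition braided_monoidal_equivalence ::
  "('o, 'm, 'x) cat_scheme \<Rightarrow> ('o, 'm) mon \<Rightarrow> ('o \<Rightarrow> 'o \<Rightarrow> 'm) \<Rightarrow>
   ('p, 'n, 'y) cat_scheme \<Rightarrow> ('p, 'n) mon \<Rightarrow> ('p \<Rightarrow> 'p \<Rightarrow> 'n) \<Rightarrow>
   ('o, 'm, 'p, 'n) func \<Rightarrow> bool" where
  "braided_monoidal_equivalence C V br D W br' F \<longleftrightarrow>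
     equivalence C D F \<and> (\<exists>t t0. braided_strong_monoidal C V br D W br' F t t0)"


section \<open>Modules and comodules\<close>

text \<open>Left modules \<open>(X, a : A \<boxtimes> X \<rightarrow> X)\<close> over a monoid \<open>(A, \<mu>, \<iota>)\<close>; arrows of the module category are
  tagged with their source and target.\<close>

definition left_modules ::
  "('o, 'm, 'x) cat_scheme \<Rightarrow> ('o, 'm) mon \<Rightarrow> 'o \<Rightarrow> 'm \<Rightarrow> 'm \<Rightarrow> ('o \<times> 'm) set" where
  "left_modules C V A \<mu> \<iota> = {(X, a). X \<in> Obj C \<and> a \<in> homs C (A \<boxtimes>\<^bsub>V\<^esub> X) X \<and>
     a \<cdot>\<^bsub>C\<^esub> (Ide C A \<boxdot>\<^bsub>V\<^esub> a) \<cdot>\<^bsub>C\<^esub> ass V A A X = a \<cdot>\<^bsub>C\<^esub> (\<mu> \<boxdot>\<^bsub>V\<^esub> Ide C X) \<and>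
     a \<cdot>\<^bsub>C\<^esub> (\<iota> \<boxdot>\<^bsub>V\<^esub> Ide C X) = lun V X}"

definition mod_cat ::
  "('o, 'm, 'x) cat_scheme \<Rightarrow> ('o, 'm) mon \<Rightarrow> 'o \<Rightarrow> 'm \<Rightarrow> 'm \<Rightarrow>
   ('o \<times> 'm, ('o \<times> 'm) \<times> 'm \<times> ('o \<times> 'm)) cat" where
  "mod_cat C V A \<mu> \<iota> =
     \<lparr>Obj = left_modules C V A \<mu> \<iota>,
      Arr = {((X, a), f, (Y, b)) | X a f Y b.
               (X, a) \<in> left_modules C V A \<mu> \<iota> \<and> (Y, b) \<in> left_modules C V A \<mu> \<iota> \<and>
               f \<in> homs C X Y \<and> f \<cdot>\<^bsub>C\<^esub> a = b \<cdot>\<^bsub>C\<^esub> (Ide C A \<boxdot>\<^bsub>V\<^esub> f)},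
      Dom = (\<lambda>(M, _, _). M),
      Cod = (\<lambda>(_, _, N). N),
      Ide = (\<lambda>M. (M, Ide C (fst M), M)),
      Cmp = (\<lambda>(_, g, P) (M, f, _). (M, g \<cdot>\<^bsub>C\<^esub> f, P))\<rparr>"

definition left_comodules ::
  "('o, 'm, 'x) cat_scheme \<Rightarrow> ('o, 'm) mon \<Rightarrow> 'o \<Rightarrow> 'm \<Rightarrow> 'm \<Rightarrow> ('o \<times> 'm) set" where
  "left_comodules C V A \<delta> \<epsilon> = {(X, c). X \<in> Obj C \<and> c \<in> homs C X (A \<boxtimes>\<^bsub>V\<^esub> X) \<and>
     ass V A A X \<cdot>\<^bsub>C\<^esub> (\<delta> \<boxdot>\<^bsub>V\<^esub> Ide C X) \<cdot>\<^bsub>C\<^esub> c = (Ide C A \<boxdot>\<^bsub>V\<^esub> c) \<cdot>\<^bsub>C\<^esub> c \<and>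
     lun V X \<cdot>\<^bsub>C\<^esub> (\<epsilon> \<boxdot>\<^bsub>V\<^esub> Ide C X) \<cdot>\<^bsub>C\<^esub> c = Ide C X}"

definition comod_cat ::
  "('o, 'm, 'x) cat_scheme \<Rightarrow> ('o, 'm) mon \<Rightarrow> 'o \<Rightarrow> 'm \<Rightarrow> 'm \<Rightarrow>
   ('o \<times> 'm, ('o \<times> 'm) \<times> 'm \<times> ('o \<times> 'm)) cat" where
  "comod_cat C V A \<delta> \<epsilon> =
     \<lparr>Obj = left_comodules C V A \<delta> \<epsilon>,
      Arr = {((X, c), f, (Y, d)) | X c f Y d.
               (X, c) \<in> left_comodules C V A \<delta> \<epsilon> \<and> (Y, d) \<in> left_comodules C V A \<delta> \<epsilon> \<and>
               f \<in> homs C X Y \<and> d \<cdot>\<^bsub>C\<^esub> f = (Ide C A \<boxdot>\<^bsub>V\<^esub> f) \<cdot>\<^bsub>C\<^esub> c},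
      Dom = (\<lambda>(M, _, _). M),
      Cod = (\<lambda>(_, _, N). N),
      Ide = (\<lambda>M. (M, Ide C (fst M), M)),
      Cmp = (\<lambda>(_, g, P) (M, f, _). (M, g \<cdot>\<^bsub>C\<^esub> f, P))\<rparr>"

definition forget :: "('o \<times> 'm, ('o \<times> 'm) \<times> 'm \<times> ('o \<times> 'm), 'o, 'm) func" where
  "forget = \<lparr>fobj = fst, farr = (\<lambda>(_, f, _). f)\<rparr>"

definition free_mod ::
  "('o, 'm, 'x) cat_scheme \<Rightarrow> ('o, 'm) mon \<Rightarrow> 'o \<Rightarrow> 'm \<Rightarrow> 'o \<Rightarrow> 'o \<times> 'm" where
  "free_mod C V A \<mu> X = (A \<boxtimes>\<^bsub>V\<^esub> X, (\<mu> \<boxdot>\<^bsub>V\<^esub> Ide C X) \<cdot>\<^bsub>C\<^esub> cinv C (ass V A A X))"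

definition free_functor ::
  "('o, 'm, 'x) cat_scheme \<Rightarrow> ('o, 'm) mon \<Rightarrow> 'o \<Rightarrow> 'm \<Rightarrow>
   ('o, 'm, 'o \<times> 'm, ('o \<times> 'm) \<times> 'm \<times> ('o \<times> 'm)) func" where
  "free_functor C V A \<mu> =
     \<lparr>fobj = free_mod C V A \<mu>,
      farr = (\<lambda>f. (free_mod C V A \<mu> (Dom C f), Ide C A \<boxdot>\<^bsub>V\<^esub> f, free_mod C V A \<mu> (Cod C f)))\<rparr>"

definition free_unit ::
  "('o, 'm, 'x) cat_scheme \<Rightarrow> ('o, 'm) mon \<Rightarrow> 'm \<Rightarrow> 'o \<Rightarrow> 'm" where
  "free_unit C V \<iota> X = (\<iota> \<boxdot>\<^bsub>V\<^esub> Ide C X) \<cdot>\<^bsub>C\<^esub> cinv C (lun V X)"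

definition free_counit ::
  "('o, 'm, 'x) cat_scheme \<Rightarrow> ('o, 'm) mon \<Rightarrow> 'o \<Rightarrow> 'm \<Rightarrow>
   'o \<times> 'm \<Rightarrow> ('o \<times> 'm) \<times> 'm \<times> ('o \<times> 'm)" where
  "free_counit C V A \<mu> M = (free_mod C V A \<mu> (fst M), snd M, M)"

definition cofree_comod ::
  "('o, 'm, 'x) cat_scheme \<Rightarrow> ('o, 'm) mon \<Rightarrow> 'o \<Rightarrow> 'm \<Rightarrow> 'o \<Rightarrow> 'o \<times> 'm" where
  "cofree_comod C V A \<delta> X = (A \<boxtimes>\<^bsub>V\<^esub> X, ass V A A X \<cdot>\<^bsub>C\<^esub> (\<delta> \<boxdot>\<^bsub>V\<^esub> Ide C X))"

definition cofree_functor ::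
  "('o, 'm, 'x) cat_scheme \<Rightarrow> ('o, 'm) mon \<Rightarrow> 'o \<Rightarrow> 'm \<Rightarrow>
   ('o, 'm, 'o \<times> 'm, ('o \<times> 'm) \<times> 'm \<times> ('o \<times> 'm)) func" where
  "cofree_functor C V A \<delta> =
     \<lparr>fobj = cofree_comod C V A \<delta>,
      farr = (\<lambda>f. (cofree_comod C V A \<delta> (Dom C f), Ide C A \<boxdot>\<^bsub>V\<^esub> f, cofree_comod C V A \<delta> (Cod C f)))\<rparr>"

definition cofree_unit ::
  "('o, 'm, 'x) cat_scheme \<Rightarrow> ('o, 'm) mon \<Rightarrow> 'o \<Rightarrow> 'm \<Rightarrow>
   'o \<times> 'm \<Rightarrow> ('o \<times> 'm) \<times> 'm \<times> ('o \<times> 'm)" where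
  "cofree_unit C V A \<delta> M = (M, snd M, cofree_comod C V A \<delta> (fst M))"

definition cofree_counit ::
  "('o, 'm, 'x) cat_scheme \<Rightarrow> ('o, 'm) mon \<Rightarrow> 'm \<Rightarrow> 'o \<Rightarrow> 'm" where
  "cofree_counit C V \<epsilon> X = lun V X \<cdot>\<^bsub>C\<^esub> (\<epsilon> \<boxdot>\<^bsub>V\<^esub> Ide C X)"

subsection \<open>Tensor products over a monoid and over a comonoid in a braided category\<close>

text \<open>\<open>q\<close> is a split coequalizer of \<open>f, g : Z \<rightarrow> X\<close>, and \<open>e\<close> a split equalizer of \<open>f, g : X \<rightarrow> Z\<close>.\<close>

definition split_coequalizer :: "('o, 'm, 'x) cat_scheme \<Rightarrow> 'm \<Rightarrow> 'm \<Rightarrow> 'm \<Rightarrow> bool" where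
  "split_coequalizer C f g q \<longleftrightarrow>
     f \<in> Arr C \<and> g \<in> homs C (Dom C f) (Cod C f) \<and> q \<in> Arr C \<and> Dom C q = Cod C f \<and>
     q \<cdot>\<^bsub>C\<^esub> f = q \<cdot>\<^bsub>C\<^esub> g \<and>
     (\<exists>s \<in> homs C (Cod C q) (Dom C q). \<exists>t \<in> homs C (Cod C f) (Dom C f).
        q \<cdot>\<^bsub>C\<^esub> s = Ide C (Cod C q) \<and> f \<cdot>\<^bsub>C\<^esub> t = Ide C (Cod C f) \<and> g \<cdot>\<^bsub>C\<^esub> t = s \<cdot>\<^bsub>C\<^esub> q)"

definition split_equalizer :: "('o, 'm, 'x) cat_scheme \<Rightarrow> 'm \<Rightarrow> 'm \<Rightarrow> 'm \<Rightarrow> bool" where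
  "split_equalizer C f g e \<longleftrightarrow>
     f \<in> Arr C \<and> g \<in> homs C (Dom C f) (Cod C f) \<and> e \<in> Arr C \<and> Cod C e = Dom C f \<and>
     f \<cdot>\<^bsub>C\<^esub> e = g \<cdot>\<^bsub>C\<^esub> e \<and>
     (\<exists>s \<in> homs C (Cod C e) (Dom C e). \<exists>t \<in> homs C (Cod C f) (Dom C f).
        s \<cdot>\<^bsub>C\<^esub> e = Ide C (Dom C e) \<and> t \<cdot>\<^bsub>C\<^esub> f = Ide C (Dom C f) \<and> t \<cdot>\<^bsub>C\<^esub> g = e \<cdot>\<^bsub>C\<^esub> s)"

text \<open>In a braided category, a left module \<open>(X, a)\<close> gets the right action
  \<open>X \<boxtimes> A \<rightarrow> A \<boxtimes> X \<rightarrow> X\<close>, and a left comodule the right coaction \<open>X \<rightarrow> A \<boxtimes> X \<rightarrow> X \<boxtimes> A\<close>.\<close>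

definition right_action ::
  "('o, 'm, 'x) cat_scheme \<Rightarrow> ('o \<Rightarrow> 'o \<Rightarrow> 'm) \<Rightarrow> 'o \<Rightarrow> 'o \<times> 'm \<Rightarrow> 'm" where
  "right_action C br A M = snd M \<cdot>\<^bsub>C\<^esub> br (fst M) A"

definition right_coaction ::
  "('o, 'm, 'x) cat_scheme \<Rightarrow> ('o \<Rightarrow> 'o \<Rightarrow> 'm) \<Rightarrow> 'o \<Rightarrow> 'o \<times> 'm \<Rightarrow> 'm" where
  "right_coaction C br A M = br A (fst M) \<cdot>\<^bsub>C\<^esub> snd M"

text \<open>\<open>mod_tensor \<dots> M N T q\<close>: the module \<open>T\<close> is a tensor product of \<open>M = (X, a)\<close> and \<open>N = (Y, b)\<close>
  over \<open>A\<close>, with quotient map \<open>q : X \<boxtimes> Y \<rightarrow> T\<close>; the action on \<open>T\<close> is induced by that on \<open>X\<close>. The map \<open>q\<close>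
  is the split coequalizer of the action on \<open>Y\<close> and the right action on \<open>X\<close>.\<close>

definition mod_tensor ::
  "('o, 'm, 'x) cat_scheme \<Rightarrow> ('o, 'm) mon \<Rightarrow> ('o \<Rightarrow> 'o \<Rightarrow> 'm) \<Rightarrow> 'o \<Rightarrow> 'm \<Rightarrow> 'm \<Rightarrow>
   'o \<times> 'm \<Rightarrow> 'o \<times> 'm \<Rightarrow> 'o \<times> 'm \<Rightarrow> 'm \<Rightarrow> bool" where
  "mod_tensor C V br A \<mu> \<iota> M N T q \<longleftrightarrow>
     T \<in> left_modules C V A \<mu> \<iota> \<and> q \<in> homs C (fst M \<boxtimes>\<^bsub>V\<^esub> fst N) (fst T) \<and>
     split_coequalizer C
       ((Ide C (fst M) \<boxdot>\<^bsub>V\<^esub> snd N) \<cdot>\<^bsub>C\<^esub> ass V (fst M) A (fst N))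
       (right_action C br A M \<boxdot>\<^bsub>V\<^esub> Ide C (fst N)) q \<and>
     snd T \<cdot>\<^bsub>C\<^esub> (Ide C A \<boxdot>\<^bsub>V\<^esub> q) =
       q \<cdot>\<^bsub>C\<^esub> (snd M \<boxdot>\<^bsub>V\<^esub> Ide C (fst N)) \<cdot>\<^bsub>C\<^esub> cinv C (ass V A (fst M) (fst N))"

definition comod_tensor ::
  "('o, 'm, 'x) cat_scheme \<Rightarrow> ('o, 'm) mon \<Rightarrow> ('o \<Rightarrow> 'o \<Rightarrow> 'm) \<Rightarrow> 'o \<Rightarrow> 'm \<Rightarrow> 'm \<Rightarrow>
   'o \<times> 'm \<Rightarrow> 'o \<times> 'm \<Rightarrow> 'o \<times> 'm \<Rightarrow> 'm \<Rightarrow> bool" where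
  "comod_tensor C V br A \<delta> \<epsilon> M N T e \<longleftrightarrow>
     T \<in> left_comodules C V A \<delta> \<epsilon> \<and> e \<in> homs C (fst T) (fst M \<boxtimes>\<^bsub>V\<^esub> fst N) \<and>
     split_equalizer C
       (cinv C (ass V (fst M) A (fst N)) \<cdot>\<^bsub>C\<^esub> (Ide C (fst M) \<boxdot>\<^bsub>V\<^esub> snd N))
       (right_coaction C br A M \<boxdot>\<^bsub>V\<^esub> Ide C (fst N)) e \<and>
     (Ide C A \<boxdot>\<^bsub>V\<^esub> e) \<cdot>\<^bsub>C\<^esub> snd T =
       ass V A (fst M) (fst N) \<cdot>\<^bsub>C\<^esub> (snd M \<boxdot>\<^bsub>V\<^esub> Ide C (fst N)) \<cdot>\<^bsub>C\<^esub> e"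

text \<open>A choice \<open>S M N = (T, q)\<close> of tensor products for all pairs. Tensor products are unique up to
  unique isomorphism, so the structures below depend on \<open>S\<close> only up to equivalence.\<close>

type_synonym ('o, 'm) tensor_choice = "'o \<times> 'm \<Rightarrow> 'o \<times> 'm \<Rightarrow> ('o \<times> 'm) \<times> 'm"

definition mod_tensors ::
  "('o, 'm, 'x) cat_scheme \<Rightarrow> ('o, 'm) mon \<Rightarrow> ('o \<Rightarrow> 'o \<Rightarrow> 'm) \<Rightarrow> 'o \<Rightarrow> 'm \<Rightarrow> 'm \<Rightarrow>
   ('o, 'm) tensor_choice \<Rightarrow> bool" where
  "mod_tensors C V br A \<mu> \<iota> S \<longleftrightarrow>
     (\<forall>M \<in> left_modules C V A \<mu> \<iota>. \<forall>N \<in> left_modules C V A \<mu> \<iota>.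
        mod_tensor C V br A \<mu> \<iota> M N (fst (S M N)) (snd (S M N)))"

definition comod_tensors ::
  "('o, 'm, 'x) cat_scheme \<Rightarrow> ('o, 'm) mon \<Rightarrow> ('o \<Rightarrow> 'o \<Rightarrow> 'm) \<Rightarrow> 'o \<Rightarrow> 'm \<Rightarrow> 'm \<Rightarrow>
   ('o, 'm) tensor_choice \<Rightarrow> bool" where
  "comod_tensors C V br A \<delta> \<epsilon> S \<longleftrightarrow>
     (\<forall>M \<in> left_comodules C V A \<delta> \<epsilon>. \<forall>N \<in> left_comodules C V A \<delta> \<epsilon>.
        comod_tensor C V br A \<delta> \<epsilon> M N (fst (S M N)) (snd (S M N)))"

text \<open>The structure maps of the tensor product over \<open>A\<close> are the arrows induced on the quotients,
  respectively on the subobjects, by those of the ambient category.\<close>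

definition mod_mon ::
  "('o, 'm, 'x) cat_scheme \<Rightarrow> ('o, 'm) mon \<Rightarrow> ('o \<Rightarrow> 'o \<Rightarrow> 'm) \<Rightarrow> 'o \<Rightarrow> 'm \<Rightarrow>
   ('o, 'm) tensor_choice \<Rightarrow> ('o \<times> 'm, ('o \<times> 'm) \<times> 'm \<times> ('o \<times> 'm)) mon" where
  "mod_mon C V br A \<mu> S =
    (let T = (\<lambda>M N. fst (S M N)); q = (\<lambda>M N. snd (S M N)) in
     \<lparr>TO = T,
      TA = (\<lambda>(M, f, M') (N, g, N').
        (T M N,
         THE h. h \<in> homs C (fst (T M N)) (fst (T M' N')) \<and>
                h \<cdot>\<^bsub>C\<^esub> q M N = q M' N' \<cdot>\<^bsub>C\<^esub> (f \<boxdot>\<^bsub>V\<^esub> g),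
         T M' N')),
      Unit = (A, \<mu>),
      ass = (\<lambda>M N P.
        (T (T M N) P,
         THE h. h \<in> homs C (fst (T (T M N) P)) (fst (T M (T N P))) \<and>
                h \<cdot>\<^bsub>C\<^esub> q (T M N) P \<cdot>\<^bsub>C\<^esub> (q M N \<boxdot>\<^bsub>V\<^esub> Ide C (fst P)) =
                q M (T N P) \<cdot>\<^bsub>C\<^esub> (Ide C (fst M) \<boxdot>\<^bsub>V\<^esub> q N P) \<cdot>\<^bsub>C\<^esub> ass V (fst M) (fst N) (fst P),
         T M (T N P))),
      lun = (\<lambda>M.
        (T (A, \<mu>) M,
         THE h. h \<in> homs C (fst (T (A, \<mu>) M)) (fst M) \<and> h \<cdot>\<^bsub>C\<^esub> q (A, \<mu>) M = snd M,
         M)),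
      run = (\<lambda>M.
        (T M (A, \<mu>),
         THE h. h \<in> homs C (fst (T M (A, \<mu>))) (fst M) \<and>
                h \<cdot>\<^bsub>C\<^esub> q M (A, \<mu>) = right_action C br A M,
         M))\<rparr>)"

definition mod_braiding ::
  "('o, 'm, 'x) cat_scheme \<Rightarrow> ('o \<Rightarrow> 'o \<Rightarrow> 'm) \<Rightarrow> ('o, 'm) tensor_choice \<Rightarrow>
   'o \<times> 'm \<Rightarrow> 'o \<times> 'm \<Rightarrow> ('o \<times> 'm) \<times> 'm \<times> ('o \<times> 'm)" where
  "mod_braiding C br S M N =
     (fst (S M N),
      THE h. h \<in> homs C (fst (fst (S M N))) (fst (fst (S N M))) \<and>
             h \<cdot>\<^bsub>C\<^esub> snd (S M N) = snd (S N M) \<cdot>\<^bsub>C\<^esub> br (fst M) (fst N),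
      fst (S N M))"

definition comod_mon ::
  "('o, 'm, 'x) cat_scheme \<Rightarrow> ('o, 'm) mon \<Rightarrow> ('o \<Rightarrow> 'o \<Rightarrow> 'm) \<Rightarrow> 'o \<Rightarrow> 'm \<Rightarrow>
   ('o, 'm) tensor_choice \<Rightarrow> ('o \<times> 'm, ('o \<times> 'm) \<times> 'm \<times> ('o \<times> 'm)) mon" where
  "comod_mon C V br A \<delta> S =
    (let T = (\<lambda>M N. fst (S M N)); e = (\<lambda>M N. snd (S M N)) in
     \<lparr>TO = T,
      TA = (\<lambda>(M, f, M') (N, g, N').
        (T M N,
         THE h. h \<in> homs C (fst (T M N)) (fst (T M' N')) \<and>
                e M' N' \<cdot>\<^bsub>C\<^esub> h = (f \<boxdot>\<^bsub>V\<^esub> g) \<cdot>\<^bsub>C\<^esub> e M N,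
         T M' N')),
      Unit = (A, \<delta>),
      ass = (\<lambda>M N P.
        (T (T M N) P,
         THE h. h \<in> homs C (fst (T (T M N) P)) (fst (T M (T N P))) \<and>
                (Ide C (fst M) \<boxdot>\<^bsub>V\<^esub> e N P) \<cdot>\<^bsub>C\<^esub> e M (T N P) \<cdot>\<^bsub>C\<^esub> h =
                ass V (fst M) (fst N) (fst P) \<cdot>\<^bsub>C\<^esub> (e M N \<boxdot>\<^bsub>V\<^esub> Ide C (fst P)) \<cdot>\<^bsub>C\<^esub> e (T M N) P,
         T M (T N P))),
      lun = (\<lambda>M.
        (T (A, \<delta>) M,
         cinv C (THE h. h \<in> homs C (fst M) (fst (T (A, \<delta>) M)) \<and> e (A, \<delta>) M \<cdot>\<^bsub>C\<^esub> h = snd M),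
         M)),
      run = (\<lambda>M.
        (T M (A, \<delta>),
         cinv C (THE h. h \<in> homs C (fst M) (fst (T M (A, \<delta>))) \<and>
                        e M (A, \<delta>) \<cdot>\<^bsub>C\<^esub> h = right_coaction C br A M),
         M))\<rparr>)"

definition comod_braiding ::
  "('o, 'm, 'x) cat_scheme \<Rightarrow> ('o \<Rightarrow> 'o \<Rightarrow> 'm) \<Rightarrow> ('o, 'm) tensor_choice \<Rightarrow>
   'o \<times> 'm \<Rightarrow> 'o \<times> 'm \<Rightarrow> ('o \<times> 'm) \<times> 'm \<times> ('o \<times> 'm)" where
  "comod_braiding C br S M N =
     (fst (S M N),
      THE h. h \<in> homs C (fst (fst (S M N))) (fst (fst (S N M))) \<and>
             snd (S N M) \<cdot>\<^bsub>C\<^esub> h = br (fst M) (fst N) \<cdot>\<^bsub>C\<^esub> snd (S M N),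
      fst (S N M))"


section \<open>Mackey 2-functors\<close>

text \<open>\<open>pull M u\<close> is \<open>u\<^sup>*\<close> and \<open>cell M \<alpha>\<close> is \<open>\<alpha>\<^sup>*\<close>. A single functor \<open>push M i\<close> plays the role of
  \<open>i\<^sub>!\<close> and of \<open>i\<^sub>*\<close>, which are equal for rectified Mackey 2-functors; \<open>leta, leps\<close> are unit and counit
  of \<open>i\<^sub>! \<stileturn> i\<^sup>*\<close>, and \<open>reta, reps\<close> those of \<open>i\<^sup>* \<stileturn> i\<^sub>*\<close>.\<close>

record ('g, 'u, 'c, 'o, 'm, 'k) twofun =
  val :: "'g \<Rightarrow> ('o, 'm, 'k) lincat"
  pull :: "'u \<Rightarrow> ('o, 'm, 'o, 'm) func"
  cell :: "'c \<Rightarrow> 'o \<Rightarrow> 'm"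

record ('g, 'u, 'c, 'o, 'm, 'k) mackey = "('g, 'u, 'c, 'o, 'm, 'k) twofun" +
  push :: "'u \<Rightarrow> ('o, 'm, 'o, 'm) func"
  leta :: "'u \<Rightarrow> 'o \<Rightarrow> 'm"
  leps :: "'u \<Rightarrow> 'o \<Rightarrow> 'm"
  reta :: "'u \<Rightarrow> 'o \<Rightarrow> 'm"
  reps :: "'u \<Rightarrow> 'o \<Rightarrow> 'm"

text \<open>Strict 2-functors from \<open>K\<close> (with 1-cells reversed) to idempotent complete additive linear
  categories.\<close>

locale additive_two_functor = K: two_category K
  for R :: "('k, 'r) ring_scheme" and K :: "('g, 'u, 'c) twocat"
    and M :: "('g, 'u, 'c, 'o, 'm, 'k, 'x) twofun_scheme" +
  assumes base_ring: "cring R"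
    and val_idempotent_complete: "G \<in> Ob K \<Longrightarrow> idempotent_complete_additive R (val M G)"
    and pull_linear: "u \<in> hom1 K H G \<Longrightarrow> linear_functor R (val M G) (val M H) (pull M u)"
    and pull_id: "G \<in> Ob K \<Longrightarrow> feq (val M G) (pull M (id1 K G)) fid"
    and pull_cmp: "\<lbrakk>u \<in> hom1 K L H; v \<in> hom1 K H G\<rbrakk>
      \<Longrightarrow> feq (val M G) (pull M (v \<star>\<^bsub>K\<^esub> u)) (fcomp (pull M u) (pull M v))"
    and cell_natural: "\<lbrakk>u \<in> hom1 K H G; \<alpha> \<in> hom2 K u v\<rbrakk>
      \<Longrightarrow> nat_trans (val M G) (val M H) (pull M u) (pull M v) (cell M \<alpha>)"
    and cell_id: "\<lbrakk>u \<in> hom1 K H G; X \<in> Obj (val M G)\<rbrakk>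
      \<Longrightarrow> cell M (id2 K u) X = Ide (val M H) (fobj (pull M u) X)"
    and cell_vcmp: "\<lbrakk>u \<in> hom1 K H G; \<alpha> \<in> hom2 K u v; \<beta> \<in> hom2 K v w; X \<in> Obj (val M G)\<rbrakk>
      \<Longrightarrow> cell M (\<beta> \<bullet>\<^bsub>K\<^esub> \<alpha>) X = cell M \<beta> X \<cdot>\<^bsub>val M H\<^esub> cell M \<alpha> X"
    and cell_hcmp: "\<lbrakk>u \<in> hom1 K L H; v \<in> hom1 K H G; \<alpha> \<in> hom2 K u u'; \<beta> \<in> hom2 K v v';
        X \<in> Obj (val M G)\<rbrakk>
      \<Longrightarrow> cell M (\<beta> \<^bold>*\<^bsub>K\<^esub> \<alpha>) X =
          cell M \<alpha> (fobj (pull M v') X) \<cdot>\<^bsub>val M L\<^esub> farr (pull M u) (cell M \<beta> X)"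

text \<open>For a square \<open>\<gamma> : i \<star> p \<Rightarrow> u \<star> q\<close>, \<open>mate_left \<dots> \<gamma> Y\<close> is the component
  \<open>q\<^sub>! p\<^sup>* Y \<rightarrow> u\<^sup>* i\<^sub>! Y\<close> of \<open>\<gamma>\<^sub>!\<close>. For \<open>\<gamma> : u \<star> q \<Rightarrow> i \<star> p\<close>, \<open>mate_right \<dots> \<gamma> Y\<close> is the component
  \<open>u\<^sup>* i\<^sub>* Y \<rightarrow> q\<^sub>* p\<^sup>* Y\<close> of \<open>\<gamma>\<^sub>*\<close>.\<close>

definition mate_left ::
  "('g, 'u, 'c) twocat \<Rightarrow> ('g, 'u, 'c, 'o, 'm, 'k, 'x) mackey_scheme \<Rightarrow>
   'u \<Rightarrow> 'u \<Rightarrow> 'u \<Rightarrow> 'u \<Rightarrow> 'c \<Rightarrow> 'o \<Rightarrow> 'm" where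
  "mate_left K M i u p q \<gamma> Y =
    (let D = val M (src1 K u); Z = fobj (push M i) Y in
     leps M q (fobj (pull M u) Z) \<cdot>\<^bsub>D\<^esub> farr (push M q) (cell M \<gamma> Z) \<cdot>\<^bsub>D\<^esub>
     farr (push M q) (farr (pull M p) (leta M i Y)))"

definition mate_right ::
  "('g, 'u, 'c) twocat \<Rightarrow> ('g, 'u, 'c, 'o, 'm, 'k, 'x) mackey_scheme \<Rightarrow>
   'u \<Rightarrow> 'u \<Rightarrow> 'u \<Rightarrow> 'u \<Rightarrow> 'c \<Rightarrow> 'o \<Rightarrow> 'm" where
  "mate_right K M i u p q \<gamma> Y =
    (let D = val M (src1 K u); Z = fobj (push M i) Y in
     farr (push M q) (farr (pull M p) (reps M i Y)) \<cdot>\<^bsub>D\<^esub> farr (push M q) (cell M \<gamma> Z) \<cdot>\<^bsub>D\<^esub>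
     reta M q (fobj (pull M u) Z))"

text \<open>The canonical comparison maps \<open>(i \<star> j)\<^sub>! Y \<rightarrow> i\<^sub>! j\<^sub>! Y\<close> and \<open>i\<^sub>* j\<^sub>* Y \<rightarrow> (i \<star> j)\<^sub>* Y\<close>.\<close>

definition push_cmp_left ::
  "('g, 'u, 'c) twocat \<Rightarrow> ('g, 'u, 'c, 'o, 'm, 'k, 'x) mackey_scheme \<Rightarrow> 'u \<Rightarrow> 'u \<Rightarrow> 'o \<Rightarrow> 'm" where
  "push_cmp_left K M i j Y =
    (let Z = fobj (push M j) Y in
     leps M (i \<star>\<^bsub>K\<^esub> j) (fobj (push M i) Z) \<cdot>\<^bsub>val M (trg1 K i)\<^esub>
     farr (push M (i \<star>\<^bsub>K\<^esub> j)) (farr (pull M j) (leta M i Z) \<cdot>\<^bsub>val M (src1 K j)\<^esub> leta M j Y))"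

definition push_cmp_right ::
  "('g, 'u, 'c) twocat \<Rightarrow> ('g, 'u, 'c, 'o, 'm, 'k, 'x) mackey_scheme \<Rightarrow> 'u \<Rightarrow> 'u \<Rightarrow> 'o \<Rightarrow> 'm" where
  "push_cmp_right K M i j Y =
    (let Z = fobj (push M j) Y in
     farr (push M (i \<star>\<^bsub>K\<^esub> j)) (reps M j Y \<cdot>\<^bsub>val M (src1 K j)\<^esub> farr (pull M j) (reps M i Z))
     \<cdot>\<^bsub>val M (trg1 K i)\<^esub> reta M (i \<star>\<^bsub>K\<^esub> j) (fobj (push M i) Z))"

text \<open>The axioms \<open>push_cell\<close>, \<open>push_cmp\<close>, \<open>push_id\<close> say that the pseudofunctors \<open>i \<mapsto> i\<^sub>!\<close> and
  \<open>i \<mapsto> i\<^sub>*\<close>, whose structure consists of mates, agree on 2-cells \<open>\<alpha> : i \<Rightarrow> j\<close> (both give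
  \<open>j\<^sub>! = j\<^sub>* \<Rightarrow> i\<^sub>! = i\<^sub>*\<close>) and on the comparison isomorphisms for composites and identities.\<close>

locale rectified_mackey_two_functor = additive_two_functor R K M + spannable_pair K J
  for R :: "('k, 'r) ring_scheme" and K :: "('g, 'u, 'c) twocat" and J :: "'u set"
    and M :: "('g, 'u, 'c, 'o, 'm, 'k, 'x) mackey_scheme" +
  assumes direct_sums: "coproduct K n A P inc
      \<Longrightarrow> equivalence (val M P) (prod_cat n (\<lambda>l. val M (A l))) (ftuple n (\<lambda>l. pull M (inc l)))"
    and push_linear: "\<lbrakk>i \<in> J; i \<in> hom1 K H G\<rbrakk>
      \<Longrightarrow> linear_functor R (val M H) (val M G) (push M i)"
    and left_adjunction: "\<lbrakk>i \<in> J; i \<in> hom1 K H G\<rbrakk>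
      \<Longrightarrow> adjunction (val M H) (val M G) (push M i) (pull M i) (leta M i) (leps M i)"
    and right_adjunction: "\<lbrakk>i \<in> J; i \<in> hom1 K H G\<rbrakk>
      \<Longrightarrow> adjunction (val M G) (val M H) (pull M i) (push M i) (reta M i) (reps M i)"
    and mackey_formula: "\<lbrakk>i \<in> J; q \<in> J; pseudopullback K i u p q \<gamma>; Y \<in> Obj (val M (src1 K i))\<rbrakk>
      \<Longrightarrow> inverse_pair (val M (src1 K u))
            (mate_left K M i u p q \<gamma> Y) (mate_right K M i u p q (inv2 K \<gamma>) Y)"
    and push_cell: "\<lbrakk>i \<in> J; j \<in> J; i \<in> hom1 K H G; \<alpha> \<in> hom2 K i j; Y \<in> Obj (val M H)\<rbrakk>
      \<Longrightarrow> mate_left K M i (id1 K G) (id1 K H) j \<alpha> Y = mate_right K M j (id1 K G) (id1 K H) i \<alpha> Y"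
    and push_cmp: "\<lbrakk>i \<in> J; j \<in> J; j \<in> hom1 K L H; i \<in> hom1 K H G; Y \<in> Obj (val M L)\<rbrakk>
      \<Longrightarrow> inverse_pair (val M G) (push_cmp_left K M i j Y) (push_cmp_right K M i j Y)"
    and push_id: "\<lbrakk>G \<in> Ob K; Y \<in> Obj (val M G)\<rbrakk>
      \<Longrightarrow> inverse_pair (val M G) (leps M (id1 K G) Y) (reta M (id1 K G) Y)"
    and special: "\<lbrakk>i \<in> J; i \<in> hom1 K H G; Y \<in> Obj (val M H)\<rbrakk>
      \<Longrightarrow> reps M i Y \<cdot>\<^bsub>val M H\<^esub> leta M i Y = Ide (val M H) Y"


section \<open>Green 2-functors\<close>

text \<open>\<open>tcoh M u X X' : u\<^sup>*(X \<otimes> X') \<rightarrow> u\<^sup>*X \<otimes> u\<^sup>*X'\<close> and \<open>ucoh M u : u\<^sup>*1 \<rightarrow> 1\<close>.\<close>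

record ('g, 'u, 'c, 'o, 'm, 'k) green = "('g, 'u, 'c, 'o, 'm, 'k) mackey" +
  mon :: "'g \<Rightarrow> ('o, 'm) mon"
  tcoh :: "'u \<Rightarrow> 'o \<Rightarrow> 'o \<Rightarrow> 'm"
  ucoh :: "'u \<Rightarrow> 'm"

definition Rp1 ::
  "('g, 'u, 'c) twocat \<Rightarrow> ('g, 'u, 'c, 'o, 'm, 'k, 'x) green_scheme \<Rightarrow> 'u \<Rightarrow> 'o \<Rightarrow> 'o \<Rightarrow> 'm" where
  "Rp1 K M i X Y =
    (let C = val M (trg1 K i); D = val M (src1 K i); V = mon M (trg1 K i); W = mon M (src1 K i) in
     farr (push M i) (Ide D (fobj (pull M i) X) \<boxdot>\<^bsub>W\<^esub> reps M i Y) \<cdot>\<^bsub>C\<^esub>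
     farr (push M i) (tcoh M i X (fobj (push M i) Y)) \<cdot>\<^bsub>C\<^esub>
     reta M i (X \<boxtimes>\<^bsub>V\<^esub> fobj (push M i) Y))"

definition Rp2 ::
  "('g, 'u, 'c) twocat \<Rightarrow> ('g, 'u, 'c, 'o, 'm, 'k, 'x) green_scheme \<Rightarrow> 'u \<Rightarrow> 'o \<Rightarrow> 'o \<Rightarrow> 'm" where
  "Rp2 K M i Y X =
    (let C = val M (trg1 K i); D = val M (src1 K i); V = mon M (trg1 K i); W = mon M (src1 K i) in
     farr (push M i) (reps M i Y \<boxdot>\<^bsub>W\<^esub> Ide D (fobj (pull M i) X)) \<cdot>\<^bsub>C\<^esub>
     farr (push M i) (tcoh M i (fobj (push M i) Y) X) \<cdot>\<^bsub>C\<^esub>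
     reta M i (fobj (push M i) Y \<boxtimes>\<^bsub>V\<^esub> X))"

definition Lp1 ::
  "('g, 'u, 'c) twocat \<Rightarrow> ('g, 'u, 'c, 'o, 'm, 'k, 'x) green_scheme \<Rightarrow> 'u \<Rightarrow> 'o \<Rightarrow> 'o \<Rightarrow> 'm" where
  "Lp1 K M i X Y =
    (let C = val M (trg1 K i); D = val M (src1 K i); V = mon M (trg1 K i); W = mon M (src1 K i) in
     leps M i (X \<boxtimes>\<^bsub>V\<^esub> fobj (push M i) Y) \<cdot>\<^bsub>C\<^esub>
     farr (push M i) (cinv D (tcoh M i X (fobj (push M i) Y))) \<cdot>\<^bsub>C\<^esub>
     farr (push M i) (Ide D (fobj (pull M i) X) \<boxdot>\<^bsub>W\<^esub> leta M i Y))"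

definition Lp2 ::
  "('g, 'u, 'c) twocat \<Rightarrow> ('g, 'u, 'c, 'o, 'm, 'k, 'x) green_scheme \<Rightarrow> 'u \<Rightarrow> 'o \<Rightarrow> 'o \<Rightarrow> 'm" where
  "Lp2 K M i Y X =
    (let C = val M (trg1 K i); D = val M (src1 K i); V = mon M (trg1 K i); W = mon M (src1 K i) in
     leps M i (fobj (push M i) Y \<boxtimes>\<^bsub>V\<^esub> X) \<cdot>\<^bsub>C\<^esub>
     farr (push M i) (cinv D (tcoh M i (fobj (push M i) Y) X)) \<cdot>\<^bsub>C\<^esub>
     farr (push M i) (leta M i Y \<boxdot>\<^bsub>W\<^esub> Ide D (fobj (pull M i) X)))"

locale green_two_functor = rectified_mackey_two_functor R K J M
  for R :: "('k, 'r) ring_scheme" and K :: "('g, 'u, 'c) twocat" and J :: "'u set"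
    and M :: "('g, 'u, 'c, 'o, 'm, 'k, 'x) green_scheme" +
  assumes val_monoidal: "G \<in> Ob K \<Longrightarrow> monoidal_category (val M G) (mon M G)"
    and tensor_add_left: "\<lbrakk>G \<in> Ob K; f \<in> homs (val M G) a b; f' \<in> homs (val M G) a b;
        g \<in> homs (val M G) c d\<rbrakk>
      \<Longrightarrow> Add (val M G) f f' \<boxdot>\<^bsub>mon M G\<^esub> g =
          Add (val M G) (f \<boxdot>\<^bsub>mon M G\<^esub> g) (f' \<boxdot>\<^bsub>mon M G\<^esub> g)"
    and tensor_add_right: "\<lbrakk>G \<in> Ob K; f \<in> homs (val M G) a b; g \<in> homs (val M G) c d;
        g' \<in> homs (val M G) c d\<rbrakk>
      \<Longrightarrow> f \<boxdot>\<^bsub>mon M G\<^esub> Add (val M G) g g' =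
          Add (val M G) (f \<boxdot>\<^bsub>mon M G\<^esub> g) (f \<boxdot>\<^bsub>mon M G\<^esub> g')"
    and tensor_smu_left: "\<lbrakk>G \<in> Ob K; r \<in> carrier R; f \<in> homs (val M G) a b;
        g \<in> homs (val M G) c d\<rbrakk>
      \<Longrightarrow> Smu (val M G) r f \<boxdot>\<^bsub>mon M G\<^esub> g = Smu (val M G) r (f \<boxdot>\<^bsub>mon M G\<^esub> g)"
    and tensor_smu_right: "\<lbrakk>G \<in> Ob K; r \<in> carrier R; f \<in> homs (val M G) a b;
        g \<in> homs (val M G) c d\<rbrakk>
      \<Longrightarrow> f \<boxdot>\<^bsub>mon M G\<^esub> Smu (val M G) r g = Smu (val M G) r (f \<boxdot>\<^bsub>mon M G\<^esub> g)"
    and pull_monoidal: "u \<in> hom1 K H G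
      \<Longrightarrow> strong_monoidal (val M G) (mon M G) (val M H) (mon M H) (pull M u) (tcoh M u) (ucoh M u)"
    and tcoh_id: "\<lbrakk>G \<in> Ob K; X \<in> Obj (val M G); X' \<in> Obj (val M G)\<rbrakk>
      \<Longrightarrow> tcoh M (id1 K G) X X' = Ide (val M G) (X \<boxtimes>\<^bsub>mon M G\<^esub> X')"
    and ucoh_id: "G \<in> Ob K \<Longrightarrow> ucoh M (id1 K G) = Ide (val M G) (Unit (mon M G))"
    and tcoh_cmp: "\<lbrakk>u \<in> hom1 K L H; v \<in> hom1 K H G; X \<in> Obj (val M G); X' \<in> Obj (val M G)\<rbrakk>
      \<Longrightarrow> tcoh M (v \<star>\<^bsub>K\<^esub> u) X X' =
          tcoh M u (fobj (pull M v) X) (fobj (pull M v) X') \<cdot>\<^bsub>val M L\<^esub> farr (pull M u) (tcoh M v X X')"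
    and ucoh_cmp: "\<lbrakk>u \<in> hom1 K L H; v \<in> hom1 K H G\<rbrakk>
      \<Longrightarrow> ucoh M (v \<star>\<^bsub>K\<^esub> u) = ucoh M u \<cdot>\<^bsub>val M L\<^esub> farr (pull M u) (ucoh M v)"
    and cell_monoidal: "\<lbrakk>u \<in> hom1 K H G; \<alpha> \<in> hom2 K u v; X \<in> Obj (val M G); X' \<in> Obj (val M G)\<rbrakk>
      \<Longrightarrow> (cell M \<alpha> X \<boxdot>\<^bsub>mon M H\<^esub> cell M \<alpha> X') \<cdot>\<^bsub>val M H\<^esub> tcoh M u X X' =
          tcoh M v X X' \<cdot>\<^bsub>val M H\<^esub> cell M \<alpha> (X \<boxtimes>\<^bsub>mon M G\<^esub> X')"
    and cell_unit: "\<lbrakk>u \<in> hom1 K H G; \<alpha> \<in> hom2 K u v\<rbrakk>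
      \<Longrightarrow> ucoh M v \<cdot>\<^bsub>val M H\<^esub> cell M \<alpha> (Unit (mon M G)) = ucoh M u"
    and projection1: "\<lbrakk>i \<in> J; i \<in> hom1 K H G; X \<in> Obj (val M G); Y \<in> Obj (val M H)\<rbrakk>
      \<Longrightarrow> inverse_pair (val M G) (Rp1 K M i X Y) (Lp1 K M i X Y)"
    and projection2: "\<lbrakk>i \<in> J; i \<in> hom1 K H G; X \<in> Obj (val M G); Y \<in> Obj (val M H)\<rbrakk>
      \<Longrightarrow> inverse_pair (val M G) (Rp2 K M i Y X) (Lp2 K M i Y X)"

locale braided_green_two_functor = green_two_functor R K J M
  for R :: "('k, 'r) ring_scheme" and K :: "('g, 'u, 'c) twocat" and J :: "'u set"
    and M :: "('g, 'u, 'c, 'o, 'm, 'k, 'x) green_scheme" +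
  fixes br :: "'g \<Rightarrow> 'o \<Rightarrow> 'o \<Rightarrow> 'm"
  assumes val_braided: "G \<in> Ob K \<Longrightarrow> braided_monoidal (val M G) (mon M G) (br G)"
    and pull_braided: "u \<in> hom1 K H G
      \<Longrightarrow> braided_strong_monoidal (val M G) (mon M G) (br G) (val M H) (mon M H) (br H)
            (pull M u) (tcoh M u) (ucoh M u)"


section \<open>The Frobenius object and the canonical functors\<close>

text \<open>\<open>A(i)\<close>, with the monoid structure from the lax structure of \<open>i\<^sub>*\<close> and the comonoid structure from
  the colax structure of \<open>i\<^sub>!\<close>.\<close>

definition frob ::
  "('g, 'u, 'c) twocat \<Rightarrow> ('g, 'u, 'c, 'o, 'm, 'k, 'x) green_scheme \<Rightarrow> 'u \<Rightarrow> 'o" where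
  "frob K M i = fobj (push M i) (Unit (mon M (src1 K i)))"

definition push_lax ::
  "('g, 'u, 'c) twocat \<Rightarrow> ('g, 'u, 'c, 'o, 'm, 'k, 'x) green_scheme \<Rightarrow> 'u \<Rightarrow> 'o \<Rightarrow> 'o \<Rightarrow> 'm" where
  "push_lax K M i Y Y' =
    (let C = val M (trg1 K i); V = mon M (trg1 K i); W = mon M (src1 K i);
         Z = fobj (push M i) Y; Z' = fobj (push M i) Y' in
     farr (push M i) (reps M i Y \<boxdot>\<^bsub>W\<^esub> reps M i Y') \<cdot>\<^bsub>C\<^esub> farr (push M i) (tcoh M i Z Z') \<cdot>\<^bsub>C\<^esub>
     reta M i (Z \<boxtimes>\<^bsub>V\<^esub> Z'))"

definition push_colax ::
  "('g, 'u, 'c) twocat \<Rightarrow> ('g, 'u, 'c, 'o, 'm, 'k, 'x) green_scheme \<Rightarrow> 'u \<Rightarrow> 'o \<Rightarrow> 'o \<Rightarrow> 'm" where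
  "push_colax K M i Y Y' =
    (let C = val M (trg1 K i); D = val M (src1 K i); V = mon M (trg1 K i); W = mon M (src1 K i);
         Z = fobj (push M i) Y; Z' = fobj (push M i) Y' in
     leps M i (Z \<boxtimes>\<^bsub>V\<^esub> Z') \<cdot>\<^bsub>C\<^esub> farr (push M i) (cinv D (tcoh M i Z Z')) \<cdot>\<^bsub>C\<^esub>
     farr (push M i) (leta M i Y \<boxdot>\<^bsub>W\<^esub> leta M i Y'))"

definition frob_mult ::
  "('g, 'u, 'c) twocat \<Rightarrow> ('g, 'u, 'c, 'o, 'm, 'k, 'x) green_scheme \<Rightarrow> 'u \<Rightarrow> 'm" where
  "frob_mult K M i =
    (let W = mon M (src1 K i) in
     farr (push M i) (lun W (Unit W)) \<cdot>\<^bsub>val M (trg1 K i)\<^esub> push_lax K M i (Unit W) (Unit W))"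

definition frob_unit ::
  "('g, 'u, 'c) twocat \<Rightarrow> ('g, 'u, 'c, 'o, 'm, 'k, 'x) green_scheme \<Rightarrow> 'u \<Rightarrow> 'm" where
  "frob_unit K M i =
     farr (push M i) (ucoh M i) \<cdot>\<^bsub>val M (trg1 K i)\<^esub> reta M i (Unit (mon M (trg1 K i)))"

definition frob_comult ::
  "('g, 'u, 'c) twocat \<Rightarrow> ('g, 'u, 'c, 'o, 'm, 'k, 'x) green_scheme \<Rightarrow> 'u \<Rightarrow> 'm" where
  "frob_comult K M i =
    (let W = mon M (src1 K i) in
     push_colax K M i (Unit W) (Unit W) \<cdot>\<^bsub>val M (trg1 K i)\<^esub>
     farr (push M i) (cinv (val M (src1 K i)) (lun W (Unit W))))"

definition frob_counit ::
  "('g, 'u, 'c) twocat \<Rightarrow> ('g, 'u, 'c, 'o, 'm, 'k, 'x) green_scheme \<Rightarrow> 'u \<Rightarrow> 'm" where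
  "frob_counit K M i =
     leps M i (Unit (mon M (trg1 K i))) \<cdot>\<^bsub>val M (trg1 K i)\<^esub>
     farr (push M i) (cinv (val M (src1 K i)) (ucoh M i))"

definition Mod ::
  "('g, 'u, 'c) twocat \<Rightarrow> ('g, 'u, 'c, 'o, 'm, 'k, 'x) green_scheme \<Rightarrow> 'u \<Rightarrow>
   ('o \<times> 'm, ('o \<times> 'm) \<times> 'm \<times> ('o \<times> 'm)) cat" where
  "Mod K M i = mod_cat (val M (trg1 K i)) (mon M (trg1 K i))
     (frob K M i) (frob_mult K M i) (frob_unit K M i)"

definition Comod ::
  "('g, 'u, 'c) twocat \<Rightarrow> ('g, 'u, 'c, 'o, 'm, 'k, 'x) green_scheme \<Rightarrow> 'u \<Rightarrow>
   ('o \<times> 'm, ('o \<times> 'm) \<times> 'm \<times> ('o \<times> 'm)) cat" where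
  "Comod K M i = comod_cat (val M (trg1 K i)) (mon M (trg1 K i))
     (frob K M i) (frob_comult K M i) (frob_counit K M i)"

text \<open>\<open>\<pi> X : A(i) \<otimes> X \<rightarrow> i\<^sub>* i\<^sup>* X\<close>.\<close>

definition frob_pi ::
  "('g, 'u, 'c) twocat \<Rightarrow> ('g, 'u, 'c, 'o, 'm, 'k, 'x) green_scheme \<Rightarrow> 'u \<Rightarrow> 'o \<Rightarrow> 'm" where
  "frob_pi K M i X =
    (let W = mon M (src1 K i) in
     farr (push M i) (lun W (fobj (pull M i) X)) \<cdot>\<^bsub>val M (trg1 K i)\<^esub> Rp2 K M i (Unit W) X)"

definition to_mod_obj ::
  "('g, 'u, 'c) twocat \<Rightarrow> ('g, 'u, 'c, 'o, 'm, 'k, 'x) green_scheme \<Rightarrow> 'u \<Rightarrow> 'o \<Rightarrow> 'o \<times> 'm" where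
  "to_mod_obj K M i Y =
    (let Z = fobj (push M i) Y in
     (Z, farr (push M i) (reps M i Y) \<cdot>\<^bsub>val M (trg1 K i)\<^esub> frob_pi K M i Z))"

definition to_mod ::
  "('g, 'u, 'c) twocat \<Rightarrow> ('g, 'u, 'c, 'o, 'm, 'k, 'x) green_scheme \<Rightarrow> 'u \<Rightarrow>
   ('o, 'm, 'o \<times> 'm, ('o \<times> 'm) \<times> 'm \<times> ('o \<times> 'm)) func" where
  "to_mod K M i =
    (let D = val M (src1 K i) in
     \<lparr>fobj = to_mod_obj K M i,
      farr = (\<lambda>f. (to_mod_obj K M i (Dom D f), farr (push M i) f, to_mod_obj K M i (Cod D f)))\<rparr>)"

definition to_comod_obj ::
  "('g, 'u, 'c) twocat \<Rightarrow> ('g, 'u, 'c, 'o, 'm, 'k, 'x) green_scheme \<Rightarrow> 'u \<Rightarrow> 'o \<Rightarrow> 'o \<times> 'm" where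
  "to_comod_obj K M i Y =
    (let C = val M (trg1 K i); Z = fobj (push M i) Y in
     (Z, cinv C (frob_pi K M i Z) \<cdot>\<^bsub>C\<^esub> farr (push M i) (leta M i Y)))"

definition to_comod ::
  "('g, 'u, 'c) twocat \<Rightarrow> ('g, 'u, 'c, 'o, 'm, 'k, 'x) green_scheme \<Rightarrow> 'u \<Rightarrow>
   ('o, 'm, 'o \<times> 'm, ('o \<times> 'm) \<times> 'm \<times> ('o \<times> 'm)) func" where
  "to_comod K M i =
    (let D = val M (src1 K i) in
     \<lparr>fobj = to_comod_obj K M i,
      farr = (\<lambda>f. (to_comod_obj K M i (Dom D f), farr (push M i) f, to_comod_obj K M i (Cod D f)))\<rparr>)"

end

theory Submission
  imports Defs
begin

text \<open>Write \<open>F = i\<^sup>*\<close> and let \<open>P = i\<^sub>! = i\<^sub>*\<close>. For modules, consider the adjunction \<open>F \<stileturn> P\<close> with counit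
  \<open>\<epsilon>\<close>. Since \<open>\<epsilon>\<close> has a natural section \<open>\<sigma>\<close>, the unit of \<open>i\<^sub>! \<stileturn> i\<^sup>*\<close>, and idempotents split, \<open>P\<close> is
  monadic: a map \<open>f\<close> of algebras over \<open>P F\<close> from \<open>P Y\<close> to \<open>P Y'\<close> comes from \<open>\<epsilon> \<cdot> F f \<cdot> \<sigma>\<close>, and an algebra
  \<open>b : P F X \<rightarrow> X\<close> comes from the object that splits the idempotent \<open>F b \<cdot> \<sigma>\<close> of \<open>F X\<close>. By the projection
  formula, \<open>P F X\<close> is isomorphic to \<open>A \<otimes> X\<close> for \<open>A = P 1\<close>, and this is an isomorphism of monads; hence
  algebras over \<open>P F\<close> are \<open>A\<close>-modules, and the free--forgetful adjunction is \<open>F \<stileturn> P\<close>. These arguments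
  are carried out for an abstract adjunction with these properties (locale \<open>projection_adjunction\<close>,
  theorems \<open>equivalence_modules\<close> and \<open>identifies_free_forgetful\<close>). Identities between arrows into some
  \<open>P Y\<close> are proved by passing to adjuncts, where they become coherence statements.

  In the braided case, the lax monoidal structure \<open>P Y \<otimes> P Y' \<rightarrow> P (Y \<otimes> Y')\<close> is a split coequalizer that
  exhibits \<open>P (Y \<otimes> Y')\<close> as the tensor product over \<open>A\<close> (\<open>lax_split_coequalizer\<close>): the projection formula
  identifies the two arrows of the coequalizer with the images under \<open>P (Y \<otimes> -)\<close> of the two maps
  \<open>F P F P Y' \<rightarrow> F P Y'\<close>, whose coequalizer \<open>Y'\<close> is split by \<open>\<sigma>\<close>. As every module is isomorphic to some
  \<open>P Y\<close>, all tensor products exist. For an arbitrary choice of tensor products, the induced structure maps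
  are carried by these isomorphisms to the structure maps of the category that \<open>Y\<close> ranges over. Arrows
  of modules are determined by the arrows that represent them there, so all coherence axioms are
  inherited, and the equivalence is strong monoidal and braided (locale \<open>presented_tensor\<close>, theorem
  \<open>braided_equivalence_modules\<close>).

  The statements on comodules are those on modules for the opposite categories. There \<open>i\<^sub>! \<stileturn> i\<^sup>*\<close> is an
  adjunction of the required kind: its unit is split by the counit of \<open>i\<^sup>* \<stileturn> i\<^sub>*\<close>, and the left
  projection map is the inverse of the right one. What remains is to see that the definitions for
  comodules are dual to those for modules, on the carriers of the categories.\<close>

section \<open>Categories in terms of domains and codomains\<close>

context category
begin

lemma homs_iff: "f \<in> homs C a b \<longleftrightarrow> f \<in> Arr C \<and> Dom C f = a \<and> Cod C f = b"
  by (simp add: homs_def)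

lemma dom_in [simp]: "f \<in> Arr C \<Longrightarrow> Dom C f \<in> Obj C"
  by (rule dom_obj)

lemma cod_in [simp]: "f \<in> Arr C \<Longrightarrow> Cod C f \<in> Obj C"
  by (rule cod_obj)

lemma ide_simps [simp]:
  assumes "a \<in> Obj C"
  shows "Ide C a \<in> Arr C" "Dom C (Ide C a) = a" "Cod C (Ide C a) = a"
  using ide_hom[OF assms] by (auto simp: homs_def)

lemma cmp_simps [simp]:
  assumes "f \<in> Arr C" "g \<in> Arr C" "Dom C g = Cod C f"
  shows "g \<cdot> f \<in> Arr C" "Dom C (g \<cdot> f) = Dom C f" "Cod C (g \<cdot> f) = Cod C g"
  using cmp_hom[of f "Dom C f" "Cod C f" g "Cod C g"] assms by (auto simp: homs_def)

lemma cmp_assoc_simp [simp]: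
  assumes "f \<in> Arr C" "g \<in> Arr C" "h \<in> Arr C" "Dom C g = Cod C f" "Dom C h = Cod C g"
  shows "(h \<cdot> g) \<cdot> f = h \<cdot> g \<cdot> f"
  using cmp_assoc[of f "Dom C f" "Cod C f" g "Cod C g" h "Cod C h"] assms by (auto simp: homs_def)

lemma cmp_ide_simps [simp]:
  assumes "f \<in> Arr C"
  shows "Dom C f = a \<Longrightarrow> f \<cdot> Ide C a = f" "Cod C f = b \<Longrightarrow> Ide C b \<cdot> f = f"
  using cmp_ide_right[of f "Dom C f" "Cod C f"] cmp_ide_left[of f "Dom C f" "Cod C f"] assms
  by (auto simp: homs_def)

text \<open>Composites are kept nested to the right. Instances of this lemma apply an equation between
  composites of two arrows inside such a composite, where a further arrow follows.\<close>

lemma tail: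
  assumes "g \<cdot> f = k" "f \<in> Arr C" "g \<in> Arr C" "Dom C g = Cod C f"
    and "x \<in> Arr C" "Cod C x = Dom C f"
  shows "g \<cdot> f \<cdot> x = k \<cdot> x"
  using assms cmp_assoc_simp[of x f g] by simp

lemma inverse_pair_unique:
  assumes "inverse_pair C f g" "inverse_pair C f h"
  shows "g = h"
proof -
  have "g = g \<cdot> f \<cdot> h" using assms by (auto simp: inverse_pair_def homs_def)
  also have "\<dots> = (g \<cdot> f) \<cdot> h"
    using assms by (subst cmp_assoc_simp) (auto simp: inverse_pair_def homs_def)
  also have "\<dots> = h" using assms by (auto simp: inverse_pair_def homs_def)
  finally show ?thesis .
qed

lemma cinv_eqI: "inverse_pair C f g \<Longrightarrow> cinv C f = g"
  unfolding cinv_def by (rule the_equality) (auto intro: inverse_pair_unique)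

lemma inverse_pair_cinv: "is_iso C f \<Longrightarrow> inverse_pair C f (cinv C f)"
  unfolding is_iso_def using cinv_eqI by blast

lemma is_isoI:
  "\<lbrakk>f \<in> Arr C; g \<in> Arr C; Dom C g = Cod C f; Cod C g = Dom C f;
    g \<cdot> f = Ide C (Dom C f); f \<cdot> g = Ide C (Cod C f)\<rbrakk> \<Longrightarrow> is_iso C f"
  unfolding is_iso_def inverse_pair_def homs_def by blast

lemma iso_arr: "is_iso C f \<Longrightarrow> f \<in> Arr C"
  unfolding is_iso_def inverse_pair_def by blast

lemma cinv_simps [simp]:
  assumes "is_iso C f"
  shows "cinv C f \<in> Arr C" "Dom C (cinv C f) = Cod C f" "Cod C (cinv C f) = Dom C f"
    and "cinv C f \<cdot> f = Ide C (Dom C f)" "f \<cdot> cinv C f = Ide C (Cod C f)"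
  using inverse_pair_cinv[OF assms] by (auto simp: inverse_pair_def homs_def)

lemma cinv_tail [simp]:
  assumes "is_iso C f" "x \<in> Arr C"
  shows "Cod C x = Dom C f \<Longrightarrow> cinv C f \<cdot> f \<cdot> x = x" "Cod C x = Cod C f \<Longrightarrow> f \<cdot> cinv C f \<cdot> x = x"
  using assms iso_arr[OF assms(1)] by (simp_all flip: cmp_assoc_simp)

lemma inverse_pair_sym: "inverse_pair C f g \<Longrightarrow> inverse_pair C g f"
  unfolding inverse_pair_def homs_iff by metis

lemma is_iso_cinv [simp]: "is_iso C f \<Longrightarrow> is_iso C (cinv C f)"
  unfolding is_iso_def[of C "cinv C f"] by (rule exI, rule inverse_pair_sym, rule inverse_pair_cinv)

lemma cinv_cinv [simp]: "is_iso C f \<Longrightarrow> cinv C (cinv C f) = f"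
  by (rule cinv_eqI, rule inverse_pair_sym, rule inverse_pair_cinv)

lemma is_iso_ide [simp]: "a \<in> Obj C \<Longrightarrow> is_iso C (Ide C a)"
  by (rule is_isoI[of _ "Ide C a"]) auto

lemma cinv_ide [simp]: "a \<in> Obj C \<Longrightarrow> cinv C (Ide C a) = Ide C a"
  by (rule cinv_eqI) (auto simp: inverse_pair_def homs_def)

lemma inverse_pair_cmp:
  assumes "is_iso C f" "is_iso C g" "Dom C g = Cod C f"
  shows "inverse_pair C (g \<cdot> f) (cinv C f \<cdot> cinv C g)"
  using assms iso_arr[OF assms(1)] iso_arr[OF assms(2)]
  by (auto simp: inverse_pair_def homs_def)

lemma is_iso_cmp [simp]: "\<lbrakk>is_iso C f; is_iso C g; Dom C g = Cod C f\<rbrakk> \<Longrightarrow> is_iso C (g \<cdot> f)"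
  unfolding is_iso_def[of C "g \<cdot> f"] by (rule exI, rule inverse_pair_cmp)

lemma cinv_cmp: "\<lbrakk>is_iso C f; is_iso C g; Dom C g = Cod C f\<rbrakk> \<Longrightarrow> cinv C (g \<cdot> f) = cinv C f \<cdot> cinv C g"
  by (intro cinv_eqI inverse_pair_cmp)

lemma split_epi_cancel:
  assumes "f \<cdot> q = g \<cdot> q" "q \<cdot> s = Ide C (Cod C q)"
    and "q \<in> Arr C" "s \<in> Arr C" "Cod C s = Dom C q"
    and "f \<in> Arr C" "g \<in> Arr C" "Dom C f = Cod C q" "Dom C g = Cod C q"
  shows "f = g"
proof -
  have "f = f \<cdot> q \<cdot> s" using assms by simp
  also have "\<dots> = (f \<cdot> q) \<cdot> s" using assms by (subst cmp_assoc_simp) auto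
  also have "\<dots> = (g \<cdot> q) \<cdot> s" using assms by simp
  also have "\<dots> = g \<cdot> q \<cdot> s" using assms by (subst cmp_assoc_simp) auto
  finally show ?thesis using assms by simp
qed

lemma iso_epi:
  assumes "f \<cdot> q = g \<cdot> q" "is_iso C q"
    and "f \<in> Arr C" "g \<in> Arr C" "Dom C f = Cod C q" "Dom C g = Cod C q"
  shows "f = g"
  by (rule split_epi_cancel[of f q g "cinv C q"]) (use assms iso_arr in auto)

lemma iso_mono:
  assumes "q \<cdot> f = q \<cdot> g" "is_iso C q"
    and "f \<in> Arr C" "g \<in> Arr C" "Cod C f = Dom C q" "Cod C g = Dom C q"
  shows "f = g"
proof -
  have "f = cinv C q \<cdot> q \<cdot> f" using assms(2-) by simp
  also have "\<dots> = cinv C q \<cdot> q \<cdot> g" by (simp only: assms(1))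
  also have "\<dots> = g" using assms(2-) by simp
  finally show ?thesis .
qed

end

context cfunctor
begin

lemma fobj_in [simp]: "a \<in> Obj C \<Longrightarrow> fobj F a \<in> Obj D"
  by (rule fobj_obj)

lemma farr_simps [simp]:
  assumes "f \<in> Arr C"
  shows "farr F f \<in> Arr D" "Dom D (farr F f) = fobj F (Dom C f)" "Cod D (farr F f) = fobj F (Cod C f)"
  using farr_hom[of f "Dom C f" "Cod C f"] assms by (auto simp: homs_def)

lemma farr_ide_simp [simp]: "a \<in> Obj C \<Longrightarrow> farr F (Ide C a) = Ide D (fobj F a)"
  by (rule farr_ide)

lemma farr_cmp_simp:
  assumes "f \<in> Arr C" "g \<in> Arr C" "Dom C g = Cod C f"
  shows "farr F (g \<cdot>\<^bsub>C\<^esub> f) = farr F g \<cdot>\<^bsub>D\<^esub> farr F f"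
  using farr_cmp[of f "Dom C f" "Cod C f" g "Cod C g"] assms by (auto simp: homs_def)

lemma inverse_pair_farr: "inverse_pair C f g \<Longrightarrow> inverse_pair D (farr F f) (farr F g)"
  by (auto simp: inverse_pair_def homs_def simp flip: farr_cmp_simp)

lemma is_iso_farr [simp]: "is_iso C f \<Longrightarrow> is_iso D (farr F f)"
  using inverse_pair_farr is_iso_def by metis

lemma cinv_farr: "is_iso C f \<Longrightarrow> cinv D (farr F f) = farr F (cinv C f)"
  by (intro D.cinv_eqI inverse_pair_farr C.inverse_pair_cinv)

end

lemma nat_trans_simps:
  assumes "nat_trans C D F F' \<tau>"
  shows "x \<in> Obj C \<Longrightarrow> \<tau> x \<in> Arr D"
    and "x \<in> Obj C \<Longrightarrow> Dom D (\<tau> x) = fobj F x"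
    and "x \<in> Obj C \<Longrightarrow> Cod D (\<tau> x) = fobj F' x"
    and "f \<in> Arr C \<Longrightarrow> \<tau> (Cod C f) \<cdot>\<^bsub>D\<^esub> farr F f = farr F' f \<cdot>\<^bsub>D\<^esub> \<tau> (Dom C f)"
  using assms by (auto simp: nat_trans_def homs_def)

lemma cfunctor_fid: "category C \<Longrightarrow> cfunctor C C fid"
  unfolding cfunctor_def cfunctor_axioms_def by (simp add: fid_def)

lemma cfunctor_fcomp:
  assumes "cfunctor C D F" "cfunctor D E G"
  shows "cfunctor C E (fcomp G F)"
proof -
  interpret F: cfunctor C D F by fact
  interpret G: cfunctor D E G by fact
  show ?thesis
    by unfold_locales
      (auto simp: fcomp_def F.C.homs_iff F.D.homs_iff G.D.homs_iff F.farr_cmp_simp G.farr_cmp_simp)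
qed

text \<open>The quasi-inverse picks for each object \<open>M\<close> of the target an isomorphism \<open>fobj F (L M) \<rightarrow> M\<close>, and
  transports arrows along these.\<close>

lemma equivalence_if_full_faithful_surjective:
  assumes "cfunctor C D F"
    and full: "\<And>a b g. \<lbrakk>a \<in> Obj C; b \<in> Obj C; g \<in> homs D (fobj F a) (fobj F b)\<rbrakk>
      \<Longrightarrow> \<exists>f \<in> homs C a b. farr F f = g"
    and faithful: "\<And>a b f f'. \<lbrakk>f \<in> homs C a b; f' \<in> homs C a b; farr F f = farr F f'\<rbrakk> \<Longrightarrow> f = f'"
    and surj: "\<And>m. m \<in> Obj D \<Longrightarrow> \<exists>a \<in> Obj C. \<exists>\<theta> \<in> homs D (fobj F a) m. is_iso D \<theta>"
  shows "equivalence C D F"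
proof -
  interpret cfunctor C D F by fact
  define lift where "lift a b g = (SOME f. f \<in> homs C a b \<and> farr F f = g)" for a b g
  have lift: "lift a b g \<in> homs C a b" "farr F (lift a b g) = g"
    if "a \<in> Obj C" "b \<in> Obj C" "g \<in> homs D (fobj F a) (fobj F b)" for a b g
    using someI_ex[of "\<lambda>f. f \<in> homs C a b \<and> farr F f = g"] full[OF that] unfolding lift_def by blast+
  obtain L \<theta> where L: "\<And>m. m \<in> Obj D \<Longrightarrow> L m \<in> Obj C"
    and \<theta>: "\<And>m. m \<in> Obj D \<Longrightarrow> \<theta> m \<in> homs D (fobj F (L m)) m \<and> is_iso D (\<theta> m)"
    using surj by metis
  have \<theta>_simps: "\<theta> m \<in> Arr D" "Dom D (\<theta> m) = fobj F (L m)" "Cod D (\<theta> m) = m" "is_iso D (\<theta> m)"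
    if "m \<in> Obj D" for m
    using \<theta>[OF that] by (auto simp: homs_def)
  define F' where "F' = \<lparr>fobj = L,
    farr = (\<lambda>g. lift (L (Dom D g)) (L (Cod D g)) (cinv D (\<theta> (Cod D g)) \<cdot>\<^bsub>D\<^esub> g \<cdot>\<^bsub>D\<^esub> \<theta> (Dom D g)))\<rparr>"
  have "cinv D (\<theta> (Cod D g)) \<cdot>\<^bsub>D\<^esub> g \<cdot>\<^bsub>D\<^esub> \<theta> (Dom D g)
      \<in> homs D (fobj F (L (Dom D g))) (fobj F (L (Cod D g)))" if "g \<in> Arr D" for g
    using that by (simp add: \<theta>_simps homs_def)
  then have F'_hom: "farr F' g \<in> homs C (L (Dom D g)) (L (Cod D g))"
    and F'_farr: "farr F (farr F' g) = cinv D (\<theta> (Cod D g)) \<cdot>\<^bsub>D\<^esub> g \<cdot>\<^bsub>D\<^esub> \<theta> (Dom D g)"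
    if "g \<in> Arr D" for g
    unfolding F'_def using that lift[of "L (Dom D g)" "L (Cod D g)"] L by simp_all
  have F'_simps [simp]: "farr F' g \<in> Arr C" "Dom C (farr F' g) = L (Dom D g)" "Cod C (farr F' g) = L (Cod D g)"
    if "g \<in> Arr D" for g
    using F'_hom[OF that] by (auto simp: homs_def)
  have F'_obj [simp]: "fobj F' m = L m" for m by (simp add: F'_def)
  have eqI: "f = f'" if "f \<in> Arr C" "f' \<in> Arr C" "Dom C f = Dom C f'" "Cod C f = Cod C f'" "farr F f = farr F f'" for f f'
    using faithful[of f "Dom C f" "Cod C f" f'] that by (auto simp: homs_def)
  have F': "cfunctor D C F'"
  proof unfold_locales
    show "farr F' (Ide D a) = Ide C (fobj F' a)" if "a \<in> Obj D" for a
      using that by (intro eqI) (auto simp: L F'_farr \<theta>_simps)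
    show "farr F' (g \<cdot>\<^bsub>D\<^esub> f) = farr F' g \<cdot>\<^bsub>C\<^esub> farr F' f" if "f \<in> homs D a b" "g \<in> homs D b c" for f g a b c
      using that by (intro eqI) (auto simp: L F'_farr \<theta>_simps homs_def farr_cmp_simp)
  qed (auto simp: L homs_def)
  define \<tau> where "\<tau> x = lift x (L (fobj F x)) (cinv D (\<theta> (fobj F x)))" for x
  have \<tau>_hom: "\<tau> x \<in> homs C x (L (fobj F x))"
    and \<tau>_farr: "farr F (\<tau> x) = cinv D (\<theta> (fobj F x))" if "x \<in> Obj C" for x
    using that lift[of x "L (fobj F x)" "cinv D (\<theta> (fobj F x))"]
    by (simp_all add: \<tau>_def L \<theta>_simps C.homs_iff D.homs_iff)
  have \<tau>_simps: "\<tau> x \<in> Arr C" "Dom C (\<tau> x) = x" "Cod C (\<tau> x) = L (fobj F x)" if "x \<in> Obj C" for x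
    using \<tau>_hom[OF that] by (auto simp: homs_def)
  have \<tau>_iso: "is_iso C (\<tau> x)" if x: "x \<in> Obj C" for x
  proof -
    define k where "k = lift (L (fobj F x)) x (\<theta> (fobj F x))"
    have "\<theta> (fobj F x) \<in> homs D (fobj F (L (fobj F x))) (fobj F x)"
      using x by (simp add: homs_def \<theta>_simps)
    then have k: "k \<in> homs C (L (fobj F x)) x" and kF: "farr F k = \<theta> (fobj F x)"
      unfolding k_def using x by (simp_all add: L lift)
    show ?thesis
      by (rule C.is_isoI[of _ k]; (rule eqI)?)
        (use x k kF in \<open>auto simp: homs_def \<tau>_simps \<tau>_farr L \<theta>_simps farr_cmp_simp\<close>)
  qed
  have "nat_iso C C fid (fcomp F' F) \<tau>"
    unfolding nat_iso_def nat_trans_def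
  proof (intro conjI ballI)
    show "cfunctor C C fid" by (rule cfunctor_fid[OF C.category_axioms])
    show "cfunctor C C (fcomp F' F)" by (rule cfunctor_fcomp[OF assms(1) F'])
    show "\<tau> (Cod C f) \<cdot>\<^bsub>C\<^esub> farr fid f = farr (fcomp F' F) f \<cdot>\<^bsub>C\<^esub> \<tau> (Dom C f)" if "f \<in> Arr C" for f
      using that by (intro eqI) (auto simp: fid_def fcomp_def \<tau>_simps \<tau>_farr F'_farr farr_cmp_simp \<theta>_simps)
  qed (auto simp: \<tau>_iso \<tau>_hom fid_def fcomp_def)
  moreover have "nat_iso D D (fcomp F F') fid \<theta>"
    unfolding nat_iso_def nat_trans_def
  proof (intro conjI ballI)
    show "cfunctor D D fid" by (rule cfunctor_fid[OF D.category_axioms])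
    show "cfunctor D D (fcomp F F')" by (rule cfunctor_fcomp[OF F' assms(1)])
    show "\<theta> (Cod D f) \<cdot>\<^bsub>D\<^esub> farr (fcomp F F') f = farr fid f \<cdot>\<^bsub>D\<^esub> \<theta> (Dom D f)" if "f \<in> Arr D" for f
      using that by (auto simp: fid_def fcomp_def F'_farr \<theta>_simps)
  qed (auto simp: \<theta>_simps homs_def fid_def fcomp_def)
  ultimately show ?thesis
    unfolding equivalence_def using F' assms(1) by blast
qed

section \<open>Monoidal categories\<close>

context monoidal_category
begin

declare TO_obj [simp] Un_obj [simp] TA_ide [simp]

lemma TA_simps [simp]:
  assumes "f \<in> Arr C" "g \<in> Arr C"
  shows "f \<boxdot> g \<in> Arr C" "Dom C (f \<boxdot> g) = Dom C f \<boxtimes> Dom C g" "Cod C (f \<boxdot> g) = Cod C f \<boxtimes> Cod C g"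
  using TA_hom[of f "Dom C f" "Cod C f" g "Dom C g" "Cod C g"] assms by (auto simp: homs_def)

text \<open>Composites of tensor products are normalized to tensor products of composites.\<close>

lemma TA_merge:
  assumes "f \<in> Arr C" "f' \<in> Arr C" "g \<in> Arr C" "g' \<in> Arr C" "Dom C f' = Cod C f" "Dom C g' = Cod C g"
  shows "(f' \<boxdot> g') \<cdot>\<^bsub>C\<^esub> (f \<boxdot> g) = (f' \<cdot>\<^bsub>C\<^esub> f) \<boxdot> (g' \<cdot>\<^bsub>C\<^esub> g)"
  using TA_cmp[of f "Dom C f" "Cod C f" f' "Cod C f'" g "Dom C g" "Cod C g" g' "Cod C g'"] assms
  by (auto simp: homs_def)

lemma TA_merge_tail:
  assumes "f \<in> Arr C" "f' \<in> Arr C" "g \<in> Arr C" "g' \<in> Arr C" "Dom C f' = Cod C f" "Dom C g' = Cod C g"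
    and "x \<in> Arr C" "Cod C x = Dom C f \<boxtimes> Dom C g"
  shows "(f' \<boxdot> g') \<cdot>\<^bsub>C\<^esub> (f \<boxdot> g) \<cdot>\<^bsub>C\<^esub> x = ((f' \<cdot>\<^bsub>C\<^esub> f) \<boxdot> (g' \<cdot>\<^bsub>C\<^esub> g)) \<cdot>\<^bsub>C\<^esub> x"
  using assms by (simp add: TA_merge flip: cmp_assoc_simp)

lemmas TA_merges = TA_merge TA_merge_tail

lemma ass_simps [simp]:
  assumes "a \<in> Obj C" "b \<in> Obj C" "c \<in> Obj C"
  shows "ass V a b c \<in> Arr C" "Dom C (ass V a b c) = (a \<boxtimes> b) \<boxtimes> c"
    "Cod C (ass V a b c) = a \<boxtimes> b \<boxtimes> c" "is_iso C (ass V a b c)"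
  using ass_hom[OF assms] by (auto simp: homs_def)

lemma lun_simps [simp]:
  assumes "a \<in> Obj C"
  shows "lun V a \<in> Arr C" "Dom C (lun V a) = Unit V \<boxtimes> a" "Cod C (lun V a) = a" "is_iso C (lun V a)"
  using lun_hom[OF assms] by (auto simp: homs_def)

lemma run_simps [simp]:
  assumes "a \<in> Obj C"
  shows "run V a \<in> Arr C" "Dom C (run V a) = a \<boxtimes> Unit V" "Cod C (run V a) = a" "is_iso C (run V a)"
  using run_hom[OF assms] by (auto simp: homs_def)

lemma ass_nat:
  assumes "f \<in> Arr C" "g \<in> Arr C" "h \<in> Arr C" "Cod C f = a" "Cod C g = b" "Cod C h = c"
  shows "ass V a b c \<cdot>\<^bsub>C\<^esub> ((f \<boxdot> g) \<boxdot> h) = (f \<boxdot> g \<boxdot> h) \<cdot>\<^bsub>C\<^esub> ass V (Dom C f) (Dom C g) (Dom C h)"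
  using ass_natural[of f "Dom C f" "Cod C f" g "Dom C g" "Cod C g" h "Dom C h" "Cod C h"] assms
  by (auto simp: homs_def)

lemma lun_nat:
  assumes "f \<in> Arr C" "Cod C f = b"
  shows "lun V b \<cdot>\<^bsub>C\<^esub> (Ide C (Unit V) \<boxdot> f) = f \<cdot>\<^bsub>C\<^esub> lun V (Dom C f)"
  using lun_natural[of f "Dom C f" "Cod C f"] assms by (auto simp: homs_def)

lemma run_nat:
  assumes "f \<in> Arr C" "Cod C f = b"
  shows "run V b \<cdot>\<^bsub>C\<^esub> (f \<boxdot> Ide C (Unit V)) = f \<cdot>\<^bsub>C\<^esub> run V (Dom C f)"
  using run_natural[of f "Dom C f" "Cod C f"] assms by (auto simp: homs_def)

lemma cinv_lun_nat:
  assumes "f \<in> Arr C" "Cod C f = b"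
  shows "cinv C (lun V b) \<cdot>\<^bsub>C\<^esub> f = (Ide C (Unit V) \<boxdot> f) \<cdot>\<^bsub>C\<^esub> cinv C (lun V (Dom C f))"
proof (rule iso_mono[of "lun V b"])
  show "lun V b \<cdot>\<^bsub>C\<^esub> cinv C (lun V b) \<cdot>\<^bsub>C\<^esub> f =
    lun V b \<cdot>\<^bsub>C\<^esub> (Ide C (Unit V) \<boxdot> f) \<cdot>\<^bsub>C\<^esub> cinv C (lun V (Dom C f))"
    using assms cod_in[of f] by (simp add: tail[OF lun_nat])
qed (use assms cod_in[of f] in auto)

lemma cinv_ass_nat:
  assumes "f \<in> Arr C" "g \<in> Arr C" "h \<in> Arr C" "Cod C f = a" "Cod C g = b" "Cod C h = c"
  shows "cinv C (ass V a b c) \<cdot>\<^bsub>C\<^esub> (f \<boxdot> g \<boxdot> h) =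
    ((f \<boxdot> g) \<boxdot> h) \<cdot>\<^bsub>C\<^esub> cinv C (ass V (Dom C f) (Dom C g) (Dom C h))"
proof (rule iso_mono[of "ass V a b c"])
  show "ass V a b c \<cdot>\<^bsub>C\<^esub> cinv C (ass V a b c) \<cdot>\<^bsub>C\<^esub> (f \<boxdot> g \<boxdot> h) =
    ass V a b c \<cdot>\<^bsub>C\<^esub> ((f \<boxdot> g) \<boxdot> h) \<cdot>\<^bsub>C\<^esub> cinv C (ass V (Dom C f) (Dom C g) (Dom C h))"
    using assms cod_in[of f] cod_in[of g] cod_in[of h] by (simp add: tail[OF ass_nat])
qed (use assms cod_in[of f] cod_in[of g] cod_in[of h] in auto)

lemma cinv_run_nat:
  assumes "f \<in> Arr C" "Cod C f = b"
  shows "cinv C (run V b) \<cdot>\<^bsub>C\<^esub> f = (f \<boxdot> Ide C (Unit V)) \<cdot>\<^bsub>C\<^esub> cinv C (run V (Dom C f))"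
proof (rule iso_mono[of "run V b"])
  show "run V b \<cdot>\<^bsub>C\<^esub> cinv C (run V b) \<cdot>\<^bsub>C\<^esub> f =
    run V b \<cdot>\<^bsub>C\<^esub> (f \<boxdot> Ide C (Unit V)) \<cdot>\<^bsub>C\<^esub> cinv C (run V (Dom C f))"
    using assms cod_in[of f] by (simp add: tail[OF run_nat])
qed (use assms cod_in[of f] in auto)

lemma inverse_pair_TA:
  assumes "is_iso C f" "is_iso C g"
  shows "inverse_pair C (f \<boxdot> g) (cinv C f \<boxdot> cinv C g)"
  using assms iso_arr[OF assms(1)] iso_arr[OF assms(2)]
  by (auto simp: inverse_pair_def homs_def TA_merge)

lemma is_iso_TA [simp]: "\<lbrakk>is_iso C f; is_iso C g\<rbrakk> \<Longrightarrow> is_iso C (f \<boxdot> g)"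
  unfolding is_iso_def[of C "f \<boxdot> g"] by (rule exI, rule inverse_pair_TA)

lemma cinv_TA: "\<lbrakk>is_iso C f; is_iso C g\<rbrakk> \<Longrightarrow> cinv C (f \<boxdot> g) = cinv C f \<boxdot> cinv C g"
  by (intro cinv_eqI inverse_pair_TA)

lemma unit_tensor_faithful:
  assumes "Ide C (Unit V) \<boxdot> f = Ide C (Unit V) \<boxdot> g"
    and "f \<in> Arr C" "g \<in> Arr C" "Dom C f = Dom C g" "Cod C f = Cod C g"
  shows "f = g"
proof -
  have "f \<cdot>\<^bsub>C\<^esub> lun V (Dom C f) = g \<cdot>\<^bsub>C\<^esub> lun V (Dom C f)"
    using lun_nat[of f "Cod C f"] lun_nat[of g "Cod C f"] assms by simp
  then show ?thesis by (rule iso_epi) (use assms in auto)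
qed

lemma tensor_unit_faithful:
  assumes "f \<boxdot> Ide C (Unit V) = g \<boxdot> Ide C (Unit V)"
    and "f \<in> Arr C" "g \<in> Arr C" "Dom C f = Dom C g" "Cod C f = Cod C g"
  shows "f = g"
proof -
  have "f \<cdot>\<^bsub>C\<^esub> run V (Dom C f) = g \<cdot>\<^bsub>C\<^esub> run V (Dom C f)"
    using run_nat[of f "Cod C f"] run_nat[of g "Cod C f"] assms by simp
  then show ?thesis by (rule iso_epi) (use assms in auto)
qed

text \<open>One of the unit coherences of Kelly: after tensoring with the unit on the left it becomes a
  consequence of the pentagon and the triangle.\<close>

lemma lun_tensor:
  assumes a: "a \<in> Obj C" and b: "b \<in> Obj C"
  shows "lun V (a \<boxtimes> b) \<cdot>\<^bsub>C\<^esub> ass V (Unit V) a b = lun V a \<boxdot> Ide C b"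
proof (rule unit_tensor_faithful)
  let ?I = "Unit V" and ?i = "Ide C (Unit V)"
  note [simp] = a b
  have "(?i \<boxdot> (lun V (a \<boxtimes> b) \<cdot>\<^bsub>C\<^esub> ass V ?I a b)) \<cdot>\<^bsub>C\<^esub> ass V ?I (?I \<boxtimes> a) b \<cdot>\<^bsub>C\<^esub> (ass V ?I ?I a \<boxdot> Ide C b)
      = (?i \<boxdot> lun V (a \<boxtimes> b)) \<cdot>\<^bsub>C\<^esub> (?i \<boxdot> ass V ?I a b) \<cdot>\<^bsub>C\<^esub> ass V ?I (?I \<boxtimes> a) b \<cdot>\<^bsub>C\<^esub> (ass V ?I ?I a \<boxdot> Ide C b)"
    by (simp add: TA_merges)
  also have "\<dots> = (?i \<boxdot> lun V (a \<boxtimes> b)) \<cdot>\<^bsub>C\<^esub> ass V ?I ?I (a \<boxtimes> b) \<cdot>\<^bsub>C\<^esub> ass V (?I \<boxtimes> ?I) a b"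
    by (simp add: pentagon)
  also have "\<dots> = (run V ?I \<boxdot> Ide C (a \<boxtimes> b)) \<cdot>\<^bsub>C\<^esub> ass V (?I \<boxtimes> ?I) a b"
    by (simp add: tail[OF triangle])
  also have "\<dots> = ass V ?I a b \<cdot>\<^bsub>C\<^esub> ((run V ?I \<boxdot> Ide C a) \<boxdot> Ide C b)"
    by (simp add: ass_nat)
  also have "\<dots> = ass V ?I a b \<cdot>\<^bsub>C\<^esub> ((?i \<boxdot> lun V a) \<boxdot> Ide C b) \<cdot>\<^bsub>C\<^esub> (ass V ?I ?I a \<boxdot> Ide C b)"
    by (simp add: TA_merge triangle)
  also have "\<dots> = (?i \<boxdot> lun V a \<boxdot> Ide C b) \<cdot>\<^bsub>C\<^esub> ass V ?I (?I \<boxtimes> a) b \<cdot>\<^bsub>C\<^esub> (ass V ?I ?I a \<boxdot> Ide C b)"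
    by (simp add: tail[OF ass_nat])
  finally show "?i \<boxdot> (lun V (a \<boxtimes> b) \<cdot>\<^bsub>C\<^esub> ass V ?I a b) = ?i \<boxdot> lun V a \<boxdot> Ide C b"
    by (rule iso_epi) auto
qed (use a b in auto)

end

context braided_monoidal
begin

lemma br_simps [simp]:
  assumes "a \<in> Obj C" "b \<in> Obj C"
  shows "br a b \<in> Arr C" "Dom C (br a b) = a \<boxtimes> b" "Cod C (br a b) = b \<boxtimes> a" "is_iso C (br a b)"
  using br_hom[OF assms] by (auto simp: homs_def)

lemma br_nat:
  assumes "f \<in> Arr C" "g \<in> Arr C" "Cod C f = a" "Cod C g = b"
  shows "br a b \<cdot>\<^bsub>C\<^esub> (f \<boxdot> g) = (g \<boxdot> f) \<cdot>\<^bsub>C\<^esub> br (Dom C f) (Dom C g)"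
  using br_natural[of f "Dom C f" "Cod C f" g "Dom C g" "Cod C g"] assms by (auto simp: homs_def)

text \<open>After tensoring with the unit and composing with the invertible \<open>br a (Unit V)\<close>, this is the
  hexagon for \<open>a\<close> and twice the unit.\<close>

lemma lun_br:
  assumes a: "a \<in> Obj C"
  shows "lun V a \<cdot>\<^bsub>C\<^esub> br a (Unit V) = run V a"
proof (rule tensor_unit_faithful)
  let ?I = "Unit V" and ?i = "Ide C (Unit V)"
  note [simp] = a
  have "br a ?I \<cdot>\<^bsub>C\<^esub> ((lun V a \<cdot>\<^bsub>C\<^esub> br a ?I) \<boxdot> ?i)
      = br a ?I \<cdot>\<^bsub>C\<^esub> (lun V a \<boxdot> ?i) \<cdot>\<^bsub>C\<^esub> (br a ?I \<boxdot> ?i)"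
    by (simp add: TA_merge)
  also have "\<dots> = br a ?I \<cdot>\<^bsub>C\<^esub> lun V (a \<boxtimes> ?I) \<cdot>\<^bsub>C\<^esub> ass V ?I a ?I \<cdot>\<^bsub>C\<^esub> (br a ?I \<boxdot> ?i)"
    by (simp add: tail[OF lun_tensor])
  also have "\<dots> = lun V (?I \<boxtimes> a) \<cdot>\<^bsub>C\<^esub> (?i \<boxdot> br a ?I) \<cdot>\<^bsub>C\<^esub> ass V ?I a ?I \<cdot>\<^bsub>C\<^esub> (br a ?I \<boxdot> ?i)"
    by (simp add: tail[OF lun_nat])
  also have "\<dots> = lun V (?I \<boxtimes> a) \<cdot>\<^bsub>C\<^esub> ass V ?I ?I a \<cdot>\<^bsub>C\<^esub> br a (?I \<boxtimes> ?I) \<cdot>\<^bsub>C\<^esub> ass V a ?I ?I"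
    by (simp add: hexagon)
  also have "\<dots> = br a ?I \<cdot>\<^bsub>C\<^esub> (Ide C a \<boxdot> lun V ?I) \<cdot>\<^bsub>C\<^esub> ass V a ?I ?I"
    by (simp add: tail[OF lun_tensor] tail[OF br_nat])
  also have "\<dots> = br a ?I \<cdot>\<^bsub>C\<^esub> (run V a \<boxdot> ?i)"
    by (simp add: triangle)
  finally show "(lun V a \<cdot>\<^bsub>C\<^esub> br a ?I) \<boxdot> ?i = run V a \<boxdot> ?i"
    by (rule iso_mono) auto
qed (use a in auto)

end

section \<open>The category of modules over a monoid\<close>

context monoidal_category
begin

lemma left_modules_simps:
  assumes "M \<in> left_modules C V A \<mu> \<iota>"
  shows "fst M \<in> Obj C" "snd M \<in> Arr C" "Dom C (snd M) = A \<boxtimes> fst M" "Cod C (snd M) = fst M"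
    and "snd M \<cdot>\<^bsub>C\<^esub> (Ide C A \<boxdot> snd M) \<cdot>\<^bsub>C\<^esub> ass V A A (fst M) = snd M \<cdot>\<^bsub>C\<^esub> (\<mu> \<boxdot> Ide C (fst M))"
    and "snd M \<cdot>\<^bsub>C\<^esub> (\<iota> \<boxdot> Ide C (fst M)) = lun V (fst M)"
  using assms by (auto simp: left_modules_def homs_def)

lemma mod_cat_simps [simp]:
  "Obj (mod_cat C V A \<mu> \<iota>) = left_modules C V A \<mu> \<iota>"
  "Dom (mod_cat C V A \<mu> \<iota>) (M, f, N) = M"
  "Cod (mod_cat C V A \<mu> \<iota>) (M, f, N) = N"
  "Ide (mod_cat C V A \<mu> \<iota>) M = (M, Ide C (fst M), M)"
  "Cmp (mod_cat C V A \<mu> \<iota>) (N, g, L) (M, f, N') = (M, g \<cdot>\<^bsub>C\<^esub> f, L)"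
  by (simp_all add: mod_cat_def)

lemma mod_cat_arr_iff:
  "(M, f, N) \<in> Arr (mod_cat C V A \<mu> \<iota>) \<longleftrightarrow>
    M \<in> left_modules C V A \<mu> \<iota> \<and> N \<in> left_modules C V A \<mu> \<iota> \<and>
    f \<in> Arr C \<and> Dom C f = fst M \<and> Cod C f = fst N \<and> f \<cdot>\<^bsub>C\<^esub> snd M = snd N \<cdot>\<^bsub>C\<^esub> (Ide C A \<boxdot> f)"
  by (cases M; cases N) (auto simp: mod_cat_def homs_def)

lemma mod_cat_homs_iff:
  "u \<in> homs (mod_cat C V A \<mu> \<iota>) M N \<longleftrightarrow> (\<exists>f. u = (M, f, N) \<and> (M, f, N) \<in> Arr (mod_cat C V A \<mu> \<iota>))"
  by (cases u) (auto simp: homs_def)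

lemma category_mod_cat:
  assumes A: "A \<in> Obj C"
  shows "category (mod_cat C V A \<mu> \<iota>)"
proof
  let ?E = "mod_cat C V A \<mu> \<iota>"
  show "Dom ?E f \<in> Obj ?E" "Cod ?E f \<in> Obj ?E" if "f \<in> Arr ?E" for f
    using that by (cases f; simp add: mod_cat_arr_iff)+
  show "Ide ?E a \<in> homs ?E a a" if "a \<in> Obj ?E" for a
    using that left_modules_simps[of a] A by (simp add: mod_cat_homs_iff mod_cat_arr_iff)
  show "Cmp ?E g f \<in> homs ?E a c" if hom: "f \<in> homs ?E a b" "g \<in> homs ?E b c" for f g a b c
  proof -
    obtain f' g' where fg: "f = (a, f', b)" "g = (b, g', c)"
      and f': "(a, f', b) \<in> Arr ?E" and g': "(b, g', c) \<in> Arr ?E"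
      using hom unfolding mod_cat_homs_iff by blast
    note [simp] = f'[unfolded mod_cat_arr_iff] g'[unfolded mod_cat_arr_iff] A
      left_modules_simps(1-4)[of a A \<mu> \<iota>] left_modules_simps(1-4)[of b A \<mu> \<iota>]
      left_modules_simps(1-4)[of c A \<mu> \<iota>]
    have "g' \<cdot>\<^bsub>C\<^esub> f' \<cdot>\<^bsub>C\<^esub> snd a = g' \<cdot>\<^bsub>C\<^esub> snd b \<cdot>\<^bsub>C\<^esub> (Ide C A \<boxdot> f')" by simp
    also have "\<dots> = snd c \<cdot>\<^bsub>C\<^esub> (Ide C A \<boxdot> g') \<cdot>\<^bsub>C\<^esub> (Ide C A \<boxdot> f')"
      by (subst tail) auto
    finally show ?thesis
      using f' g' unfolding fg by (simp add: mod_cat_homs_iff mod_cat_arr_iff TA_merge)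
  qed
qed (auto simp: mod_cat_homs_iff mod_cat_arr_iff left_modules_simps(1))

lemma cfunctor_forget:
  assumes "A \<in> Obj C"
  shows "cfunctor (mod_cat C V A \<mu> \<iota>) C forget"
proof -
  interpret E: category "mod_cat C V A \<mu> \<iota>" by (rule category_mod_cat[OF assms])
  show ?thesis
    by unfold_locales (auto simp: mod_cat_homs_iff mod_cat_arr_iff homs_iff forget_def left_modules_simps(1))
qed

lemma mod_cat_inverse_pair:
  assumes A: "A \<in> Obj C" and f: "(M, f, N) \<in> Arr (mod_cat C V A \<mu> \<iota>)" and iso: "is_iso C f"
  shows "inverse_pair (mod_cat C V A \<mu> \<iota>) (M, f, N) (N, cinv C f, M)"
proof -
  note [simp] = f[unfolded mod_cat_arr_iff] A iso
    left_modules_simps(1-4)[of M A \<mu> \<iota>] left_modules_simps(1-4)[of N A \<mu> \<iota>]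
  have "cinv C f \<cdot>\<^bsub>C\<^esub> snd N = snd M \<cdot>\<^bsub>C\<^esub> (Ide C A \<boxdot> cinv C f)"
  proof (rule iso_mono[of f], rule iso_epi[of _ "Ide C A \<boxdot> f"])
    have "f \<cdot>\<^bsub>C\<^esub> snd M \<cdot>\<^bsub>C\<^esub> (Ide C A \<boxdot> cinv C f) = (f \<cdot>\<^bsub>C\<^esub> snd M) \<cdot>\<^bsub>C\<^esub> (Ide C A \<boxdot> cinv C f)"
      by (subst cmp_assoc_simp) auto
    then show "(f \<cdot>\<^bsub>C\<^esub> cinv C f \<cdot>\<^bsub>C\<^esub> snd N) \<cdot>\<^bsub>C\<^esub> (Ide C A \<boxdot> f)
      = (f \<cdot>\<^bsub>C\<^esub> snd M \<cdot>\<^bsub>C\<^esub> (Ide C A \<boxdot> cinv C f)) \<cdot>\<^bsub>C\<^esub> (Ide C A \<boxdot> f)"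
      by (simp add: TA_merge)
  qed auto
  then show ?thesis
    using f by (simp add: inverse_pair_def mod_cat_homs_iff mod_cat_arr_iff)
qed

lemma is_iso_mod_cat:
  assumes A: "A \<in> Obj C"
  shows "is_iso (mod_cat C V A \<mu> \<iota>) (M, f, N) \<longleftrightarrow> (M, f, N) \<in> Arr (mod_cat C V A \<mu> \<iota>) \<and> is_iso C f"
    (is "?lhs \<longleftrightarrow> ?rhs")
proof
  assume ?lhs
  then obtain g where g: "inverse_pair (mod_cat C V A \<mu> \<iota>) (M, f, N) g" by (auto simp: is_iso_def)
  then obtain g' where "g = (N, g', M)" by (auto simp: inverse_pair_def mod_cat_homs_iff)
  then show ?rhs
    using g by (auto simp: inverse_pair_def mod_cat_homs_iff mod_cat_arr_iff intro!: is_isoI[of f g'])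
next
  assume ?rhs
  then show ?lhs
    using mod_cat_inverse_pair[OF A] unfolding is_iso_def[of "mod_cat C V A \<mu> \<iota>"] by blast
qed

lemma cinv_mod_cat:
  assumes A: "A \<in> Obj C" and "is_iso (mod_cat C V A \<mu> \<iota>) (M, f, N)"
  shows "cinv (mod_cat C V A \<mu> \<iota>) (M, f, N) = (N, cinv C f, M)"
proof -
  interpret E: category "mod_cat C V A \<mu> \<iota>" by (rule category_mod_cat[OF A])
  show ?thesis
    using assms by (intro E.cinv_eqI mod_cat_inverse_pair) (auto simp: is_iso_mod_cat)
qed

text \<open>The module axioms for \<open>a'\<close> hold because they do so after precomposition with the invertible arrow
  \<open>\<theta>\<close> in the factor \<open>X\<close>.\<close>

lemma left_module_transport:
  assumes A: "A \<in> Obj C" and \<mu>: "\<mu> \<in> homs C (A \<boxtimes> A) A" and \<iota>: "\<iota> \<in> homs C (Unit V) A"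
    and M: "(X, a) \<in> left_modules C V A \<mu> \<iota>"
    and \<theta>: "is_iso C \<theta>" "Dom C \<theta> = X" "Cod C \<theta> = X'"
    and a': "a' \<in> homs C (A \<boxtimes> X') X'" "a' \<cdot>\<^bsub>C\<^esub> (Ide C A \<boxdot> \<theta>) = \<theta> \<cdot>\<^bsub>C\<^esub> a"
  shows "(X', a') \<in> left_modules C V A \<mu> \<iota>"
proof -
  have [simp]: "\<theta> \<in> Arr C" using \<theta>(1) by (rule iso_arr)
  have X': "X' \<in> Obj C" using \<theta>(3) cod_in[of \<theta>] by simp
  note [simp] = A \<mu>[unfolded homs_iff] \<iota>[unfolded homs_iff] \<theta> X' a'(1)[unfolded homs_iff]
    left_modules_simps(1-4)[OF M, simplified]
  have "(a' \<cdot>\<^bsub>C\<^esub> (Ide C A \<boxdot> a') \<cdot>\<^bsub>C\<^esub> ass V A A X') \<cdot>\<^bsub>C\<^esub> (Ide C (A \<boxtimes> A) \<boxdot> \<theta>)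
      = a' \<cdot>\<^bsub>C\<^esub> (Ide C A \<boxdot> a') \<cdot>\<^bsub>C\<^esub> ass V A A X' \<cdot>\<^bsub>C\<^esub> ((Ide C A \<boxdot> Ide C A) \<boxdot> \<theta>)"
    by simp
  also have "\<dots> = a' \<cdot>\<^bsub>C\<^esub> (Ide C A \<boxdot> \<theta>) \<cdot>\<^bsub>C\<^esub> (Ide C A \<boxdot> a) \<cdot>\<^bsub>C\<^esub> ass V A A X"
    by (simp add: ass_nat TA_merges a'(2) del: TA_ide)
  also have "\<dots> = \<theta> \<cdot>\<^bsub>C\<^esub> a \<cdot>\<^bsub>C\<^esub> (Ide C A \<boxdot> a) \<cdot>\<^bsub>C\<^esub> ass V A A X"
    by (subst tail[OF a'(2)]) auto
  also have "\<dots> = \<theta> \<cdot>\<^bsub>C\<^esub> a \<cdot>\<^bsub>C\<^esub> (\<mu> \<boxdot> Ide C X)"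
    using left_modules_simps(5)[OF M] by simp
  also have "\<dots> = a' \<cdot>\<^bsub>C\<^esub> (Ide C A \<boxdot> \<theta>) \<cdot>\<^bsub>C\<^esub> (\<mu> \<boxdot> Ide C X)"
    by (subst tail[OF a'(2)]) auto
  also have "\<dots> = (a' \<cdot>\<^bsub>C\<^esub> (\<mu> \<boxdot> Ide C X')) \<cdot>\<^bsub>C\<^esub> (Ide C (A \<boxtimes> A) \<boxdot> \<theta>)"
    by (simp add: TA_merges)
  finally have 1: "a' \<cdot>\<^bsub>C\<^esub> (Ide C A \<boxdot> a') \<cdot>\<^bsub>C\<^esub> ass V A A X' = a' \<cdot>\<^bsub>C\<^esub> (\<mu> \<boxdot> Ide C X')"
    by (rule iso_epi) auto
  have "(a' \<cdot>\<^bsub>C\<^esub> (\<iota> \<boxdot> Ide C X')) \<cdot>\<^bsub>C\<^esub> (Ide C (Unit V) \<boxdot> \<theta>)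
      = a' \<cdot>\<^bsub>C\<^esub> (Ide C A \<boxdot> \<theta>) \<cdot>\<^bsub>C\<^esub> (\<iota> \<boxdot> Ide C X)"
    by (simp add: TA_merges)
  also have "\<dots> = \<theta> \<cdot>\<^bsub>C\<^esub> a \<cdot>\<^bsub>C\<^esub> (\<iota> \<boxdot> Ide C X)"
    by (subst tail[OF a'(2)]) auto
  also have "\<dots> = lun V X' \<cdot>\<^bsub>C\<^esub> (Ide C (Unit V) \<boxdot> \<theta>)"
    using left_modules_simps(6)[OF M] by (simp add: lun_nat)
  finally have 2: "a' \<cdot>\<^bsub>C\<^esub> (\<iota> \<boxdot> Ide C X') = lun V X'"
    by (rule iso_epi) auto
  show ?thesis
    using 1 2 X' a'(1) by (simp add: left_modules_def)
qed

end

section \<open>Adjunctions with a projection formula\<close>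

text \<open>The situation of \<open>i\<^sup>* \<stileturn> i\<^sub>*\<close> for a 1-cell \<open>i\<close>, reduced to what the comparison with modules
  depends on: the left adjoint \<open>F\<close> is strong monoidal, the right projection map is invertible, the
  counit has a natural section \<open>\<sigma>\<close>, and idempotents split in \<open>D\<close>. For \<open>i\<^sup>* \<stileturn> i\<^sub>*\<close> the section is the unit of
  \<open>i\<^sub>! \<stileturn> i\<^sup>*\<close>. In the opposite categories, \<open>i\<^sub>! \<stileturn> i\<^sup>*\<close> is another instance, whose section is the counit of
  \<open>i\<^sup>* \<stileturn> i\<^sub>*\<close>.\<close>

locale projection_adjunction =
  strong_monoidal C V D W F t t0 + P: cfunctor D C P
  for C :: "('o, 'm, 'x) cat_scheme" and V :: "('o, 'm) mon"
    and D :: "('p, 'n, 'y) cat_scheme" and W :: "('p, 'n) mon"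
    and F :: "('o, 'm, 'p, 'n) func" and t :: "'o \<Rightarrow> 'o \<Rightarrow> 'n" and t0 :: 'n
    and P :: "('p, 'n, 'o, 'm) func" +
  fixes \<eta> :: "'o \<Rightarrow> 'm" and \<epsilon> :: "'p \<Rightarrow> 'n" and \<sigma> :: "'p \<Rightarrow> 'n"
  assumes adj: "adjunction C D F P \<eta> \<epsilon>"
    and section_nat: "nat_trans D D fid (fcomp F P) \<sigma>"
    and section_counit: "y \<in> Obj D \<Longrightarrow> \<epsilon> y \<cdot>\<^bsub>D\<^esub> \<sigma> y = Ide D y"
    and projection_iso: "\<lbrakk>X \<in> Obj C; Y \<in> Obj D\<rbrakk> \<Longrightarrow> is_iso C
      (farr P (\<epsilon> Y \<boxdot>\<^bsub>W\<^esub> Ide D (fobj F X)) \<cdot>\<^bsub>C\<^esub> farr P (t (fobj P Y) X) \<cdot>\<^bsub>C\<^esub> \<eta> (fobj P Y \<boxtimes>\<^bsub>V\<^esub> X))"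
    and idempotents_split: "\<lbrakk>e \<in> homs D a a; e \<cdot>\<^bsub>D\<^esub> e = e\<rbrakk> \<Longrightarrow>
      \<exists>b \<in> Obj D. \<exists>r \<in> homs D a b. \<exists>s \<in> homs D b a. r \<cdot>\<^bsub>D\<^esub> s = Ide D b \<and> s \<cdot>\<^bsub>D\<^esub> r = e"
begin

abbreviation cmpC (infixr "\<cdot>\<^sub>C" 55) where "g \<cdot>\<^sub>C f \<equiv> g \<cdot>\<^bsub>C\<^esub> f"
abbreviation cmpD (infixr "\<cdot>\<^sub>D" 55) where "g \<cdot>\<^sub>D f \<equiv> g \<cdot>\<^bsub>D\<^esub> f"
abbreviation TOV (infixr "\<boxtimes>\<^sub>V" 70) where "X \<boxtimes>\<^sub>V Y \<equiv> X \<boxtimes>\<^bsub>V\<^esub> Y"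
abbreviation TOW (infixr "\<boxtimes>\<^sub>W" 70) where "X \<boxtimes>\<^sub>W Y \<equiv> X \<boxtimes>\<^bsub>W\<^esub> Y"
abbreviation TAV (infixr "\<boxdot>\<^sub>V" 70) where "f \<boxdot>\<^sub>V g \<equiv> f \<boxdot>\<^bsub>V\<^esub> g"
abbreviation TAW (infixr "\<boxdot>\<^sub>W" 70) where "f \<boxdot>\<^sub>W g \<equiv> f \<boxdot>\<^bsub>W\<^esub> g"
abbreviation "I \<equiv> Unit W"
abbreviation "A \<equiv> fobj P I"

text \<open>\<open>proj\<close> is the projection map \<open>P Y \<otimes> X \<rightarrow> P (Y \<otimes> F X)\<close>, \<open>lax\<close> the lax monoidal structure of \<open>P\<close>, and
  \<open>mlt\<close>, \<open>unt\<close> the induced monoid structure of \<open>A = P I\<close>. The maps \<open>pi X : A \<otimes> X \<rightarrow> P F X\<close> compare the monads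
  \<open>A \<otimes> -\<close> and \<open>P F\<close>, and \<open>act Y : A \<otimes> P Y \<rightarrow> P Y\<close> is the action of \<open>A\<close> that corresponds to the algebra
  structure \<open>P \<epsilon>\<close> over \<open>P F\<close>.\<close>

definition "proj Y X =
  farr P (\<epsilon> Y \<boxdot>\<^sub>W Ide D (fobj F X)) \<cdot>\<^sub>C farr P (t (fobj P Y) X) \<cdot>\<^sub>C \<eta> (fobj P Y \<boxtimes>\<^sub>V X)"

definition "lax Y Y' =
  farr P (\<epsilon> Y \<boxdot>\<^sub>W \<epsilon> Y') \<cdot>\<^sub>C farr P (t (fobj P Y) (fobj P Y')) \<cdot>\<^sub>C \<eta> (fobj P Y \<boxtimes>\<^sub>V fobj P Y')"

definition "mlt = farr P (lun W I) \<cdot>\<^sub>C lax I I"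

definition "unt = farr P t0 \<cdot>\<^sub>C \<eta> (Unit V)"

definition "pi X = farr P (lun W (fobj F X)) \<cdot>\<^sub>C proj I X"

definition "act Y = farr P (\<epsilon> Y) \<cdot>\<^sub>C pi (fobj P Y)"

abbreviation "Modules \<equiv> mod_cat C V A mlt unt"

definition "\<Phi> = \<lparr>fobj = (\<lambda>Y. (fobj P Y, act Y)),
  farr = (\<lambda>f. ((fobj P (Dom D f), act (Dom D f)), farr P f, (fobj P (Cod D f), act (Cod D f))))\<rparr>"

lemma \<Phi>_simps [simp]:
  "fobj \<Phi> Y = (fobj P Y, act Y)"
  "farr \<Phi> f = ((fobj P (Dom D f), act (Dom D f)), farr P f, (fobj P (Cod D f), act (Cod D f)))"
  by (simp_all add: \<Phi>_def)

lemma eta_simps [simp]: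
  assumes "X \<in> Obj C"
  shows "\<eta> X \<in> Arr C" "Dom C (\<eta> X) = X" "Cod C (\<eta> X) = fobj P (fobj F X)"
  using adj assms by (auto simp: adjunction_def fcomp_def fid_def dest: nat_trans_simps)

lemma eps_simps [simp]:
  assumes "Y \<in> Obj D"
  shows "\<epsilon> Y \<in> Arr D" "Dom D (\<epsilon> Y) = fobj F (fobj P Y)" "Cod D (\<epsilon> Y) = Y"
  using adj assms by (auto simp: adjunction_def fcomp_def fid_def dest: nat_trans_simps)

lemma section_simps [simp]:
  assumes "Y \<in> Obj D"
  shows "\<sigma> Y \<in> Arr D" "Dom D (\<sigma> Y) = Y" "Cod D (\<sigma> Y) = fobj F (fobj P Y)"
    "\<epsilon> Y \<cdot>\<^sub>D \<sigma> Y = Ide D Y"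
  using nat_trans_simps[OF section_nat] section_counit assms by (auto simp: fcomp_def fid_def)

lemma eta_nat: "\<lbrakk>f \<in> Arr C; Cod C f = X\<rbrakk> \<Longrightarrow> \<eta> X \<cdot>\<^sub>C f = farr P (farr F f) \<cdot>\<^sub>C \<eta> (Dom C f)"
  using adj nat_trans_simps(4)[of C C fid "fcomp P F" \<eta> f] by (auto simp: adjunction_def fcomp_def fid_def)

lemma eps_nat: "\<lbrakk>f \<in> Arr D; Cod D f = Y\<rbrakk> \<Longrightarrow> \<epsilon> Y \<cdot>\<^sub>D farr F (farr P f) = f \<cdot>\<^sub>D \<epsilon> (Dom D f)"
  using adj nat_trans_simps(4)[of D D "fcomp F P" fid \<epsilon> f] by (auto simp: adjunction_def fcomp_def fid_def)

lemma section_natural: "\<lbrakk>f \<in> Arr D; Cod D f = Y\<rbrakk> \<Longrightarrow> \<sigma> Y \<cdot>\<^sub>D f = farr F (farr P f) \<cdot>\<^sub>D \<sigma> (Dom D f)"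
  using nat_trans_simps(4)[OF section_nat, of f] by (auto simp: fcomp_def fid_def)

lemma eps_eta [simp]: "X \<in> Obj C \<Longrightarrow> \<epsilon> (fobj F X) \<cdot>\<^sub>D farr F (\<eta> X) = Ide D (fobj F X)"
  using adj by (simp add: adjunction_def)

lemma P_eps_eta [simp]: "Y \<in> Obj D \<Longrightarrow> farr P (\<epsilon> Y) \<cdot>\<^sub>C \<eta> (fobj P Y) = Ide C (fobj P Y)"
  using adj by (simp add: adjunction_def)

text \<open>Arrows into \<open>P Y\<close> are compared through their adjuncts. The adjuncts of all structure maps are
  composites of counits, unit constraints and the coherence isomorphisms \<open>t\<close> of \<open>F\<close>, so that identities
  between structure maps reduce to coherence in \<open>D\<close>.\<close>

lemma adj_eq:
  assumes "\<epsilon> Y \<cdot>\<^sub>D farr F f = \<epsilon> Y \<cdot>\<^sub>D farr F g" and "Y \<in> Obj D"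
    and "f \<in> Arr C" "g \<in> Arr C" "Dom C f = Dom C g" "Cod C f = fobj P Y" "Cod C g = fobj P Y"
  shows "f = g"
proof -
  have *: "h = farr P (\<epsilon> Y \<cdot>\<^sub>D farr F h) \<cdot>\<^sub>C \<eta> (Dom C h)" if "h \<in> Arr C" "Cod C h = fobj P Y" for h
  proof -
    have "farr P (\<epsilon> Y \<cdot>\<^sub>D farr F h) \<cdot>\<^sub>C \<eta> (Dom C h) = farr P (\<epsilon> Y) \<cdot>\<^sub>C \<eta> (fobj P Y) \<cdot>\<^sub>C h"
      using that assms(2) by (simp add: P.farr_cmp_simp eta_nat)
    also have "\<dots> = h" using that assms(2) by (simp add: C.tail[OF P_eps_eta])
    finally show ?thesis ..
  qed
  show ?thesis using *[of f] *[of g] assms by simp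
qed

lemma eps_transpose:
  assumes "h \<in> Arr D" "Dom D h = fobj F X" "X \<in> Obj C" "Cod D h = Y"
  shows "\<epsilon> Y \<cdot>\<^sub>D farr F (farr P h) \<cdot>\<^sub>D farr F (\<eta> X) = h"
  using assms D.cod_in[OF assms(1)] by (simp add: D.tail[OF eps_nat])

lemma t_simps [simp]:
  assumes "a \<in> Obj C" "b \<in> Obj C"
  shows "t a b \<in> Arr D" "Dom D (t a b) = fobj F (a \<boxtimes>\<^sub>V b)" "Cod D (t a b) = fobj F a \<boxtimes>\<^sub>W fobj F b"
    "is_iso D (t a b)"
  using t_hom[OF assms] by (auto simp: homs_def)

lemma t0_simps [simp]: "t0 \<in> Arr D" "Dom D t0 = fobj F (Unit V)" "Cod D t0 = I" "is_iso D t0"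
  using t0_hom by (auto simp: homs_def)

lemma t_nat:
  assumes "f \<in> Arr C" "g \<in> Arr C" "Cod C f = a" "Cod C g = b"
  shows "t a b \<cdot>\<^sub>D farr F (f \<boxdot>\<^sub>V g) = (farr F f \<boxdot>\<^sub>W farr F g) \<cdot>\<^sub>D t (Dom C f) (Dom C g)"
  using t_natural[of f "Dom C f" "Cod C f" g "Dom C g" "Cod C g"] assms by (auto simp: homs_def)

lemma proj_simps [simp]:
  assumes "X \<in> Obj C" "Y \<in> Obj D"
  shows "proj Y X \<in> Arr C" "Dom C (proj Y X) = fobj P Y \<boxtimes>\<^sub>V X"
    "Cod C (proj Y X) = fobj P (Y \<boxtimes>\<^sub>W fobj F X)" "is_iso C (proj Y X)"
  using assms projection_iso[OF assms] by (auto simp: proj_def)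

lemma lax_simps [simp]:
  assumes "Y \<in> Obj D" "Y' \<in> Obj D"
  shows "lax Y Y' \<in> Arr C" "Dom C (lax Y Y') = fobj P Y \<boxtimes>\<^sub>V fobj P Y'"
    "Cod C (lax Y Y') = fobj P (Y \<boxtimes>\<^sub>W Y')"
  using assms by (auto simp: lax_def)

lemma monoid_simps [simp]:
  "mlt \<in> Arr C" "Dom C mlt = A \<boxtimes>\<^sub>V A" "Cod C mlt = A"
  "unt \<in> Arr C" "Dom C unt = Unit V" "Cod C unt = A"
  by (auto simp: mlt_def unt_def)

lemma pi_simps [simp]:
  assumes "X \<in> Obj C"
  shows "pi X \<in> Arr C" "Dom C (pi X) = A \<boxtimes>\<^sub>V X" "Cod C (pi X) = fobj P (fobj F X)"
    "is_iso C (pi X)"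
  using assms by (auto simp: pi_def)

lemma act_simps [simp]:
  assumes "Y \<in> Obj D"
  shows "act Y \<in> Arr C" "Dom C (act Y) = A \<boxtimes>\<^sub>V fobj P Y" "Cod C (act Y) = fobj P Y"
  using assms by (auto simp: act_def)

lemma eps_proj:
  assumes "X \<in> Obj C" "Y \<in> Obj D"
  shows "\<epsilon> (Y \<boxtimes>\<^sub>W fobj F X) \<cdot>\<^sub>D farr F (proj Y X) = (\<epsilon> Y \<boxdot>\<^sub>W Ide D (fobj F X)) \<cdot>\<^sub>D t (fobj P Y) X"
  using assms by (simp add: proj_def farr_cmp_simp D.tail[OF eps_nat] eps_transpose)

lemma eps_lax:
  assumes "Y \<in> Obj D" "Y' \<in> Obj D"
  shows "\<epsilon> (Y \<boxtimes>\<^sub>W Y') \<cdot>\<^sub>D farr F (lax Y Y') = (\<epsilon> Y \<boxdot>\<^sub>W \<epsilon> Y') \<cdot>\<^sub>D t (fobj P Y) (fobj P Y')"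
  using assms by (simp add: lax_def farr_cmp_simp D.tail[OF eps_nat] eps_transpose)

lemma eps_unt: "\<epsilon> I \<cdot>\<^sub>D farr F unt = t0"
  by (simp add: unt_def farr_cmp_simp eps_transpose)

lemma eps_mlt: "\<epsilon> I \<cdot>\<^sub>D farr F mlt = lun W I \<cdot>\<^sub>D (\<epsilon> I \<boxdot>\<^sub>W \<epsilon> I) \<cdot>\<^sub>D t A A"
  by (simp add: mlt_def farr_cmp_simp D.tail[OF eps_nat] eps_lax)

lemma eps_pi:
  "X \<in> Obj C \<Longrightarrow> \<epsilon> (fobj F X) \<cdot>\<^sub>D farr F (pi X) =
    lun W (fobj F X) \<cdot>\<^sub>D (\<epsilon> I \<boxdot>\<^sub>W Ide D (fobj F X)) \<cdot>\<^sub>D t A X"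
  by (simp add: pi_def farr_cmp_simp D.tail[OF eps_nat] eps_proj)

lemma eps_act:
  assumes "Y \<in> Obj D"
  shows "\<epsilon> Y \<cdot>\<^sub>D farr F (act Y) = lun W Y \<cdot>\<^sub>D (\<epsilon> I \<boxdot>\<^sub>W \<epsilon> Y) \<cdot>\<^sub>D t A (fobj P Y)"
proof -
  have "\<epsilon> Y \<cdot>\<^sub>D farr F (act Y)
      = \<epsilon> Y \<cdot>\<^sub>D lun W (fobj F (fobj P Y)) \<cdot>\<^sub>D (\<epsilon> I \<boxdot>\<^sub>W Ide D (fobj F (fobj P Y))) \<cdot>\<^sub>D t A (fobj P Y)"
    using assms by (simp add: act_def farr_cmp_simp D.tail[OF eps_nat] eps_pi)
  also have "\<dots> = lun W Y \<cdot>\<^sub>D (Ide D I \<boxdot>\<^sub>W \<epsilon> Y) \<cdot>\<^sub>D (\<epsilon> I \<boxdot>\<^sub>W Ide D (fobj F (fobj P Y))) \<cdot>\<^sub>D t A (fobj P Y)"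
    using assms by (simp add: D.tail[OF D.lun_nat])
  finally show ?thesis using assms by (simp add: D.TA_merges)
qed

lemmas eps_rules = farr_cmp_simp eps_proj eps_lax eps_unt eps_mlt eps_pi eps_act eps_nat t_nat
  D.tail[OF eps_proj] D.tail[OF eps_lax] D.tail[OF eps_unt] D.tail[OF eps_mlt] D.tail[OF eps_pi]
  D.tail[OF eps_act] D.tail[OF eps_nat] D.tail[OF t_nat] D.TA_merges

lemma lax_nat:
  assumes "f \<in> Arr D" "g \<in> Arr D" "Cod D f = Y" "Cod D g = Y'"
  shows "lax Y Y' \<cdot>\<^sub>C (farr P f \<boxdot>\<^sub>V farr P g) = farr P (f \<boxdot>\<^sub>W g) \<cdot>\<^sub>C lax (Dom D f) (Dom D g)"
  by (rule adj_eq[of "Y \<boxtimes>\<^sub>W Y'"])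
    (use assms D.cod_in[of f] D.cod_in[of g] in \<open>auto simp: eps_rules\<close>)

lemma pi_nat:
  assumes "f \<in> Arr C" "Cod C f = X"
  shows "pi X \<cdot>\<^sub>C (Ide C A \<boxdot>\<^sub>V f) = farr P (farr F f) \<cdot>\<^sub>C pi (Dom C f)"
proof (rule adj_eq[of "fobj F X"])
  have [simp]: "X \<in> Obj C" using assms C.cod_in by blast
  have "farr F f \<cdot>\<^sub>D lun W (fobj F (Dom C f)) = lun W (fobj F X) \<cdot>\<^sub>D (Ide D I \<boxdot>\<^sub>W farr F f)"
    using assms by (simp add: D.lun_nat)
  from D.tail[OF this] show "\<epsilon> (fobj F X) \<cdot>\<^sub>D farr F (pi X \<cdot>\<^sub>C (Ide C A \<boxdot>\<^sub>V f)) =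
      \<epsilon> (fobj F X) \<cdot>\<^sub>D farr F (farr P (farr F f) \<cdot>\<^sub>C pi (Dom C f))"
    using assms by (simp add: eps_rules)
qed (use assms C.cod_in[of f] in auto)

lemma pi_unit:
  assumes [simp]: "X \<in> Obj C"
  shows "pi X \<cdot>\<^sub>C (unt \<boxdot>\<^sub>V Ide C X) = \<eta> X \<cdot>\<^sub>C lun V X"
  by (rule adj_eq[of "fobj F X"]) (auto simp: eps_rules t_lun D.tail[OF eps_eta])

text \<open>The compatibility of \<open>t\<close> with the associators, in the form in which it occurs in adjuncts: an arrow
  to \<open>D\<close> is applied to each of the three factors.\<close>

lemma t_ass_push:
  assumes "u \<in> Arr D" "v \<in> Arr D" "w \<in> Arr D"
    and "Dom D u = fobj F a" "Dom D v = fobj F b" "Dom D w = fobj F c"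
    and "a \<in> Obj C" "b \<in> Obj C" "c \<in> Obj C"
  shows "(u \<boxdot>\<^sub>W ((v \<boxdot>\<^sub>W w) \<cdot>\<^sub>D t b c)) \<cdot>\<^sub>D t a (b \<boxtimes>\<^sub>V c) \<cdot>\<^sub>D farr F (ass V a b c) =
    ass W (Cod D u) (Cod D v) (Cod D w) \<cdot>\<^sub>D (((u \<boxdot>\<^sub>W v) \<cdot>\<^sub>D t a b) \<boxdot>\<^sub>W w) \<cdot>\<^sub>D t (a \<boxtimes>\<^sub>V b) c"
proof -
  have "(u \<boxdot>\<^sub>W ((v \<boxdot>\<^sub>W w) \<cdot>\<^sub>D t b c)) \<cdot>\<^sub>D t a (b \<boxtimes>\<^sub>V c) \<cdot>\<^sub>D farr F (ass V a b c)
    = (u \<boxdot>\<^sub>W v \<boxdot>\<^sub>W w) \<cdot>\<^sub>D (Ide D (fobj F a) \<boxdot>\<^sub>W t b c) \<cdot>\<^sub>D t a (b \<boxtimes>\<^sub>V c) \<cdot>\<^sub>D farr F (ass V a b c)"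
    using assms by (simp add: D.TA_merges)
  also have "\<dots> = (u \<boxdot>\<^sub>W v \<boxdot>\<^sub>W w) \<cdot>\<^sub>D ass W (fobj F a) (fobj F b) (fobj F c) \<cdot>\<^sub>D
      (t a b \<boxdot>\<^sub>W Ide D (fobj F c)) \<cdot>\<^sub>D t (a \<boxtimes>\<^sub>V b) c"
    using assms by (simp add: t_ass)
  also have "\<dots> = ass W (Cod D u) (Cod D v) (Cod D w) \<cdot>\<^sub>D ((u \<boxdot>\<^sub>W v) \<boxdot>\<^sub>W w) \<cdot>\<^sub>D
      (t a b \<boxdot>\<^sub>W Ide D (fobj F c)) \<cdot>\<^sub>D t (a \<boxtimes>\<^sub>V b) c"
    using assms by (simp add: D.tail[OF D.ass_nat])
  finally show ?thesis using assms by (simp add: D.TA_merges)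
qed

text \<open>The maps \<open>pi X\<close> are compatible with the multiplications of the two monads. Both adjuncts apply the
  counit to the two factors \<open>A\<close> and remove the resulting units, but in a different order; this makes no
  difference by the compatibility of the left unit constraint with the associator.\<close>

lemma pi_mlt:
  assumes [simp]: "X \<in> Obj C"
  shows "pi X \<cdot>\<^sub>C (mlt \<boxdot>\<^sub>V Ide C X) = act (fobj F X) \<cdot>\<^sub>C (Ide C A \<boxdot>\<^sub>V pi X) \<cdot>\<^sub>C ass V A A X"
  (is "?l = ?r")
proof (rule adj_eq[of "fobj F X"])
  let ?FX = "fobj F X"
  have "\<epsilon> ?FX \<cdot>\<^sub>D farr F (act ?FX \<cdot>\<^sub>C (Ide C A \<boxdot>\<^sub>V pi X) \<cdot>\<^sub>C ass V A A X)
      = lun W ?FX \<cdot>\<^sub>D (Ide D I \<boxdot>\<^sub>W lun W ?FX) \<cdot>\<^sub>D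
        (\<epsilon> I \<boxdot>\<^sub>W ((\<epsilon> I \<boxdot>\<^sub>W Ide D ?FX) \<cdot>\<^sub>D t A X)) \<cdot>\<^sub>D t A (A \<boxtimes>\<^sub>V X) \<cdot>\<^sub>D farr F (ass V A A X)"
    by (simp add: eps_rules)
  also have "\<dots> = lun W ?FX \<cdot>\<^sub>D (Ide D I \<boxdot>\<^sub>W lun W ?FX) \<cdot>\<^sub>D ass W I I ?FX \<cdot>\<^sub>D
        (((\<epsilon> I \<boxdot>\<^sub>W \<epsilon> I) \<cdot>\<^sub>D t A A) \<boxdot>\<^sub>W Ide D ?FX) \<cdot>\<^sub>D t (A \<boxtimes>\<^sub>V A) X"
    by (simp add: t_ass_push)
  also have "\<dots> = lun W ?FX \<cdot>\<^sub>D (lun W I \<boxdot>\<^sub>W Ide D ?FX) \<cdot>\<^sub>D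
        (((\<epsilon> I \<boxdot>\<^sub>W \<epsilon> I) \<cdot>\<^sub>D t A A) \<boxdot>\<^sub>W Ide D ?FX) \<cdot>\<^sub>D t (A \<boxtimes>\<^sub>V A) X"
    by (simp add: D.tail[OF D.lun_nat] D.tail[OF D.lun_tensor])
  also have "\<dots> = \<epsilon> ?FX \<cdot>\<^sub>D farr F (pi X \<cdot>\<^sub>C (mlt \<boxdot>\<^sub>V Ide C X))"
    by (simp add: eps_rules)
  finally show "\<epsilon> ?FX \<cdot>\<^sub>D farr F ?l = \<epsilon> ?FX \<cdot>\<^sub>D farr F ?r" ..
qed auto

lemma act_nat:
  assumes "f \<in> Arr D" "Cod D f = Y"
  shows "act Y \<cdot>\<^sub>C (Ide C A \<boxdot>\<^sub>V farr P f) = farr P f \<cdot>\<^sub>C act (Dom D f)"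
proof (rule adj_eq[of Y])
  have [simp]: "Y \<in> Obj D" using assms D.cod_in by blast
  have "f \<cdot>\<^sub>D lun W (Dom D f) = lun W Y \<cdot>\<^sub>D (Ide D I \<boxdot>\<^sub>W f)"
    using assms by (simp add: D.lun_nat)
  from D.tail[OF this] show "\<epsilon> Y \<cdot>\<^sub>D farr F (act Y \<cdot>\<^sub>C (Ide C A \<boxdot>\<^sub>V farr P f)) =
      \<epsilon> Y \<cdot>\<^sub>D farr F (farr P f \<cdot>\<^sub>C act (Dom D f))"
    using assms by (simp add: eps_rules)
qed (use assms D.cod_in[of f] in auto)

lemma act_module [simp]:
  assumes [simp]: "Y \<in> Obj D"
  shows "(fobj P Y, act Y) \<in> left_modules C V A mlt unt"
proof -
  let ?PY = "fobj P Y"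
  have "act Y \<cdot>\<^sub>C (Ide C A \<boxdot>\<^sub>V act Y) \<cdot>\<^sub>C ass V A A ?PY
      = act Y \<cdot>\<^sub>C (Ide C A \<boxdot>\<^sub>V farr P (\<epsilon> Y)) \<cdot>\<^sub>C (Ide C A \<boxdot>\<^sub>V pi ?PY) \<cdot>\<^sub>C ass V A A ?PY"
    by (simp add: C.TA_merges act_def)
  also have "\<dots> = farr P (\<epsilon> Y) \<cdot>\<^sub>C act (fobj F ?PY) \<cdot>\<^sub>C (Ide C A \<boxdot>\<^sub>V pi ?PY) \<cdot>\<^sub>C ass V A A ?PY"
    by (simp add: C.tail[OF act_nat])
  also have "\<dots> = act Y \<cdot>\<^sub>C (mlt \<boxdot>\<^sub>V Ide C ?PY)"
    by (simp add: act_def[of Y] flip: pi_mlt)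
  finally have "act Y \<cdot>\<^sub>C (Ide C A \<boxdot>\<^sub>V act Y) \<cdot>\<^sub>C ass V A A ?PY = act Y \<cdot>\<^sub>C (mlt \<boxdot>\<^sub>V Ide C ?PY)" .
  moreover have "act Y \<cdot>\<^sub>C (unt \<boxdot>\<^sub>V Ide C ?PY) = lun V ?PY"
    by (simp add: act_def pi_unit C.tail[OF P_eps_eta])
  ultimately show ?thesis by (simp add: left_modules_def C.homs_iff)
qed

sublocale E: category Modules
  by (rule C.category_mod_cat) simp

sublocale \<Phi>: cfunctor D Modules \<Phi>
  by unfold_locales
    (auto simp: C.mod_cat_homs_iff C.mod_cat_arr_iff D.homs_iff act_nat P.farr_cmp_simp)

text \<open>Maps of modules are maps of algebras over the monad of the adjunction.\<close>

lemma module_map_adjunct: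
  assumes "f \<in> Arr C" "Dom C f = fobj P Y" "Cod C f = fobj P Y'" "Y \<in> Obj D" "Y' \<in> Obj D"
    and "f \<cdot>\<^sub>C act Y = act Y' \<cdot>\<^sub>C (Ide C A \<boxdot>\<^sub>V f)"
  shows "f \<cdot>\<^sub>C farr P (\<epsilon> Y) = farr P (\<epsilon> Y') \<cdot>\<^sub>C farr P (farr F f)"
  (is "?l = ?r")
proof (rule C.iso_epi[of _ "pi (fobj P Y)"])
  have "(f \<cdot>\<^sub>C farr P (\<epsilon> Y)) \<cdot>\<^sub>C pi (fobj P Y) = act Y' \<cdot>\<^sub>C (Ide C A \<boxdot>\<^sub>V f)"
    using assms by (simp add: act_def)
  also have "\<dots> = (farr P (\<epsilon> Y') \<cdot>\<^sub>C farr P (farr F f)) \<cdot>\<^sub>C pi (fobj P Y)"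
    using assms by (simp add: act_def pi_nat)
  finally show "?l \<cdot>\<^sub>C pi (fobj P Y) = ?r \<cdot>\<^sub>C pi (fobj P Y)" .
qed (use assms in auto)

text \<open>A preimage of a module map \<open>f : P Y \<rightarrow> P Y'\<close> is \<open>Y \<rightarrow> F P Y \<rightarrow> F P Y' \<rightarrow> Y'\<close>, the first arrow being the
  section of the counit.\<close>

lemma \<Phi>_full:
  assumes [simp]: "Y \<in> Obj D" "Y' \<in> Obj D" and g: "g \<in> homs Modules (fobj \<Phi> Y) (fobj \<Phi> Y')"
  shows "\<exists>x \<in> homs D Y Y'. farr \<Phi> x = g"
proof -
  obtain f where gf: "g = (fobj \<Phi> Y, f, fobj \<Phi> Y')" and "g \<in> Arr Modules"
    using g by (auto simp: C.mod_cat_homs_iff)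
  then have [simp]: "f \<in> Arr C" "Dom C f = fobj P Y" "Cod C f = fobj P Y'"
    and f: "f \<cdot>\<^sub>C act Y = act Y' \<cdot>\<^sub>C (Ide C A \<boxdot>\<^sub>V f)"
    by (auto simp: C.mod_cat_arr_iff)
  let ?x = "\<epsilon> Y' \<cdot>\<^sub>D farr F f \<cdot>\<^sub>D \<sigma> Y"
  have "farr P ?x = f \<cdot>\<^sub>C farr P (\<epsilon> Y) \<cdot>\<^sub>C farr P (\<sigma> Y)"
    using f by (simp add: P.farr_cmp_simp C.tail[OF module_map_adjunct])
  also have "\<dots> = f" by (simp flip: P.farr_cmp_simp)
  finally have "farr \<Phi> ?x = g" by (simp add: gf)
  then show ?thesis by (intro bexI[of _ ?x]) (auto simp: D.homs_iff)
qed

lemma P_faithful: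
  assumes "f \<in> homs D Y Y'" "f' \<in> homs D Y Y'" "farr P f = farr P f'"
  shows "f = f'"
proof -
  have [simp]: "Y \<in> Obj D" using assms(1) D.dom_in by (auto simp: D.homs_iff)
  have *: "h = \<epsilon> Y' \<cdot>\<^sub>D farr F (farr P h) \<cdot>\<^sub>D \<sigma> Y" if "h \<in> homs D Y Y'" for h
    using that D.cod_in[of h] by (auto simp: D.homs_iff D.tail[OF eps_nat])
  show ?thesis using *[OF assms(1)] *[OF assms(2)] assms(3) by simp
qed

text \<open>A module \<open>(X, a)\<close> amounts to an algebra \<open>b : P F X \<rightarrow> X\<close> over the monad of the adjunction. The
  section turns \<open>b\<close> into an idempotent \<open>F b \<cdot> \<sigma>\<close> of \<open>F X\<close>; the object that splits it is sent to \<open>(X, a)\<close>.\<close>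

lemma \<Phi>_surj:
  assumes M: "M \<in> left_modules C V A mlt unt"
  shows "\<exists>Y \<in> Obj D. \<exists>\<theta> \<in> homs Modules (fobj \<Phi> Y) M. is_iso Modules \<theta>"
proof -
  obtain X a where Ma: "M = (X, a)" by (cases M)
  note M' = C.left_modules_simps[OF M, unfolded Ma, simplified]
  note [simp] = M'(1-4)
  define b where "b = a \<cdot>\<^sub>C cinv C (pi X)"
  have [simp]: "b \<in> Arr C" "Dom C b = fobj P (fobj F X)" "Cod C b = X" by (auto simp: b_def)
  have b_pi: "b \<cdot>\<^sub>C pi X = a" by (simp add: b_def)
  have b_act: "b \<cdot>\<^sub>C act (fobj F X) = a \<cdot>\<^sub>C (Ide C A \<boxdot>\<^sub>V b)"
    (is "?l = ?r")
  proof (rule C.iso_epi[of _ "(Ide C A \<boxdot>\<^sub>V pi X) \<cdot>\<^sub>C ass V A A X"])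
    have "(b \<cdot>\<^sub>C act (fobj F X)) \<cdot>\<^sub>C (Ide C A \<boxdot>\<^sub>V pi X) \<cdot>\<^sub>C ass V A A X
        = a \<cdot>\<^sub>C (mlt \<boxdot>\<^sub>V Ide C X)"
      by (simp add: C.tail[OF b_pi] flip: pi_mlt)
    also have "\<dots> = (a \<cdot>\<^sub>C (Ide C A \<boxdot>\<^sub>V b)) \<cdot>\<^sub>C (Ide C A \<boxdot>\<^sub>V pi X) \<cdot>\<^sub>C ass V A A X"
      by (simp add: C.TA_merges b_pi M'(5))
    finally show "?l \<cdot>\<^sub>C (Ide C A \<boxdot>\<^sub>V pi X) \<cdot>\<^sub>C ass V A A X =
        ?r \<cdot>\<^sub>C (Ide C A \<boxdot>\<^sub>V pi X) \<cdot>\<^sub>C ass V A A X" .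
  qed auto
  have b_alg: "b \<cdot>\<^sub>C farr P (\<epsilon> (fobj F X)) = b \<cdot>\<^sub>C farr P (farr F b)"
  proof (rule C.iso_epi[of _ "pi (fobj P (fobj F X))"])
    have "(b \<cdot>\<^sub>C farr P (\<epsilon> (fobj F X))) \<cdot>\<^sub>C pi (fobj P (fobj F X)) = b \<cdot>\<^sub>C pi X \<cdot>\<^sub>C (Ide C A \<boxdot>\<^sub>V b)"
      using b_act by (simp add: act_def C.tail[OF b_pi])
    then show "(b \<cdot>\<^sub>C farr P (\<epsilon> (fobj F X))) \<cdot>\<^sub>C pi (fobj P (fobj F X)) =
      (b \<cdot>\<^sub>C farr P (farr F b)) \<cdot>\<^sub>C pi (fobj P (fobj F X))"
      by (simp add: pi_nat)
  qed auto
  have b_eta: "b \<cdot>\<^sub>C \<eta> X = Ide C X"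
  proof (rule C.iso_epi[of _ "lun V X"])
    show "(b \<cdot>\<^sub>C \<eta> X) \<cdot>\<^sub>C lun V X = Ide C X \<cdot>\<^sub>C lun V X"
      by (simp add: C.tail[OF b_pi] M'(6) flip: pi_unit)
  qed auto
  have Fb_alg: "farr F b \<cdot>\<^sub>D farr F (farr P (\<epsilon> (fobj F X))) = farr F b \<cdot>\<^sub>D farr F (farr P (farr F b))"
    using arg_cong[OF b_alg, of "farr F"] by (simp add: farr_cmp_simp)
  define e where "e = farr F b \<cdot>\<^sub>D \<sigma> (fobj F X)"
  have [simp]: "e \<in> Arr D" "Dom D e = fobj F X" "Cod D e = fobj F X" by (auto simp: e_def)
  have \<sigma>Fb: "\<sigma> (fobj F X) \<cdot>\<^sub>D farr F b = farr F (farr P (farr F b)) \<cdot>\<^sub>D \<sigma> (fobj F (fobj P (fobj F X)))"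
    by (simp add: section_natural)
  have Fb\<sigma>: "farr F b \<cdot>\<^sub>D \<sigma> (fobj F X) \<cdot>\<^sub>D farr F b = farr F b \<cdot>\<^sub>D \<sigma> (fobj F X) \<cdot>\<^sub>D \<epsilon> (fobj F X)"
  proof -
    have "farr F b \<cdot>\<^sub>D \<sigma> (fobj F X) \<cdot>\<^sub>D farr F b
        = farr F b \<cdot>\<^sub>D farr F (farr P (\<epsilon> (fobj F X))) \<cdot>\<^sub>D \<sigma> (fobj F (fobj P (fobj F X)))"
      by (simp add: \<sigma>Fb D.tail[OF Fb_alg])
    then show ?thesis by (simp add: section_natural)
  qed
  have "e \<cdot>\<^sub>D e = e"
  proof -
    have "e \<cdot>\<^sub>D e = (farr F b \<cdot>\<^sub>D \<sigma> (fobj F X) \<cdot>\<^sub>D farr F b) \<cdot>\<^sub>D \<sigma> (fobj F X)"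
      by (simp add: e_def)
    then show ?thesis unfolding Fb\<sigma> by (simp add: e_def)
  qed
  moreover have "e \<in> homs D (fobj F X) (fobj F X)" by (simp add: D.homs_iff)
  ultimately obtain Y r s where "Y \<in> Obj D" "r \<in> homs D (fobj F X) Y" "s \<in> homs D Y (fobj F X)"
    and rs: "r \<cdot>\<^sub>D s = Ide D Y" and sr: "s \<cdot>\<^sub>D r = e"
    using idempotents_split by meson
  then have [simp]: "Y \<in> Obj D" "r \<in> Arr D" "Dom D r = fobj F X" "Cod D r = Y"
    "s \<in> Arr D" "Dom D s = Y" "Cod D s = fobj F X"
    by (auto simp: D.homs_iff)
  let ?\<theta> = "b \<cdot>\<^sub>C farr P s" and ?\<theta>' = "farr P r \<cdot>\<^sub>C \<eta> X"
  \<comment> \<open>The quotient \<open>Y\<close> of \<open>F X\<close> coequalizes the two maps from \<open>F P F X\<close>.\<close>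
  have r: "r \<cdot>\<^sub>D farr F b = r \<cdot>\<^sub>D \<epsilon> (fobj F X)"
  proof -
    have "r = (r \<cdot>\<^sub>D s) \<cdot>\<^sub>D r" by (simp add: rs)
    also have "\<dots> = r \<cdot>\<^sub>D e" by (simp add: sr)
    finally have re: "r \<cdot>\<^sub>D farr F b \<cdot>\<^sub>D \<sigma> (fobj F X) = r" by (simp add: e_def)
    then have "r \<cdot>\<^sub>D h = r \<cdot>\<^sub>D farr F b \<cdot>\<^sub>D \<sigma> (fobj F X) \<cdot>\<^sub>D h" if "h \<in> Arr D" "Cod D h = fobj F X" for h
      using that D.cmp_assoc_simp[of h "farr F b \<cdot>\<^sub>D \<sigma> (fobj F X)" r] by simp
    from this[of "farr F b"] this[of "\<epsilon> (fobj F X)"] show ?thesis by (simp add: Fb\<sigma>)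
  qed
  have 1: "?\<theta> \<cdot>\<^sub>C ?\<theta>' = Ide C X"
  proof -
    have "?\<theta> \<cdot>\<^sub>C ?\<theta>' = b \<cdot>\<^sub>C farr P (s \<cdot>\<^sub>D r) \<cdot>\<^sub>C \<eta> X"
      by (simp add: P.farr_cmp_simp)
    also have "\<dots> = b \<cdot>\<^sub>C farr P (farr F b) \<cdot>\<^sub>C farr P (\<sigma> (fobj F X)) \<cdot>\<^sub>C \<eta> X"
      by (simp add: sr e_def P.farr_cmp_simp)
    also have "\<dots> = b \<cdot>\<^sub>C farr P (\<epsilon> (fobj F X) \<cdot>\<^sub>D \<sigma> (fobj F X)) \<cdot>\<^sub>C \<eta> X"
      by (simp add: C.tail[OF b_alg[symmetric]] P.farr_cmp_simp del: section_simps(4))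
    finally show ?thesis by (simp add: b_eta)
  qed
  have 2: "?\<theta>' \<cdot>\<^sub>C ?\<theta> = Ide C (fobj P Y)"
  proof -
    have "?\<theta>' \<cdot>\<^sub>C ?\<theta> = farr P (r \<cdot>\<^sub>D farr F b) \<cdot>\<^sub>C \<eta> (fobj P (fobj F X)) \<cdot>\<^sub>C farr P s"
      by (simp add: P.farr_cmp_simp C.tail[OF eta_nat])
    also have "\<dots> = farr P r \<cdot>\<^sub>C farr P s"
      by (simp add: r P.farr_cmp_simp C.tail[OF P_eps_eta])
    finally show ?thesis by (simp add: rs flip: P.farr_cmp_simp)
  qed
  have "?\<theta> \<cdot>\<^sub>C act Y = a \<cdot>\<^sub>C (Ide C A \<boxdot>\<^sub>V ?\<theta>)"
  proof -
    have "?\<theta> \<cdot>\<^sub>C act Y = b \<cdot>\<^sub>C act (fobj F X) \<cdot>\<^sub>C (Ide C A \<boxdot>\<^sub>V farr P s)"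
      by (simp add: act_nat)
    also have "\<dots> = a \<cdot>\<^sub>C (Ide C A \<boxdot>\<^sub>V b) \<cdot>\<^sub>C (Ide C A \<boxdot>\<^sub>V farr P s)"
      by (simp add: C.tail[OF b_act])
    finally show ?thesis by (simp add: C.TA_merges)
  qed
  then have "(fobj \<Phi> Y, ?\<theta>, M) \<in> Arr Modules"
    using M unfolding Ma by (simp add: C.mod_cat_arr_iff)
  moreover have "is_iso C ?\<theta>"
    by (rule C.is_isoI[of _ ?\<theta>']) (use 1 2 in auto)
  ultimately show ?thesis
    by (intro bexI[of _ Y] bexI[of _ "(fobj \<Phi> Y, ?\<theta>, M)"])
      (simp_all add: C.is_iso_mod_cat C.mod_cat_homs_iff)
qed

theorem equivalence_modules: "equivalence D Modules \<Phi>"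
  by (rule equivalence_if_full_faithful_surjective)
    (use \<Phi>.cfunctor_axioms \<Phi>_full \<Phi>_surj P_faithful in auto)

text \<open>The isomorphisms \<open>pi X\<close> identify the free module on \<open>X\<close> with the image of \<open>fobj F X\<close>; along
  them the free--forgetful adjunction is the given one.\<close>

lemma pi_free:
  assumes [simp]: "X \<in> Obj C"
  shows "pi X \<cdot>\<^sub>C (mlt \<boxdot>\<^sub>V Ide C X) \<cdot>\<^sub>C cinv C (ass V A A X) = act (fobj F X) \<cdot>\<^sub>C (Ide C A \<boxdot>\<^sub>V pi X)"
  by (simp add: C.tail[OF pi_mlt])

lemma free_mod_module:
  assumes [simp]: "X \<in> Obj C"
  shows "free_mod C V A mlt X \<in> left_modules C V A mlt unt"
  unfolding free_mod_def
proof (rule C.left_module_transport[of _ _ _ "fobj P (fobj F X)" "act (fobj F X)" "cinv C (pi X)"])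
  let ?a = "(mlt \<boxdot>\<^sub>V Ide C X) \<cdot>\<^sub>C cinv C (ass V A A X)"
  have "?a = cinv C (pi X) \<cdot>\<^sub>C act (fobj F X) \<cdot>\<^sub>C (Ide C A \<boxdot>\<^sub>V pi X)"
    by (simp flip: pi_free)
  then show "?a \<cdot>\<^sub>C (Ide C A \<boxdot>\<^sub>V cinv C (pi X)) = cinv C (pi X) \<cdot>\<^sub>C act (fobj F X)"
    by (simp add: C.TA_merges)
qed (auto simp: C.homs_iff)

theorem identifies_free_forgetful:
  "identifies_right_adjoints C D Modules \<Phi> F P \<eta> \<epsilon>
    (free_functor C V A mlt) forget (free_unit C V unt) (free_counit C V A mlt)"
proof -
  let ?free = "free_functor C V A mlt" and ?free_obj = "free_mod C V A mlt"
  note simps = C.mod_cat_homs_iff C.mod_cat_arr_iff C.homs_iff free_functor_def forget_def free_unit_def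
    free_counit_def fcomp_def fid_def C.left_modules_simps(1-4)
  have fst_free: "fst (?free_obj X) = A \<boxtimes>\<^sub>V X"
    and snd_free: "snd (?free_obj X) = (mlt \<boxdot>\<^sub>V Ide C X) \<cdot>\<^sub>C cinv C (ass V A A X)" for X
    by (simp_all add: free_mod_def)
  have free_arr: "(Ide C A \<boxdot>\<^sub>V f) \<cdot>\<^sub>C snd (?free_obj (Dom C f)) =
      snd (?free_obj (Cod C f)) \<cdot>\<^sub>C (Ide C A \<boxdot>\<^sub>V Ide C A \<boxdot>\<^sub>V f)" (is "?l = ?r") if [simp]: "f \<in> Arr C" for f
  proof (rule C.iso_epi[of _ "ass V A A (Dom C f)"])
    have "((Ide C A \<boxdot>\<^sub>V f) \<cdot>\<^sub>C snd (?free_obj (Dom C f))) \<cdot>\<^sub>C ass V A A (Dom C f)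
        = (mlt \<boxdot>\<^sub>V Ide C (Cod C f)) \<cdot>\<^sub>C ((Ide C A \<boxdot>\<^sub>V Ide C A) \<boxdot>\<^sub>V f)"
      by (simp add: snd_free C.TA_merges)
    also have "\<dots> = (mlt \<boxdot>\<^sub>V Ide C (Cod C f)) \<cdot>\<^sub>C cinv C (ass V A A (Cod C f)) \<cdot>\<^sub>C ass V A A (Cod C f)
        \<cdot>\<^sub>C ((Ide C A \<boxdot>\<^sub>V Ide C A) \<boxdot>\<^sub>V f)"
      by simp
    also have "\<dots> = (snd (?free_obj (Cod C f)) \<cdot>\<^sub>C (Ide C A \<boxdot>\<^sub>V Ide C A \<boxdot>\<^sub>V f)) \<cdot>\<^sub>C ass V A A (Dom C f)"
      by (simp add: snd_free C.ass_nat del: C.TA_ide C.cinv_tail)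
    finally show "?l \<cdot>\<^sub>C ass V A A (Dom C f) = ?r \<cdot>\<^sub>C ass V A A (Dom C f)" .
  qed (auto simp: snd_free)
  interpret free: cfunctor C Modules ?free
    by unfold_locales (auto simp: simps free_mod_module fst_free free_arr C.TA_merge)
  interpret forget: cfunctor Modules C forget
    by (rule C.cfunctor_forget) simp
  have unit_arr: "free_unit C V unt X \<in> Arr C" "Dom C (free_unit C V unt X) = X"
    "Cod C (free_unit C V unt X) = A \<boxtimes>\<^sub>V X" if "X \<in> Obj C" for X
    using that by (auto simp: free_unit_def)
  have pi_free_unit: "pi X \<cdot>\<^sub>C free_unit C V unt X = \<eta> X" if "X \<in> Obj C" for X
    using that by (simp add: free_unit_def C.tail[OF pi_unit])
  have counit_arr: "free_counit C V A mlt M \<in> homs Modules (?free_obj (fst M)) M"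
    if M: "M \<in> left_modules C V A mlt unt" for M
  proof -
    note [simp] = C.left_modules_simps(1-4)[OF M]
    have "snd M \<cdot>\<^sub>C snd (?free_obj (fst M)) = snd M \<cdot>\<^sub>C (Ide C A \<boxdot>\<^sub>V snd M)"
    proof (rule C.iso_epi[of _ "ass V A A (fst M)"])
      show "(snd M \<cdot>\<^sub>C snd (?free_obj (fst M))) \<cdot>\<^sub>C ass V A A (fst M) =
        (snd M \<cdot>\<^sub>C (Ide C A \<boxdot>\<^sub>V snd M)) \<cdot>\<^sub>C ass V A A (fst M)"
        using C.left_modules_simps(5)[OF M] by (simp add: snd_free)
    qed (auto simp: snd_free)
    then show ?thesis
      using M by (simp add: C.mod_cat_homs_iff C.mod_cat_arr_iff free_counit_def free_mod_module fst_free)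
  qed
  have unit_nat: "nat_trans C C fid (fcomp forget ?free) (free_unit C V unt)"
    unfolding nat_trans_def
  proof (intro conjI ballI)
    show "cfunctor C C fid" "cfunctor C C (fcomp forget ?free)"
      by (rule cfunctor_fid[OF C.category_axioms],
          rule cfunctor_fcomp[OF free.cfunctor_axioms forget.cfunctor_axioms])
    show "free_unit C V unt (Cod C f) \<cdot>\<^sub>C farr fid f =
        farr (fcomp forget ?free) f \<cdot>\<^sub>C free_unit C V unt (Dom C f)" if "f \<in> Arr C" for f
      using that by (simp add: simps C.cinv_lun_nat C.TA_merges)
  qed (auto simp: C.homs_iff unit_arr fcomp_def forget_def free_functor_def fst_free fid_def)
  have counit_nat: "nat_trans Modules Modules (fcomp ?free forget) fid (free_counit C V A mlt)"
    unfolding nat_trans_def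
  proof (intro conjI ballI)
    show "cfunctor Modules Modules fid" "cfunctor Modules Modules (fcomp ?free forget)"
      by (rule cfunctor_fid[OF E.category_axioms],
          rule cfunctor_fcomp[OF forget.cfunctor_axioms free.cfunctor_axioms])
    show "Cmp Modules (free_counit C V A mlt (Cod Modules f)) (farr (fcomp ?free forget) f) =
        Cmp Modules (farr fid f) (free_counit C V A mlt (Dom Modules f))" if "f \<in> Arr Modules" for f
      using that by (cases f) (simp add: C.mod_cat_arr_iff fcomp_def free_functor_def forget_def
          free_counit_def fid_def)
    show "free_counit C V A mlt M \<in> homs Modules (fobj (fcomp ?free forget) M) (fobj fid M)"
      if "M \<in> Obj Modules" for M
      using counit_arr[of M] that by (simp add: fcomp_def free_functor_def forget_def fid_def)
  qed
  have triangle1: "Cmp Modules (free_counit C V A mlt (fobj ?free X)) (farr ?free (free_unit C V unt X))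
      = Ide Modules (fobj ?free X)" if [simp]: "X \<in> Obj C" for X
  proof -
    let ?u = "free_unit C V unt X"
    note [simp] = unit_arr[of X]
    have "snd (?free_obj X) \<cdot>\<^sub>C (Ide C A \<boxdot>\<^sub>V ?u) = Ide C (A \<boxtimes>\<^sub>V X)"
    proof (rule C.iso_mono[of "pi X"])
      have "pi X \<cdot>\<^sub>C snd (?free_obj X) \<cdot>\<^sub>C (Ide C A \<boxdot>\<^sub>V ?u)
          = (pi X \<cdot>\<^sub>C (mlt \<boxdot>\<^sub>V Ide C X) \<cdot>\<^sub>C cinv C (ass V A A X)) \<cdot>\<^sub>C (Ide C A \<boxdot>\<^sub>V ?u)"
        by (simp add: snd_free)
      also have "\<dots> = act (fobj F X) \<cdot>\<^sub>C (Ide C A \<boxdot>\<^sub>V \<eta> X)"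
        by (simp add: pi_free C.TA_merges pi_free_unit)
      also have "\<dots> = farr P (\<epsilon> (fobj F X) \<cdot>\<^sub>D farr F (\<eta> X)) \<cdot>\<^sub>C pi X"
        by (simp add: act_def pi_nat P.farr_cmp_simp del: eps_eta)
      finally show "pi X \<cdot>\<^sub>C snd (?free_obj X) \<cdot>\<^sub>C (Ide C A \<boxdot>\<^sub>V ?u) = pi X \<cdot>\<^sub>C Ide C (A \<boxtimes>\<^sub>V X)"
        by simp
    qed (auto simp: snd_free)
    then show ?thesis by (simp add: free_functor_def free_counit_def fst_free unit_arr)
  qed
  have triangle2: "farr forget (free_counit C V A mlt M) \<cdot>\<^sub>C free_unit C V unt (fobj forget M)
      = Ide C (fobj forget M)" if M: "M \<in> Obj Modules" for M
  proof -
    have M: "M \<in> left_modules C V A mlt unt" using M by simp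
    note [simp] = C.left_modules_simps(1-4)[OF M]
    show ?thesis
      by (simp add: forget_def free_counit_def free_unit_def C.tail[OF C.left_modules_simps(6)[OF M]])
  qed
  define \<theta> where "\<theta> X = (?free_obj X, pi X, fobj \<Phi> (fobj F X))" for X
  have \<theta>_arr: "\<theta> X \<in> Arr Modules" if "X \<in> Obj C" for X
    using that by (simp add: \<theta>_def C.mod_cat_arr_iff free_mod_module fst_free snd_free pi_free)
  have "nat_iso C Modules ?free (fcomp \<Phi> F) \<theta>"
    unfolding nat_iso_def nat_trans_def
  proof (intro conjI ballI)
    show "cfunctor C Modules ?free" by (rule free.cfunctor_axioms)
    show "cfunctor C Modules (fcomp \<Phi> F)" by (rule cfunctor_fcomp[OF cfunctor_axioms \<Phi>.cfunctor_axioms])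
    show "\<theta> X \<in> homs Modules (fobj ?free X) (fobj (fcomp \<Phi> F) X)" if "X \<in> Obj C" for X
      using \<theta>_arr[OF that] by (simp add: C.mod_cat_homs_iff free_functor_def fcomp_def \<theta>_def)
    show "Cmp Modules (\<theta> (Cod C f)) (farr ?free f) = Cmp Modules (farr (fcomp \<Phi> F) f) (\<theta> (Dom C f))"
      if "f \<in> Arr C" for f
      using that by (simp add: free_functor_def fcomp_def \<theta>_def pi_nat)
    show "is_iso Modules (\<theta> X)" if "X \<in> Obj C" for X
      using \<theta>_arr[OF that] that unfolding \<theta>_def by (simp add: C.is_iso_mod_cat)
  qed
  moreover have "feq D (fcomp forget \<Phi>) P"
    by (simp add: feq_def fcomp_def forget_def)
  moreover have "farr forget (\<theta> X) \<cdot>\<^sub>C free_unit C V unt X = \<eta> X" if "X \<in> Obj C" for X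
    using that by (simp add: forget_def \<theta>_def pi_free_unit)
  moreover have "Cmp Modules (farr \<Phi> (\<epsilon> Y)) (\<theta> (fobj P Y)) = free_counit C V A mlt (fobj \<Phi> Y)"
    if "Y \<in> Obj D" for Y
    using that by (simp add: \<theta>_def free_counit_def act_def)
  moreover have "adjunction C Modules ?free forget (free_unit C V unt) (free_counit C V A mlt)"
    unfolding adjunction_def using unit_nat counit_nat triangle1 triangle2 by blast
  ultimately show ?thesis
    unfolding identifies_right_adjoints_def using adj by blast
qed

end

section \<open>Transport of a braided monoidal structure along a presentation\<close>

text \<open>A presentation of an object \<open>m\<close> of \<open>E\<close> is an object of \<open>D\<close> together with an isomorphism from its
  image under \<open>\<Phi>\<close> to \<open>m\<close>. An arrow \<open>f\<close> of \<open>E\<close> is represented by an arrow \<open>x\<close> of \<open>D\<close> if \<open>farr \<Phi> x\<close>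
  becomes \<open>f\<close> along given presentations of source and target.\<close>

definition presents where
  "presents D E \<Phi> p \<longleftrightarrow> fst p \<in> Obj D \<and> is_iso E (snd p) \<and> Dom E (snd p) = fobj \<Phi> (fst p)"

definition represents where
  "represents D E \<Phi> p x f p' \<longleftrightarrow> presents D E \<Phi> p \<and> presents D E \<Phi> p' \<and>
     x \<in> homs D (fst p) (fst p') \<and> f \<in> homs E (Cod E (snd p)) (Cod E (snd p')) \<and>
     f \<cdot>\<^bsub>E\<^esub> snd p = snd p' \<cdot>\<^bsub>E\<^esub> farr \<Phi> x"

text \<open>Suppose that the tensor product of presented objects has a presentation by the tensor product in
  \<open>D\<close>, for which all structure maps of \<open>E\<close> are represented by those of \<open>D\<close>. Since an arrow is determined
  by a representative, every equation between structure maps is inherited from \<open>D\<close>.\<close>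

locale presented_tensor =
  D: braided_monoidal D W brD + E: category E + \<Phi>: cfunctor D E \<Phi>
  for D :: "('p, 'n, 'y) cat_scheme" and W :: "('p, 'n) mon" and brD :: "'p \<Rightarrow> 'p \<Rightarrow> 'n"
    and E :: "('q, 'l, 'z) cat_scheme" and \<Phi> :: "('p, 'n, 'q, 'l) func" +
  fixes U :: "('q, 'l) mon" and brE :: "'q \<Rightarrow> 'q \<Rightarrow> 'l"
    and pt :: "'p \<times> 'l \<Rightarrow> 'p \<times> 'l \<Rightarrow> 'p \<times> 'l" (infixr "\<odot>" 70) and \<tau>0 :: 'l
  assumes full: "\<lbrakk>Y \<in> Obj D; Y' \<in> Obj D; g \<in> homs E (fobj \<Phi> Y) (fobj \<Phi> Y')\<rbrakk>
      \<Longrightarrow> \<exists>x \<in> homs D Y Y'. farr \<Phi> x = g"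
    and surj: "m \<in> Obj E \<Longrightarrow> \<exists>p. presents D E \<Phi> p \<and> Cod E (snd p) = m"
    and fst_pt: "fst (p \<odot> q) = fst p \<boxtimes>\<^bsub>W\<^esub> fst q"
    and presents_pt: "\<lbrakk>presents D E \<Phi> p; presents D E \<Phi> q\<rbrakk> \<Longrightarrow> presents D E \<Phi> (p \<odot> q)"
    and cod_pt: "\<lbrakk>presents D E \<Phi> p; presents D E \<Phi> q\<rbrakk>
      \<Longrightarrow> Cod E (snd (p \<odot> q)) = Cod E (snd p) \<boxtimes>\<^bsub>U\<^esub> Cod E (snd q)"
    and presents_unit: "presents D E \<Phi> (Unit W, \<tau>0)"
    and cod_unit: "Cod E \<tau>0 = Unit U"
    and represents_TA: "\<lbrakk>represents D E \<Phi> p x f p'; represents D E \<Phi> q y g q'\<rbrakk>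
      \<Longrightarrow> represents D E \<Phi> (p \<odot> q) (x \<boxdot>\<^bsub>W\<^esub> y) (f \<boxdot>\<^bsub>U\<^esub> g) (p' \<odot> q')"
    and represents_ass: "\<lbrakk>presents D E \<Phi> p; presents D E \<Phi> q; presents D E \<Phi> r\<rbrakk>
      \<Longrightarrow> represents D E \<Phi> ((p \<odot> q) \<odot> r) (ass W (fst p) (fst q) (fst r))
            (ass U (Cod E (snd p)) (Cod E (snd q)) (Cod E (snd r))) (p \<odot> q \<odot> r)"
    and represents_lun: "presents D E \<Phi> p
      \<Longrightarrow> represents D E \<Phi> ((Unit W, \<tau>0) \<odot> p) (lun W (fst p)) (lun U (Cod E (snd p))) p"
    and represents_run: "presents D E \<Phi> p
      \<Longrightarrow> represents D E \<Phi> (p \<odot> (Unit W, \<tau>0)) (run W (fst p)) (run U (Cod E (snd p))) p"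
    and represents_br: "\<lbrakk>presents D E \<Phi> p; presents D E \<Phi> q\<rbrakk>
      \<Longrightarrow> represents D E \<Phi> (p \<odot> q) (brD (fst p) (fst q)) (brE (Cod E (snd p)) (Cod E (snd q))) (q \<odot> p)"
begin

abbreviation "pres \<equiv> presents D E \<Phi>"
abbreviation "rep \<equiv> represents D E \<Phi>"
abbreviation "tgt p \<equiv> Cod E (snd p)"
abbreviation "un \<equiv> (Unit W, \<tau>0)"

declare fst_pt [simp] presents_pt [simp] cod_pt [simp] presents_unit [simp] cod_unit [simp]

lemma presents_simps [simp]:
  assumes "pres p"
  shows "fst p \<in> Obj D" "is_iso E (snd p)" "snd p \<in> Arr E" "Dom E (snd p) = fobj \<Phi> (fst p)" "tgt p \<in> Obj E"
  using assms E.iso_arr E.cod_in by (auto simp: presents_def)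

lemma rep_homs:
  assumes "rep p x f p'"
  shows "x \<in> homs D (fst p) (fst p')" "f \<in> homs E (tgt p) (tgt p')" "pres p" "pres p'"
    and "f \<cdot>\<^bsub>E\<^esub> snd p = snd p' \<cdot>\<^bsub>E\<^esub> farr \<Phi> x"
  using assms by (auto simp: represents_def)

lemma rep_eq:
  assumes "rep p x f p'" "rep p y g p'" "x = y"
  shows "f = g"
proof (rule E.iso_epi[of _ "snd p"])
  show "f \<cdot>\<^bsub>E\<^esub> snd p = g \<cdot>\<^bsub>E\<^esub> snd p" using rep_homs(5)[OF assms(1)] rep_homs(5)[OF assms(2)] assms(3) by simp
qed (use rep_homs[OF assms(1)] rep_homs[OF assms(2)] in \<open>auto simp: E.homs_iff\<close>)

lemma rep_cmp:
  assumes "rep p x f p'" "rep p' y g p''"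
  shows "rep p (y \<cdot>\<^bsub>D\<^esub> x) (g \<cdot>\<^bsub>E\<^esub> f) p''"
proof -
  note h = rep_homs(1-4)[OF assms(1)] rep_homs(1-4)[OF assms(2)]
  have "g \<cdot>\<^bsub>E\<^esub> f \<cdot>\<^bsub>E\<^esub> snd p = (g \<cdot>\<^bsub>E\<^esub> snd p') \<cdot>\<^bsub>E\<^esub> farr \<Phi> x"
    using h by (simp add: D.homs_iff E.homs_iff rep_homs(5)[OF assms(1)])
  also have "\<dots> = snd p'' \<cdot>\<^bsub>E\<^esub> farr \<Phi> y \<cdot>\<^bsub>E\<^esub> farr \<Phi> x"
    using h by (simp add: D.homs_iff E.homs_iff rep_homs(5)[OF assms(2)])
  finally show ?thesis
    using h by (simp add: represents_def D.homs_iff E.homs_iff \<Phi>.farr_cmp_simp)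
qed

lemma rep_ide [simp]: "pres p \<Longrightarrow> rep p (Ide D (fst p)) (Ide E (tgt p)) p"
  by (simp add: represents_def D.homs_iff E.homs_iff)

lemma rep_exists:
  assumes "f \<in> homs E (tgt p) (tgt p')" "pres p" "pres p'"
  obtains x where "rep p x f p'"
proof -
  have "cinv E (snd p') \<cdot>\<^bsub>E\<^esub> f \<cdot>\<^bsub>E\<^esub> snd p \<in> homs E (fobj \<Phi> (fst p)) (fobj \<Phi> (fst p'))"
    using assms by (simp add: E.homs_iff)
  then obtain x where "x \<in> homs D (fst p) (fst p')" "farr \<Phi> x = cinv E (snd p') \<cdot>\<^bsub>E\<^esub> f \<cdot>\<^bsub>E\<^esub> snd p"
    using full[of "fst p" "fst p'"] assms by auto
  then have "rep p x f p'"
    using assms by (simp add: represents_def E.homs_iff D.homs_iff)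
  then show ?thesis by (rule that)
qed

lemma rep_inverse:
  assumes "rep p x f p'" "is_iso D x"
  shows "is_iso E f" "rep p' (cinv D x) (cinv E f) p"
proof -
  note h [simp] = rep_homs(1-4)[OF assms(1), unfolded D.homs_iff E.homs_iff]
  have f: "f \<cdot>\<^bsub>E\<^esub> snd p = snd p' \<cdot>\<^bsub>E\<^esub> farr \<Phi> x" by (rule rep_homs(5)[OF assms(1)])
  have "f = snd p' \<cdot>\<^bsub>E\<^esub> farr \<Phi> x \<cdot>\<^bsub>E\<^esub> cinv E (snd p)"
    by (rule E.iso_epi[of _ "snd p"]) (auto simp: f)
  then show iso: "is_iso E f" using assms(2) by simp
  have "cinv E f \<cdot>\<^bsub>E\<^esub> snd p' = snd p \<cdot>\<^bsub>E\<^esub> farr \<Phi> (cinv D x)"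
  proof (rule E.iso_mono[of f])
    show "f \<cdot>\<^bsub>E\<^esub> cinv E f \<cdot>\<^bsub>E\<^esub> snd p' = f \<cdot>\<^bsub>E\<^esub> snd p \<cdot>\<^bsub>E\<^esub> farr \<Phi> (cinv D x)"
      using assms(2) iso by (simp add: E.tail[OF f] flip: \<Phi>.farr_cmp_simp)
  qed (use assms(2) iso in auto)
  then show "rep p' (cinv D x) (cinv E f) p"
    using assms(2) iso by (simp add: represents_def E.homs_iff D.homs_iff)
qed

lemma rep_ass_cinv:
  assumes "pres p" "pres q" "pres r"
  shows "rep (p \<odot> q \<odot> r) (cinv D (ass W (fst p) (fst q) (fst r)))
    (cinv E (ass U (tgt p) (tgt q) (tgt r))) ((p \<odot> q) \<odot> r)"
  by (rule rep_inverse(2)[OF represents_ass[OF assms]]) (use assms in simp)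

definition "chosen_pres m = (SOME p. pres p \<and> tgt p = m)"

definition "chosen_rep f = (SOME x. rep (chosen_pres (Dom E f)) x f (chosen_pres (Cod E f)))"

lemma chosen_pres:
  assumes "m \<in> Obj E"
  shows "pres (chosen_pres m)" "tgt (chosen_pres m) = m"
  unfolding chosen_pres_def using someI_ex[OF surj[OF assms]] by blast+

lemma chosen_rep:
  assumes f: "f \<in> homs E a b"
  shows "rep (chosen_pres a) (chosen_rep f) f (chosen_pres b)"
    "pres (chosen_pres a)" "pres (chosen_pres b)" "tgt (chosen_pres a) = a" "tgt (chosen_pres b) = b"
proof -
  have o: "a \<in> Obj E" "b \<in> Obj E" using f E.dom_obj[of f] E.cod_obj[of f] by (auto simp: E.homs_iff)
  obtain x where "rep (chosen_pres a) x f (chosen_pres b)"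
    using rep_exists[of f "chosen_pres a" "chosen_pres b"] chosen_pres[OF o(1)] chosen_pres[OF o(2)] f by auto
  then show "rep (chosen_pres a) (chosen_rep f) f (chosen_pres b)"
    unfolding chosen_rep_def using someI[of "\<lambda>x. rep (chosen_pres a) x f (chosen_pres b)"] f by (simp add: E.homs_iff)
qed (use f E.dom_obj[of f] E.cod_obj[of f] in \<open>auto simp: E.homs_iff chosen_pres\<close>)

lemma monoidal_presented: "monoidal_category E U"
proof unfold_locales
  show "a \<boxtimes>\<^bsub>U\<^esub> b \<in> Obj E" if a: "a \<in> Obj E" and b: "b \<in> Obj E" for a b
    using presents_simps(5)[OF presents_pt[OF chosen_pres(1)[OF a] chosen_pres(1)[OF b]]]
      chosen_pres[OF a] chosen_pres[OF b] by simp
  show "Unit U \<in> Obj E" using presents_simps(5)[OF presents_unit] by simp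
  show "f \<boxdot>\<^bsub>U\<^esub> g \<in> homs E (a \<boxtimes>\<^bsub>U\<^esub> b) (a' \<boxtimes>\<^bsub>U\<^esub> b')"
    if f: "f \<in> homs E a a'" and g: "g \<in> homs E b b'" for f g a a' b b'
  proof -
    note f = chosen_rep[OF f]
    note g = chosen_rep[OF g]
    show ?thesis using rep_homs(2)[OF represents_TA[OF f(1) g(1)]] f g by simp
  qed
  show "Ide E a \<boxdot>\<^bsub>U\<^esub> Ide E b = Ide E (a \<boxtimes>\<^bsub>U\<^esub> b)" if a: "a \<in> Obj E" and b: "b \<in> Obj E" for a b
  proof -
    note p = chosen_pres[OF a]
    note q = chosen_pres[OF b]
    show ?thesis
      using rep_eq[OF represents_TA[OF rep_ide[OF p(1)] rep_ide[OF q(1)]] rep_ide[OF presents_pt[OF p(1) q(1)]]] p q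
      by simp
  qed
  show "(f' \<cdot>\<^bsub>E\<^esub> f) \<boxdot>\<^bsub>U\<^esub> (g' \<cdot>\<^bsub>E\<^esub> g) = (f' \<boxdot>\<^bsub>U\<^esub> g') \<cdot>\<^bsub>E\<^esub> (f \<boxdot>\<^bsub>U\<^esub> g)"
    if f: "f \<in> homs E a b" and f': "f' \<in> homs E b c" and g: "g \<in> homs E u v" and g': "g' \<in> homs E v w"
    for f f' g g' a b c u v w
  proof -
    note r = chosen_rep(1)[OF f] chosen_rep(1)[OF f'] chosen_rep(1)[OF g] chosen_rep(1)[OF g']
    show ?thesis
      by (rule rep_eq[OF represents_TA[OF rep_cmp[OF r(1,2)] rep_cmp[OF r(3,4)]]
            rep_cmp[OF represents_TA[OF r(1,3)] represents_TA[OF r(2,4)]]])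
        (use rep_homs(1)[OF r(1)] rep_homs(1)[OF r(2)] rep_homs(1)[OF r(3)] rep_homs(1)[OF r(4)] in
          \<open>simp add: D.homs_iff D.TA_merge\<close>)
  qed
  show "ass U a b c \<in> homs E ((a \<boxtimes>\<^bsub>U\<^esub> b) \<boxtimes>\<^bsub>U\<^esub> c) (a \<boxtimes>\<^bsub>U\<^esub> b \<boxtimes>\<^bsub>U\<^esub> c) \<and> is_iso E (ass U a b c)"
    if a: "a \<in> Obj E" and b: "b \<in> Obj E" and c: "c \<in> Obj E" for a b c
  proof -
    note p = chosen_pres[OF a]
    note q = chosen_pres[OF b]
    note r = chosen_pres[OF c]
    note R = represents_ass[OF p(1) q(1) r(1)]
    show ?thesis using rep_homs(2)[OF R] rep_inverse(1)[OF R] p q r by simp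
  qed
  show "ass U a' b' c' \<cdot>\<^bsub>E\<^esub> ((f \<boxdot>\<^bsub>U\<^esub> g) \<boxdot>\<^bsub>U\<^esub> h) = (f \<boxdot>\<^bsub>U\<^esub> g \<boxdot>\<^bsub>U\<^esub> h) \<cdot>\<^bsub>E\<^esub> ass U a b c"
    if f: "f \<in> homs E a a'" and g: "g \<in> homs E b b'" and h: "h \<in> homs E c c'" for f g h a a' b b' c c'
  proof -
    note f = chosen_rep[OF f]
    note g = chosen_rep[OF g]
    note h = chosen_rep[OF h]
    show ?thesis
      using rep_eq[OF rep_cmp[OF represents_TA[OF represents_TA[OF f(1) g(1)] h(1)] represents_ass[OF f(3) g(3) h(3)]]
            rep_cmp[OF represents_ass[OF f(2) g(2) h(2)] represents_TA[OF f(1) represents_TA[OF g(1) h(1)]]]]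
        rep_homs(1)[OF f(1)] rep_homs(1)[OF g(1)] rep_homs(1)[OF h(1)] f g h
      by (simp add: D.homs_iff D.ass_nat)
  qed
  show "lun U a \<in> homs E (Unit U \<boxtimes>\<^bsub>U\<^esub> a) a \<and> is_iso E (lun U a)" if a: "a \<in> Obj E" for a
  proof -
    note p = chosen_pres[OF a]
    note R = represents_lun[OF p(1)]
    show ?thesis using rep_homs(2)[OF R] rep_inverse(1)[OF R] p by simp
  qed
  show "lun U b \<cdot>\<^bsub>E\<^esub> (Ide E (Unit U) \<boxdot>\<^bsub>U\<^esub> f) = f \<cdot>\<^bsub>E\<^esub> lun U a" if f: "f \<in> homs E a b" for f a b
  proof -
    note f = chosen_rep[OF f]
    show ?thesis
      using rep_eq[OF rep_cmp[OF represents_TA[OF rep_ide[OF presents_unit] f(1)] represents_lun[OF f(3)]]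
            rep_cmp[OF represents_lun[OF f(2)] f(1)]] rep_homs(1)[OF f(1)] f
      by (simp add: D.homs_iff D.lun_nat)
  qed
  show "run U a \<in> homs E (a \<boxtimes>\<^bsub>U\<^esub> Unit U) a \<and> is_iso E (run U a)" if a: "a \<in> Obj E" for a
  proof -
    note p = chosen_pres[OF a]
    note R = represents_run[OF p(1)]
    show ?thesis using rep_homs(2)[OF R] rep_inverse(1)[OF R] p by simp
  qed
  show "run U b \<cdot>\<^bsub>E\<^esub> (f \<boxdot>\<^bsub>U\<^esub> Ide E (Unit U)) = f \<cdot>\<^bsub>E\<^esub> run U a" if f: "f \<in> homs E a b" for f a b
  proof -
    note f = chosen_rep[OF f]
    show ?thesis
      using rep_eq[OF rep_cmp[OF represents_TA[OF f(1) rep_ide[OF presents_unit]] represents_run[OF f(3)]]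
            rep_cmp[OF represents_run[OF f(2)] f(1)]] rep_homs(1)[OF f(1)] f
      by (simp add: D.homs_iff D.run_nat)
  qed
  show "(Ide E a \<boxdot>\<^bsub>U\<^esub> ass U b c d) \<cdot>\<^bsub>E\<^esub> ass U a (b \<boxtimes>\<^bsub>U\<^esub> c) d \<cdot>\<^bsub>E\<^esub> (ass U a b c \<boxdot>\<^bsub>U\<^esub> Ide E d) =
      ass U a b (c \<boxtimes>\<^bsub>U\<^esub> d) \<cdot>\<^bsub>E\<^esub> ass U (a \<boxtimes>\<^bsub>U\<^esub> b) c d"
    if a: "a \<in> Obj E" and b: "b \<in> Obj E" and c: "c \<in> Obj E" and d: "d \<in> Obj E" for a b c d
  proof -
    note p = chosen_pres[OF a]
    note q = chosen_pres[OF b]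
    note r = chosen_pres[OF c]
    note s = chosen_pres[OF d]
    note P = p(1) and Q = q(1) and R = r(1) and S = s(1)
    show ?thesis
      using rep_eq[OF rep_cmp[OF rep_cmp[OF represents_TA[OF represents_ass[OF P Q R] rep_ide[OF S]]
                represents_ass[OF P presents_pt[OF Q R] S, folded fst_pt]]
              represents_TA[OF rep_ide[OF P] represents_ass[OF Q R S]]]
            rep_cmp[OF represents_ass[OF presents_pt[OF P Q] R S] represents_ass[OF P Q presents_pt[OF R S]]]]
        p q r s
      by (simp add: D.pentagon)
  qed
  show "(Ide E a \<boxdot>\<^bsub>U\<^esub> lun U b) \<cdot>\<^bsub>E\<^esub> ass U a (Unit U) b = run U a \<boxdot>\<^bsub>U\<^esub> Ide E b"
    if a: "a \<in> Obj E" and b: "b \<in> Obj E" for a b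
  proof -
    note p = chosen_pres[OF a]
    note q = chosen_pres[OF b]
    show ?thesis
      using rep_eq[OF rep_cmp[OF represents_ass[OF p(1) presents_unit q(1)]
              represents_TA[OF rep_ide[OF p(1)] represents_lun[OF q(1)]]]
            represents_TA[OF represents_run[OF p(1)] rep_ide[OF q(1)]]] p q
      by (simp add: D.triangle)
  qed
qed

lemma braided_presented: "braided_monoidal E U brE"
proof -
  interpret EM: monoidal_category E U by (rule monoidal_presented)
  show ?thesis
  proof unfold_locales
    show "brE a b \<in> homs E (a \<boxtimes>\<^bsub>U\<^esub> b) (b \<boxtimes>\<^bsub>U\<^esub> a) \<and> is_iso E (brE a b)"
      if a: "a \<in> Obj E" and b: "b \<in> Obj E" for a b
    proof -
      note p = chosen_pres[OF a]
      note q = chosen_pres[OF b]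
      note R = represents_br[OF p(1) q(1)]
      show ?thesis using rep_homs(2)[OF R] rep_inverse(1)[OF R] p q by simp
    qed
    show "brE a' b' \<cdot>\<^bsub>E\<^esub> (f \<boxdot>\<^bsub>U\<^esub> g) = (g \<boxdot>\<^bsub>U\<^esub> f) \<cdot>\<^bsub>E\<^esub> brE a b"
      if f: "f \<in> homs E a a'" and g: "g \<in> homs E b b'" for f g a a' b b'
    proof -
      note f = chosen_rep[OF f]
      note g = chosen_rep[OF g]
      show ?thesis
        using rep_eq[OF rep_cmp[OF represents_TA[OF f(1) g(1)] represents_br[OF f(3) g(3)]]
              rep_cmp[OF represents_br[OF f(2) g(2)] represents_TA[OF g(1) f(1)]]]
          rep_homs(1)[OF f(1)] rep_homs(1)[OF g(1)] f g
        by (simp add: D.homs_iff D.br_nat)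
    qed
    show "ass U b c a \<cdot>\<^bsub>E\<^esub> brE a (b \<boxtimes>\<^bsub>U\<^esub> c) \<cdot>\<^bsub>E\<^esub> ass U a b c =
        (Ide E b \<boxdot>\<^bsub>U\<^esub> brE a c) \<cdot>\<^bsub>E\<^esub> ass U b a c \<cdot>\<^bsub>E\<^esub> (brE a b \<boxdot>\<^bsub>U\<^esub> Ide E c)"
      if a: "a \<in> Obj E" and b: "b \<in> Obj E" and c: "c \<in> Obj E" for a b c
    proof -
      note p = chosen_pres[OF a]
      note q = chosen_pres[OF b]
      note r = chosen_pres[OF c]
      note P = p(1) and Q = q(1) and R = r(1)
      show ?thesis
        using rep_eq[OF rep_cmp[OF rep_cmp[OF represents_ass[OF P Q R] represents_br[OF P presents_pt[OF Q R]]]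
                represents_ass[OF Q R P]]
              rep_cmp[OF rep_cmp[OF represents_TA[OF represents_br[OF P Q] rep_ide[OF R]] represents_ass[OF Q P R]]
                represents_TA[OF rep_ide[OF Q] represents_br[OF P R]]]] p q r
        by (simp add: D.hexagon)
    qed
    show "cinv E (ass U c a b) \<cdot>\<^bsub>E\<^esub> brE (a \<boxtimes>\<^bsub>U\<^esub> b) c \<cdot>\<^bsub>E\<^esub> cinv E (ass U a b c) =
        (brE a c \<boxdot>\<^bsub>U\<^esub> Ide E b) \<cdot>\<^bsub>E\<^esub> cinv E (ass U a c b) \<cdot>\<^bsub>E\<^esub> (Ide E a \<boxdot>\<^bsub>U\<^esub> brE b c)"
      if a: "a \<in> Obj E" and b: "b \<in> Obj E" and c: "c \<in> Obj E" for a b c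
    proof -
      note p = chosen_pres[OF a]
      note q = chosen_pres[OF b]
      note r = chosen_pres[OF c]
      note P = p(1) and Q = q(1) and R = r(1)
      show ?thesis
        using rep_eq[OF rep_cmp[OF rep_cmp[OF rep_ass_cinv[OF P Q R] represents_br[OF presents_pt[OF P Q] R]]
                rep_ass_cinv[OF R P Q]]
              rep_cmp[OF rep_cmp[OF represents_TA[OF rep_ide[OF P] represents_br[OF Q R]] rep_ass_cinv[OF P R Q]]
                represents_TA[OF represents_br[OF P R] rep_ide[OF Q]]]] p q r
        by (simp add: D.hexagon')
    qed
  qed
qed

text \<open>An object in the image of \<open>\<Phi>\<close> is presented by the identity; for these presentations the
  comparison isomorphisms of \<open>\<Phi>\<close> are represented by identities.\<close>

abbreviation "ip Y \<equiv> (Y, Ide E (fobj \<Phi> Y))"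
abbreviation "cmpr Y Y' \<equiv> snd (ip Y \<odot> ip Y')"

lemma ip_presents [simp]: "Y \<in> Obj D \<Longrightarrow> pres (ip Y)"
  by (simp add: presents_def)

lemma rep_ip: "x \<in> homs D Y Y' \<Longrightarrow> rep (ip Y) x (farr \<Phi> x) (ip Y')"
  using D.dom_in[of x] D.cod_in[of x] by (auto simp: represents_def D.homs_iff E.homs_iff)

lemma rep_cmpr:
  assumes "Y \<in> Obj D" "Y' \<in> Obj D"
  shows "rep (ip (Y \<boxtimes>\<^bsub>W\<^esub> Y')) (Ide D (Y \<boxtimes>\<^bsub>W\<^esub> Y')) (cmpr Y Y') (ip Y \<odot> ip Y')"
  using assms presents_simps[OF presents_pt[OF ip_presents[OF assms(1)] ip_presents[OF assms(2)]]]
  by (simp add: represents_def D.homs_iff E.homs_iff)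

lemma rep_cmpr0: "rep (ip (Unit W)) (Ide D (Unit W)) \<tau>0 un"
  using presents_simps[OF presents_unit] by (simp add: represents_def D.homs_iff E.homs_iff)

lemma braided_strong_presented: "braided_strong_monoidal D W brD E U brE \<Phi> cmpr \<tau>0"
proof -
  interpret EB: braided_monoidal E U brE by (rule braided_presented)
  have cod_ip: "tgt (ip Y) = fobj \<Phi> Y" if "Y \<in> Obj D" for Y using that by simp
  have "strong_monoidal D W E U \<Phi> cmpr \<tau>0"
  proof unfold_locales
    show "cmpr a b \<in> homs E (fobj \<Phi> (a \<boxtimes>\<^bsub>W\<^esub> b)) (fobj \<Phi> a \<boxtimes>\<^bsub>U\<^esub> fobj \<Phi> b) \<and> is_iso E (cmpr a b)"
      if "a \<in> Obj D" "b \<in> Obj D" for a b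
      using presents_simps[OF presents_pt[OF ip_presents[OF that(1)] ip_presents[OF that(2)]]] that
      by (simp add: E.homs_iff)
    show "\<tau>0 \<in> homs E (fobj \<Phi> (Unit W)) (Unit U) \<and> is_iso E \<tau>0"
      using presents_simps[OF presents_unit] by (simp add: E.homs_iff)
    show "cmpr a' b' \<cdot>\<^bsub>E\<^esub> farr \<Phi> (f \<boxdot>\<^bsub>W\<^esub> g) = (farr \<Phi> f \<boxdot>\<^bsub>U\<^esub> farr \<Phi> g) \<cdot>\<^bsub>E\<^esub> cmpr a b"
      if f: "f \<in> homs D a a'" and g: "g \<in> homs D b b'" for f g a a' b b'
    proof -
      have o: "a \<in> Obj D" "a' \<in> Obj D" "b \<in> Obj D" "b' \<in> Obj D"
        using f g D.dom_in D.cod_in by (auto simp: D.homs_iff)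
      show ?thesis
        by (rule rep_eq[OF rep_cmp[OF rep_ip[OF D.TA_hom[OF f g]] rep_cmpr[OF o(2) o(4)]]
              rep_cmp[OF rep_cmpr[OF o(1) o(3)] represents_TA[OF rep_ip[OF f] rep_ip[OF g]]]])
          (use f g in \<open>auto simp: D.homs_iff\<close>)
    qed
    show "ass U (fobj \<Phi> a) (fobj \<Phi> b) (fobj \<Phi> c) \<cdot>\<^bsub>E\<^esub> (cmpr a b \<boxdot>\<^bsub>U\<^esub> Ide E (fobj \<Phi> c)) \<cdot>\<^bsub>E\<^esub> cmpr (a \<boxtimes>\<^bsub>W\<^esub> b) c =
        (Ide E (fobj \<Phi> a) \<boxdot>\<^bsub>U\<^esub> cmpr b c) \<cdot>\<^bsub>E\<^esub> cmpr a (b \<boxtimes>\<^bsub>W\<^esub> c) \<cdot>\<^bsub>E\<^esub> farr \<Phi> (ass W a b c)"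
      if a: "a \<in> Obj D" and b: "b \<in> Obj D" and c: "c \<in> Obj D" for a b c
      using rep_eq[OF rep_cmp[OF rep_cmp[OF rep_cmpr[OF D.TO_obj[OF a b] c]
                represents_TA[OF rep_cmpr[OF a b] rep_ide[OF ip_presents[OF c]]]]
              represents_ass[OF ip_presents[OF a] ip_presents[OF b] ip_presents[OF c]]]
            rep_cmp[OF rep_cmp[OF rep_ip rep_cmpr[OF a D.TO_obj[OF b c]]]
              represents_TA[OF rep_ide[OF ip_presents[OF a]] rep_cmpr[OF b c]]], of "ass W a b c"] a b c
      by (simp add: D.homs_iff)
    show "lun U (fobj \<Phi> a) \<cdot>\<^bsub>E\<^esub> (\<tau>0 \<boxdot>\<^bsub>U\<^esub> Ide E (fobj \<Phi> a)) \<cdot>\<^bsub>E\<^esub> cmpr (Unit W) a = farr \<Phi> (lun W a)"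
      if a: "a \<in> Obj D" for a
      using rep_eq[OF rep_cmp[OF rep_cmp[OF rep_cmpr[OF D.Un_obj a]
                represents_TA[OF rep_cmpr0 rep_ide[OF ip_presents[OF a]]]]
              represents_lun[OF ip_presents[OF a]]] rep_ip, of "lun W a"] a
      by (simp add: D.homs_iff)
    show "run U (fobj \<Phi> a) \<cdot>\<^bsub>E\<^esub> (Ide E (fobj \<Phi> a) \<boxdot>\<^bsub>U\<^esub> \<tau>0) \<cdot>\<^bsub>E\<^esub> cmpr a (Unit W) = farr \<Phi> (run W a)"
      if a: "a \<in> Obj D" for a
      using rep_eq[OF rep_cmp[OF rep_cmp[OF rep_cmpr[OF a D.Un_obj]
                represents_TA[OF rep_ide[OF ip_presents[OF a]] rep_cmpr0]]
              represents_run[OF ip_presents[OF a]]] rep_ip, of "run W a"] a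
      by (simp add: D.homs_iff)
  qed
  moreover have "brE (fobj \<Phi> a) (fobj \<Phi> b) \<cdot>\<^bsub>E\<^esub> cmpr a b = cmpr b a \<cdot>\<^bsub>E\<^esub> farr \<Phi> (brD a b)"
    if a: "a \<in> Obj D" and b: "b \<in> Obj D" for a b
    using rep_eq[OF rep_cmp[OF rep_cmpr[OF a b] represents_br[OF ip_presents[OF a] ip_presents[OF b]]]
          rep_cmp[OF rep_ip rep_cmpr[OF b a]], of "brD a b"] a b
    by (simp add: D.homs_iff)
  ultimately show ?thesis
    unfolding braided_strong_monoidal_def
    using D.braided_monoidal_axioms EB.braided_monoidal_axioms by blast
qed

end

section \<open>Tensor products over a monoid\<close>

context category
begin

lemma split_coequalizerE:
  assumes "split_coequalizer C f g q"
  obtains s t where "f \<in> Arr C" "g \<in> Arr C" "Dom C g = Dom C f" "Cod C g = Cod C f"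
    and "q \<in> Arr C" "Dom C q = Cod C f" "s \<in> Arr C" "Dom C s = Cod C q" "Cod C s = Cod C f"
    and "t \<in> Arr C" "Dom C t = Cod C f" "Cod C t = Dom C f"
    and "q \<cdot> f = q \<cdot> g" "q \<cdot> s = Ide C (Cod C q)" "f \<cdot> t = Ide C (Cod C f)" "g \<cdot> t = s \<cdot> q"
proof -
  obtain s t where "s \<in> homs C (Cod C q) (Dom C q)" "t \<in> homs C (Cod C f) (Dom C f)"
    "q \<cdot> s = Ide C (Cod C q)" "f \<cdot> t = Ide C (Cod C f)" "g \<cdot> t = s \<cdot> q"
    using assms unfolding split_coequalizer_def by blast
  with assms show ?thesis by (intro that[of s t]) (auto simp: split_coequalizer_def homs_iff)
qed

lemma split_coequalizer_transport:
  assumes q: "split_coequalizer C f g q"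
    and w: "is_iso C w" "Cod C w = Cod C f" and z: "is_iso C z" "Cod C z = Dom C f"
    and f': "f' \<in> Arr C" "Dom C f' = Dom C z" "Cod C f' = Dom C w" "w \<cdot> f' = f \<cdot> z"
    and g': "g' \<in> Arr C" "Dom C g' = Dom C z" "Cod C g' = Dom C w" "w \<cdot> g' = g \<cdot> z"
  shows "split_coequalizer C f' g' (q \<cdot> w)"
proof -
  from q obtain s t where st [simp]: "f \<in> Arr C" "g \<in> Arr C" "Dom C g = Dom C f" "Cod C g = Cod C f"
    "q \<in> Arr C" "Dom C q = Cod C f" "s \<in> Arr C" "Dom C s = Cod C q" "Cod C s = Cod C f"
    "t \<in> Arr C" "Dom C t = Cod C f" "Cod C t = Dom C f"
    and eqs: "q \<cdot> f = q \<cdot> g" "q \<cdot> s = Ide C (Cod C q)" "f \<cdot> t = Ide C (Cod C f)" "g \<cdot> t = s \<cdot> q"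
    by (rule split_coequalizerE)
  note [simp] = w z iso_arr[OF w(1)] iso_arr[OF z(1)] f'(1-3) g'(1-3)
  let ?s = "cinv C w \<cdot> s" and ?t = "cinv C z \<cdot> t \<cdot> w"
  have "(q \<cdot> w) \<cdot> f' = (q \<cdot> f) \<cdot> z" by (simp add: f'(4))
  also have "\<dots> = (q \<cdot> w) \<cdot> g'" unfolding eqs(1) by (simp add: g'(4))
  finally have 1: "(q \<cdot> w) \<cdot> f' = (q \<cdot> w) \<cdot> g'" .
  have "w \<cdot> f' \<cdot> ?t = (f \<cdot> t) \<cdot> w" by (simp add: tail[OF f'(4)])
  then have "w \<cdot> f' \<cdot> ?t = w \<cdot> Ide C (Cod C f')" unfolding eqs(3) by simp
  then have 2: "f' \<cdot> ?t = Ide C (Cod C f')" by (rule iso_mono) auto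
  have "w \<cdot> g' \<cdot> ?t = (g \<cdot> t) \<cdot> w" by (simp add: tail[OF g'(4)])
  then have "w \<cdot> g' \<cdot> ?t = w \<cdot> ?s \<cdot> q \<cdot> w" unfolding eqs(4) by simp
  then have 3: "g' \<cdot> ?t = ?s \<cdot> q \<cdot> w" by (rule iso_mono) auto
  show ?thesis
    unfolding split_coequalizer_def using 1 2 3 eqs(2)
    by (intro conjI bexI[of _ ?s] bexI[of _ ?t]) (simp_all add: homs_iff)
qed

lemma split_coequalizer_unique:
  assumes "split_coequalizer C f g q" "split_coequalizer C f g q'"
  shows "\<exists>h. is_iso C h \<and> Dom C h = Cod C q \<and> Cod C h = Cod C q' \<and> h \<cdot> q = q'"
proof -
  from assms(1) obtain s t where st [simp]: "f \<in> Arr C" "g \<in> Arr C" "Dom C g = Dom C f" "Cod C g = Cod C f"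
    "q \<in> Arr C" "Dom C q = Cod C f" "s \<in> Arr C" "Dom C s = Cod C q" "Cod C s = Cod C f"
    "t \<in> Arr C" "Dom C t = Cod C f" "Cod C t = Dom C f"
    and eqs: "q \<cdot> f = q \<cdot> g" "q \<cdot> s = Ide C (Cod C q)" "f \<cdot> t = Ide C (Cod C f)" "g \<cdot> t = s \<cdot> q"
    by (rule split_coequalizerE)
  from assms(2) obtain s' t' where st' [simp]: "q' \<in> Arr C" "Dom C q' = Cod C f"
    "s' \<in> Arr C" "Dom C s' = Cod C q'" "Cod C s' = Cod C f" "t' \<in> Arr C" "Dom C t' = Cod C f" "Cod C t' = Dom C f"
    and eqs': "q' \<cdot> f = q' \<cdot> g" "q' \<cdot> s' = Ide C (Cod C q')" "f \<cdot> t' = Ide C (Cod C f)" "g \<cdot> t' = s' \<cdot> q'"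
    by (rule split_coequalizerE)
  \<comment> \<open>An arrow that coequalizes \<open>f\<close> and \<open>g\<close> factors through a split coequalizer by composition with the
    splitting.\<close>
  have factor: "k \<cdot> s \<cdot> q = k" "k \<cdot> s' \<cdot> q' = k" if k: "k \<in> Arr C" "Dom C k = Cod C f" "k \<cdot> f = k \<cdot> g" for k
  proof -
    have "k \<cdot> g \<cdot> u = k" if "u \<in> Arr C" "Dom C u = Cod C f" "Cod C u = Dom C f" "f \<cdot> u = Ide C (Cod C f)" for u
      by (subst tail[OF k(3)[symmetric]]) (use k(1,2) that in simp_all)
    from this[of t] this[of t'] show "k \<cdot> s \<cdot> q = k" "k \<cdot> s' \<cdot> q' = k"
      using eqs eqs' by simp_all
  qed
  let ?h = "q' \<cdot> s" and ?h' = "q \<cdot> s'"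
  have hq: "?h \<cdot> q = q'" "?h' \<cdot> q' = q" using factor eqs(1) eqs'(1) by simp_all
  have "?h' \<cdot> ?h \<cdot> q = Ide C (Cod C q) \<cdot> q" "?h \<cdot> ?h' \<cdot> q' = Ide C (Cod C q') \<cdot> q'"
    unfolding hq by (simp_all add: factor eqs(1) eqs'(1))
  then have "?h' \<cdot> ?h = Ide C (Cod C q)" "?h \<cdot> ?h' = Ide C (Cod C q')"
    using split_epi_cancel[of "?h' \<cdot> ?h" q "Ide C (Cod C q)" s]
      split_epi_cancel[of "?h \<cdot> ?h'" q' "Ide C (Cod C q')" s'] eqs(2) eqs'(2)
    by simp_all
  then have "is_iso C ?h" by (intro is_isoI[of _ ?h']) auto
  then show ?thesis using hq(1) by (intro exI[of _ ?h]) auto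
qed

end

context braided_monoidal
begin

lemma right_action_simps [simp]:
  assumes "A \<in> Obj C" "M \<in> left_modules C V A \<mu> \<iota>"
  shows "right_action C br A M \<in> Arr C" "Dom C (right_action C br A M) = fst M \<boxtimes> A"
    "Cod C (right_action C br A M) = fst M"
  using assms left_modules_simps(1-4)[OF assms(2)] by (auto simp: right_action_def)

lemma mod_tensor_transport:
  assumes A [simp]: "A \<in> Obj C" and T: "mod_tensor C V br A \<mu> \<iota> M N T q"
    and M: "M \<in> left_modules C V A \<mu> \<iota>" and N: "N \<in> left_modules C V A \<mu> \<iota>"
    and \<alpha>: "(M', \<alpha>, M) \<in> Arr (mod_cat C V A \<mu> \<iota>)" "is_iso C \<alpha>"
    and \<beta>: "(N', \<beta>, N) \<in> Arr (mod_cat C V A \<mu> \<iota>)" "is_iso C \<beta>"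
  shows "mod_tensor C V br A \<mu> \<iota> M' N' T (q \<cdot>\<^bsub>C\<^esub> (\<alpha> \<boxdot> \<beta>))"
proof -
  have M': "M' \<in> left_modules C V A \<mu> \<iota>" and N': "N' \<in> left_modules C V A \<mu> \<iota>"
    using \<alpha> \<beta> by (simp_all add: mod_cat_arr_iff)
  note [simp] = left_modules_simps(1-4)[OF M] left_modules_simps(1-4)[OF N]
    left_modules_simps(1-4)[OF M'] left_modules_simps(1-4)[OF N']
    right_action_simps[OF A M] right_action_simps[OF A M'] \<alpha>(2) \<beta>(2)
  have [simp]: "\<alpha> \<in> Arr C" "Dom C \<alpha> = fst M'" "Cod C \<alpha> = fst M"
    "\<beta> \<in> Arr C" "Dom C \<beta> = fst N'" "Cod C \<beta> = fst N"
    and \<alpha>_act: "\<alpha> \<cdot>\<^bsub>C\<^esub> snd M' = snd M \<cdot>\<^bsub>C\<^esub> (Ide C A \<boxdot> \<alpha>)" and \<beta>_act: "\<beta> \<cdot>\<^bsub>C\<^esub> snd N' = snd N \<cdot>\<^bsub>C\<^esub> (Ide C A \<boxdot> \<beta>)"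
    using \<alpha> \<beta> by (simp_all add: mod_cat_arr_iff)
  have \<alpha>_ract: "\<alpha> \<cdot>\<^bsub>C\<^esub> right_action C br A M' = right_action C br A M \<cdot>\<^bsub>C\<^esub> (\<alpha> \<boxdot> Ide C A)"
    by (simp add: right_action_def tail[OF \<alpha>_act] br_nat)
  let ?f = "(Ide C (fst M) \<boxdot> snd N) \<cdot>\<^bsub>C\<^esub> ass V (fst M) A (fst N)"
  let ?f' = "(Ide C (fst M') \<boxdot> snd N') \<cdot>\<^bsub>C\<^esub> ass V (fst M') A (fst N')"
  let ?g = "right_action C br A M \<boxdot> Ide C (fst N)"
  let ?g' = "right_action C br A M' \<boxdot> Ide C (fst N')"
  let ?w = "\<alpha> \<boxdot> \<beta>" and ?z = "(\<alpha> \<boxdot> Ide C A) \<boxdot> \<beta>"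
  have f': "?w \<cdot>\<^bsub>C\<^esub> ?f' = ?f \<cdot>\<^bsub>C\<^esub> ?z"
    by (simp add: ass_nat TA_merges \<beta>_act)
  have g': "?w \<cdot>\<^bsub>C\<^esub> ?g' = ?g \<cdot>\<^bsub>C\<^esub> ?z"
    by (simp add: TA_merges \<alpha>_ract)
  have split: "split_coequalizer C ?f ?g q"
    and q: "q \<in> homs C (fst M \<boxtimes> fst N) (fst T)" and T_mod: "T \<in> left_modules C V A \<mu> \<iota>"
    and T_act: "snd T \<cdot>\<^bsub>C\<^esub> (Ide C A \<boxdot> q) = q \<cdot>\<^bsub>C\<^esub> (snd M \<boxdot> Ide C (fst N)) \<cdot>\<^bsub>C\<^esub> cinv C (ass V A (fst M) (fst N))"
    using T unfolding mod_tensor_def by blast+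
  note [simp] = q[unfolded homs_iff] left_modules_simps(1-4)[OF T_mod]
  have "split_coequalizer C ?f' ?g' (q \<cdot>\<^bsub>C\<^esub> ?w)"
    by (rule split_coequalizer_transport[OF split _ _ _ _ _ _ _ f' _ _ _ g']) auto
  moreover have "snd T \<cdot>\<^bsub>C\<^esub> (Ide C A \<boxdot> (q \<cdot>\<^bsub>C\<^esub> ?w)) =
      (q \<cdot>\<^bsub>C\<^esub> ?w) \<cdot>\<^bsub>C\<^esub> (snd M' \<boxdot> Ide C (fst N')) \<cdot>\<^bsub>C\<^esub> cinv C (ass V A (fst M') (fst N'))"
    (is "?l = ?r")
  proof (rule iso_epi[of _ "ass V A (fst M') (fst N')"])
    have "?l \<cdot>\<^bsub>C\<^esub> ass V A (fst M') (fst N')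
        = (snd T \<cdot>\<^bsub>C\<^esub> (Ide C A \<boxdot> q)) \<cdot>\<^bsub>C\<^esub> ass V A (fst M) (fst N) \<cdot>\<^bsub>C\<^esub> ((Ide C A \<boxdot> \<alpha>) \<boxdot> \<beta>)"
      by (simp add: TA_merges ass_nat)
    also have "\<dots> = q \<cdot>\<^bsub>C\<^esub> (snd M \<boxdot> Ide C (fst N)) \<cdot>\<^bsub>C\<^esub> ((Ide C A \<boxdot> \<alpha>) \<boxdot> \<beta>)"
      unfolding T_act by simp
    finally show "?l \<cdot>\<^bsub>C\<^esub> ass V A (fst M') (fst N') = ?r \<cdot>\<^bsub>C\<^esub> ass V A (fst M') (fst N')"
      by (simp add: TA_merges \<alpha>_act)
  qed auto
  ultimately show ?thesis
    using T_mod by (simp add: mod_tensor_def homs_iff)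
qed

text \<open>The comparison map is a module map because \<open>A \<otimes> q\<close> is an epimorphism, \<open>q\<close> being split.\<close>

lemma mod_tensor_unique:
  assumes A [simp]: "A \<in> Obj C"
    and M: "M \<in> left_modules C V A \<mu> \<iota>" and N: "N \<in> left_modules C V A \<mu> \<iota>"
    and T: "mod_tensor C V br A \<mu> \<iota> M N T q" and T': "mod_tensor C V br A \<mu> \<iota> M N T' q'"
  shows "\<exists>h. (T, h, T') \<in> Arr (mod_cat C V A \<mu> \<iota>) \<and> is_iso C h \<and> h \<cdot>\<^bsub>C\<^esub> q = q'"
proof -
  let ?f = "(Ide C (fst M) \<boxdot> snd N) \<cdot>\<^bsub>C\<^esub> ass V (fst M) A (fst N)"
  let ?g = "right_action C br A M \<boxdot> Ide C (fst N)"
  have q: "q \<in> homs C (fst M \<boxtimes> fst N) (fst T)" "T \<in> left_modules C V A \<mu> \<iota>" "split_coequalizer C ?f ?g q"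
    and T_act: "snd T \<cdot>\<^bsub>C\<^esub> (Ide C A \<boxdot> q) = q \<cdot>\<^bsub>C\<^esub> (snd M \<boxdot> Ide C (fst N)) \<cdot>\<^bsub>C\<^esub> cinv C (ass V A (fst M) (fst N))"
    using T unfolding mod_tensor_def by blast+
  have q': "q' \<in> homs C (fst M \<boxtimes> fst N) (fst T')" "T' \<in> left_modules C V A \<mu> \<iota>" "split_coequalizer C ?f ?g q'"
    and T'_act: "snd T' \<cdot>\<^bsub>C\<^esub> (Ide C A \<boxdot> q') = q' \<cdot>\<^bsub>C\<^esub> (snd M \<boxdot> Ide C (fst N)) \<cdot>\<^bsub>C\<^esub> cinv C (ass V A (fst M) (fst N))"
    using T' unfolding mod_tensor_def by blast+
  note [simp] = q(1)[unfolded homs_iff] q'(1)[unfolded homs_iff] left_modules_simps(1-4)[OF q(2)]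
    left_modules_simps(1-4)[OF q'(2)] left_modules_simps(1-4)[OF M] left_modules_simps(1-4)[OF N]
  obtain h where h: "is_iso C h" "Dom C h = Cod C q" "Cod C h = Cod C q'" and hq: "h \<cdot>\<^bsub>C\<^esub> q = q'"
    using split_coequalizer_unique[OF q(3) q'(3)] by blast
  note [simp] = h iso_arr[OF h(1)]
  obtain s where s [simp]: "s \<in> Arr C" "Dom C s = Cod C q" "Cod C s = Dom C q" "q \<cdot>\<^bsub>C\<^esub> s = Ide C (Cod C q)"
    using q(3) by (rule split_coequalizerE) auto
  have "h \<cdot>\<^bsub>C\<^esub> snd T = snd T' \<cdot>\<^bsub>C\<^esub> (Ide C A \<boxdot> h)" (is "?l = ?r")
  proof (rule split_epi_cancel[of _ "Ide C A \<boxdot> q" _ "Ide C A \<boxdot> s"])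
    have "?l \<cdot>\<^bsub>C\<^esub> (Ide C A \<boxdot> q) = h \<cdot>\<^bsub>C\<^esub> (snd T \<cdot>\<^bsub>C\<^esub> (Ide C A \<boxdot> q))" by simp
    also have "\<dots> = (h \<cdot>\<^bsub>C\<^esub> q) \<cdot>\<^bsub>C\<^esub> (snd M \<boxdot> Ide C (fst N)) \<cdot>\<^bsub>C\<^esub> cinv C (ass V A (fst M) (fst N))"
      unfolding T_act by simp
    also have "\<dots> = snd T' \<cdot>\<^bsub>C\<^esub> (Ide C A \<boxdot> (h \<cdot>\<^bsub>C\<^esub> q))" unfolding hq T'_act ..
    finally show "?l \<cdot>\<^bsub>C\<^esub> (Ide C A \<boxdot> q) = ?r \<cdot>\<^bsub>C\<^esub> (Ide C A \<boxdot> q)"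
      by (simp add: TA_merges)
  qed (auto simp: TA_merges)
  then show ?thesis
    using q(2) q'(2) hq by (intro exI[of _ h]) (simp add: mod_cat_arr_iff)
qed

end

locale braided_projection_adjunction =
  projection_adjunction C V D W F t t0 P \<eta> \<epsilon> \<sigma> +
  C: braided_monoidal C V brC + D: braided_monoidal D W brD
  for C :: "('o, 'm, 'x) cat_scheme" and V :: "('o, 'm) mon"
    and D :: "('p, 'n, 'y) cat_scheme" and W :: "('p, 'n) mon"
    and F :: "('o, 'm, 'p, 'n) func" and t :: "'o \<Rightarrow> 'o \<Rightarrow> 'n" and t0 :: 'n
    and P :: "('p, 'n, 'o, 'm) func" and \<eta> :: "'o \<Rightarrow> 'm" and \<epsilon> :: "'p \<Rightarrow> 'n" and \<sigma> :: "'p \<Rightarrow> 'n"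
    and brC :: "'o \<Rightarrow> 'o \<Rightarrow> 'm" and brD :: "'p \<Rightarrow> 'p \<Rightarrow> 'n" +
  assumes t_br: "\<lbrakk>a \<in> Obj C; b \<in> Obj C\<rbrakk>
    \<Longrightarrow> brD (fobj F a) (fobj F b) \<cdot>\<^bsub>D\<^esub> t a b = t b a \<cdot>\<^bsub>D\<^esub> farr F (brC a b)"
begin

text \<open>The lax monoidal structure of \<open>P\<close> is compatible with associators and braidings, and its components
  at the unit are the left and right actions of \<open>A\<close>.\<close>

lemma eps_right_action:
  assumes [simp]: "Y \<in> Obj D"
  shows "\<epsilon> Y \<cdot>\<^sub>D farr F (right_action C brC A (fobj P Y, act Y)) =
    run W Y \<cdot>\<^sub>D (\<epsilon> Y \<boxdot>\<^sub>W \<epsilon> I) \<cdot>\<^sub>D t (fobj P Y) A"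
proof -
  have "\<epsilon> Y \<cdot>\<^sub>D farr F (right_action C brC A (fobj P Y, act Y))
      = lun W Y \<cdot>\<^sub>D (\<epsilon> I \<boxdot>\<^sub>W \<epsilon> Y) \<cdot>\<^sub>D brD (fobj F (fobj P Y)) (fobj F A) \<cdot>\<^sub>D t (fobj P Y) A"
    by (simp add: right_action_def eps_rules t_br)
  also have "\<dots> = lun W Y \<cdot>\<^sub>D brD Y I \<cdot>\<^sub>D (\<epsilon> Y \<boxdot>\<^sub>W \<epsilon> I) \<cdot>\<^sub>D t (fobj P Y) A"
    by (simp add: D.tail[OF D.br_nat])
  finally show ?thesis by (simp add: D.tail[OF D.lun_br])
qed

lemma lax_lun: "Y \<in> Obj D \<Longrightarrow> farr P (lun W Y) \<cdot>\<^sub>C lax I Y = act Y"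
  by (rule adj_eq[of Y]) (auto simp: eps_rules)

lemma lax_run:
  assumes [simp]: "Y \<in> Obj D"
  shows "farr P (run W Y) \<cdot>\<^sub>C lax Y I = right_action C brC A (fobj P Y, act Y)"
  by (rule adj_eq[of Y])
    (use C.right_action_simps[OF P.fobj_in[OF D.Un_obj] act_module[OF assms], simplified] in \<open>auto simp: eps_rules eps_right_action\<close>)

lemma lax_br:
  assumes [simp]: "Y \<in> Obj D" "Y' \<in> Obj D"
  shows "farr P (brD Y Y') \<cdot>\<^sub>C lax Y Y' = lax Y' Y \<cdot>\<^sub>C brC (fobj P Y) (fobj P Y')"
  by (rule adj_eq[of "Y' \<boxtimes>\<^sub>W Y"])
    (auto simp: eps_rules D.tail[OF D.br_nat] t_br[symmetric])

lemma lax_ass: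
  assumes [simp]: "Y \<in> Obj D" "Y' \<in> Obj D" "Y'' \<in> Obj D"
  shows "farr P (ass W Y Y' Y'') \<cdot>\<^sub>C lax (Y \<boxtimes>\<^sub>W Y') Y'' \<cdot>\<^sub>C (lax Y Y' \<boxdot>\<^sub>V Ide C (fobj P Y'')) =
    lax Y (Y' \<boxtimes>\<^sub>W Y'') \<cdot>\<^sub>C (Ide C (fobj P Y) \<boxdot>\<^sub>V lax Y' Y'') \<cdot>\<^sub>C ass V (fobj P Y) (fobj P Y') (fobj P Y'')"
  by (rule adj_eq[of "Y \<boxtimes>\<^sub>W Y' \<boxtimes>\<^sub>W Y''"]) (auto simp: eps_rules t_ass_push)

text \<open>Since the action of \<open>A\<close> is a special case of the lax structure, its compatibility with the lax
  structure is a case of \<open>lax_ass\<close>.\<close>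

lemma act_lax:
  assumes [simp]: "Y \<in> Obj D" "Y' \<in> Obj D"
  shows "act (Y \<boxtimes>\<^sub>W Y') \<cdot>\<^sub>C (Ide C A \<boxdot>\<^sub>V lax Y Y') =
    lax Y Y' \<cdot>\<^sub>C (act Y \<boxdot>\<^sub>V Ide C (fobj P Y')) \<cdot>\<^sub>C cinv C (ass V A (fobj P Y) (fobj P Y'))"
  (is "?l = ?r")
proof (rule C.iso_epi[of _ "ass V A (fobj P Y) (fobj P Y')"])
  have "(act (Y \<boxtimes>\<^sub>W Y') \<cdot>\<^sub>C (Ide C A \<boxdot>\<^sub>V lax Y Y')) \<cdot>\<^sub>C ass V A (fobj P Y) (fobj P Y')
      = farr P (lun W (Y \<boxtimes>\<^sub>W Y') \<cdot>\<^sub>D ass W I Y Y') \<cdot>\<^sub>C lax (I \<boxtimes>\<^sub>W Y) Y' \<cdot>\<^sub>C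
        (lax I Y \<boxdot>\<^sub>V Ide C (fobj P Y'))"
    by (simp add: P.farr_cmp_simp lax_ass flip: lax_lun)
  also have "\<dots> = farr P (lun W Y \<boxdot>\<^sub>W Ide D Y') \<cdot>\<^sub>C lax (I \<boxtimes>\<^sub>W Y) Y' \<cdot>\<^sub>C (lax I Y \<boxdot>\<^sub>V Ide C (fobj P Y'))"
    by (simp only: D.lun_tensor[OF assms])
  also have "\<dots> = lax Y Y' \<cdot>\<^sub>C (farr P (lun W Y) \<boxdot>\<^sub>V farr P (Ide D Y')) \<cdot>\<^sub>C (lax I Y \<boxdot>\<^sub>V Ide C (fobj P Y'))"
    by (subst C.tail[OF lax_nat]) auto
  finally show "?l \<cdot>\<^sub>C ass V A (fobj P Y) (fobj P Y') = ?r \<cdot>\<^sub>C ass V A (fobj P Y) (fobj P Y')"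
    by (simp add: C.TA_merges lax_lun)
qed auto

lemma lax_proj:
  assumes [simp]: "Y \<in> Obj D" "Y' \<in> Obj D"
  shows "lax Y Y' = farr P (Ide D Y \<boxdot>\<^sub>W \<epsilon> Y') \<cdot>\<^sub>C proj Y (fobj P Y')"
  by (rule adj_eq[of "Y \<boxtimes>\<^sub>W Y'"]) (auto simp: eps_rules)

lemma proj_nat:
  assumes [simp]: "Y \<in> Obj D" "f \<in> Arr C" "Cod C f = X"
  shows "proj Y X \<cdot>\<^sub>C (Ide C (fobj P Y) \<boxdot>\<^sub>V f) = farr P (Ide D Y \<boxdot>\<^sub>W farr F f) \<cdot>\<^sub>C proj Y (Dom C f)"
proof -
  have [simp]: "X \<in> Obj C" using assms(2,3) C.cod_in by blast
  show ?thesis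
    by (rule adj_eq[of "Y \<boxtimes>\<^sub>W fobj F X"]) (auto simp: eps_rules)
qed

text \<open>The projection isomorphisms turn the pair of maps \<open>(P Y \<otimes> A) \<otimes> P Y' \<rightarrow> P Y \<otimes> P Y'\<close> into the image
  under \<open>P (Y \<otimes> -)\<close> of the pair \<open>F P \<epsilon>, \<epsilon>\<close> of maps \<open>F P F P Y' \<rightarrow> F P Y'\<close>, and \<open>lax Y Y'\<close> into the
  image of \<open>\<epsilon>\<close>. The latter is split by the section, as in the monadicity of \<open>P\<close>.\<close>

lemma lax_split_coequalizer:
  assumes [simp]: "Y \<in> Obj D" "Y' \<in> Obj D"
  shows "split_coequalizer C
    ((Ide C (fobj P Y) \<boxdot>\<^sub>V act Y') \<cdot>\<^sub>C ass V (fobj P Y) A (fobj P Y'))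
    (right_action C brC A (fobj P Y, act Y) \<boxdot>\<^sub>V Ide C (fobj P Y')) (lax Y Y')"
    (is "split_coequalizer C ?f ?g ?q")
proof -
  let ?X = "fobj P Y" and ?X' = "fobj P Y'"
  let ?p = "proj Y ?X'"
  note [simp] = C.right_action_simps[OF P.fobj_in[OF D.Un_obj] act_module[OF assms(1)], simplified]
  define \<rho> where "\<rho> = proj Y (fobj P (fobj F ?X')) \<cdot>\<^sub>C (Ide C ?X \<boxdot>\<^sub>V pi ?X') \<cdot>\<^sub>C ass V ?X A ?X'"
  have \<rho> [simp]: "is_iso C \<rho>" "\<rho> \<in> Arr C" "Dom C \<rho> = (?X \<boxtimes>\<^sub>V A) \<boxtimes>\<^sub>V ?X'"
    "Cod C \<rho> = fobj P (Y \<boxtimes>\<^sub>W fobj F (fobj P (fobj F ?X')))"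
    by (auto simp: \<rho>_def)
  have f: "?p \<cdot>\<^sub>C ?f = farr P (Ide D Y \<boxdot>\<^sub>W farr F (farr P (\<epsilon> Y'))) \<cdot>\<^sub>C \<rho>"
  proof -
    have "?p \<cdot>\<^sub>C ?f = (?p \<cdot>\<^sub>C (Ide C ?X \<boxdot>\<^sub>V farr P (\<epsilon> Y'))) \<cdot>\<^sub>C (Ide C ?X \<boxdot>\<^sub>V pi ?X') \<cdot>\<^sub>C ass V ?X A ?X'"
      by (simp add: act_def C.TA_merges)
    then show ?thesis by (subst (asm) proj_nat) (auto simp: \<rho>_def)
  qed
  have g: "?p \<cdot>\<^sub>C ?g = farr P (Ide D Y \<boxdot>\<^sub>W \<epsilon> (fobj F ?X')) \<cdot>\<^sub>C \<rho>"
    (is "?l = ?r")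
  proof (rule adj_eq[of "Y \<boxtimes>\<^sub>W fobj F ?X'"])
    have "\<epsilon> (Y \<boxtimes>\<^sub>W fobj F ?X') \<cdot>\<^sub>D farr F (farr P (Ide D Y \<boxdot>\<^sub>W \<epsilon> (fobj F ?X')) \<cdot>\<^sub>C \<rho>)
        = (Ide D Y \<boxdot>\<^sub>W lun W (fobj F ?X')) \<cdot>\<^sub>D
          (\<epsilon> Y \<boxdot>\<^sub>W ((\<epsilon> I \<boxdot>\<^sub>W Ide D (fobj F ?X')) \<cdot>\<^sub>D t A ?X')) \<cdot>\<^sub>D t ?X (A \<boxtimes>\<^sub>V ?X') \<cdot>\<^sub>D
          farr F (ass V ?X A ?X')"
      by (simp add: \<rho>_def eps_rules)
    also have "\<dots> = (run W Y \<boxdot>\<^sub>W Ide D (fobj F ?X')) \<cdot>\<^sub>D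
          (((\<epsilon> Y \<boxdot>\<^sub>W \<epsilon> I) \<cdot>\<^sub>D t ?X A) \<boxdot>\<^sub>W Ide D (fobj F ?X')) \<cdot>\<^sub>D t (?X \<boxtimes>\<^sub>V A) ?X'"
      by (simp add: t_ass_push D.tail[OF D.triangle])
    also have "\<dots> = \<epsilon> (Y \<boxtimes>\<^sub>W fobj F ?X') \<cdot>\<^sub>D farr F (?p \<cdot>\<^sub>C ?g)"
      by (simp add: eps_rules eps_right_action)
    finally show "\<epsilon> (Y \<boxtimes>\<^sub>W fobj F ?X') \<cdot>\<^sub>D farr F ?l =
      \<epsilon> (Y \<boxtimes>\<^sub>W fobj F ?X') \<cdot>\<^sub>D farr F ?r" ..
  qed auto
  let ?s = "cinv C ?p \<cdot>\<^sub>C farr P (Ide D Y \<boxdot>\<^sub>W \<sigma> Y')"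
  let ?t = "cinv C \<rho> \<cdot>\<^sub>C farr P (Ide D Y \<boxdot>\<^sub>W farr F (farr P (\<sigma> Y'))) \<cdot>\<^sub>C ?p"
  have split1: "farr F (farr P (\<epsilon> Y')) \<cdot>\<^sub>D farr F (farr P (\<sigma> Y')) = Ide D (fobj F ?X')"
    by (simp flip: farr_cmp_simp P.farr_cmp_simp)
  have "?q \<cdot>\<^sub>C ?f = farr P (Ide D Y \<boxdot>\<^sub>W \<epsilon> Y') \<cdot>\<^sub>C (?p \<cdot>\<^sub>C ?f)" by (simp add: lax_proj)
  also have "\<dots> = farr P (Ide D Y \<boxdot>\<^sub>W \<epsilon> Y') \<cdot>\<^sub>C (?p \<cdot>\<^sub>C ?g)"
    unfolding f g by (simp add: D.TA_merges eps_nat flip: C.cmp_assoc_simp P.farr_cmp_simp)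
  also have "\<dots> = ?q \<cdot>\<^sub>C ?g" by (simp add: lax_proj)
  finally have "?q \<cdot>\<^sub>C ?f = ?q \<cdot>\<^sub>C ?g" .
  moreover have "?q \<cdot>\<^sub>C ?s = Ide C (Cod C ?q)"
    by (simp add: lax_proj D.TA_merges flip: P.farr_cmp_simp)
  moreover have "?f \<cdot>\<^sub>C ?t = Ide C (Cod C ?f)"
  proof (rule C.iso_mono[of ?p])
    have "?p \<cdot>\<^sub>C ?f \<cdot>\<^sub>C ?t = (?p \<cdot>\<^sub>C ?f) \<cdot>\<^sub>C ?t" by simp
    also have "\<dots> = farr P (Ide D Y \<boxdot>\<^sub>W farr F (farr P (\<epsilon> Y'))) \<cdot>\<^sub>C
        farr P (Ide D Y \<boxdot>\<^sub>W farr F (farr P (\<sigma> Y'))) \<cdot>\<^sub>C ?p"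
      unfolding f by simp
    also have "\<dots> = farr P (Ide D Y \<boxdot>\<^sub>W (farr F (farr P (\<epsilon> Y')) \<cdot>\<^sub>D farr F (farr P (\<sigma> Y')))) \<cdot>\<^sub>C ?p"
      by (simp add: D.TA_merges flip: C.cmp_assoc_simp P.farr_cmp_simp)
    finally show "?p \<cdot>\<^sub>C ?f \<cdot>\<^sub>C ?t = ?p \<cdot>\<^sub>C Ide C (Cod C ?f)"
      unfolding split1 by simp
  qed auto
  moreover have "?g \<cdot>\<^sub>C ?t = ?s \<cdot>\<^sub>C ?q"
  proof (rule C.iso_mono[of ?p])
    have "?p \<cdot>\<^sub>C ?g \<cdot>\<^sub>C ?t = (?p \<cdot>\<^sub>C ?g) \<cdot>\<^sub>C ?t" by simp
    also have "\<dots> = farr P (Ide D Y \<boxdot>\<^sub>W \<epsilon> (fobj F ?X')) \<cdot>\<^sub>C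
        farr P (Ide D Y \<boxdot>\<^sub>W farr F (farr P (\<sigma> Y'))) \<cdot>\<^sub>C ?p"
      unfolding g by simp
    also have "\<dots> = farr P (Ide D Y \<boxdot>\<^sub>W (\<sigma> Y' \<cdot>\<^sub>D \<epsilon> Y')) \<cdot>\<^sub>C ?p"
      \<comment> \<open>Here the section enters: \<open>\<epsilon> \<cdot> F P \<sigma> = \<sigma> \<cdot> \<epsilon>\<close>.\<close>
      by (simp add: D.TA_merges eps_nat flip: C.cmp_assoc_simp P.farr_cmp_simp)
    also have "\<dots> = farr P (Ide D Y \<boxdot>\<^sub>W \<sigma> Y') \<cdot>\<^sub>C farr P (Ide D Y \<boxdot>\<^sub>W \<epsilon> Y') \<cdot>\<^sub>C ?p"
      by (simp add: D.TA_merges flip: C.cmp_assoc_simp P.farr_cmp_simp)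
    finally show "?p \<cdot>\<^sub>C ?g \<cdot>\<^sub>C ?t = ?p \<cdot>\<^sub>C ?s \<cdot>\<^sub>C ?q"
      by (simp add: lax_proj)
  qed auto
  ultimately show ?thesis
    unfolding split_coequalizer_def
    by (intro conjI bexI[of _ ?s] bexI[of _ ?t]) (simp_all add: C.homs_iff)
qed

lemma mod_tensor_image:
  assumes [simp]: "Y \<in> Obj D" "Y' \<in> Obj D"
  shows "mod_tensor C V brC A mlt unt (fobj \<Phi> Y) (fobj \<Phi> Y') (fobj \<Phi> (Y \<boxtimes>\<^sub>W Y')) (lax Y Y')"
  unfolding mod_tensor_def using lax_split_coequalizer[OF assms] by (simp add: C.homs_iff act_lax)

text \<open>Every module is isomorphic to one in the image of \<open>\<Phi>\<close>.\<close>

lemma mod_tensor_exists: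
  assumes M: "M \<in> left_modules C V A mlt unt" and N: "N \<in> left_modules C V A mlt unt"
  shows "\<exists>T q. mod_tensor C V brC A mlt unt M N T q"
proof -
  obtain Y \<theta> where Y: "Y \<in> Obj D" "(fobj \<Phi> Y, \<theta>, M) \<in> Arr Modules" "is_iso C \<theta>"
    using \<Phi>_surj[OF M] by (auto simp: C.mod_cat_homs_iff C.is_iso_mod_cat)
  obtain Y' \<theta>' where Y': "Y' \<in> Obj D" "(fobj \<Phi> Y', \<theta>', N) \<in> Arr Modules" "is_iso C \<theta>'"
    using \<Phi>_surj[OF N] by (auto simp: C.mod_cat_homs_iff C.is_iso_mod_cat)
  have inv: "(M, cinv C \<theta>, fobj \<Phi> Y) \<in> Arr Modules" "(N, cinv C \<theta>', fobj \<Phi> Y') \<in> Arr Modules"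
    using C.mod_cat_inverse_pair[OF _ Y(2,3)] C.mod_cat_inverse_pair[OF _ Y'(2,3)]
    by (auto simp: inverse_pair_def homs_def)
  from C.mod_tensor_transport[OF _ mod_tensor_image[OF Y(1) Y'(1)] _ _ inv(1) _ inv(2)] show ?thesis
    using Y Y' by auto
qed

lemma mod_tensors_exist: "\<exists>S. mod_tensors C V brC A mlt unt S"
proof -
  have "\<forall>M N. \<exists>S. M \<in> left_modules C V A mlt unt \<longrightarrow> N \<in> left_modules C V A mlt unt \<longrightarrow>
      mod_tensor C V brC A mlt unt M N (fst S) (snd S)"
    using mod_tensor_exists by (metis fst_conv snd_conv)
  then obtain S where "\<forall>M N. M \<in> left_modules C V A mlt unt \<longrightarrow> N \<in> left_modules C V A mlt unt \<longrightarrow>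
      mod_tensor C V brC A mlt unt M N (fst (S M N)) (snd (S M N))"
    by metis
  then show ?thesis unfolding mod_tensors_def by blast
qed

end

section \<open>The braided monoidal category of modules\<close>

locale braided_projection_adjunction_choice =
  braided_projection_adjunction C V D W F t t0 P \<eta> \<epsilon> \<sigma> brC brD
  for C :: "('o, 'm, 'x) cat_scheme" and V :: "('o, 'm) mon"
    and D :: "('p, 'n, 'y) cat_scheme" and W :: "('p, 'n) mon"
    and F :: "('o, 'm, 'p, 'n) func" and t :: "'o \<Rightarrow> 'o \<Rightarrow> 'n" and t0 :: 'n
    and P :: "('p, 'n, 'o, 'm) func" and \<eta> :: "'o \<Rightarrow> 'm" and \<epsilon> :: "'p \<Rightarrow> 'n" and \<sigma> :: "'p \<Rightarrow> 'n"
    and brC :: "'o \<Rightarrow> 'o \<Rightarrow> 'm" and brD :: "'p \<Rightarrow> 'p \<Rightarrow> 'n" +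
  fixes S :: "('o, 'm) tensor_choice"
  assumes choice: "mod_tensors C V brC A mlt unt S"
begin

abbreviation "tens M N \<equiv> fst (S M N)"
abbreviation "quot M N \<equiv> snd (S M N)"
abbreviation "Mods \<equiv> left_modules C V A mlt unt"

lemma choice_tensor: "\<lbrakk>M \<in> Mods; N \<in> Mods\<rbrakk> \<Longrightarrow> mod_tensor C V brC A mlt unt M N (tens M N) (quot M N)"
  using choice by (simp add: mod_tensors_def)

lemma choice_simps [simp]:
  assumes "M \<in> Mods" "N \<in> Mods"
  shows "tens M N \<in> Mods" "quot M N \<in> Arr C" "Dom C (quot M N) = fst M \<boxtimes>\<^sub>V fst N"
    "Cod C (quot M N) = fst (tens M N)"
  using choice_tensor[OF assms] by (auto simp: mod_tensor_def C.homs_iff)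

lemma fst_module [simp]: "M \<in> Mods \<Longrightarrow> fst M \<in> Obj C"
  by (rule C.left_modules_simps)

lemma quot_split_epi:
  assumes "M \<in> Mods" "N \<in> Mods"
  obtains s where "s \<in> Arr C" "Dom C s = fst (tens M N)" "Cod C s = fst M \<boxtimes>\<^sub>V fst N"
    "quot M N \<cdot>\<^sub>C s = Ide C (fst (tens M N))"
proof -
  have "split_coequalizer C ((Ide C (fst M) \<boxdot>\<^sub>V snd N) \<cdot>\<^sub>C ass V (fst M) A (fst N))
      (right_action C brC A M \<boxdot>\<^sub>V Ide C (fst N)) (quot M N)"
    using choice_tensor[OF assms] by (simp add: mod_tensor_def)
  then show ?thesis by (rule C.split_coequalizerE) (use assms that in auto)
qed

text \<open>A presentation of a module consists of an object \<open>Y\<close> and an isomorphism \<open>\<theta>\<close> on underlying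
  objects. By uniqueness of the tensor product, presentations of two factors induce one of the
  tensor product.\<close>

abbreviation "pres \<equiv> presents D Modules \<Phi>"
abbreviation "rep \<equiv> represents D Modules \<Phi>"
abbreviation "pmod p \<equiv> snd (snd (snd p))"
abbreviation "piso p \<equiv> fst (snd (snd p))"

lemma pres_iff:
  "pres p \<longleftrightarrow> fst p \<in> Obj D \<and> snd p \<in> Arr Modules \<and> fst (snd p) = fobj \<Phi> (fst p) \<and> is_iso C (piso p)"
  by (cases p) (auto simp: presents_def C.is_iso_mod_cat)

lemma pres_simps [simp]:
  assumes "pres p"
  shows "fst p \<in> Obj D" "pmod p \<in> Mods" "is_iso C (piso p)" "piso p \<in> Arr C"
    "Dom C (piso p) = fobj P (fst p)" "Cod C (piso p) = fst (pmod p)"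
  using assms by (cases p; auto simp: pres_iff C.mod_cat_arr_iff)+

lemma pres_act:
  assumes "pres p"
  shows "piso p \<cdot>\<^sub>C act (fst p) = snd (pmod p) \<cdot>\<^sub>C (Ide C A \<boxdot>\<^sub>V piso p)"
  using assms by (cases p) (auto simp: pres_iff C.mod_cat_arr_iff)

lemma pres_eta: "pres p \<Longrightarrow> p = (fst p, fobj \<Phi> (fst p), piso p, pmod p)"
  by (cases p) (auto simp: pres_iff)

definition pt where
  "pt p r = (fst p \<boxtimes>\<^sub>W fst r, fobj \<Phi> (fst p \<boxtimes>\<^sub>W fst r),
     SOME h. (fobj \<Phi> (fst p \<boxtimes>\<^sub>W fst r), h, tens (pmod p) (pmod r)) \<in> Arr Modules \<and> is_iso C h \<and>
       h \<cdot>\<^sub>C lax (fst p) (fst r) = quot (pmod p) (pmod r) \<cdot>\<^sub>C (piso p \<boxdot>\<^sub>V piso r),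
     tens (pmod p) (pmod r))"

lemma pt_simps [simp]:
  "fst (pt p r) = fst p \<boxtimes>\<^sub>W fst r" "pmod (pt p r) = tens (pmod p) (pmod r)"
  by (simp_all add: pt_def)

lemma pt_pres:
  assumes p: "pres p" and r: "pres r"
  shows "pres (pt p r)"
    and "piso (pt p r) \<cdot>\<^sub>C lax (fst p) (fst r) = quot (pmod p) (pmod r) \<cdot>\<^sub>C (piso p \<boxdot>\<^sub>V piso r)"
proof -
  have arr: "(fobj \<Phi> (fst p), piso p, pmod p) \<in> Arr Modules" "(fobj \<Phi> (fst r), piso r, pmod r) \<in> Arr Modules"
    using p r pres_eta[OF p] pres_eta[OF r] by (metis pres_iff snd_conv)+
  have [simp]: "fst p \<in> Obj D" "fst r \<in> Obj D" using p r by auto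
  have "mod_tensor C V brC A mlt unt (fobj \<Phi> (fst p)) (fobj \<Phi> (fst r)) (tens (pmod p) (pmod r))
      (quot (pmod p) (pmod r) \<cdot>\<^sub>C (piso p \<boxdot>\<^sub>V piso r))"
    by (rule C.mod_tensor_transport[OF _ choice_tensor _ _ arr(1) _ arr(2)]) (use p r in auto)
  from C.mod_tensor_unique[OF _ _ _ mod_tensor_image this]
  have "\<exists>h. (fobj \<Phi> (fst p \<boxtimes>\<^sub>W fst r), h, tens (pmod p) (pmod r)) \<in> Arr Modules \<and> is_iso C h \<and>
       h \<cdot>\<^sub>C lax (fst p) (fst r) = quot (pmod p) (pmod r) \<cdot>\<^sub>C (piso p \<boxdot>\<^sub>V piso r)"
    by simp
  from someI_ex[OF this] show "pres (pt p r)"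
    and "piso (pt p r) \<cdot>\<^sub>C lax (fst p) (fst r) = quot (pmod p) (pmod r) \<cdot>\<^sub>C (piso p \<boxdot>\<^sub>V piso r)"
    unfolding pt_def by (auto simp: pres_iff)
qed

text \<open>An arrow that is represented on underlying objects is automatically a module map, because the
  presentations are isomorphisms of modules.\<close>

lemma representsI:
  assumes p: "pres p" and p': "pres p'" and x: "x \<in> homs D (fst p) (fst p')"
    and h: "h \<in> Arr C" "Dom C h = fst (pmod p)" "Cod C h = fst (pmod p')"
    and eq: "h \<cdot>\<^sub>C piso p = piso p' \<cdot>\<^sub>C farr P x"
  shows "rep p x (pmod p, h, pmod p') p'"
proof -
  note [simp] = p p' h C.left_modules_simps(1-4)[OF pres_simps(2)[OF p]]
    C.left_modules_simps(1-4)[OF pres_simps(2)[OF p']]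
  have [simp]: "x \<in> Arr D" "Dom D x = fst p" "Cod D x = fst p'"
    using x by (auto simp: D.homs_iff)
  have "h \<cdot>\<^sub>C snd (pmod p) = snd (pmod p') \<cdot>\<^sub>C (Ide C A \<boxdot>\<^sub>V h)"
    (is "?l = ?r")
  proof (rule C.iso_epi[of _ "Ide C A \<boxdot>\<^sub>V piso p"])
    have "(h \<cdot>\<^sub>C snd (pmod p)) \<cdot>\<^sub>C (Ide C A \<boxdot>\<^sub>V piso p) = (h \<cdot>\<^sub>C piso p) \<cdot>\<^sub>C act (fst p)"
      by (simp add: pres_act)
    also have "\<dots> = (piso p' \<cdot>\<^sub>C act (fst p')) \<cdot>\<^sub>C (Ide C A \<boxdot>\<^sub>V farr P x)"
      unfolding eq by (simp add: act_nat)
    also have "\<dots> = snd (pmod p') \<cdot>\<^sub>C (Ide C A \<boxdot>\<^sub>V (h \<cdot>\<^sub>C piso p))"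
      unfolding eq pres_act[OF p'] by (simp add: C.TA_merges)
    finally show "?l \<cdot>\<^sub>C (Ide C A \<boxdot>\<^sub>V piso p) = ?r \<cdot>\<^sub>C (Ide C A \<boxdot>\<^sub>V piso p)"
      by (simp add: C.TA_merges)
  qed auto
  then have arr: "(pmod p, h, pmod p') \<in> Arr Modules"
    by (simp add: C.mod_cat_arr_iff)
  obtain Y \<theta> M where pe: "p = (Y, fobj \<Phi> Y, \<theta>, M)" using pres_eta[OF p] by blast
  obtain Y' \<theta>' M' where pe': "p' = (Y', fobj \<Phi> Y', \<theta>', M')" using pres_eta[OF p'] by blast
  show ?thesis
    using p p' x arr eq by (simp add: represents_def C.mod_cat_homs_iff pe pe')
qed

text \<open>All structure maps of the tensor product are characterized by their composite with a quotient map
  \<open>Q\<close>. To see that such a map exists and is represented by \<open>x\<close>, it suffices to compare the composites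
  of the images under \<open>P\<close> with the lax structure \<open>Q0\<close> that corresponds to \<open>Q\<close>.\<close>

lemma represents_descent:
  assumes p: "pres p" and p': "pres p'" and x: "x \<in> homs D (fst p) (fst p')"
    and M: "pmod p = M" and M': "pmod p' = M'"
    and Q: "Q \<in> Arr C" "Cod C Q = fst M"
    and s: "s \<in> Arr C" "Dom C s = Cod C Q" "Cod C s = Dom C Q" "Q \<cdot>\<^sub>C s = Ide C (Cod C Q)"
    and R: "R \<in> Arr C" "Dom C R = Dom C Q" "Cod C R = fst M'"
    and w: "is_iso C w" "Cod C w = Dom C Q"
    and Q0: "Q0 \<in> Arr C" "Cod C Q0 = fobj P (fst p)"
    and 1: "piso p \<cdot>\<^sub>C Q0 = Q \<cdot>\<^sub>C w" and 2: "piso p' \<cdot>\<^sub>C farr P x \<cdot>\<^sub>C Q0 = R \<cdot>\<^sub>C w"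
  shows "rep p x (M, THE h. h \<in> homs C (fst M) (fst M') \<and> h \<cdot>\<^sub>C Q = R, M') p'"
proof -
  have [simp]: "x \<in> Arr D" "Dom D x = fst p" "Cod D x = fst p'" "w \<in> Arr C"
    using x C.iso_arr[OF w(1)] by (auto simp: D.homs_iff)
  note [simp] = Q s(1-3) R w Q0 p p' M M' pres_simps(6)[OF p, unfolded M] pres_simps(6)[OF p', unfolded M']
  have domw: "Dom C w = Dom C Q0"
    using arg_cong[OF 1, of "Dom C"] by simp
  let ?k = "piso p' \<cdot>\<^sub>C farr P x \<cdot>\<^sub>C cinv C (piso p)"
  have k: "?k \<cdot>\<^sub>C Q = R"
  proof (rule C.iso_epi[of _ w])
    have "(?k \<cdot>\<^sub>C Q) \<cdot>\<^sub>C w = ?k \<cdot>\<^sub>C (Q \<cdot>\<^sub>C w)" by simp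
    also have "\<dots> = R \<cdot>\<^sub>C w" by (simp add: 2 domw flip: 1)
    finally show "(?k \<cdot>\<^sub>C Q) \<cdot>\<^sub>C w = R \<cdot>\<^sub>C w" .
  qed auto
  have the: "(THE h. h \<in> homs C (fst M) (fst M') \<and> h \<cdot>\<^sub>C Q = R) = ?k"
  proof (rule the_equality)
    show "?k \<in> homs C (fst M) (fst M') \<and> ?k \<cdot>\<^sub>C Q = R"
      using k by (simp add: C.homs_iff)
    show "h = ?k" if h: "h \<in> homs C (fst M) (fst M') \<and> h \<cdot>\<^sub>C Q = R" for h
    proof (rule C.split_epi_cancel[of _ Q _ s])
      show "h \<cdot>\<^sub>C Q = ?k \<cdot>\<^sub>C Q" using h k by simp
    qed (use h s(4) in \<open>simp_all add: C.homs_iff\<close>)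
  qed
  show ?thesis
    unfolding the using representsI[OF p p' x, of ?k] by simp
qed

abbreviation "un \<equiv> (I, Ide Modules (fobj \<Phi> I))"

lemma act_unit: "act I = mlt"
  by (rule adj_eq[of I]) (auto simp: eps_rules)

lemma unit_module [simp]: "(A, mlt) \<in> Mods"
  using act_module[of I] by (simp add: act_unit)

lemma pres_unit [simp]: "pres un"
  using E.is_iso_ide[of "fobj \<Phi> I"] by (auto simp: presents_def)

lemmas mod_mon_simps = mod_mon_def Let_def

lemma pt_represents_TA:
  assumes f: "rep p x f p'" and g: "rep r y g r'"
  shows "rep (pt p r) (x \<boxdot>\<^sub>W y) (f \<boxdot>\<^bsub>mod_mon C V brC A mlt S\<^esub> g) (pt p' r')"
proof -
  have p [simp]: "pres p" "pres p'" "pres r" "pres r'"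
    and x: "x \<in> homs D (fst p) (fst p')" and y: "y \<in> homs D (fst r) (fst r')"
    using f g by (auto simp: represents_def)
  obtain f0 g0 where fe: "f = (pmod p, f0, pmod p')" and ge: "g = (pmod r, g0, pmod r')"
    and f0: "f0 \<in> homs C (fst (pmod p)) (fst (pmod p'))" "f0 \<cdot>\<^sub>C piso p = piso p' \<cdot>\<^sub>C farr P x"
    and g0: "g0 \<in> homs C (fst (pmod r)) (fst (pmod r'))" "g0 \<cdot>\<^sub>C piso r = piso r' \<cdot>\<^sub>C farr P y"
  proof -
    have "\<exists>f0. f = (pmod p, f0, pmod p') \<and> f0 \<in> homs C (fst (pmod p)) (fst (pmod p')) \<and>
        f0 \<cdot>\<^sub>C piso p = piso p' \<cdot>\<^sub>C farr P x" if "rep p x f p'" for p x f p'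
      using that by (cases p; cases p') (auto simp: represents_def C.mod_cat_homs_iff C.mod_cat_arr_iff C.homs_iff)
    from this[OF f] this[OF g] show ?thesis using that by blast
  qed
  note [simp] = x[unfolded D.homs_iff] y[unfolded D.homs_iff] f0(1)[unfolded C.homs_iff] g0(1)[unfolded C.homs_iff]
  obtain s where s: "s \<in> Arr C" "Dom C s = fst (tens (pmod p) (pmod r))" "Cod C s = fst (pmod p) \<boxtimes>\<^sub>V fst (pmod r)"
    "quot (pmod p) (pmod r) \<cdot>\<^sub>C s = Ide C (fst (tens (pmod p) (pmod r)))"
    using quot_split_epi[OF pres_simps(2)[OF p(1)] pres_simps(2)[OF p(3)]] by blast
  have "rep (pt p r) (x \<boxdot>\<^sub>W y) (tens (pmod p) (pmod r),
      THE h. h \<in> homs C (fst (tens (pmod p) (pmod r))) (fst (tens (pmod p') (pmod r'))) \<and>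
        h \<cdot>\<^sub>C quot (pmod p) (pmod r) = quot (pmod p') (pmod r') \<cdot>\<^sub>C (f0 \<boxdot>\<^sub>V g0),
      tens (pmod p') (pmod r')) (pt p' r')"
  proof (rule represents_descent[where s = s and w = "piso p \<boxdot>\<^sub>V piso r" and ?Q0.0 = "lax (fst p) (fst r)"])
    show "piso (pt p' r') \<cdot>\<^sub>C farr P (x \<boxdot>\<^sub>W y) \<cdot>\<^sub>C lax (fst p) (fst r) =
      (quot (pmod p') (pmod r') \<cdot>\<^sub>C (f0 \<boxdot>\<^sub>V g0)) \<cdot>\<^sub>C (piso p \<boxdot>\<^sub>V piso r)"
    proof -
      have "piso (pt p' r') \<cdot>\<^sub>C farr P (x \<boxdot>\<^sub>W y) \<cdot>\<^sub>C lax (fst p) (fst r)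
          = (piso (pt p' r') \<cdot>\<^sub>C lax (fst p') (fst r')) \<cdot>\<^sub>C (farr P x \<boxdot>\<^sub>V farr P y)"
        using pres_simps(3-6)[OF pt_pres(1)[OF p(2,4)]] by (simp add: lax_nat)
      also have "\<dots> = (quot (pmod p') (pmod r') \<cdot>\<^sub>C (f0 \<boxdot>\<^sub>V g0)) \<cdot>\<^sub>C (piso p \<boxdot>\<^sub>V piso r)"
        unfolding pt_pres(2)[OF p(2,4)] by (simp add: C.TA_merges f0(2) g0(2))
      finally show ?thesis .
    qed
  qed (use s in \<open>auto simp: pt_pres D.homs_iff\<close>)
  then show ?thesis by (simp add: mod_mon_simps fe ge)
qed

lemma pt_pt_left:
  assumes p [simp]: "pres p" and q [simp]: "pres q" and r [simp]: "pres r"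
  shows "piso (pt (pt p q) r) \<cdot>\<^sub>C lax (fst p \<boxtimes>\<^sub>W fst q) (fst r) \<cdot>\<^sub>C (lax (fst p) (fst q) \<boxdot>\<^sub>V Ide C (fobj P (fst r))) =
    (quot (tens (pmod p) (pmod q)) (pmod r) \<cdot>\<^sub>C (quot (pmod p) (pmod q) \<boxdot>\<^sub>V Ide C (fst (pmod r)))) \<cdot>\<^sub>C
      ((piso p \<boxdot>\<^sub>V piso q) \<boxdot>\<^sub>V piso r)"
proof -
  have mods [simp]: "pmod p \<in> Mods" "pmod q \<in> Mods" "pmod r \<in> Mods" by auto
  note [simp] = pres_simps(3-6)[OF pt_pres(1)[OF pt_pres(1)[OF p q] r]] pres_simps(3-6)[OF pt_pres(1)[OF p q]]
  have "piso (pt (pt p q) r) \<cdot>\<^sub>C lax (fst p \<boxtimes>\<^sub>W fst q) (fst r) \<cdot>\<^sub>C (lax (fst p) (fst q) \<boxdot>\<^sub>V Ide C (fobj P (fst r)))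
      = (piso (pt (pt p q) r) \<cdot>\<^sub>C lax (fst (pt p q)) (fst r)) \<cdot>\<^sub>C (lax (fst p) (fst q) \<boxdot>\<^sub>V Ide C (fobj P (fst r)))"
    by simp
  also have "\<dots> = quot (tens (pmod p) (pmod q)) (pmod r) \<cdot>\<^sub>C ((piso (pt p q) \<cdot>\<^sub>C lax (fst p) (fst q)) \<boxdot>\<^sub>V piso r)"
    unfolding pt_pres(2)[OF pt_pres(1)[OF p q] r] by (simp add: C.TA_merges)
  finally show ?thesis unfolding pt_pres(2)[OF p q] by (simp add: C.TA_merges)
qed

lemma pt_pt_right:
  assumes p [simp]: "pres p" and q [simp]: "pres q" and r [simp]: "pres r"
  shows "piso (pt p (pt q r)) \<cdot>\<^sub>C lax (fst p) (fst q \<boxtimes>\<^sub>W fst r) \<cdot>\<^sub>C (Ide C (fobj P (fst p)) \<boxdot>\<^sub>V lax (fst q) (fst r)) =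
    (quot (pmod p) (tens (pmod q) (pmod r)) \<cdot>\<^sub>C (Ide C (fst (pmod p)) \<boxdot>\<^sub>V quot (pmod q) (pmod r))) \<cdot>\<^sub>C
      (piso p \<boxdot>\<^sub>V piso q \<boxdot>\<^sub>V piso r)"
proof -
  have mods [simp]: "pmod p \<in> Mods" "pmod q \<in> Mods" "pmod r \<in> Mods" by auto
  note [simp] = pres_simps(3-6)[OF pt_pres(1)[OF p pt_pres(1)[OF q r]]] pres_simps(3-6)[OF pt_pres(1)[OF q r]]
  have "piso (pt p (pt q r)) \<cdot>\<^sub>C lax (fst p) (fst q \<boxtimes>\<^sub>W fst r) \<cdot>\<^sub>C (Ide C (fobj P (fst p)) \<boxdot>\<^sub>V lax (fst q) (fst r))
      = (piso (pt p (pt q r)) \<cdot>\<^sub>C lax (fst p) (fst (pt q r))) \<cdot>\<^sub>C (Ide C (fobj P (fst p)) \<boxdot>\<^sub>V lax (fst q) (fst r))"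
    by simp
  also have "\<dots> = quot (pmod p) (tens (pmod q) (pmod r)) \<cdot>\<^sub>C (piso p \<boxdot>\<^sub>V (piso (pt q r) \<cdot>\<^sub>C lax (fst q) (fst r)))"
    unfolding pt_pres(2)[OF p pt_pres(1)[OF q r]] by (simp add: C.TA_merges)
  finally show ?thesis unfolding pt_pres(2)[OF q r] by (simp add: C.TA_merges)
qed

lemma pt_represents_ass:
  assumes [simp]: "pres p" "pres q" "pres r"
  shows "rep (pt (pt p q) r) (ass W (fst p) (fst q) (fst r))
    (ass (mod_mon C V brC A mlt S) (pmod p) (pmod q) (pmod r)) (pt p (pt q r))"
proof -
  note [simp] = pt_pres(1)
  let ?M = "pmod p" and ?N = "pmod q" and ?L = "pmod r"
  have mods [simp]: "?M \<in> Mods" "?N \<in> Mods" "?L \<in> Mods" by auto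
  obtain s where s: "s \<in> Arr C" "Dom C s = fst (tens ?M ?N)" "Cod C s = fst ?M \<boxtimes>\<^sub>V fst ?N"
    "quot ?M ?N \<cdot>\<^sub>C s = Ide C (fst (tens ?M ?N))"
    using quot_split_epi[OF mods(1,2)] by blast
  obtain s' where s': "s' \<in> Arr C" "Dom C s' = fst (tens (tens ?M ?N) ?L)"
    "Cod C s' = fst (tens ?M ?N) \<boxtimes>\<^sub>V fst ?L"
    "quot (tens ?M ?N) ?L \<cdot>\<^sub>C s' = Ide C (fst (tens (tens ?M ?N) ?L))"
    using quot_split_epi[OF choice_simps(1)[OF mods(1,2)] mods(3)] by blast
  let ?Q = "quot (tens ?M ?N) ?L \<cdot>\<^sub>C (quot ?M ?N \<boxdot>\<^sub>V Ide C (fst ?L))"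
  have "rep (pt (pt p q) r) (ass W (fst p) (fst q) (fst r)) (tens (tens ?M ?N) ?L,
      THE h. h \<in> homs C (fst (tens (tens ?M ?N) ?L)) (fst (tens ?M (tens ?N ?L))) \<and>
        h \<cdot>\<^sub>C ?Q = quot ?M (tens ?N ?L) \<cdot>\<^sub>C (Ide C (fst ?M) \<boxdot>\<^sub>V quot ?N ?L) \<cdot>\<^sub>C ass V (fst ?M) (fst ?N) (fst ?L),
      tens ?M (tens ?N ?L)) (pt p (pt q r))"
  proof (rule represents_descent[where s = "(s \<boxdot>\<^sub>V Ide C (fst ?L)) \<cdot>\<^sub>C s'"
        and w = "(piso p \<boxdot>\<^sub>V piso q) \<boxdot>\<^sub>V piso r"
        and ?Q0.0 = "lax (fst p \<boxtimes>\<^sub>W fst q) (fst r) \<cdot>\<^sub>C (lax (fst p) (fst q) \<boxdot>\<^sub>V Ide C (fobj P (fst r)))"])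
    show "?Q \<cdot>\<^sub>C (s \<boxdot>\<^sub>V Ide C (fst ?L)) \<cdot>\<^sub>C s' = Ide C (Cod C ?Q)"
      using s s' by (simp add: C.TA_merges)
    show "piso (pt p (pt q r)) \<cdot>\<^sub>C farr P (ass W (fst p) (fst q) (fst r)) \<cdot>\<^sub>C
        lax (fst p \<boxtimes>\<^sub>W fst q) (fst r) \<cdot>\<^sub>C (lax (fst p) (fst q) \<boxdot>\<^sub>V Ide C (fobj P (fst r))) =
      (quot ?M (tens ?N ?L) \<cdot>\<^sub>C (Ide C (fst ?M) \<boxdot>\<^sub>V quot ?N ?L) \<cdot>\<^sub>C ass V (fst ?M) (fst ?N) (fst ?L)) \<cdot>\<^sub>C
        ((piso p \<boxdot>\<^sub>V piso q) \<boxdot>\<^sub>V piso r)"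
    proof -
      note [simp] = pres_simps(3-6)[OF pt_pres(1)[OF assms(1) pt_pres(1)[OF assms(2,3)]]]
      have "piso (pt p (pt q r)) \<cdot>\<^sub>C farr P (ass W (fst p) (fst q) (fst r)) \<cdot>\<^sub>C
          lax (fst p \<boxtimes>\<^sub>W fst q) (fst r) \<cdot>\<^sub>C (lax (fst p) (fst q) \<boxdot>\<^sub>V Ide C (fobj P (fst r)))
          = (piso (pt p (pt q r)) \<cdot>\<^sub>C lax (fst p) (fst q \<boxtimes>\<^sub>W fst r) \<cdot>\<^sub>C
            (Ide C (fobj P (fst p)) \<boxdot>\<^sub>V lax (fst q) (fst r))) \<cdot>\<^sub>C ass V (fobj P (fst p)) (fobj P (fst q)) (fobj P (fst r))"
        by (simp add: lax_ass)
      then show ?thesis unfolding pt_pt_right[OF assms] by (simp add: C.ass_nat)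
    qed
  qed (use s s' pt_pt_left[OF assms] in \<open>auto simp: D.homs_iff\<close>)
  then show ?thesis by (simp add: mod_mon_simps)
qed

lemma pt_represents_lun:
  assumes p [simp]: "pres p"
  shows "rep (pt un p) (lun W (fst p)) (lun (mod_mon C V brC A mlt S) (pmod p)) p"
proof -
  let ?M = "pmod p"
  have M [simp]: "?M \<in> Mods" by auto
  note [simp] = pt_pres(1) C.left_modules_simps(1-4)[OF M]
  obtain s where s: "s \<in> Arr C" "Dom C s = fst (tens (A, mlt) ?M)" "Cod C s = A \<boxtimes>\<^sub>V fst ?M"
    "quot (A, mlt) ?M \<cdot>\<^sub>C s = Ide C (fst (tens (A, mlt) ?M))"
    using quot_split_epi[OF unit_module M] by auto
  have "rep (pt un p) (lun W (fst p)) (tens (A, mlt) ?M,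
      THE h. h \<in> homs C (fst (tens (A, mlt) ?M)) (fst ?M) \<and> h \<cdot>\<^sub>C quot (A, mlt) ?M = snd ?M, ?M) p"
    by (rule represents_descent[OF pt_pres(1)[OF pres_unit p] p, where s = s and w = "Ide C A \<boxdot>\<^sub>V piso p" and ?Q0.0 = "lax I (fst p)"])
      (use s pt_pres(2)[OF pres_unit p] in \<open>auto simp: D.homs_iff act_unit lax_lun pres_act\<close>)
  then show ?thesis by (simp add: mod_mon_simps)
qed

lemma pt_represents_run:
  assumes p [simp]: "pres p"
  shows "rep (pt p un) (run W (fst p)) (run (mod_mon C V brC A mlt S) (pmod p)) p"
proof -
  let ?M = "pmod p"
  have M [simp]: "?M \<in> Mods" by auto
  note [simp] = pt_pres(1) C.left_modules_simps(1-4)[OF M] C.right_action_simps[OF _ M]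
  obtain s where s: "s \<in> Arr C" "Dom C s = fst (tens ?M (A, mlt))" "Cod C s = fst ?M \<boxtimes>\<^sub>V A"
    "quot ?M (A, mlt) \<cdot>\<^sub>C s = Ide C (fst (tens ?M (A, mlt)))"
    using quot_split_epi[OF M unit_module] by auto
  have "piso p \<cdot>\<^sub>C right_action C brC A (fobj P (fst p), act (fst p)) =
      right_action C brC A ?M \<cdot>\<^sub>C (piso p \<boxdot>\<^sub>V Ide C A)"
    by (simp add: right_action_def C.br_nat C.tail[OF pres_act[OF p]])
  then have "rep (pt p un) (run W (fst p)) (tens ?M (A, mlt),
      THE h. h \<in> homs C (fst (tens ?M (A, mlt))) (fst ?M) \<and> h \<cdot>\<^sub>C quot ?M (A, mlt) = right_action C brC A ?M, ?M) p"
    by (intro represents_descent[OF pt_pres(1)[OF p pres_unit] p, where s = s and w = "piso p \<boxdot>\<^sub>V Ide C A" and ?Q0.0 = "lax (fst p) I"])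
      (use s pt_pres(2)[OF p pres_unit] in \<open>auto simp: D.homs_iff act_unit lax_run\<close>)
  then show ?thesis by (simp add: mod_mon_simps)
qed

lemma pt_represents_br:
  assumes p [simp]: "pres p" and r [simp]: "pres r"
  shows "rep (pt p r) (brD (fst p) (fst r)) (mod_braiding C brC S (pmod p) (pmod r)) (pt r p)"
proof -
  let ?M = "pmod p" and ?N = "pmod r"
  have M [simp]: "?M \<in> Mods" "?N \<in> Mods" by auto
  note [simp] = pt_pres(1)
  obtain s where s: "s \<in> Arr C" "Dom C s = fst (tens ?M ?N)" "Cod C s = fst ?M \<boxtimes>\<^sub>V fst ?N"
    "quot ?M ?N \<cdot>\<^sub>C s = Ide C (fst (tens ?M ?N))"
    using quot_split_epi[OF M] by auto
  note [simp] = pres_simps(3-6)[OF pt_pres(1)[OF r p]]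
  have "piso (pt r p) \<cdot>\<^sub>C farr P (brD (fst p) (fst r)) \<cdot>\<^sub>C lax (fst p) (fst r)
      = (quot ?N ?M \<cdot>\<^sub>C brC (fst ?M) (fst ?N)) \<cdot>\<^sub>C (piso p \<boxdot>\<^sub>V piso r)"
    by (simp add: lax_br C.br_nat C.tail[OF pt_pres(2)[OF r p]])
  then have "rep (pt p r) (brD (fst p) (fst r)) (tens ?M ?N,
      THE h. h \<in> homs C (fst (tens ?M ?N)) (fst (tens ?N ?M)) \<and> h \<cdot>\<^sub>C quot ?M ?N = quot ?N ?M \<cdot>\<^sub>C brC (fst ?M) (fst ?N),
      tens ?N ?M) (pt r p)"
    by (intro represents_descent[where s = s and w = "piso p \<boxdot>\<^sub>V piso r" and ?Q0.0 = "lax (fst p) (fst r)"])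
      (use s pt_pres(2)[OF p r] in \<open>auto simp: D.homs_iff\<close>)
  then show ?thesis by (simp add: mod_braiding_def)
qed

sublocale T: presented_tensor D W brD Modules \<Phi> "mod_mon C V brC A mlt S" "mod_braiding C brC S" pt
  "Ide Modules (fobj \<Phi> I)"
proof unfold_locales
  have cod: "Cod Modules (snd p) = pmod p" for p :: "'p \<times> ('o \<times> 'm) \<times> 'm \<times> 'o \<times> 'm"
    by (cases p) simp
  show "\<exists>x\<in>homs D Y Y'. farr \<Phi> x = g"
    if "Y \<in> Obj D" "Y' \<in> Obj D" "g \<in> homs Modules (fobj \<Phi> Y) (fobj \<Phi> Y')" for Y Y' g
    using \<Phi>_full[OF that] .
  show "\<exists>p. pres p \<and> Cod Modules (snd p) = m" if m: "m \<in> Obj Modules" for m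
  proof -
    obtain Y \<theta> where "Y \<in> Obj D" "\<theta> \<in> homs Modules (fobj \<Phi> Y) m" "is_iso Modules \<theta>"
      using \<Phi>_surj[of m] m unfolding C.mod_cat_simps(1) by blast
    then show ?thesis by (intro exI[of _ "(Y, \<theta>)"]) (simp add: presents_def E.homs_iff)
  qed
  show "rep (pt p q) (x \<boxdot>\<^sub>W y) (f \<boxdot>\<^bsub>mod_mon C V brC A mlt S\<^esub> g) (pt p' q')"
    if "rep p x f p'" "rep q y g q'" for p x f p' q y g q'
    using pt_represents_TA[OF that] .
  show "rep (pt (pt p q) r) (ass W (fst p) (fst q) (fst r)) (ass (mod_mon C V brC A mlt S)
      (Cod Modules (snd p)) (Cod Modules (snd q)) (Cod Modules (snd r))) (pt p (pt q r))"
    if "pres p" "pres q" "pres r" for p q r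
    unfolding cod by (rule pt_represents_ass[OF that])
  show "rep (pt un p) (lun W (fst p)) (lun (mod_mon C V brC A mlt S) (Cod Modules (snd p))) p"
    and "rep (pt p un) (run W (fst p)) (run (mod_mon C V brC A mlt S) (Cod Modules (snd p))) p"
    if "pres p" for p
    unfolding cod by (rule pt_represents_lun[OF that], rule pt_represents_run[OF that])
  show "rep (pt p q) (brD (fst p) (fst q))
      (mod_braiding C brC S (Cod Modules (snd p)) (Cod Modules (snd q))) (pt q p)"
    if "pres p" "pres q" for p q
    unfolding cod by (rule pt_represents_br[OF that])
  show "Cod Modules (snd (pt p q)) =
      Cod Modules (snd p) \<boxtimes>\<^bsub>mod_mon C V brC A mlt S\<^esub> Cod Modules (snd q)" for p q
    unfolding cod by (simp add: mod_mon_simps)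
  show "pres (pt p q)" if "pres p" "pres q" for p q
    by (rule pt_pres(1)[OF that])
  show "pres un" by (rule pres_unit)
  show "Cod Modules (Ide Modules (fobj \<Phi> I)) = Unit (mod_mon C V brC A mlt S)"
    by (simp add: mod_mon_simps act_unit)
qed auto

theorem braided_equivalence_modules:
  "braided_monoidal_equivalence D W brD Modules (mod_mon C V brC A mlt S) (mod_braiding C brC S) \<Phi>"
  unfolding braided_monoidal_equivalence_def
  using equivalence_modules T.braided_strong_presented by blast

text \<open>The inverse of the associator has the dual characterization. For comodules it is the latter that
  defines the associator.\<close>

lemma cinv_mod_mon_ass:
  assumes M: "M \<in> Mods" and N: "N \<in> Mods" and L: "L \<in> Mods"
  shows "cinv Modules (ass (mod_mon C V brC A mlt S) M N L) =
    (tens M (tens N L),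
     THE h. h \<in> homs C (fst (tens M (tens N L))) (fst (tens (tens M N) L)) \<and>
       h \<cdot>\<^sub>C quot M (tens N L) \<cdot>\<^sub>C (Ide C (fst M) \<boxdot>\<^sub>V quot N L) =
       quot (tens M N) L \<cdot>\<^sub>C (quot M N \<boxdot>\<^sub>V Ide C (fst L)) \<cdot>\<^sub>C cinv C (ass V (fst M) (fst N) (fst L)),
     tens (tens M N) L)"
proof -
  have cod: "Cod Modules (snd p) = pmod p" for p :: "'p \<times> ('o \<times> 'm) \<times> 'm \<times> 'o \<times> 'm"
    by (cases p) simp
  from M N L obtain p q r where p [simp]: "pres p" "pres q" "pres r"
    and mods: "M = pmod p" "N = pmod q" "L = pmod r"
    using T.surj[of M] T.surj[of N] T.surj[of L] by (auto simp: cod)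
  note [simp] = pt_pres(1) pres_simps(3-6)[OF pt_pres(1)[OF pt_pres(1)[OF p(1,2)] p(3)]]
  let ?M = "pmod p" and ?N = "pmod q" and ?L = "pmod r"
  have mods' [simp]: "?M \<in> Mods" "?N \<in> Mods" "?L \<in> Mods" by auto
  obtain s where s: "s \<in> Arr C" "Dom C s = fst (tens ?N ?L)" "Cod C s = fst ?N \<boxtimes>\<^sub>V fst ?L"
    "quot ?N ?L \<cdot>\<^sub>C s = Ide C (fst (tens ?N ?L))"
    using quot_split_epi[OF mods'(2,3)] by blast
  obtain s' where s': "s' \<in> Arr C" "Dom C s' = fst (tens ?M (tens ?N ?L))"
    "Cod C s' = fst ?M \<boxtimes>\<^sub>V fst (tens ?N ?L)"
    "quot ?M (tens ?N ?L) \<cdot>\<^sub>C s' = Ide C (fst (tens ?M (tens ?N ?L)))"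
    using quot_split_epi[OF mods'(1) choice_simps(1)[OF mods'(2,3)]] by blast
  let ?Q = "quot ?M (tens ?N ?L) \<cdot>\<^sub>C (Ide C (fst ?M) \<boxdot>\<^sub>V quot ?N ?L)"
  have "rep (pt p (pt q r)) (cinv D (ass W (fst p) (fst q) (fst r))) (tens ?M (tens ?N ?L),
      THE h. h \<in> homs C (fst (tens ?M (tens ?N ?L))) (fst (tens (tens ?M ?N) ?L)) \<and>
        h \<cdot>\<^sub>C ?Q = quot (tens ?M ?N) ?L \<cdot>\<^sub>C (quot ?M ?N \<boxdot>\<^sub>V Ide C (fst ?L)) \<cdot>\<^sub>C
          cinv C (ass V (fst ?M) (fst ?N) (fst ?L)),
      tens (tens ?M ?N) ?L) (pt (pt p q) r)"
  proof (rule represents_descent[where s = "(Ide C (fst ?M) \<boxdot>\<^sub>V s) \<cdot>\<^sub>C s'"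
        and w = "piso p \<boxdot>\<^sub>V piso q \<boxdot>\<^sub>V piso r"
        and ?Q0.0 = "lax (fst p) (fst q \<boxtimes>\<^sub>W fst r) \<cdot>\<^sub>C (Ide C (fobj P (fst p)) \<boxdot>\<^sub>V lax (fst q) (fst r))"])
    show "?Q \<cdot>\<^sub>C (Ide C (fst ?M) \<boxdot>\<^sub>V s) \<cdot>\<^sub>C s' = Ide C (Cod C ?Q)"
      using s s' by (simp add: C.TA_merges)
    show "piso (pt (pt p q) r) \<cdot>\<^sub>C farr P (cinv D (ass W (fst p) (fst q) (fst r))) \<cdot>\<^sub>C
        lax (fst p) (fst q \<boxtimes>\<^sub>W fst r) \<cdot>\<^sub>C (Ide C (fobj P (fst p)) \<boxdot>\<^sub>V lax (fst q) (fst r)) =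
      (quot (tens ?M ?N) ?L \<cdot>\<^sub>C (quot ?M ?N \<boxdot>\<^sub>V Ide C (fst ?L)) \<cdot>\<^sub>C cinv C (ass V (fst ?M) (fst ?N) (fst ?L))) \<cdot>\<^sub>C
        (piso p \<boxdot>\<^sub>V piso q \<boxdot>\<^sub>V piso r)"
      (is "?l = ?r")
    proof (rule C.iso_epi[of _ "ass V (fobj P (fst p)) (fobj P (fst q)) (fobj P (fst r))"])
      let ?k = "lax (fst p \<boxtimes>\<^sub>W fst q) (fst r) \<cdot>\<^sub>C (lax (fst p) (fst q) \<boxdot>\<^sub>V Ide C (fobj P (fst r)))"
      have "?l \<cdot>\<^sub>C ass V (fobj P (fst p)) (fobj P (fst q)) (fobj P (fst r))
          = piso (pt (pt p q) r) \<cdot>\<^sub>C farr P (cinv D (ass W (fst p) (fst q) (fst r))) \<cdot>\<^sub>C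
            farr P (ass W (fst p) (fst q) (fst r)) \<cdot>\<^sub>C ?k"
        by (simp add: lax_ass)
      also have "\<dots> = piso (pt (pt p q) r) \<cdot>\<^sub>C ?k"
        by (simp flip: P.cinv_farr)
      also have "\<dots> = ?r \<cdot>\<^sub>C ass V (fobj P (fst p)) (fobj P (fst q)) (fobj P (fst r))"
        unfolding pt_pt_left[OF p] by (simp add: C.tail[OF C.cinv_ass_nat] C.cinv_ass_nat)
      finally show "?l \<cdot>\<^sub>C ass V (fobj P (fst p)) (fobj P (fst q)) (fobj P (fst r)) =
        ?r \<cdot>\<^sub>C ass V (fobj P (fst p)) (fobj P (fst q)) (fobj P (fst r))" .
    qed auto
  qed (use s s' pt_pt_right[OF p] in \<open>auto simp: D.homs_iff\<close>)
  moreover have "rep (pt p (pt q r)) (cinv D (ass W (fst p) (fst q) (fst r)))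
      (cinv Modules (ass (mod_mon C V brC A mlt S) ?M ?N ?L)) (pt (pt p q) r)"
    by (rule T.rep_inverse(2)[OF pt_represents_ass[OF p]]) auto
  ultimately show ?thesis
    unfolding mods by (auto intro: T.rep_eq)
qed

end

section \<open>Duality\<close>

text \<open>Comodules are modules in the opposite category, but their arrows are tagged with source and target
  and so have to be relabelled. The opposite is therefore formed together with an involution \<open>w\<close> of
  the arrows.\<close>

definition involution :: "('a \<Rightarrow> 'a) \<Rightarrow> bool" where
  "involution w \<longleftrightarrow> (\<forall>x. w (w x) = x)"

definition dual :: "('m \<Rightarrow> 'm) \<Rightarrow> ('o, 'm, 'x) cat_scheme \<Rightarrow> ('o, 'm) cat" where
  "dual w C = \<lparr>Obj = Obj C, Arr = {f. w f \<in> Arr C}, Dom = (\<lambda>f. Cod C (w f)), Cod = (\<lambda>f. Dom C (w f)),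
     Ide = (\<lambda>a. w (Ide C a)), Cmp = (\<lambda>g f. w (w f \<cdot>\<^bsub>C\<^esub> w g))\<rparr>"

definition dual_func ::
  "('m \<Rightarrow> 'm) \<Rightarrow> ('n \<Rightarrow> 'n) \<Rightarrow> ('o, 'm, 'p, 'n) func \<Rightarrow> ('o, 'm, 'p, 'n) func" where
  "dual_func v w F = \<lparr>fobj = fobj F, farr = (\<lambda>f. w (farr F (v f)))\<rparr>"

definition dual_mon ::
  "('m \<Rightarrow> 'm) \<Rightarrow> ('o, 'm, 'x) cat_scheme \<Rightarrow> ('o, 'm) mon \<Rightarrow> ('o, 'm) mon" where
  "dual_mon w C V = \<lparr>TO = TO V, TA = (\<lambda>f g. w (w f \<boxdot>\<^bsub>V\<^esub> w g)), Unit = Unit V,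
     ass = (\<lambda>a b c. w (cinv C (ass V a b c))),
     lun = (\<lambda>a. w (cinv C (lun V a))), run = (\<lambda>a. w (cinv C (run V a)))\<rparr>"

definition dual_br :: "('m \<Rightarrow> 'm) \<Rightarrow> ('o \<Rightarrow> 'o \<Rightarrow> 'm) \<Rightarrow> 'o \<Rightarrow> 'o \<Rightarrow> 'm" where
  "dual_br w br a b = w (br b a)"

lemma involutionD [simp]: "involution w \<Longrightarrow> w (w x) = x"
  by (simp add: involution_def)

lemma involution_eq_iff: "involution w \<Longrightarrow> w x = w y \<longleftrightarrow> x = y"
  by (metis involutionD)

lemma involution_id [simp]: "involution (\<lambda>x. x)"
  by (simp add: involution_def)

lemma dual_simps [simp]:
  "Obj (dual w C) = Obj C" "f \<in> Arr (dual w C) \<longleftrightarrow> w f \<in> Arr C"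
  "Dom (dual w C) f = Cod C (w f)" "Cod (dual w C) f = Dom C (w f)"
  "Ide (dual w C) a = w (Ide C a)" "Cmp (dual w C) g f = w (w f \<cdot>\<^bsub>C\<^esub> w g)"
  by (simp_all add: dual_def)

lemma dual_func_simps [simp]:
  "fobj (dual_func v w F) a = fobj F a" "farr (dual_func v w F) f = w (farr F (v f))"
  by (simp_all add: dual_func_def)

lemma dual_mon_simps [simp]:
  "TO (dual_mon w C V) a b = TO V a b" "TA (dual_mon w C V) f g = w (w f \<boxdot>\<^bsub>V\<^esub> w g)"
  "Unit (dual_mon w C V) = Unit V" "ass (dual_mon w C V) a b c = w (cinv C (ass V a b c))"
  "lun (dual_mon w C V) a = w (cinv C (lun V a))" "run (dual_mon w C V) a = w (cinv C (run V a))"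
  by (simp_all add: dual_mon_def)

lemma homs_dual [simp]: "f \<in> homs (dual w C) a b \<longleftrightarrow> w f \<in> homs C b a"
  by (auto simp: homs_def)

lemma inverse_pair_dual:
  "involution w \<Longrightarrow> inverse_pair (dual w C) f g \<longleftrightarrow> inverse_pair C (w f) (w g)"
  by (auto simp: inverse_pair_def involution_eq_iff)

lemma is_iso_dual [simp]: "involution w \<Longrightarrow> is_iso (dual w C) f \<longleftrightarrow> is_iso C (w f)"
proof -
  assume w: "involution w"
  have "inverse_pair (dual w C) f (w g) \<longleftrightarrow> inverse_pair C (w f) g" for g
    using w by (simp add: inverse_pair_dual)
  then show "is_iso (dual w C) f \<longleftrightarrow> is_iso C (w f)"
    using inverse_pair_dual[OF w, of C f] unfolding is_iso_def by blast
qed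

lemma dual_dual:
  fixes C :: "('o, 'm) cat"
  shows "involution w \<Longrightarrow> dual w (dual w C) = C"
  by (cases C) (simp add: dual_def)

lemma dual_func_id: "dual_func (\<lambda>f. f) (\<lambda>f. f) F = F"
  by (simp add: dual_func_def)

lemma dual_func_fid: "involution v \<Longrightarrow> dual_func v v fid = fid"
  by (simp add: dual_func_def fid_def)

lemma dual_func_fcomp:
  "involution w \<Longrightarrow> dual_func v u (fcomp G F) = fcomp (dual_func w u G) (dual_func v w F)"
  by (simp add: dual_func_def fcomp_def)

context category
begin

lemma category_dual: "involution w \<Longrightarrow> category (dual w C)"
  by unfold_locales (auto simp: homs_iff)

lemma cinv_dual: "\<lbrakk>involution w; is_iso C (w f)\<rbrakk> \<Longrightarrow> cinv (dual w C) f = w (cinv C (w f))"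
  by (rule category.cinv_eqI[OF category_dual])
    (auto simp: inverse_pair_dual intro: inverse_pair_cinv)

end

lemma cfunctor_dual:
  assumes "category C" "category D" "involution v" "involution w" "cfunctor C D F"
  shows "cfunctor (dual v C) (dual w D) (dual_func v w F)"
proof -
  interpret cfunctor C D F by fact
  interpret C': category "dual v C" by (rule C.category_dual[OF assms(3)])
  interpret D': category "dual w D" by (rule D.category_dual[OF assms(4)])
  show ?thesis
    using assms(3,4) by unfold_locales (auto simp: C.homs_iff D.homs_iff farr_cmp_simp)
qed

lemma cfunctor_undual:
  assumes "category C" "category D" "involution v" "involution w" "cfunctor (dual v C) (dual w D) F"
  shows "cfunctor C D (dual_func v w F)"
proof -
  interpret C: category C by fact
  interpret D: category D by fact
  interpret F: cfunctor "dual v C" "dual w D" F by fact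
  note [simp] = assms(3,4)
  show ?thesis
  proof unfold_locales
    fix f g a b c
    assume f: "f \<in> homs C a b"
    show "farr (dual_func v w F) f \<in> homs D (fobj (dual_func v w F) a) (fobj (dual_func v w F) b)"
      using F.farr_hom[of "v f" b a] f by simp
    assume g: "g \<in> homs C b c"
    show "farr (dual_func v w F) (g \<cdot>\<^bsub>C\<^esub> f) = farr (dual_func v w F) g \<cdot>\<^bsub>D\<^esub> farr (dual_func v w F) f"
      using F.farr_cmp[of "v g" c b "v f" a] f g by simp
  next
    fix a assume "a \<in> Obj C"
    then show "fobj (dual_func v w F) a \<in> Obj D"
      "farr (dual_func v w F) (Ide C a) = Ide D (fobj (dual_func v w F) a)"
      using F.fobj_obj[of a] F.farr_ide[of a] by simp_all
  qed
qed

lemma nat_trans_dual: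
  assumes "category C" "category D" "involution v" "involution w" "nat_trans C D F G \<tau>"
  shows "nat_trans (dual v C) (dual w D) (dual_func v w G) (dual_func v w F) (\<lambda>x. w (\<tau> x))"
  using assms(5) cfunctor_dual[OF assms(1-4)] assms(3,4) unfolding nat_trans_def by auto

lemma nat_trans_undual:
  assumes "category C" "category D" "involution v" "involution w"
    and "nat_trans (dual v C) (dual w D) F G \<tau>"
  shows "nat_trans C D (dual_func v w G) (dual_func v w F) (\<lambda>x. w (\<tau> x))"
proof -
  have "w (\<tau> (Cod C f)) \<cdot>\<^bsub>D\<^esub> w (farr G (v f)) = w (farr F (v f)) \<cdot>\<^bsub>D\<^esub> w (\<tau> (Dom C f))" if f: "f \<in> Arr C" for f
  proof -
    have "w (w (farr F (v f)) \<cdot>\<^bsub>D\<^esub> w (\<tau> (Dom C f))) = w (w (\<tau> (Cod C f)) \<cdot>\<^bsub>D\<^esub> w (farr G (v f)))"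
      using assms(3-5) f unfolding nat_trans_def by (auto dest: bspec[of _ _ "v f"])
    then show ?thesis using assms(4) by (simp add: involution_eq_iff)
  qed
  then show ?thesis
    using assms(5) cfunctor_undual[OF assms(1-4)] assms(3,4) unfolding nat_trans_def by auto
qed

lemma nat_iso_undual:
  assumes "category C" "category D" "involution v" "involution w"
    and "nat_iso (dual v C) (dual w D) F G \<tau>"
  shows "nat_iso C D (dual_func v w G) (dual_func v w F) (\<lambda>x. w (\<tau> x))"
  using assms(5) nat_trans_undual[OF assms(1-4)] assms(4) unfolding nat_iso_def by auto

lemma nat_iso_inverse:
  assumes "nat_iso C D F G \<tau>"
  shows "nat_iso C D G F (\<lambda>x. cinv D (\<tau> x))"
proof -
  have nt: "nat_trans C D F G \<tau>" and iso: "\<And>x. x \<in> Obj C \<Longrightarrow> is_iso D (\<tau> x)"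
    using assms by (auto simp: nat_iso_def)
  interpret F: cfunctor C D F using nt by (simp add: nat_trans_def)
  interpret G: cfunctor C D G using nt by (simp add: nat_trans_def)
  note [simp] = nat_trans_simps(1-3)[OF nt] iso
  have "cinv D (\<tau> (Cod C f)) \<cdot>\<^bsub>D\<^esub> farr G f = farr F f \<cdot>\<^bsub>D\<^esub> cinv D (\<tau> (Dom C f))" if [simp]: "f \<in> Arr C" for f
  proof (rule F.D.iso_mono[of "\<tau> (Cod C f)"], rule F.D.iso_epi[of _ "\<tau> (Dom C f)"])
    show "(\<tau> (Cod C f) \<cdot>\<^bsub>D\<^esub> cinv D (\<tau> (Cod C f)) \<cdot>\<^bsub>D\<^esub> farr G f) \<cdot>\<^bsub>D\<^esub> \<tau> (Dom C f) =
      (\<tau> (Cod C f) \<cdot>\<^bsub>D\<^esub> farr F f \<cdot>\<^bsub>D\<^esub> cinv D (\<tau> (Dom C f))) \<cdot>\<^bsub>D\<^esub> \<tau> (Dom C f)"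
      using nat_trans_simps(4)[OF nt, of f] by simp
  qed auto
  then show ?thesis
    using nt unfolding nat_iso_def nat_trans_def by (auto simp: F.D.homs_iff)
qed

lemma equivalence_undual:
  assumes CD: "category C" "category D" and vw: "involution v" "involution w"
    and "equivalence (dual v C) (dual w D) F"
  shows "equivalence C D (dual_func v w F)"
proof -
  obtain F' \<tau> \<sigma> where F: "cfunctor (dual v C) (dual w D) F" "cfunctor (dual w D) (dual v C) F'"
    and \<tau>: "nat_iso (dual v C) (dual v C) fid (fcomp F' F) \<tau>"
    and \<sigma>: "nat_iso (dual w D) (dual w D) (fcomp F F') fid \<sigma>"
    using assms(5) unfolding equivalence_def by blast
  have n1: "nat_iso C C (fcomp (dual_func w v F') (dual_func v w F)) fid (\<lambda>x. v (\<tau> x))"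
    using nat_iso_undual[OF CD(1) CD(1) vw(1) vw(1) \<tau>] vw by (simp add: dual_func_fid dual_func_fcomp)
  have n2: "nat_iso D D fid (fcomp (dual_func v w F) (dual_func w v F')) (\<lambda>x. w (\<sigma> x))"
    using nat_iso_undual[OF CD(2) CD(2) vw(2) vw(2) \<sigma>] vw by (simp add: dual_func_fid dual_func_fcomp)
  show ?thesis
    unfolding equivalence_def
    using cfunctor_undual[OF CD vw F(1)] cfunctor_undual[OF CD(2,1) vw(2,1) F(2)]
      nat_iso_inverse[OF n1] nat_iso_inverse[OF n2] by blast
qed

lemma adjunction_dual:
  assumes CD: "category C" "category D" and adj: "adjunction D C F U \<eta> \<epsilon>"
  shows "adjunction (dual (\<lambda>f. f) C) (dual (\<lambda>f. f) D) U F \<epsilon> \<eta>"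
  using adj nat_trans_dual[OF CD(1) CD(1) involution_id involution_id, of "fcomp F U" fid \<epsilon>]
    nat_trans_dual[OF CD(2) CD(2) involution_id involution_id, of fid "fcomp U F" \<eta>]
  unfolding adjunction_def dual_func_id by auto

lemma adjunction_undual:
  assumes CD: "category C" "category D" and v: "involution v" and w: "involution w"
    and adj: "adjunction (dual v C) (dual w D) F U \<eta> \<epsilon>"
  shows "adjunction D C (dual_func w v U) (dual_func v w F) (\<lambda>x. w (\<epsilon> x)) (\<lambda>x. v (\<eta> x))"
proof -
  have "nat_trans C C (fcomp (dual_func w v U) (dual_func v w F)) fid (\<lambda>x. v (\<eta> x))"
    using adj nat_trans_undual[OF CD(1) CD(1) v v, of fid "fcomp U F" \<eta>] v w
    by (simp add: adjunction_def dual_func_fid dual_func_fcomp)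
  moreover have "nat_trans D D fid (fcomp (dual_func v w F) (dual_func w v U)) (\<lambda>x. w (\<epsilon> x))"
    using adj nat_trans_undual[OF CD(2) CD(2) w w, of "fcomp F U" fid \<epsilon>] v w
    by (simp add: adjunction_def dual_func_fid dual_func_fcomp)
  moreover have "v (\<eta> (fobj U y)) \<cdot>\<^bsub>C\<^esub> v (farr U (\<epsilon> y)) = Ide C (fobj U y)" if "y \<in> Obj D" for y
    using adj that v by (simp add: adjunction_def involution_eq_iff)
  moreover have "w (farr F (\<eta> x)) \<cdot>\<^bsub>D\<^esub> w (\<epsilon> (fobj F x)) = Ide D (fobj F x)" if "x \<in> Obj C" for x
    using adj that w by (simp add: adjunction_def involution_eq_iff)
  ultimately show ?thesis
    unfolding adjunction_def using v w by simp
qed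

lemma identifies_left_adjoints_undual:
  assumes cats: "category C" "category D" "category D'"
    and inv: "involution u" "involution v" "involution w"
    and id: "identifies_right_adjoints (dual u C) (dual v D) (dual w D') E F U \<eta> \<epsilon> F' U' \<eta>' \<epsilon>'"
  shows "identifies_left_adjoints C D D' (dual_func v w E)
    (dual_func v u U) (dual_func u v F) (\<lambda>x. v (\<epsilon> x)) (\<lambda>x. u (\<eta> x))
    (dual_func w u U') (dual_func u w F') (\<lambda>x. w (\<epsilon>' x)) (\<lambda>x. u (\<eta>' x))"
proof -
  have adj: "adjunction (dual u C) (dual v D) F U \<eta> \<epsilon>" "adjunction (dual u C) (dual w D') F' U' \<eta>' \<epsilon>'"
    and feq: "feq (dual v D) (fcomp U' E) U"
    using id unfolding identifies_right_adjoints_def by blast+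
  obtain \<theta> where \<theta>: "nat_iso (dual u C) (dual w D') F' (fcomp E F) \<theta>"
    and \<theta>1: "\<And>x. x \<in> Obj (dual u C) \<Longrightarrow> Cmp (dual u C) (farr U' (\<theta> x)) (\<eta>' x) = \<eta> x"
    and \<theta>2: "\<And>y. y \<in> Obj (dual v D) \<Longrightarrow> Cmp (dual w D') (farr E (\<epsilon> y)) (\<theta> (fobj U y)) = \<epsilon>' (fobj E y)"
    using id unfolding identifies_right_adjoints_def by blast
  have "nat_iso C D' (fcomp (dual_func v w E) (dual_func u v F)) (dual_func u w F') (\<lambda>x. w (\<theta> x))"
    using nat_iso_undual[OF cats(1,3) inv(1,3) \<theta>] inv by (simp add: dual_func_fcomp[of v])
  moreover have "u (\<eta>' x) \<cdot>\<^bsub>C\<^esub> u (farr U' (\<theta> x)) = u (\<eta> x)" if "x \<in> Obj C" for x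
    using arg_cong[OF \<theta>1[of x], of u] that inv by simp
  moreover have "w (\<theta> (fobj U y)) \<cdot>\<^bsub>D'\<^esub> w (farr E (\<epsilon> y)) = w (\<epsilon>' (fobj E y))" if "y \<in> Obj D" for y
    using arg_cong[OF \<theta>2[of y], of w] that inv by simp
  moreover have "feq D (fcomp (dual_func w u U') (dual_func v w E)) (dual_func v u U)"
    using feq inv by (auto simp: feq_def fcomp_def)
  ultimately show ?thesis
    unfolding identifies_left_adjoints_def
    using adjunction_undual[OF cats(1,2) inv(1,2) adj(1)] adjunction_undual[OF cats(1,3) inv(1,3) adj(2)] inv
    by (intro conjI exI[of _ "\<lambda>x. w (\<theta> x)"]) auto
qed

context monoidal_category
begin

lemma monoidal_dual:
  assumes [simp]: "involution w"
  shows "monoidal_category (dual w C) (dual_mon w C V)"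
proof -
  let ?C = "dual w C" and ?V = "dual_mon w C V"
  interpret C': category "dual w C" by (rule category_dual[OF assms])
  show ?thesis
  proof unfold_locales
    fix a b c d
    assume "a \<in> Obj ?C" "b \<in> Obj ?C" "c \<in> Obj ?C" "d \<in> Obj ?C"
    then have [simp]: "a \<in> Obj C" "b \<in> Obj C" "c \<in> Obj C" "d \<in> Obj C"
      by simp_all
    show "Cmp ?C (TA ?V (Ide ?C a) (ass ?V b c d))
        (Cmp ?C (ass ?V a (TO ?V b c) d)
          (TA ?V (ass ?V a b c) (Ide ?C d))) =
      Cmp ?C (ass ?V a b (TO ?V c d))
        (ass ?V (TO ?V a b) c d)"
      using arg_cong[OF pentagon[of a b c d], of "cinv C"] by (simp add: cinv_cmp cinv_TA)
  next
    fix a b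
    assume "a \<in> Obj ?C" "b \<in> Obj ?C"
    then have [simp]: "a \<in> Obj C" "b \<in> Obj C"
      by simp_all
    show "Cmp ?C (TA ?V (Ide ?C a) (lun ?V b))
        (ass ?V a (Unit ?V) b) =
      TA ?V (run ?V a) (Ide ?C b)"
      using arg_cong[OF triangle[of a b], of "cinv C"] by (simp add: cinv_cmp cinv_TA)
  qed (auto simp: homs_iff TA_merge cinv_ass_nat cinv_lun_nat cinv_run_nat)
qed

end

lemma (in braided_monoidal) braided_dual:
  assumes [simp]: "involution w"
  shows "braided_monoidal (dual w C) (dual_mon w C V) (dual_br w br)"
proof -
  let ?C = "dual w C" and ?V = "dual_mon w C V" and ?b = "dual_br w br"
  interpret C': monoidal_category "dual w C" "dual_mon w C V" by (rule monoidal_dual[OF assms])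
  show ?thesis
  proof unfold_locales
    fix a b c
    assume "a \<in> Obj ?C" "b \<in> Obj ?C" "c \<in> Obj ?C"
    then have [simp]: "a \<in> Obj C" "b \<in> Obj C" "c \<in> Obj C"
      by simp_all
    show "Cmp ?C (ass ?V b c a)
        (Cmp ?C (?b a (TO ?V b c)) (ass ?V a b c)) =
      Cmp ?C (TA ?V (Ide ?C b) (?b a c))
        (Cmp ?C (ass ?V b a c)
          (TA ?V (?b a b) (Ide ?C c)))"
      using hexagon'[of b c a] by (simp add: dual_br_def)
    show "Cmp ?C (cinv ?C (ass ?V c a b))
        (Cmp ?C (?b (TO ?V a b) c)
          (cinv ?C (ass ?V a b c))) =
      Cmp ?C (TA ?V (?b a c) (Ide ?C b))
        (Cmp ?C (cinv ?C (ass ?V a c b))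
          (TA ?V (Ide ?C a) (?b b c)))"
      using hexagon[of c a b] by (simp add: dual_br_def cinv_dual)
  qed (auto simp: homs_iff dual_br_def br_nat)
qed

lemma (in strong_monoidal) strong_dual:
  assumes [simp]: "involution v" "involution w"
  shows "strong_monoidal (dual v C) (dual_mon v C V) (dual w D) (dual_mon w D W) (dual_func v w F)
    (\<lambda>a b. w (cinv D (t a b))) (w (cinv D t0))"
proof -
  let ?C = "dual v C" and ?V = "dual_mon v C V" and ?D = "dual w D" and ?W = "dual_mon w D W"
    and ?F = "dual_func v w F"
  interpret C': monoidal_category "dual v C" "dual_mon v C V" by (rule C.monoidal_dual[OF assms(1)])
  interpret D': monoidal_category "dual w D" "dual_mon w D W" by (rule D.monoidal_dual[OF assms(2)])
  interpret F': cfunctor "dual v C" "dual w D" "dual_func v w F"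
    by (rule cfunctor_dual[OF C.category_axioms D.category_axioms assms cfunctor_axioms])
  have t_s [simp]: "t a b \<in> Arr D" "Dom D (t a b) = fobj F (a \<boxtimes>\<^bsub>V\<^esub> b)" "Cod D (t a b) = fobj F a \<boxtimes>\<^bsub>W\<^esub> fobj F b"
    "is_iso D (t a b)" if "a \<in> Obj C" "b \<in> Obj C" for a b
    using t_hom[OF that] by (auto simp: homs_def)
  have t0_s [simp]: "t0 \<in> Arr D" "Dom D t0 = fobj F (Unit V)" "Cod D t0 = Unit W" "is_iso D t0"
    using t0_hom by (auto simp: homs_def)
  have cinv_t_nat: "cinv D (t a b) \<cdot>\<^bsub>D\<^esub> (farr F f \<boxdot>\<^bsub>W\<^esub> farr F g) = farr F (f \<boxdot>\<^bsub>V\<^esub> g) \<cdot>\<^bsub>D\<^esub> cinv D (t a' b')"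
    if "f \<in> homs C a' a" "g \<in> homs C b' b" for f g a a' b b'
  proof -
    have [simp]: "a \<in> Obj C" "a' \<in> Obj C" "b \<in> Obj C" "b' \<in> Obj C"
      using that C.dom_obj[of f] C.cod_obj[of f] C.dom_obj[of g] C.cod_obj[of g] by (auto simp: C.homs_iff)
    note [simp] = that[unfolded C.homs_iff]
    show ?thesis
    proof (rule D.iso_mono[of "t a b"], rule D.iso_epi[of _ "t a' b'"])
      show "(t a b \<cdot>\<^bsub>D\<^esub> cinv D (t a b) \<cdot>\<^bsub>D\<^esub> (farr F f \<boxdot>\<^bsub>W\<^esub> farr F g)) \<cdot>\<^bsub>D\<^esub> t a' b' =
        (t a b \<cdot>\<^bsub>D\<^esub> farr F (f \<boxdot>\<^bsub>V\<^esub> g) \<cdot>\<^bsub>D\<^esub> cinv D (t a' b')) \<cdot>\<^bsub>D\<^esub> t a' b'"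
        using t_natural[OF that] by simp
    qed auto
  qed
  show ?thesis
  proof unfold_locales
    fix a b c
    assume "a \<in> Obj ?C" "b \<in> Obj ?C" "c \<in> Obj ?C"
    then have [simp]: "a \<in> Obj C" "b \<in> Obj C" "c \<in> Obj C"
      by simp_all
    show "Cmp ?D (ass ?W (fobj ?F a) (fobj ?F b) (fobj ?F c))
        (Cmp ?D (TA ?W (w (cinv D (t a b))) (Ide ?D (fobj ?F c)))
          (w (cinv D (t (TO ?V a b) c)))) =
      Cmp ?D (TA ?W (Ide ?D (fobj ?F a)) (w (cinv D (t b c))))
        (Cmp ?D (w (cinv D (t a (TO ?V b c)))) (farr ?F (ass ?V a b c)))"
      using arg_cong[OF t_ass[of a b c], of "cinv D"] by (simp add: D.cinv_cmp D.cinv_TA cinv_farr)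
  next
    fix a
    assume "a \<in> Obj ?C"
    then have [simp]: "a \<in> Obj C"
      by simp_all
    show "Cmp ?D (lun ?W (fobj ?F a))
        (Cmp ?D (TA ?W (w (cinv D t0)) (Ide ?D (fobj ?F a)))
          (w (cinv D (t (Unit ?V) a)))) = farr ?F (lun ?V a)"
      using arg_cong[OF t_lun[of a], of "cinv D"] by (simp add: D.cinv_cmp D.cinv_TA cinv_farr)
    show "Cmp ?D (run ?W (fobj ?F a))
        (Cmp ?D (TA ?W (Ide ?D (fobj ?F a)) (w (cinv D t0)))
          (w (cinv D (t a (Unit ?V))))) = farr ?F (run ?V a)"
      using arg_cong[OF t_run[of a], of "cinv D"] by (simp add: D.cinv_cmp D.cinv_TA cinv_farr)
  next
    fix f g a a' b b'
    assume "f \<in> homs ?C a a'" "g \<in> homs ?C b b'"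
    then have fg: "v f \<in> homs C a' a" "v g \<in> homs C b' b" by simp_all
    show "Cmp ?D (w (cinv D (t a' b'))) (farr ?F (TA ?V f g)) =
      Cmp ?D (TA ?W (farr ?F f) (farr ?F g)) (w (cinv D (t a b)))"
      using cinv_t_nat[OF fg] by simp
  qed (auto simp: D.homs_iff)
qed

section \<open>Structures that agree on the carriers\<close>

text \<open>Dualizing twice, or dualizing a construction instead of repeating it for the opposite category,
  changes the structure maps outside the carriers only.\<close>

definition mon_agree :: "('o, 'm, 'x) cat_scheme \<Rightarrow> ('o, 'm) mon \<Rightarrow> ('o, 'm) mon \<Rightarrow> bool" where
  "mon_agree C V V' \<longleftrightarrow> Unit V = Unit V' \<and> (\<forall>a \<in> Obj C. lun V a = lun V' a \<and> run V a = run V' a) \<and>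
     (\<forall>a \<in> Obj C. \<forall>b \<in> Obj C. TO V a b = TO V' a b) \<and> (\<forall>f \<in> Arr C. \<forall>g \<in> Arr C. TA V f g = TA V' f g) \<and>
     (\<forall>a \<in> Obj C. \<forall>b \<in> Obj C. \<forall>c \<in> Obj C. ass V a b c = ass V' a b c)"

definition cat_agree :: "('o, 'm, 'x) cat_scheme \<Rightarrow> ('o, 'm, 'y) cat_scheme \<Rightarrow> bool" where
  "cat_agree C C' \<longleftrightarrow> Obj C = Obj C' \<and> Arr C = Arr C' \<and> Dom C = Dom C' \<and> Cod C = Cod C' \<and>
     Ide C = Ide C' \<and> Cmp C = Cmp C'"

lemma mon_agree_simps:
  assumes "mon_agree C V V'"
  shows "Unit V' = Unit V" "a \<in> Obj C \<Longrightarrow> lun V' a = lun V a" "a \<in> Obj C \<Longrightarrow> run V' a = run V a"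
    and "\<lbrakk>a \<in> Obj C; b \<in> Obj C\<rbrakk> \<Longrightarrow> TO V' a b = TO V a b"
    and "\<lbrakk>f \<in> Arr C; g \<in> Arr C\<rbrakk> \<Longrightarrow> TA V' f g = TA V f g"
    and "\<lbrakk>a \<in> Obj C; b \<in> Obj C; c \<in> Obj C\<rbrakk> \<Longrightarrow> ass V' a b c = ass V a b c"
  using assms by (simp_all add: mon_agree_def)

lemma feq_fcomp:
  assumes "feq C F F'" "feq D G G'" "cfunctor C D F"
  shows "feq C (fcomp G F) (fcomp G' F')"
proof -
  interpret cfunctor C D F by fact
  have [simp]: "\<And>x. x \<in> Obj C \<Longrightarrow> fobj F' x = fobj F x" "\<And>f. f \<in> Arr C \<Longrightarrow> farr F' f = farr F f"
    "\<And>y. y \<in> Obj D \<Longrightarrow> fobj G' y = fobj G y" "\<And>g. g \<in> Arr D \<Longrightarrow> farr G' g = farr G g"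
    using assms(1,2) by (simp_all add: feq_def)
  show ?thesis by (simp add: feq_def fcomp_def)
qed

lemma cfunctor_feq:
  assumes "cfunctor C D F" "feq C F F'"
  shows "cfunctor C D F'"
proof -
  interpret cfunctor C D F by fact
  have [simp]: "fobj F' a = fobj F a" if "a \<in> Obj C" for a using assms(2) that by (simp add: feq_def)
  have [simp]: "farr F' f = farr F f" if "f \<in> Arr C" for f using assms(2) that by (simp add: feq_def)
  show ?thesis by unfold_locales (auto simp: C.homs_iff D.homs_iff farr_cmp_simp)
qed

lemma nat_trans_feq:
  assumes "nat_trans C D F G \<tau>" "feq C F F'" "feq C G G'" "\<And>x. x \<in> Obj C \<Longrightarrow> \<tau>' x = \<tau> x"
  shows "nat_trans C D F' G' \<tau>'"
proof -
  interpret cfunctor C D F using assms(1) by (simp add: nat_trans_def)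
  show ?thesis
    using assms cfunctor_feq[OF _ assms(2)] cfunctor_feq[OF _ assms(3)]
    by (auto simp: nat_trans_def feq_def)
qed

lemma nat_iso_feq:
  assumes "nat_iso C D F G \<tau>" "feq C F F'" "feq C G G'"
  shows "nat_iso C D F' G' \<tau>"
  using assms nat_trans_feq[of C D F G \<tau> F' G' \<tau>] by (simp add: nat_iso_def)

lemma feq_refl [simp]: "feq C F F"
  by (simp add: feq_def)

lemma equivalence_feq:
  assumes "equivalence C D F" "feq C F F'"
  shows "equivalence C D F'"
proof -
  obtain G \<tau> \<sigma> where G: "cfunctor C D F" "cfunctor D C G"
    and \<tau>: "nat_iso C C fid (fcomp G F) \<tau>" and \<sigma>: "nat_iso D D (fcomp F G) fid \<sigma>"
    using assms(1) unfolding equivalence_def by blast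
  have "nat_iso C C fid (fcomp G F') \<tau>"
    by (rule nat_iso_feq[OF \<tau> feq_refl feq_fcomp[OF assms(2) feq_refl G(1)]])
  moreover have "nat_iso D D (fcomp F' G) fid \<sigma>"
    by (rule nat_iso_feq[OF \<sigma> feq_fcomp[OF feq_refl assms(2) G(2)] feq_refl])
  ultimately show ?thesis
    unfolding equivalence_def using G(2) cfunctor_feq[OF G(1) assms(2)] by blast
qed

lemma identifies_left_adjoints_agree:
  assumes id: "identifies_left_adjoints C D D' E U F \<eta> \<epsilon> U' F' \<eta>' \<epsilon>'"
    and E: "cfunctor D D' E" "feq D E E1" and F': "feq C F' F1"
    and \<eta>: "\<And>m. m \<in> Obj D' \<Longrightarrow> \<eta>1 m = \<eta>' m" and \<epsilon>: "\<And>x. x \<in> Obj C \<Longrightarrow> \<epsilon>1 x = \<epsilon>' x"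
    and functors: "cfunctor C D F" "cfunctor D' C U'" "cfunctor C D' F'"
  shows "identifies_left_adjoints C D D' E1 U F \<eta> \<epsilon> U' F1 \<eta>1 \<epsilon>1"
proof -
  interpret E: cfunctor D D' E by fact
  interpret U': cfunctor D' C U' by fact
  interpret F': cfunctor C D' F' by fact
  have adj: "adjunction D C U F \<eta> \<epsilon>" "adjunction D' C U' F' \<eta>' \<epsilon>'" and feq: "feq D (fcomp U' E) U"
    using id unfolding identifies_left_adjoints_def by blast+
  obtain \<theta> where \<theta>: "nat_iso C D' (fcomp E F) F' \<theta>"
    and \<theta>1: "\<And>y. y \<in> Obj D \<Longrightarrow> \<theta> (fobj U y) \<cdot>\<^bsub>D'\<^esub> farr E (\<eta> y) = \<eta>' (fobj E y)"
    and \<theta>2: "\<And>x. x \<in> Obj C \<Longrightarrow> \<epsilon>' x \<cdot>\<^bsub>C\<^esub> farr U' (\<theta> x) = \<epsilon> x"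
    using id unfolding identifies_left_adjoints_def by blast
  have E1: "farr E1 f = farr E f" if "f \<in> Arr D" for f using E(2) that by (auto simp: feq_def)
  have F1: "fobj F1 x = fobj F' x" if "x \<in> Obj C" for x using F' that by (auto simp: feq_def)
  have F1': "farr F1 f = farr F' f" if "f \<in> Arr C" for f using F' that by (auto simp: feq_def)
  have E1': "fobj E1 y = fobj E y" if "y \<in> Obj D" for y using E(2) that by (auto simp: feq_def)
  have "adjunction D' C U' F1 \<eta>1 \<epsilon>1"
  proof -
    have n1: "nat_trans D' D' fid (fcomp F' U') \<eta>'" and n2: "nat_trans C C (fcomp U' F') fid \<epsilon>'"
      using adj(2) unfolding adjunction_def by blast+
    have "nat_trans D' D' fid (fcomp F1 U') \<eta>1"
      by (rule nat_trans_feq[OF n1 feq_refl feq_fcomp[OF feq_refl F' functors(2)] \<eta>])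
    moreover have "nat_trans C C (fcomp U' F1) fid \<epsilon>1"
      by (rule nat_trans_feq[OF n2 feq_fcomp[OF F' feq_refl functors(3)] feq_refl \<epsilon>])
    moreover have "\<epsilon>' x \<in> Arr C" if "x \<in> Obj C" for x
      using nat_trans_simps(1)[OF n2 that] .
    ultimately show ?thesis
      using adj(2) unfolding adjunction_def by (auto simp: \<eta> \<epsilon> F1 F1')
  qed
  moreover have "nat_iso C D' (fcomp E1 F) F1 \<theta>"
    by (rule nat_iso_feq[OF \<theta> feq_fcomp[OF feq_refl E(2) functors(1)] F'])
  moreover have "feq D (fcomp U' E1) U"
    using feq by (auto simp: feq_def fcomp_def E1 E1')
  moreover have "\<eta> y \<in> Arr D" if "y \<in> Obj D" for y
    using nat_trans_simps(1)[of D D fid "fcomp F U" \<eta>] adj(1) that unfolding adjunction_def by blast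
  ultimately show ?thesis
    using adj(1) \<theta>1 \<theta>2 unfolding identifies_left_adjoints_def
    by (intro conjI exI[of _ \<theta>]) (auto simp: E1 E1' \<eta> \<epsilon>)
qed

lemma monoidal_agree:
  assumes "monoidal_category C V" "mon_agree C V V'"
  shows "monoidal_category C V'"
proof -
  interpret V: monoidal_category C V by fact
  note [simp] = mon_agree_simps[OF assms(2)]
  show ?thesis
    by unfold_locales
      (auto simp: V.homs_iff V.TA_merge V.ass_nat V.lun_nat V.run_nat V.pentagon V.triangle)
qed

lemma braided_agree:
  assumes "braided_monoidal C V br" "mon_agree C V V'"
    and br: "\<And>a b. \<lbrakk>a \<in> Obj C; b \<in> Obj C\<rbrakk> \<Longrightarrow> br' a b = br a b"
  shows "braided_monoidal C V' br'"
proof -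
  interpret V: braided_monoidal C V br by fact
  interpret V': monoidal_category C V' by (rule monoidal_agree[OF V.monoidal_category_axioms assms(2)])
  note [simp] = mon_agree_simps[OF assms(2)]
  show ?thesis
    by unfold_locales (auto simp: V.homs_iff br V.br_nat V.hexagon V.hexagon')
qed

lemma strong_agree:
  assumes S: "strong_monoidal C V D W F t t0" and C': "monoidal_category C' V'"
    and C: "cat_agree C C'" and V: "mon_agree C V V'" and W: "mon_agree D W W'" and F: "feq C F F'"
  shows "strong_monoidal C' V' D W' F' t t0"
proof -
  interpret S: strong_monoidal C V D W F t t0 by fact
  interpret C': monoidal_category C' V' by fact
  interpret D': monoidal_category D W' by (rule monoidal_agree[OF S.D.monoidal_category_axioms W])
  have [simp]: "Obj C' = Obj C" "Arr C' = Arr C" "Dom C' = Dom C" "Cod C' = Cod C" "Ide C' = Ide C" "Cmp C' = Cmp C"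
    "homs C' = homs C"
    using C by (auto simp: cat_agree_def homs_def fun_eq_iff)
  note [simp] = mon_agree_simps[OF V] mon_agree_simps[OF W]
  have [simp]: "\<And>a. a \<in> Obj C \<Longrightarrow> fobj F' a = fobj F a" "\<And>f. f \<in> Arr C \<Longrightarrow> farr F' f = farr F f"
    using F by (simp_all add: feq_def)
  have t [simp]: "t a b \<in> Arr D" "Dom D (t a b) = fobj F (a \<boxtimes>\<^bsub>V\<^esub> b)" "Cod D (t a b) = fobj F a \<boxtimes>\<^bsub>W\<^esub> fobj F b"
    "is_iso D (t a b)" if "a \<in> Obj C" "b \<in> Obj C" for a b
    using S.t_hom[OF that] by (auto simp: homs_def)
  have t0 [simp]: "t0 \<in> Arr D" "Dom D t0 = fobj F (Unit V)" "Cod D t0 = Unit W" "is_iso D t0"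
    using S.t0_hom by (auto simp: homs_def)
  have tn: "t (Cod C f) (Cod C g) \<cdot>\<^bsub>D\<^esub> farr F (f \<boxdot>\<^bsub>V\<^esub> g) = (farr F f \<boxdot>\<^bsub>W\<^esub> farr F g) \<cdot>\<^bsub>D\<^esub> t (Dom C f) (Dom C g)"
    if "f \<in> Arr C" "g \<in> Arr C" for f g
    using S.t_natural[of f _ _ g] that by (simp add: S.C.homs_iff)
  show ?thesis
    by unfold_locales
      (auto simp: S.C.homs_iff S.D.homs_iff S.farr_cmp_simp tn S.t_ass S.t_lun S.t_run)
qed

text \<open>An equivalence of the opposites is one of the original categories; its comparison isomorphisms are
  inverted.\<close>

lemma braided_equivalence_undual:
  fixes E :: "('q, 'l) cat"
  assumes D: "braided_monoidal D W brD" and E: "category E" and w [simp]: "involution w"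
    and equiv: "braided_monoidal_equivalence (dual (\<lambda>f. f) D) (dual_mon (\<lambda>f. f) D W) (dual_br (\<lambda>f. f) brD)
      (dual w E) U br \<Phi>"
    and U: "mon_agree E (dual_mon w (dual w E) U) U'"
    and br: "\<And>M N. \<lbrakk>M \<in> Obj E; N \<in> Obj E\<rbrakk> \<Longrightarrow> br' M N = dual_br w br M N"
    and \<Phi>: "feq D (dual_func (\<lambda>f. f) w \<Phi>) \<Phi>'"
  shows "braided_monoidal_equivalence D W brD E U' br' \<Phi>'"
proof -
  interpret D: braided_monoidal D W brD by fact
  interpret E: category E by fact
  obtain t t0 where S: "strong_monoidal (dual (\<lambda>f. f) D) (dual_mon (\<lambda>f. f) D W) (dual w E) U \<Phi> t t0"
    and B: "braided_monoidal (dual w E) U br"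
    and t_br: "\<And>a b. \<lbrakk>a \<in> Obj D; b \<in> Obj D\<rbrakk> \<Longrightarrow>
      Cmp (dual w E) (br (fobj \<Phi> a) (fobj \<Phi> b)) (t a b) =
      Cmp (dual w E) (t b a) (farr \<Phi> (dual_br (\<lambda>f. f) brD a b))"
    using equiv unfolding braided_monoidal_equivalence_def braided_strong_monoidal_def by auto
  interpret S: strong_monoidal "dual (\<lambda>f. f) D" "dual_mon (\<lambda>f. f) D W" "dual w E" U \<Phi> t t0 by fact
  interpret B: braided_monoidal "dual w E" U br by fact
  let ?t = "\<lambda>a b. w (cinv (dual w E) (t a b))" and ?tu = "w (cinv (dual w E) t0)"
  have "equivalence D E (dual_func (\<lambda>f. f) w \<Phi>)"
    using equiv equivalence_undual[OF D.category_axioms E involution_id w]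
    unfolding braided_monoidal_equivalence_def by blast
  then have "equivalence D E \<Phi>'" by (rule equivalence_feq[OF _ \<Phi>])
  moreover have braided: "braided_monoidal E U' br'"
    using braided_agree[OF B.braided_dual[OF w, unfolded dual_dual[OF w]] U br] .
  moreover have "strong_monoidal D W E U' \<Phi>' ?t ?tu"
  proof (rule strong_agree[OF S.strong_dual[OF involution_id w, unfolded dual_dual[OF w]]])
    show "monoidal_category D W" by unfold_locales
    show "cat_agree (dual (\<lambda>f. f) (dual (\<lambda>f. f) D)) D"
      by (simp add: cat_agree_def dual_def)
    show "mon_agree (dual (\<lambda>f. f) (dual (\<lambda>f. f) D))
      (dual_mon (\<lambda>f. f) (dual (\<lambda>f. f) D) (dual_mon (\<lambda>f. f) D W)) W"
      by (simp add: mon_agree_def D.cinv_dual)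
    show "mon_agree E (dual_mon w (dual w E) U) U'" by (rule U)
    show "feq (dual (\<lambda>f. f) (dual (\<lambda>f. f) D)) (dual_func (\<lambda>f. f) w \<Phi>) \<Phi>'"
      using \<Phi> by (simp add: feq_def)
  qed
  moreover have "br' (fobj \<Phi>' a) (fobj \<Phi>' b) \<cdot>\<^bsub>E\<^esub> ?t a b = ?t b a \<cdot>\<^bsub>E\<^esub> farr \<Phi>' (brD a b)"
    if [simp]: "a \<in> Obj D" "b \<in> Obj D" for a b
  proof -
    have t [simp]: "w (t a b) \<in> Arr E" "Dom E (w (t a b)) = fobj \<Phi> a \<boxtimes>\<^bsub>U\<^esub> fobj \<Phi> b"
      "Cod E (w (t a b)) = fobj \<Phi> (a \<boxtimes>\<^bsub>W\<^esub> b)" "is_iso E (w (t a b))" if "a \<in> Obj D" "b \<in> Obj D" for a b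
      using S.t_hom[of a b] that by (auto simp: homs_def)
    have ob: "fobj \<Phi> c \<in> Obj E" if "c \<in> Obj D" for c using S.fobj_obj[of c] that by simp
    have br_s [simp]: "w (br (fobj \<Phi> c) (fobj \<Phi> d)) \<in> Arr E"
      "Cod E (w (br (fobj \<Phi> c) (fobj \<Phi> d))) = fobj \<Phi> c \<boxtimes>\<^bsub>U\<^esub> fobj \<Phi> d"
      "Dom E (w (br (fobj \<Phi> c) (fobj \<Phi> d))) = fobj \<Phi> d \<boxtimes>\<^bsub>U\<^esub> fobj \<Phi> c"
      if "c \<in> Obj D" "d \<in> Obj D" for c d
      using B.br_simps[of "fobj \<Phi> c" "fobj \<Phi> d"] ob that by simp_all
    have \<Phi>br [simp]: "w (farr \<Phi> (brD a b)) \<in> Arr E" "Dom E (w (farr \<Phi> (brD a b))) = fobj \<Phi> (a \<boxtimes>\<^bsub>W\<^esub> b)"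
      "Cod E (w (farr \<Phi> (brD a b))) = fobj \<Phi> (b \<boxtimes>\<^bsub>W\<^esub> a)"
      using S.farr_simps[of "brD a b"] by simp_all
    have e: "w (t b a) \<cdot>\<^bsub>E\<^esub> w (br (fobj \<Phi> b) (fobj \<Phi> a)) = w (farr \<Phi> (brD a b)) \<cdot>\<^bsub>E\<^esub> w (t a b)"
      using t_br[of b a] by (simp add: involution_eq_iff dual_br_def)
    have "w (br (fobj \<Phi> b) (fobj \<Phi> a)) \<cdot>\<^bsub>E\<^esub> cinv E (w (t a b)) = cinv E (w (t b a)) \<cdot>\<^bsub>E\<^esub> w (farr \<Phi> (brD a b))"
    proof (rule E.iso_mono[of "w (t b a)"], rule E.iso_epi[of _ "w (t a b)"])
      show "(w (t b a) \<cdot>\<^bsub>E\<^esub> w (br (fobj \<Phi> b) (fobj \<Phi> a)) \<cdot>\<^bsub>E\<^esub> cinv E (w (t a b))) \<cdot>\<^bsub>E\<^esub> w (t a b) =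
        (w (t b a) \<cdot>\<^bsub>E\<^esub> cinv E (w (t b a)) \<cdot>\<^bsub>E\<^esub> w (farr \<Phi> (brD a b))) \<cdot>\<^bsub>E\<^esub> w (t a b)"
        using e by simp
    qed auto
    then show ?thesis
      using \<Phi> ob by (simp add: feq_def br E.cinv_dual dual_br_def)
  qed
  ultimately show ?thesis
    unfolding braided_monoidal_equivalence_def braided_strong_monoidal_def using D by blast
qed

section \<open>Comodules as modules in the opposite category\<close>

abbreviation "op \<equiv> dual (\<lambda>f. f)"
abbreviation "op_mon \<equiv> dual_mon (\<lambda>f. f)"
abbreviation "op_br \<equiv> dual_br (\<lambda>f. f)"

definition swap :: "'a \<times> 'b \<times> 'a \<Rightarrow> 'a \<times> 'b \<times> 'a" where
  "swap = (\<lambda>(M, f, N). (N, f, M))"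

lemma swap_simps [simp]: "swap (M, f, N) = (N, f, M)" "involution swap"
  by (auto simp: swap_def involution_def)

lemma homs_op [simp]: "homs (op C) a b = homs C b a"
  by auto

lemma split_coequalizer_op: "split_coequalizer (op C) f g q \<longleftrightarrow> split_equalizer C f g q"
  unfolding split_coequalizer_def split_equalizer_def by (simp cong: conj_cong)

context monoidal_category
begin

lemma left_comodules_simps:
  assumes "M \<in> left_comodules C V A \<delta> \<epsilon>"
  shows "fst M \<in> Obj C" "snd M \<in> Arr C" "Dom C (snd M) = fst M" "Cod C (snd M) = A \<boxtimes> fst M"
  using assms by (auto simp: left_comodules_def homs_def)

lemma left_modules_op:
  assumes A: "A \<in> Obj C" and \<delta>: "\<delta> \<in> homs C A (A \<boxtimes> A)" and \<epsilon>: "\<epsilon> \<in> homs C A (Unit V)"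
  shows "left_modules (op C) (op_mon C V) A \<delta> \<epsilon> = left_comodules C V A \<delta> \<epsilon>"
proof -
  have "(cinv C (ass V A A X) \<cdot>\<^bsub>C\<^esub> (Ide C A \<boxdot> c)) \<cdot>\<^bsub>C\<^esub> c = (\<delta> \<boxdot> Ide C X) \<cdot>\<^bsub>C\<^esub> c \<and>
      (\<epsilon> \<boxdot> Ide C X) \<cdot>\<^bsub>C\<^esub> c = cinv C (lun V X) \<longleftrightarrow>
    ass V A A X \<cdot>\<^bsub>C\<^esub> (\<delta> \<boxdot> Ide C X) \<cdot>\<^bsub>C\<^esub> c = (Ide C A \<boxdot> c) \<cdot>\<^bsub>C\<^esub> c \<and>
      lun V X \<cdot>\<^bsub>C\<^esub> (\<epsilon> \<boxdot> Ide C X) \<cdot>\<^bsub>C\<^esub> c = Ide C X"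
    if X: "X \<in> Obj C" and c: "c \<in> homs C X (A \<boxtimes> X)" for X c
  proof -
    note [simp] = A X \<delta>[unfolded homs_iff] \<epsilon>[unfolded homs_iff] c[unfolded homs_iff]
    have "(cinv C (ass V A A X) \<cdot>\<^bsub>C\<^esub> (Ide C A \<boxdot> c)) \<cdot>\<^bsub>C\<^esub> c = (\<delta> \<boxdot> Ide C X) \<cdot>\<^bsub>C\<^esub> c \<longleftrightarrow>
        ass V A A X \<cdot>\<^bsub>C\<^esub> (cinv C (ass V A A X) \<cdot>\<^bsub>C\<^esub> (Ide C A \<boxdot> c)) \<cdot>\<^bsub>C\<^esub> c =
        ass V A A X \<cdot>\<^bsub>C\<^esub> (\<delta> \<boxdot> Ide C X) \<cdot>\<^bsub>C\<^esub> c"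
      by (rule iffI, simp only:, rule iso_mono[of "ass V A A X"]) auto
    moreover have "(\<epsilon> \<boxdot> Ide C X) \<cdot>\<^bsub>C\<^esub> c = cinv C (lun V X) \<longleftrightarrow>
        lun V X \<cdot>\<^bsub>C\<^esub> (\<epsilon> \<boxdot> Ide C X) \<cdot>\<^bsub>C\<^esub> c = lun V X \<cdot>\<^bsub>C\<^esub> cinv C (lun V X)"
      by (rule iffI, simp only:, rule iso_mono[of "lun V X"]) auto
    ultimately show ?thesis by auto
  qed
  then show ?thesis
    unfolding left_modules_def left_comodules_def by auto
qed

lemma mod_cat_op:
  assumes "A \<in> Obj C" "\<delta> \<in> homs C A (A \<boxtimes> A)" "\<epsilon> \<in> homs C A (Unit V)"
  shows "mod_cat (op C) (op_mon C V) A \<delta> \<epsilon> = dual swap (comod_cat C V A \<delta> \<epsilon>)"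
  unfolding mod_cat_def comod_cat_def dual_def[of swap] left_modules_op[OF assms]
  by (auto simp: swap_def fun_eq_iff split: prod.splits)

lemma cofree_op:
  assumes [simp]: "A \<in> Obj C" and "\<delta> \<in> homs C A (A \<boxtimes> A)" and [simp]: "X \<in> Obj C"
  shows "free_mod (op C) (op_mon C V) A \<delta> X = cofree_comod C V A \<delta> X"
  by (simp add: free_mod_def cofree_comod_def cinv_dual)

end

lemma comod_tensor_op:
  assumes "braided_monoidal C V br"
    and A: "A \<in> Obj C" and \<delta>: "\<delta> \<in> homs C A (A \<boxtimes>\<^bsub>V\<^esub> A)" and \<epsilon>: "\<epsilon> \<in> homs C A (Unit V)"
    and M: "M \<in> left_comodules C V A \<delta> \<epsilon>" and N: "N \<in> left_comodules C V A \<delta> \<epsilon>"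
  shows "mod_tensor (op C) (op_mon C V) (op_br br) A \<delta> \<epsilon> M N T e \<longleftrightarrow> comod_tensor C V br A \<delta> \<epsilon> M N T e"
proof -
  interpret braided_monoidal C V br by fact
  note [simp] = A left_comodules_simps[OF M] left_comodules_simps[OF N]
  have "(ass V A (fst M) (fst N) \<cdot>\<^bsub>C\<^esub> (snd M \<boxdot>\<^bsub>V\<^esub> Ide C (fst N))) \<cdot>\<^bsub>C\<^esub> e =
      ass V A (fst M) (fst N) \<cdot>\<^bsub>C\<^esub> (snd M \<boxdot>\<^bsub>V\<^esub> Ide C (fst N)) \<cdot>\<^bsub>C\<^esub> e"
    if "e \<in> homs C (fst T) (fst M \<boxtimes>\<^bsub>V\<^esub> fst N)"
    using that by (simp add: homs_iff)
  then show ?thesis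
    unfolding mod_tensor_def comod_tensor_def split_coequalizer_op left_modules_op[OF A \<delta> \<epsilon>]
    by (auto simp: right_action_def right_coaction_def dual_br_def cinv_dual)
qed

lemma comod_tensors_op:
  assumes "braided_monoidal C V br"
    and "A \<in> Obj C" "\<delta> \<in> homs C A (A \<boxtimes>\<^bsub>V\<^esub> A)" "\<epsilon> \<in> homs C A (Unit V)"
  shows "mod_tensors (op C) (op_mon C V) (op_br br) A \<delta> \<epsilon> S \<longleftrightarrow> comod_tensors C V br A \<delta> \<epsilon> S"
proof -
  interpret braided_monoidal C V br by fact
  show ?thesis
    unfolding mod_tensors_def comod_tensors_def left_modules_op[OF assms(2-4)]
    using comod_tensor_op[OF assms] by blast
qed

lemma comod_braiding_op:
  "comod_braiding C br S M N = dual_br swap (mod_braiding (op C) (op_br br) S) M N"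
  by (simp add: comod_braiding_def mod_braiding_def dual_br_def)

text \<open>The structure of comodules is dual to that of modules in the opposite category. The unit constraints
  correspond directly, since for comodules they are by definition inverses of induced maps. The
  associator of comodules, however, is itself an induced map, and has to be compared with the inverse of
  the one for modules.\<close>

lemma comod_mon_op:
  fixes C :: "('o, 'm, 'x) cat_scheme" and V :: "('o, 'm) mon"
  assumes "braided_monoidal C V br"
    and A: "A \<in> Obj C" and \<delta>: "\<delta> \<in> homs C A (A \<boxtimes>\<^bsub>V\<^esub> A)" and \<epsilon>: "\<epsilon> \<in> homs C A (Unit V)"
    and S: "comod_tensors C V br A \<delta> \<epsilon> S"
    and U: "U = mod_mon (op C) (op_mon C V) (op_br br) A \<delta> S"
    and E: "E = mod_cat (op C) (op_mon C V) A \<delta> \<epsilon>"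
    and monoidal: "monoidal_category E U"
    and ass: "\<And>M N L. \<lbrakk>M \<in> left_modules (op C) (op_mon C V) A \<delta> \<epsilon>; N \<in> left_modules (op C) (op_mon C V) A \<delta> \<epsilon>;
        L \<in> left_modules (op C) (op_mon C V) A \<delta> \<epsilon>\<rbrakk> \<Longrightarrow> cinv E (ass U M N L) =
      (fst (S M (fst (S N L))),
       THE h. h \<in> homs (op C) (fst (fst (S M (fst (S N L))))) (fst (fst (S (fst (S M N)) L))) \<and>
         Cmp (op C) h (Cmp (op C) (snd (S M (fst (S N L)))) (TA (op_mon C V) (Ide (op C) (fst M)) (snd (S N L)))) =
         Cmp (op C) (snd (S (fst (S M N)) L)) (Cmp (op C) (TA (op_mon C V) (snd (S M N)) (Ide (op C) (fst L)))
           (cinv (op C) (ass (op_mon C V) (fst M) (fst N) (fst L)))),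
       fst (S (fst (S M N)) L))"
  shows "mon_agree (comod_cat C V A \<delta> \<epsilon>) (dual_mon swap (dual swap (comod_cat C V A \<delta> \<epsilon>)) U)
    (comod_mon C V br A \<delta> S)"
proof -
  interpret C: braided_monoidal C V br by fact
  interpret O: monoidal_category "op C" "op_mon C V" by (rule C.monoidal_dual) simp
  interpret E: monoidal_category E U by fact
  have E': "dual swap (comod_cat C V A \<delta> \<epsilon>) = E"
    unfolding E by (rule C.mod_cat_op[OF A \<delta> \<epsilon>, symmetric])
  have Aop: "A \<in> Obj (op C)" using A by simp
  have obj [simp]: "Obj (comod_cat C V A \<delta> \<epsilon>) = left_comodules C V A \<delta> \<epsilon>" "Obj E = left_comodules C V A \<delta> \<epsilon>"
    unfolding E by (simp_all add: comod_cat_def C.left_modules_op[OF A \<delta> \<epsilon>] C.mod_cat_op[OF A \<delta> \<epsilon>])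
  have cinv_E: "cinv E (M, f, N) = (N, cinv C f, M)" if "is_iso E (M, f, N)" for M f N
  proof -
    have "is_iso C f" using that O.is_iso_mod_cat[OF Aop] unfolding E by simp
    then show ?thesis
      using that unfolding E by (subst O.cinv_mod_cat[OF Aop]) (auto simp: C.cinv_dual)
  qed
  have e [simp]: "snd (S M N) \<in> Arr C" "Dom C (snd (S M N)) = fst (fst (S M N))"
      "Cod C (snd (S M N)) = fst M \<boxtimes>\<^bsub>V\<^esub> fst N" "fst (S M N) \<in> left_comodules C V A \<delta> \<epsilon>"
    if "M \<in> left_comodules C V A \<delta> \<epsilon>" "N \<in> left_comodules C V A \<delta> \<epsilon>" for M N
    using S that by (auto simp: comod_tensors_def comod_tensor_def C.homs_iff)
  have "swap (cinv E (lun U M)) = lun (comod_mon C V br A \<delta> S) M" if M: "M \<in> left_comodules C V A \<delta> \<epsilon>" for M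
  proof -
    have "is_iso E (lun U M)" using M by simp
    then show ?thesis
      unfolding U by (simp add: mod_mon_def comod_mon_def Let_def cinv_E)
  qed
  moreover have "swap (cinv E (run U M)) = run (comod_mon C V br A \<delta> S) M" if M: "M \<in> left_comodules C V A \<delta> \<epsilon>" for M
  proof -
    have "is_iso E (run U M)" using M by simp
    then show ?thesis
      unfolding U
      by (simp add: mod_mon_def comod_mon_def Let_def cinv_E right_action_def right_coaction_def dual_br_def)
  qed
  moreover have "swap (cinv E (ass U M N L)) = ass (comod_mon C V br A \<delta> S) M N L"
    if M: "M \<in> left_comodules C V A \<delta> \<epsilon>" "N \<in> left_comodules C V A \<delta> \<epsilon>" "L \<in> left_comodules C V A \<delta> \<epsilon>" for M N L
  proof -
    note [simp] = M C.left_comodules_simps(1)[OF M(1)] C.left_comodules_simps(1)[OF M(2)]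
      C.left_comodules_simps(1)[OF M(3)]
    have "h \<in> homs C (fst (fst (S (fst (S M N)) L))) (fst (fst (S M (fst (S N L))))) \<and>
        ((Ide C (fst M) \<boxdot>\<^bsub>V\<^esub> snd (S N L)) \<cdot>\<^bsub>C\<^esub> snd (S M (fst (S N L)))) \<cdot>\<^bsub>C\<^esub> h =
        (ass V (fst M) (fst N) (fst L) \<cdot>\<^bsub>C\<^esub> (snd (S M N) \<boxdot>\<^bsub>V\<^esub> Ide C (fst L))) \<cdot>\<^bsub>C\<^esub> snd (S (fst (S M N)) L) \<longleftrightarrow>
      h \<in> homs C (fst (fst (S (fst (S M N)) L))) (fst (fst (S M (fst (S N L))))) \<and>
        (Ide C (fst M) \<boxdot>\<^bsub>V\<^esub> snd (S N L)) \<cdot>\<^bsub>C\<^esub> snd (S M (fst (S N L))) \<cdot>\<^bsub>C\<^esub> h =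
        ass V (fst M) (fst N) (fst L) \<cdot>\<^bsub>C\<^esub> (snd (S M N) \<boxdot>\<^bsub>V\<^esub> Ide C (fst L)) \<cdot>\<^bsub>C\<^esub> snd (S (fst (S M N)) L)" for h
      by (rule conj_cong[OF refl]) (simp add: C.homs_iff)
    then show ?thesis
      by (simp add: ass comod_mon_def Let_def C.cinv_dual C.left_modules_op[OF A \<delta> \<epsilon>])
  qed
  ultimately show ?thesis
    unfolding mon_agree_def E'
    by (auto simp: U mod_mon_def comod_mon_def Let_def split: prod.splits)
qed

section \<open>Green 2-functors\<close>

text \<open>A Green 2-functor and a 1-cell \<open>i\<close> give rise to two adjunctions with a projection formula, one for
  modules and one, in the opposite categories, for comodules.\<close>

locale green_one_cell = green_two_functor R K J M
  for R :: "('k, 'r) ring_scheme" and K :: "('g, 'u, 'c) twocat" and J :: "'u set"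
    and M :: "('g, 'u, 'c, 'o, 'm, 'k, 'x) green_scheme" +
  fixes i :: 'u and H G :: 'g
  assumes i_J: "i \<in> J" and i_hom: "i \<in> hom1 K H G"
begin

abbreviation "VG \<equiv> val M G"
abbreviation "VH \<equiv> val M H"
abbreviation "mG \<equiv> mon M G"
abbreviation "mH \<equiv> mon M H"

lemma src_trg [simp]: "src1 K i = H" "trg1 K i = G" and ob [simp]: "H \<in> Ob K" "G \<in> Ob K"
  using i_hom K.one.dom_obj[of i] K.one.cod_obj[of i] by (auto simp: homs_def cat1_def)

sublocale pull: strong_monoidal VG mG VH mH "pull M i" "tcoh M i" "ucoh M i"
  by (rule pull_monoidal[OF i_hom])

sublocale push: cfunctor VH VG "push M i"
  using push_linear[OF i_J i_hom] by (simp add: linear_functor_def)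

lemma adjs: "adjunction VH VG (push M i) (pull M i) (leta M i) (leps M i)"
  "adjunction VG VH (pull M i) (push M i) (reta M i) (reps M i)"
  by (rule left_adjunction[OF i_J i_hom], rule right_adjunction[OF i_J i_hom])

lemma idempotents_split:
  assumes "e \<in> homs VH a a" "e \<cdot>\<^bsub>VH\<^esub> e = e"
  shows "\<exists>b \<in> Obj VH. \<exists>r \<in> homs VH a b. \<exists>s \<in> homs VH b a. r \<cdot>\<^bsub>VH\<^esub> s = Ide VH b \<and> s \<cdot>\<^bsub>VH\<^esub> r = e"
  using idempotent_complete_additive.idempotents_split[OF val_idempotent_complete[OF ob(1)] assms] .

sublocale Md: projection_adjunction VG mG VH mH "pull M i" "tcoh M i" "ucoh M i" "push M i"
  "reta M i" "reps M i" "leta M i"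
proof unfold_locales
  show "adjunction VG VH (pull M i) (push M i) (reta M i) (reps M i)" by (rule adjs)
  show "nat_trans VH VH fid (fcomp (pull M i) (push M i)) (leta M i)"
    using adjs(1) by (simp add: adjunction_def)
  show "reps M i y \<cdot>\<^bsub>VH\<^esub> leta M i y = Ide VH y" if "y \<in> Obj VH" for y
    by (rule special[OF i_J i_hom that])
  show "is_iso VG (farr (push M i) (reps M i Y \<boxdot>\<^bsub>mH\<^esub> Ide VH (fobj (pull M i) X)) \<cdot>\<^bsub>VG\<^esub>
      farr (push M i) (tcoh M i (fobj (push M i) Y) X) \<cdot>\<^bsub>VG\<^esub> reta M i (fobj (push M i) Y \<boxtimes>\<^bsub>mG\<^esub> X))"
    if "X \<in> Obj VG" "Y \<in> Obj VH" for X Y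
    using projection2[OF i_J i_hom that] unfolding is_iso_def Rp2_def Let_def src_trg by blast
qed (rule idempotents_split)

lemma leta_simps [simp]:
  assumes "Y \<in> Obj VH"
  shows "leta M i Y \<in> Arr VH" "Dom VH (leta M i Y) = Y" "Cod VH (leta M i Y) = fobj (pull M i) (fobj (push M i) Y)"
  using Md.section_simps[OF assms] by auto

lemma leps_simps [simp]:
  assumes "X \<in> Obj VG"
  shows "leps M i X \<in> Arr VG" "Dom VG (leps M i X) = fobj (push M i) (fobj (pull M i) X)" "Cod VG (leps M i X) = X"
  using adjs(1) assms by (auto simp: adjunction_def fcomp_def fid_def dest: nat_trans_simps)

sublocale Co: projection_adjunction "op VG" "op_mon VG mG" "op VH" "op_mon VH mH" "pull M i"
  "\<lambda>a b. cinv VH (tcoh M i a b)" "cinv VH (ucoh M i)" "push M i" "leps M i" "leta M i" "reps M i"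
proof (intro projection_adjunction.intro projection_adjunction_axioms.intro)
  show "strong_monoidal (op VG) (op_mon VG mG) (op VH) (op_mon VH mH) (pull M i)
      (\<lambda>a b. cinv VH (tcoh M i a b)) (cinv VH (ucoh M i))"
    using pull.strong_dual[OF involution_id involution_id] by (simp add: dual_func_id)
  show "cfunctor (op VH) (op VG) (push M i)"
    using cfunctor_dual[OF pull.D.category_axioms pull.C.category_axioms involution_id involution_id push.cfunctor_axioms]
    by (simp add: dual_func_id)
  show "adjunction (op VG) (op VH) (pull M i) (push M i) (leps M i) (leta M i)"
    by (rule adjunction_dual[OF pull.C.category_axioms pull.D.category_axioms adjs(1)])
  show "nat_trans (op VH) (op VH) fid (fcomp (pull M i) (push M i)) (reps M i)"
    using nat_trans_dual[OF pull.D.category_axioms pull.D.category_axioms involution_id involution_id, of "fcomp (pull M i) (push M i)" fid "reps M i"]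
      adjs(2) by (simp add: adjunction_def dual_func_id)
  show "Cmp (op VH) (leta M i y) (reps M i y) = Ide (op VH) y" if "y \<in> Obj (op VH)" for y
    using special[OF i_J i_hom] that by simp
  show "is_iso (op VG) (Cmp (op VG)
      (farr (push M i) (TA (op_mon VH mH) (leta M i Y) (Ide (op VH) (fobj (pull M i) X))))
      (Cmp (op VG) (farr (push M i) (cinv VH (tcoh M i (fobj (push M i) Y) X)))
        (leps M i (TO (op_mon VG mG) (fobj (push M i) Y) X))))"
    if X: "X \<in> Obj (op VG)" and Y: "Y \<in> Obj (op VH)" for X Y
  proof -
    have XY: "X \<in> Obj VG" "Y \<in> Obj VH" using X Y by auto
    have "inverse_pair VG (Lp2 K M i Y X) (Rp2 K M i Y X)"
      by (rule pull.C.inverse_pair_sym[OF projection2[OF i_J i_hom XY]])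
    then have "is_iso VG (Lp2 K M i Y X)" unfolding is_iso_def by blast
    then show ?thesis using XY by (simp add: Lp2_def Let_def)
  qed
  show "\<exists>b\<in>Obj (op VH). \<exists>r\<in>homs (op VH) a b. \<exists>s\<in>homs (op VH) b a.
      Cmp (op VH) r s = Ide (op VH) b \<and> Cmp (op VH) s r = e"
    if "e \<in> homs (op VH) a a" "Cmp (op VH) e e = e" for e a
    using idempotents_split[of e a] that by auto
qed

subsection \<open>The canonical functors\<close>

lemma frob_eqs: "frob K M i = Md.A" "frob_mult K M i = Md.mlt" "frob_unit K M i = Md.unt"
  by (simp_all add: frob_def frob_mult_def frob_unit_def Md.mlt_def Md.unt_def Md.lax_def push_lax_def Let_def)

lemma Rp2_eq: "Rp2 K M i Y X = Md.proj Y X"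
  by (simp add: Rp2_def Md.proj_def Let_def)

lemma frob_pi_eq: "frob_pi K M i X = Md.pi X"
  by (simp add: frob_pi_def Md.pi_def Rp2_eq Let_def)

lemma Mod_eq: "Mod K M i = Md.Modules"
  by (simp add: Mod_def frob_eqs)

lemma to_mod_eq: "to_mod K M i = Md.\<Phi>"
  by (simp add: to_mod_def Md.\<Phi>_def to_mod_obj_def Md.act_def frob_pi_eq Let_def fun_eq_iff)

lemma co_monoid: "Co.mlt \<in> homs VG Md.A (Md.A \<boxtimes>\<^bsub>mG\<^esub> Md.A)" "Co.unt \<in> homs VG Md.A (Unit mG)"
  using Co.monoid_simps by (auto simp: pull.C.homs_iff)

lemma frob_co_eqs: "frob_comult K M i = Co.mlt" "frob_counit K M i = Co.unt"
  by (simp_all add: frob_comult_def frob_counit_def Co.mlt_def Co.unt_def Co.lax_def push_colax_def Let_def)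

lemma Comod_dual: "Co.Modules = dual swap (Comod K M i)"
  using pull.C.mod_cat_op[OF _ co_monoid] by (simp add: Comod_def frob_eqs frob_co_eqs)

lemma category_Comod: "category (Comod K M i)"
  using Co.E.category_dual[OF swap_simps(2)] unfolding Comod_dual dual_dual[OF swap_simps(2)] .

text \<open>The two projection maps are inverse to each other. Therefore the map that compares the comonads is
  the inverse of the one that compares the monads.\<close>

lemma co_act:
  assumes [simp]: "Y \<in> Obj VH"
  shows "Co.act Y = cinv VG (Md.pi (fobj (push M i) Y)) \<cdot>\<^bsub>VG\<^esub> farr (push M i) (leta M i Y)"
proof -
  let ?X = "fobj (push M i) Y"
  have inv: "inverse_pair VG (Md.proj Md.I ?X) (Lp2 K M i Md.I ?X)"
    using projection2[OF i_J i_hom, of ?X Md.I] by (simp add: Rp2_eq)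
  have "Co.pi ?X = Lp2 K M i Md.I ?X \<cdot>\<^bsub>VG\<^esub> cinv VG (farr (push M i) (lun mH (fobj (pull M i) ?X)))"
    by (simp add: Co.pi_def Co.proj_def Lp2_def Let_def push.cinv_farr)
  also have "\<dots> = cinv VG (Md.pi ?X)"
    using inv by (simp add: Md.pi_def pull.C.cinv_cmp pull.C.cinv_eqI)
  finally show ?thesis by (simp add: Co.act_def)
qed

lemma to_comod_eq: "feq VH (dual_func (\<lambda>f. f) swap Co.\<Phi>) (to_comod K M i)"
  by (simp add: feq_def to_comod_def to_comod_obj_def co_act frob_pi_eq Let_def)

lemma equivalences: "equivalence VH (Mod K M i) (to_mod K M i)" "equivalence VH (Comod K M i) (to_comod K M i)"
proof -
  show "equivalence VH (Mod K M i) (to_mod K M i)"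
    by (simp add: Mod_eq to_mod_eq Md.equivalence_modules)
  have "equivalence VH (Comod K M i) (dual_func (\<lambda>f. f) swap Co.\<Phi>)"
    by (rule equivalence_undual[OF pull.D.category_axioms category_Comod involution_id swap_simps(2)
          Co.equivalence_modules[unfolded Comod_dual]])
  then show "equivalence VH (Comod K M i) (to_comod K M i)"
    by (rule equivalence_feq[OF _ to_comod_eq])
qed

lemma identifies_modules:
  "identifies_right_adjoints VG VH (Mod K M i) (to_mod K M i) (pull M i) (push M i) (reta M i) (reps M i)
    (free_functor VG mG (frob K M i) (frob_mult K M i)) forget
    (free_unit VG mG (frob_unit K M i)) (free_counit VG mG (frob K M i) (frob_mult K M i))"
  using Md.identifies_free_forgetful by (simp add: Mod_eq to_mod_eq frob_eqs)

lemma identifies_comodules: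
  "identifies_left_adjoints VG VH (Comod K M i) (to_comod K M i) (push M i) (pull M i) (leta M i) (leps M i)
    forget (cofree_functor VG mG (frob K M i) (frob_comult K M i))
    (cofree_unit VG mG (frob K M i) (frob_comult K M i)) (cofree_counit VG mG (frob_counit K M i))"
proof -
  let ?E = "dual_func (\<lambda>f. f) swap Co.\<Phi>" and ?A = "fobj (push M i) (Unit mH)"
  let ?free = "free_functor (op VG) (op_mon VG mG) ?A Co.mlt"
  have forget: "dual_func swap (\<lambda>f. f) forget = (forget :: ('o \<times> 'm, ('o \<times> 'm) \<times> 'm \<times> ('o \<times> 'm), 'o, 'm) func)"
    by (simp add: dual_func_def forget_def swap_def fun_eq_iff split: prod.splits)
  have 0: "identifies_right_adjoints (op VG) (op VH) (dual swap (Comod K M i)) Co.\<Phi> (pull M i) (push M i)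
      (leps M i) (leta M i) ?free forget (free_unit (op VG) (op_mon VG mG) Co.unt)
      (free_counit (op VG) (op_mon VG mG) ?A Co.mlt)"
    using Co.identifies_free_forgetful unfolding Comod_dual by simp
  have 1: "identifies_left_adjoints VG VH (Comod K M i) ?E (push M i) (pull M i) (leta M i) (leps M i)
      forget (dual_func (\<lambda>f. f) swap ?free)
      (\<lambda>x. swap (free_counit (op VG) (op_mon VG mG) ?A Co.mlt x)) (free_unit (op VG) (op_mon VG mG) Co.unt)"
    using identifies_left_adjoints_undual[OF pull.C.category_axioms pull.D.category_axioms category_Comod
        involution_id involution_id swap_simps(2) 0]
    by (simp add: dual_func_id forget)
  have free: "cfunctor VG (Comod K M i) (dual_func (\<lambda>f. f) swap ?free)"
    using 1 unfolding identifies_left_adjoints_def nat_iso_def nat_trans_def by blast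
  have forget_functor: "cfunctor (Comod K M i) VG forget"
    using cfunctor_undual[OF category_Comod pull.C.category_axioms swap_simps(2) involution_id
        Co.C.cfunctor_forget[of ?A Co.mlt Co.unt, unfolded Comod_dual[simplified]]]
    by (simp add: forget)
  have E: "cfunctor VH (Comod K M i) ?E"
    by (rule cfunctor_undual[OF pull.D.category_axioms category_Comod involution_id swap_simps(2)
          Co.\<Phi>.cfunctor_axioms[unfolded Comod_dual]])
  have cofree: "free_mod (op VG) (op_mon VG mG) ?A Co.mlt X = cofree_comod VG mG ?A Co.mlt X" if "X \<in> Obj VG" for X
    by (rule pull.C.cofree_op[OF _ co_monoid(1) that]) simp
  note co_monoid_simps [simp] = co_monoid[unfolded pull.C.homs_iff]
  show ?thesis
    unfolding frob_eqs frob_co_eqs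
  proof (rule identifies_left_adjoints_agree[OF 1 E to_comod_eq])
    show "feq VG (dual_func (\<lambda>f. f) swap ?free) (cofree_functor VG mG ?A Co.mlt)"
      by (simp add: feq_def free_functor_def cofree_functor_def cofree)
    show "cofree_unit VG mG ?A Co.mlt m = swap (free_counit (op VG) (op_mon VG mG) ?A Co.mlt m)"
      if "m \<in> Obj (Comod K M i)" for m
      using that pull.C.left_comodules_simps(1)[of m]
      by (auto simp: cofree_unit_def free_counit_def cofree Comod_def comod_cat_def)
    show "cofree_counit VG mG Co.unt x = free_unit (op VG) (op_mon VG mG) Co.unt x" if "x \<in> Obj VG" for x
      using that by (simp add: cofree_counit_def free_unit_def pull.C.cinv_dual)
  qed (fact pull.cfunctor_axioms forget_functor free)+
qed

subsection \<open>The braided case\<close>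

context
  fixes br :: "'g \<Rightarrow> 'o \<Rightarrow> 'o \<Rightarrow> 'm"
  assumes braided: "braided_green_two_functor R K J M br"
begin

lemma pull_braids: "braided_strong_monoidal VG mG (br G) VH mH (br H) (pull M i) (tcoh M i) (ucoh M i)"
  by (rule braided_green_two_functor.pull_braided[OF braided i_hom])

lemma brG: "braided_monoidal VG mG (br G)" and brH: "braided_monoidal VH mH (br H)"
  using pull_braids by (simp_all add: braided_strong_monoidal_def)

lemma pull_br: "\<lbrakk>a \<in> Obj VG; b \<in> Obj VG\<rbrakk> \<Longrightarrow>
  br H (fobj (pull M i) a) (fobj (pull M i) b) \<cdot>\<^bsub>VH\<^esub> tcoh M i a b = tcoh M i b a \<cdot>\<^bsub>VH\<^esub> farr (pull M i) (br G a b)"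
  using pull_braids by (simp add: braided_strong_monoidal_def)

lemma braided_modules: "braided_projection_adjunction VG mG VH mH (pull M i) (tcoh M i) (ucoh M i) (push M i)
  (reta M i) (reps M i) (leta M i) (br G) (br H)"
  by (intro braided_projection_adjunction.intro braided_projection_adjunction_axioms.intro
      Md.projection_adjunction_axioms brG brH pull_br)

lemma braided_comodules: "braided_projection_adjunction (op VG) (op_mon VG mG) (op VH) (op_mon VH mH) (pull M i)
  (\<lambda>a b. cinv VH (tcoh M i a b)) (cinv VH (ucoh M i)) (push M i) (leps M i) (leta M i) (reps M i)
  (op_br (br G)) (op_br (br H))"
proof (intro braided_projection_adjunction.intro braided_projection_adjunction_axioms.intro)
  interpret G: braided_monoidal VG mG "br G" by (rule brG)
  interpret H: braided_monoidal VH mH "br H" by (rule brH)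
  show "projection_adjunction (op VG) (op_mon VG mG) (op VH) (op_mon VH mH) (pull M i)
      (\<lambda>a b. cinv VH (tcoh M i a b)) (cinv VH (ucoh M i)) (push M i) (leps M i) (leta M i) (reps M i)"
    by (rule Co.projection_adjunction_axioms)
  show "braided_monoidal (op VG) (op_mon VG mG) (op_br (br G))"
    "braided_monoidal (op VH) (op_mon VH mH) (op_br (br H))"
    by (rule G.braided_dual H.braided_dual; simp)+
  show "Cmp (op VH) (op_br (br H) (fobj (pull M i) a) (fobj (pull M i) b)) (cinv VH (tcoh M i a b)) =
      Cmp (op VH) (cinv VH (tcoh M i b a)) (farr (pull M i) (op_br (br G) a b))"
    if "a \<in> Obj (op VG)" "b \<in> Obj (op VG)" for a b
  proof -
    have [simp]: "a \<in> Obj VG" "b \<in> Obj VG" using that by auto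
    have "cinv VH (tcoh M i a b) \<cdot>\<^bsub>VH\<^esub> br H (fobj (pull M i) b) (fobj (pull M i) a) =
        farr (pull M i) (br G b a) \<cdot>\<^bsub>VH\<^esub> cinv VH (tcoh M i b a)"
    proof (rule pull.D.iso_mono[of "tcoh M i a b"], rule pull.D.iso_epi[of _ "tcoh M i b a"])
      show "(tcoh M i a b \<cdot>\<^bsub>VH\<^esub> cinv VH (tcoh M i a b) \<cdot>\<^bsub>VH\<^esub> br H (fobj (pull M i) b) (fobj (pull M i) a)) \<cdot>\<^bsub>VH\<^esub> tcoh M i b a =
        (tcoh M i a b \<cdot>\<^bsub>VH\<^esub> farr (pull M i) (br G b a) \<cdot>\<^bsub>VH\<^esub> cinv VH (tcoh M i b a)) \<cdot>\<^bsub>VH\<^esub> tcoh M i b a"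
        using pull_br[of b a] by simp
    qed auto
    then show ?thesis by (simp add: dual_br_def)
  qed
qed

lemma mod_tensors_exist:
  "\<exists>S. mod_tensors VG mG (br G) (frob K M i) (frob_mult K M i) (frob_unit K M i) S"
  unfolding frob_eqs by (rule braided_projection_adjunction.mod_tensors_exist[OF braided_modules])

lemma modules_braided_equivalence:
  assumes "mod_tensors VG mG (br G) (frob K M i) (frob_mult K M i) (frob_unit K M i) S"
  shows "braided_monoidal_equivalence VH mH (br H) (Mod K M i)
    (mod_mon VG mG (br G) (frob K M i) (frob_mult K M i) S) (mod_braiding VG (br G) S) (to_mod K M i)"
proof -
  interpret braided_projection_adjunction VG mG VH mH "pull M i" "tcoh M i" "ucoh M i" "push M i"
    "reta M i" "reps M i" "leta M i" "br G" "br H"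
    by (rule braided_modules)
  interpret X: braided_projection_adjunction_choice VG mG VH mH "pull M i" "tcoh M i" "ucoh M i" "push M i"
    "reta M i" "reps M i" "leta M i" "br G" "br H" S
    by unfold_locales (use assms in \<open>simp add: frob_eqs\<close>)
  show ?thesis
    using X.braided_equivalence_modules by (simp add: Mod_eq to_mod_eq frob_eqs)
qed

lemma comod_tensors_iff:
  "mod_tensors (op VG) (op_mon VG mG) (op_br (br G)) Co.A Co.mlt Co.unt S \<longleftrightarrow>
    comod_tensors VG mG (br G) (frob K M i) (frob_comult K M i) (frob_counit K M i) S"
  using comod_tensors_op[OF brG _ co_monoid] by (simp add: frob_eqs frob_co_eqs)

lemma comod_tensors_exist:
  "\<exists>S. comod_tensors VG mG (br G) (frob K M i) (frob_comult K M i) (frob_counit K M i) S"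
  using braided_projection_adjunction.mod_tensors_exist[OF braided_comodules] unfolding comod_tensors_iff .

lemma comodules_braided_equivalence:
  assumes S: "comod_tensors VG mG (br G) (frob K M i) (frob_comult K M i) (frob_counit K M i) S"
  shows "braided_monoidal_equivalence VH mH (br H) (Comod K M i)
    (comod_mon VG mG (br G) (frob K M i) (frob_comult K M i) S) (comod_braiding VG (br G) S) (to_comod K M i)"
proof -
  interpret X: braided_projection_adjunction "op VG" "op_mon VG mG" "op VH" "op_mon VH mH" "pull M i"
    "\<lambda>a b. cinv VH (tcoh M i a b)" "cinv VH (ucoh M i)" "push M i" "leps M i" "leta M i" "reps M i"
    "op_br (br G)" "op_br (br H)"
    by (rule braided_comodules)
  interpret Y: braided_projection_adjunction_choice "op VG" "op_mon VG mG" "op VH" "op_mon VH mH" "pull M i"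
    "\<lambda>a b. cinv VH (tcoh M i a b)" "cinv VH (ucoh M i)" "push M i" "leps M i" "leta M i" "reps M i"
    "op_br (br G)" "op_br (br H)" S
    by unfold_locales (use S comod_tensors_iff in blast)
  let ?U = "mod_mon (op VG) (op_mon VG mG) (op_br (br G)) Co.A Co.mlt S"
  have agree: "mon_agree (comod_cat VG mG Md.A Co.mlt Co.unt) (dual_mon swap (dual swap (comod_cat VG mG Md.A Co.mlt Co.unt)) ?U)
      (comod_mon VG mG (br G) Md.A Co.mlt S)"
  proof (rule comod_mon_op[OF brG _ co_monoid])
    show "comod_tensors VG mG (br G) Md.A Co.mlt Co.unt S" using S by (simp add: frob_eqs frob_co_eqs)
    show "monoidal_category Co.Modules ?U" by (rule Y.T.monoidal_presented)
  qed (rule Y.cinv_mod_mon_ass | simp)+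
  show ?thesis
    by (rule braided_equivalence_undual[OF brH category_Comod swap_simps(2)
          Y.braided_equivalence_modules[unfolded Comod_dual] _ comod_braiding_op to_comod_eq])
      (use agree in \<open>simp add: Comod_def frob_eqs frob_co_eqs\<close>)
qed

end

end

theorem theorem9p2:
  fixes R :: "('k, 'r) ring_scheme" and K :: "('g, 'u, 'c) twocat" and J :: "'u set"
    and M :: "('g, 'u, 'c, 'o, 'm, 'k) green" and i :: 'u and H G :: 'g
  assumes "cring R"
    and "spannable_pair K J"
    and "green_two_functor R K J M"
    and "i \<in> J" and "i \<in> hom1 K H G"
  shows
    "equivalence (val M H) (Comod K M i) (to_comod K M i) \<and>
     equivalence (val M H) (Mod K M i) (to_mod K M i) \<and>
     identifies_left_adjoints (val M G) (val M H) (Comod K M i) (to_comod K M i)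
       (push M i) (pull M i) (leta M i) (leps M i)
       forget (cofree_functor (val M G) (mon M G) (frob K M i) (frob_comult K M i))
       (cofree_unit (val M G) (mon M G) (frob K M i) (frob_comult K M i))
       (cofree_counit (val M G) (mon M G) (frob_counit K M i)) \<and>
     identifies_right_adjoints (val M G) (val M H) (Mod K M i) (to_mod K M i)
       (pull M i) (push M i) (reta M i) (reps M i)
       (free_functor (val M G) (mon M G) (frob K M i) (frob_mult K M i)) forget
       (free_unit (val M G) (mon M G) (frob_unit K M i))
       (free_counit (val M G) (mon M G) (frob K M i) (frob_mult K M i)) \<and>
     (\<forall>br. braided_green_two_functor R K J M br \<longrightarrow>
       (\<exists>S. comod_tensors (val M G) (mon M G) (br G)
              (frob K M i) (frob_comult K M i) (frob_counit K M i) S) \<and>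
       (\<forall>S. comod_tensors (val M G) (mon M G) (br G)
              (frob K M i) (frob_comult K M i) (frob_counit K M i) S \<longrightarrow>
          braided_monoidal_equivalence (val M H) (mon M H) (br H)
            (Comod K M i)
            (comod_mon (val M G) (mon M G) (br G) (frob K M i) (frob_comult K M i) S)
            (comod_braiding (val M G) (br G) S)
            (to_comod K M i)) \<and>
       (\<exists>S. mod_tensors (val M G) (mon M G) (br G)
              (frob K M i) (frob_mult K M i) (frob_unit K M i) S) \<and>
       (\<forall>S. mod_tensors (val M G) (mon M G) (br G)
              (frob K M i) (frob_mult K M i) (frob_unit K M i) S \<longrightarrow>
          braided_monoidal_equivalence (val M H) (mon M H) (br H)
            (Mod K M i)
            (mod_mon (val M G) (mon M G) (br G) (frob K M i) (frob_mult K M i) S)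
            (mod_braiding (val M G) (br G) S)
            (to_mod K M i)))"
proof -
  interpret green_one_cell R K J M i H G
    by (intro green_one_cell.intro green_one_cell_axioms.intro) (fact assms)+
  show ?thesis
    using equivalences identifies_comodules identifies_modules comod_tensors_exist
      comodules_braided_equivalence mod_tensors_exist modules_braided_equivalence by blast
qed

end
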